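(* Let $0\le\alpha\le1$, $\theta>0$ and $(n_1,\ldots,n_k)\in\mathcal{C}$. Let $(\mathcal{S}^y)_{y\ge0}$ be the concatenation $\mathcal{S}^y=\mathcal{S}^{1,y}\cdots\mathcal{S}^{k,y}$ of the skewer processes $(\mathcal{S}^{j,y})_{y\ge0}$ of $k$ independent marked processes $P_{n_j}$-distributed, $1\le j\le k$. Independently, let $(A_{-j})_{j\ge1}$ be the (increasing) points of a Poisson process of rate $\theta$ on $(0,\infty)$ and let $((X^{-j}_r)_{0\le r\le\xi_{-j}},\text{marks})$, $j\ge1$, be IID marked processes with law $P_1$, independent of $(A_{-j})$. Set $L_{-j}=-A_{-j}-\sum_{i=1}^j\xi_{-i}$, $R_{-j}=L_{-j}+\xi_{-j}$, $L_0=0$, and for $t<0$ $$X_t=\begin{cases}A_{-j}+X^{-j}_{t-L_{-j}}, & t\in[L_{-j},R_{-j}] \text{ for some } j\ge1,\\ |t|-\sum_{i=1}^{j-1}\xi_{-i}, & t\in(R_{-j},L_{-j+1}) \text{ for some } j\ge1,\end{cases}$$ where each jump of $(X_t)_{t<0}$ occurring at time $L_{-j}+u$ inherits as mark the mark of the jump of $X^{-j}$ at time $u$ (with convention $X^{-j}_{0-}=0$, so the jump at $u=0$ goes from level $A_{-j}$). Define $\mathcal{S}^y_-$, $y\ge0$, as the composition listing, from left to right in increasing order of jump time, the values $Z(y-B)$ over all jumps of $(X_t)_{t<0}$ with pre-jump height $B$ and post-jump height $D$ satisfying $B\le y<D$, where $Z$ is the mark of that jump. Then $(\mathcal{S}^y_-\mathcal{S}^y)_{y\ge0}$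 is an up-down oCRP$(\alpha,\theta)$ starting from $(n_1,\ldots,n_k)$.
   Context: $\mathcal{C}$ is the set of integer compositions $(n_1,\ldots,n_k)$, $k\ge0$, $n_i\ge1$; $uv$ denotes concatenation of compositions. A $Q_\alpha$-Markov chain is a continuous-time Markov chain on $\mathbb{N}_0$ with only nonzero off-diagonal rates $q_\alpha(m,m+1)=m-\alpha$, $q_\alpha(m,m-1)=m$, $m\ge1$. For $n\ge1$, $P_n$ denotes the law of the marked process $(X,Z)=((X_t)_{0\le t\le T},(Z^i)_{0\le i\le J_T})$ where $(Z^i)_{i\ge0}$ are independent $Q_\alpha$-Markov chains with $Z^0(0)=n$, $Z^i(0)=1$ ($i\ge1$), $\zeta_i=\inf\{s\colon Z^i(s)=0\}$, $(J_t)$ an independent rate-$\alpha$ Poisson process, $X_t=-t+\sum_{i=0}^{J_t}\zeta_i$, $T=\inf\{t\ge0\colon X_t=0\}$, and $Z^i$ marks the $i$-th jump of $X$ (the $0$-th jump is at time $0$ from level $X_{0-}:=0$). Its length (the analogue of $\xi_{-j}$) is $T$. Skewer process of such a marked path: with jump times $U_0<\cdots<U_J$, $B_i=X_{U_i-}$, $D_i=X_{U_i}$, for $y\ge0$ list the indices $i$ with $B_i\le y<D_i$ in increasing order as $I^y_1<\cdots<I^y_{K^y}$, and set $\mathcal{S}^y=(Z^{I^y_l}(y-B_{I^y_l}))_{1\le l\le K^y}$. An up-down oCRP$(\alpha,\theta)$ is the Markov chain on $\mathcal{C}$ which from $(n_1,\ldots,n_k)$ jumps: at rate $n_i-\alpha$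 to increase $n_i$ by one; at rate $\alpha$ to $(n_1,\ldots,n_i,1,n_{i+1},\ldots,n_k)$; at rate $\theta$ to $(1,n_1,\ldots,n_k)$; at rate $n_i$ to decrease $n_i$ by one, removing the entry if it becomes $0$; $1\le i\le k$. *)

theory Defs
  imports "HOL-Probability.Probability"
begin

definition qtot :: "('s \<Rightarrow> 's \<Rightarrow> real) \<Rightarrow> 's \<Rightarrow> real" where
  "qtot q x = (\<Sum>y \<in> {y. y \<noteq> x \<and> q x y \<noteq> 0}. q x y)"

definition jump_prob :: "('s \<Rightarrow> 's \<Rightarrow> real) \<Rightarrow> 's \<Rightarrow> 's \<Rightarrow> real" where
  "jump_prob q a b =
     (if qtot q a = 0 then (if b = a then 1 else 0)
      else (if b = a then 0 else q a b / qtot q a))"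

definition path_of :: "(nat \<Rightarrow> 's) \<Rightarrow> (nat \<Rightarrow> ennreal) \<Rightarrow> real \<Rightarrow> 's" where
  "path_of Y H t = Y (LEAST n. ennreal t < (\<Sum>i\<le>n. H i))"

text \<open>X (a random path on [0,\<infinity>)) is a (non-explosive) continuous-time Markov chain with
  rates q started at x0: its jump chain and holding times have the standard joint law
  (embedded chain with transition probabilities jump_prob, holding time in state x
  exponential with parameter qtot q x, all conditionally independent).\<close>

definition is_ctmc :: "'w measure \<Rightarrow> ('s \<Rightarrow> 's \<Rightarrow> real) \<Rightarrow> 's \<Rightarrow> ('w \<Rightarrow> real \<Rightarrow> 's) \<Rightarrow> bool" where
  "is_ctmc M q x0 X \<longleftrightarrow>
    (\<exists>(Y :: 'w \<Rightarrow> nat \<Rightarrow> 's) (H :: 'w \<Rightarrow> nat \<Rightarrow> ennreal).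
       (\<forall>i. (\<lambda>\<omega>. Y \<omega> i) \<in> M \<rightarrow>\<^sub>M count_space UNIV) \<and>
       (\<forall>i. (\<lambda>\<omega>. H \<omega> i) \<in> borel_measurable M) \<and>
       (\<forall>(n::nat) (y :: nat \<Rightarrow> 's) (s :: nat \<Rightarrow> real). (\<forall>i<n. 0 \<le> s i) \<longrightarrow>
          measure M {\<omega> \<in> space M. (\<forall>i\<le>n. Y \<omega> i = y i) \<and> (\<forall>i<n. ennreal (s i) < H \<omega> i)}
          = (if y 0 = x0 then 1 else 0) *
            (\<Prod>i<n. jump_prob q (y i) (y (Suc i)) * exp (- qtot q (y i) * s i))) \<and>
       (AE \<omega> in M. (\<Sum>i. H \<omega> i) = \<top> \<and> (\<forall>t\<ge>0. X \<omega> t = path_of (Y \<omega>) (H \<omega>) t)))"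

definition qQ :: "real \<Rightarrow> nat \<Rightarrow> nat \<Rightarrow> real" where
  "qQ \<alpha> m m' = (if 1 \<le> m \<and> m' = m + 1 then real m - \<alpha>
                 else if 1 \<le> m \<and> m' + 1 = m then real m else 0)"

definition qPois :: "real \<Rightarrow> nat \<Rightarrow> nat \<Rightarrow> real" where
  "qPois r m m' = (if m' = m + 1 then r else 0)"

definition composition :: "nat list \<Rightarrow> bool" where
  "composition c \<longleftrightarrow> (\<forall>x\<in>set c. 1 \<le> x)"

definition ocrp_moves :: "real \<Rightarrow> real \<Rightarrow> nat list \<Rightarrow> (real \<times> nat list) list" where
  "ocrp_moves \<alpha> \<theta> c =
     map (\<lambda>i. (real (c!i) - \<alpha>, c[i := c!i + 1])) [0..<length c]
   @ map (\<lambda>i. (\<alpha>, take (Suc i) c @ [1] @ drop (Suc i) c)) [0..<length c]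
   @ [(\<theta>, 1 # c)]
   @ map (\<lambda>i. (real (c!i), if c!i = 1 then take i c @ drop (Suc i) c else c[i := c!i - 1]))
         [0..<length c]"

definition qOCRP :: "real \<Rightarrow> real \<Rightarrow> nat list \<Rightarrow> nat list \<Rightarrow> real" where
  "qOCRP \<alpha> \<theta> c c' = sum_list (map fst (filter (\<lambda>m. snd m = c') (ocrp_moves \<alpha> \<theta> c)))"

definition skewer_list :: "('j \<Rightarrow> bool) \<Rightarrow> ('j \<Rightarrow> real) \<Rightarrow> ('j \<Rightarrow> real) \<Rightarrow> ('j \<Rightarrow> real)
    \<Rightarrow> ('j \<Rightarrow> real \<Rightarrow> nat) \<Rightarrow> real \<Rightarrow> nat list" where
  "skewer_list I time B D mark y =
     map (\<lambda>a. mark a (y - B a))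
       (THE xs. set xs = {a. I a \<and> B a \<le> y \<and> y < D a} \<and> sorted_wrt (\<lambda>a b. time a < time b) xs)"

definition jtime :: "(real \<Rightarrow> nat) \<Rightarrow> nat \<Rightarrow> real" where
  "jtime J i = Inf {t. 0 \<le> t \<and> i \<le> J t}"

definition hit0 :: "(real \<Rightarrow> nat) \<Rightarrow> real" where
  "hit0 f = Inf {s. 0 \<le> s \<and> f s = 0}"

text \<open>Marked process built from chains Z i and Poisson process J:
  X_t = -t + sum_{i \<le> J_t} zeta_i, T its hitting time of 0.\<close>
definition mp_X :: "(nat \<Rightarrow> real \<Rightarrow> nat) \<Rightarrow> (real \<Rightarrow> nat) \<Rightarrow> real \<Rightarrow> real" where
  "mp_X Z J t = - t + (\<Sum>l\<le>J t. hit0 (Z l))"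

definition mp_T :: "(nat \<Rightarrow> real \<Rightarrow> nat) \<Rightarrow> (real \<Rightarrow> nat) \<Rightarrow> real" where
  "mp_T Z J = Inf {t. 0 \<le> t \<and> mp_X Z J t = 0}"

text \<open>Pre-jump height (left limit; X_{0-} = 0) and post-jump height of the i-th jump.\<close>
definition mp_B :: "(nat \<Rightarrow> real \<Rightarrow> nat) \<Rightarrow> (real \<Rightarrow> nat) \<Rightarrow> nat \<Rightarrow> real" where
  "mp_B Z J i = (if i = 0 then 0 else Lim (at_left (jtime J i)) (mp_X Z J))"

definition mp_D :: "(nat \<Rightarrow> real \<Rightarrow> nat) \<Rightarrow> (real \<Rightarrow> nat) \<Rightarrow> nat \<Rightarrow> real" where
  "mp_D Z J i = mp_X Z J (jtime J i)"

definition mp_skewer :: "(nat \<Rightarrow> real \<Rightarrow> nat) \<Rightarrow> (real \<Rightarrow> nat) \<Rightarrow> real \<Rightarrow> nat list" where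
  "mp_skewer Z J y =
     skewer_list (\<lambda>i. i \<le> J (mp_T Z J)) (jtime J) (mp_B Z J) (mp_D Z J) Z y"

text \<open>Negative-time part: N a rate-theta counting process whose jump times are the A_{-j};
  ZN j, JN j the ingredients of the j-th (P_1) marked process, j \<ge> 1.\<close>
definition neg_xi :: "(nat \<Rightarrow> nat \<Rightarrow> real \<Rightarrow> nat) \<Rightarrow> (nat \<Rightarrow> real \<Rightarrow> nat) \<Rightarrow> nat \<Rightarrow> real" where
  "neg_xi ZN JN j = mp_T (ZN j) (JN j)"

definition neg_L :: "(real \<Rightarrow> nat) \<Rightarrow> (nat \<Rightarrow> nat \<Rightarrow> real \<Rightarrow> nat) \<Rightarrow> (nat \<Rightarrow> real \<Rightarrow> nat) \<Rightarrow> nat \<Rightarrow> real" where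
  "neg_L N ZN JN j = - jtime N j - (\<Sum>i=1..j. neg_xi ZN JN i)"

definition neg_skewer :: "(real \<Rightarrow> nat) \<Rightarrow> (nat \<Rightarrow> nat \<Rightarrow> real \<Rightarrow> nat) \<Rightarrow> (nat \<Rightarrow> real \<Rightarrow> nat)
    \<Rightarrow> real \<Rightarrow> nat list" where
  "neg_skewer N ZN JN y =
     skewer_list
       (\<lambda>(j, i). 1 \<le> j \<and> i \<le> JN j (neg_xi ZN JN j))
       (\<lambda>(j, i). neg_L N ZN JN j + jtime (JN j) i)
       (\<lambda>(j, i). jtime N j + mp_B (ZN j) (JN j) i)
       (\<lambda>(j, i). jtime N j + mp_D (ZN j) (JN j) i)
       (\<lambda>(j, i). ZN j i) y"

datatype ingr = PosZ nat nat | PosJ nat | NegZ nat nat | NegJ nat | NegN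

end

theory Submission
  imports Defs
begin

text \<open>A marked path with law P_n is a forest explored depth-first: below the root spindle, births occur
  at the levels met by descending through IID exponential gaps, restarting each time from the top of
  the newborn spindle. Its skewer is a right-continuous path of compositions. Cutting the forest at
  the time s of the first event of the root spindle leaves the forest above s and an independent
  exploration descending from s; decomposing the latter at its lowest birth below s, and using that
  the gaps are memoryless, turns that birth into a competing clock of rate alpha. Hence the skewer
  law of P_n satisfies a first-event equation: after an exponential time it is continued by the law
  of P_(n+1), of P_(n-1), or of independent copies for n and 1 side by side, at rates n - alpha, n
  and alpha. Such equations superpose when independent paths are concatenated, and the immigrants
  contribute one with rate theta, so the concatenated skewer satisfies the first-event equation with
  the rates of the up-down oCRP. Iterating it gives the joint law of jump chain and holding times,
  and a Laplace transform bound excludes explosion since the total rate grows by at most 2 per jump.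
  The path being right-continuous, it is recovered from its jump chain and holding times.\<close>

text \<open>The obstacle is to show that the exploration below a root stops almost surely; without
  this the skewer of a marked path has no law of mass one. In terms of X, a compound Poisson process
  with rate \<alpha>, jumps zeta and drift -1 must reach 0. The stopping probability u(s) from
  height s is multiplicative in s and at least exp(-x s), where x = \<alpha> (1 - q) and q is the
  mean of u(zeta). Averaging gives q \<ge> E exp(-x zeta), whereas E exp(-x zeta) > 1 - x/\<alpha> =
  q for 0 < x \<le> \<alpha>; hence x = 0. The slope 1/\<alpha> in this bound is the mean lifetime
  of a spindle, so the process is critical. A second difficulty is that the exploration meets the
  lowest root birth last. The decomposition at that birth is therefore verified indirectly: it
  solves the renewal equation at the topmost birth, truncated explorations stay below such a
  solution, and of two laws with equal mass none can lie strictly below the other.\<close>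

section \<open>Right-continuous paths with discrete values\<close>

definition rc :: "(real \<Rightarrow> 'a) \<Rightarrow> bool" where
  "rc p \<longleftrightarrow> (\<forall>t. \<forall>\<^sub>F u in at_right t. p u = p t)"

text \<open>A right-continuous path is determined by its values at countably many times. On these
  paths evaluation at a random time, hitting times and jump times are measurable, which fails on the
  full product space. Times before 0 are immaterial for the processes; they are included so that
  shifting a path needs no side condition.\<close>

definition path_space :: "(real \<Rightarrow> 'a) measure" where
  "path_space = restrict_space (PiM UNIV (\<lambda>_. count_space UNIV)) {p. rc p}"

lemma space_path_space [simp]: "space path_space = {p. rc p}"
  by (simp add: path_space_def space_restrict_space space_PiM)

lemma measurable_path_spaceI:
  assumes "\<And>\<omega>. \<omega> \<in> space M \<Longrightarrow> rc (f \<omega>)"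
    and "\<And>t. (\<lambda>\<omega>. f \<omega> t) \<in> M \<rightarrow>\<^sub>M count_space UNIV"
  shows "f \<in> M \<rightarrow>\<^sub>M path_space"
  unfolding path_space_def
  using assms by (intro measurable_restrict_space2 measurable_PiM_single') (auto simp: space_PiM)

lemma measurable_path_eval_fixed: "(\<lambda>p. p t) \<in> path_space \<rightarrow>\<^sub>M count_space UNIV"
  unfolding path_space_def by (intro measurable_restrict_space1 measurable_component_singleton) auto

lemma rc_iff: "rc p \<longleftrightarrow> (\<forall>t. \<exists>d>0. \<forall>u. t \<le> u \<and> u < t + d \<longrightarrow> p u = p t)"
proof -
  have "(\<forall>\<^sub>F u in at_right t. p u = p t) \<longleftrightarrow> (\<exists>d>0. \<forall>u. t \<le> u \<and> u < t + d \<longrightarrow> p u = p t)" (is "?L \<longleftrightarrow> ?R") for t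
  proof
    assume ?L
    then obtain b where b: "b > t" "\<And>y. t < y \<Longrightarrow> y < b \<Longrightarrow> p y = p t"
      unfolding eventually_at_right_field by auto
    show ?R
      by (rule exI[of _ "b - t"]) (use b in \<open>force simp: order_le_less\<close>)
  next
    assume ?R
    then obtain d where d: "d>0" "\<forall>u. t \<le> u \<and> u < t + d \<longrightarrow> p u = p t" by blast
    have "t < t + d" using d(1) by simp
    moreover have "\<forall>y>t. y < t + d \<longrightarrow> p y = p t" using d(2) less_imp_le by blast
    ultimately show ?L unfolding eventually_at_right_field by blast
  qed
  then show ?thesis unfolding rc_def by simp
qed

lemma rcD:
  assumes "rc p" obtains d where "d > 0" "\<And>u. t \<le> u \<Longrightarrow> u < t + d \<Longrightarrow> p u = p t"
  using assms unfolding rc_iff by blast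

lemma rcI: "(\<And>t. \<exists>d>0. \<forall>u. t \<le> u \<and> u < t + d \<longrightarrow> p u = p t) \<Longrightarrow> rc p"
  unfolding rc_iff by blast

lemma rc_const [simp]: "rc (\<lambda>_. c)"
  by (simp add: rc_def)

lemma rc_comp2:
  assumes "rc p" "rc q" shows "rc (\<lambda>t. h (p t) (q t))"
  unfolding rc_def
proof
  fix t
  have "\<forall>\<^sub>F u in at_right t. p u = p t" "\<forall>\<^sub>F u in at_right t. q u = q t"
    using assms by (auto simp: rc_def)
  then show "\<forall>\<^sub>F u in at_right t. h (p u) (q u) = h (p t) (q t)"
    by eventually_elim simp
qed

lemma rc_shift:
  assumes "rc p" shows "rc (\<lambda>t. p (t + s))"
proof (rule rcI)
  fix t
  obtain d where d: "d > 0" "\<And>u. t + s \<le> u \<Longrightarrow> u < t + s + d \<Longrightarrow> p u = p (t + s)"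
    using rcD[OF assms] by blast
  have "p (u + s) = p (t + s)" if "t \<le> u" "u < t + d" for u
    using that by (intro d(2)) auto
  then show "\<exists>d>0. \<forall>u. t \<le> u \<and> u < t + d \<longrightarrow> p (u + s) = p (t + s)"
    using d(1) by blast
qed

text \<open>The value of a right-continuous path is read off along the dyadic points to the right;
  this gives joint measurability in time and path.\<close>

definition dy :: "nat \<Rightarrow> real \<Rightarrow> real" where
  "dy n t = (of_int \<lfloor>t * real (Suc n)\<rfloor> + 1) / real (Suc n)"

lemma dy_gt: "t < dy n t" and dy_le: "dy n t \<le> t + 1 / real (Suc n)"
proof -
  have "t * real (Suc n) < of_int \<lfloor>t * real (Suc n)\<rfloor> + 1" "of_int \<lfloor>t * real (Suc n)\<rfloor> \<le> t * real (Suc n)"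
    by linarith+
  then show "t < dy n t" "dy n t \<le> t + 1 / real (Suc n)"
    unfolding dy_def by (simp_all add: pos_less_divide_eq pos_divide_le_eq distrib_right del: of_nat_Suc)
qed

lemma rc_eventually_dy:
  assumes "rc p" shows "\<forall>\<^sub>F n in sequentially. p (dy n t) = p t"
proof -
  obtain d where d: "d > 0" "\<And>u. t \<le> u \<Longrightarrow> u < t + d \<Longrightarrow> p u = p t" using rcD[OF assms] by blast
  have "\<forall>\<^sub>F n in sequentially. 1 / real (Suc n) < d"
    using d(1) by real_asymp
  then show ?thesis
  proof eventually_elim
    case (elim n)
    then show ?case using dy_gt[of t n] dy_le[of n t] by (intro d(2)) linarith+
  qed
qed

lemma rc_eq_iff_dy:
  assumes "rc p" shows "p t = c \<longleftrightarrow> (\<exists>N. \<forall>n\<ge>N. p (dy n t) = c)"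
  using rc_eventually_dy[OF assms, of t] unfolding eventually_sequentially
  by (metis nle_le)

lemma measurable_path_eval [measurable (raw)]:
  fixes f :: "'b \<Rightarrow> real \<Rightarrow> 'a::countable"
  assumes f [measurable]: "f \<in> M \<rightarrow>\<^sub>M path_space" and g [measurable]: "g \<in> M \<rightarrow>\<^sub>M borel"
  shows "(\<lambda>x. f x (g x)) \<in> M \<rightarrow>\<^sub>M count_space UNIV"
proof (rule measurable_count_space_eq2_countable[THEN iffD2])
  \<comment> \<open>For fixed n the evaluation time runs through a countable grid, so this is a
    countable case distinction over evaluations at fixed times.\<close>
  have 1: "(\<lambda>x. f x (dy n (g x))) \<in> M \<rightarrow>\<^sub>M count_space UNIV" for n
  proof -
    have "(\<lambda>x. f x ((of_int i + 1) / real (Suc n))) \<in> M \<rightarrow>\<^sub>M count_space UNIV" for i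
      by (rule measurable_compose[OF f measurable_path_eval_fixed])
    moreover have "(\<lambda>x. \<lfloor>g x * real (Suc n)\<rfloor>) \<in> M \<rightarrow>\<^sub>M count_space UNIV"
      by measurable
    ultimately have "(\<lambda>x. (\<lambda>i x. f x ((of_int i + 1) / real (Suc n))) (\<lfloor>g x * real (Suc n)\<rfloor>) x) \<in> M \<rightarrow>\<^sub>M count_space UNIV"
      by (rule measurable_compose_countable)
    then show ?thesis by (simp only: dy_def)
  qed
  have 2: "rc (f x)" if "x \<in> space M" for x
    using measurable_space[OF f that] by simp
  have "(\<lambda>x. f x (g x)) -` {a} \<inter> space M \<in> sets M" for a
  proof -
    have "(\<lambda>x. f x (g x)) -` {a} \<inter> space M
        = {x\<in>space M. \<exists>N. \<forall>n\<in>{N..}. f x (dy n (g x)) \<in> {a}}" (is "?L = ?R")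
    proof -
      have "f x (g x) = a \<longleftrightarrow> (\<exists>N. \<forall>n\<in>{N..}. f x (dy n (g x)) \<in> {a})" if "x \<in> space M" for x
        using rc_eq_iff_dy[OF 2[OF that]] by (metis atLeast_iff singleton_iff)
      then show "?L = ?R" by blast
    qed
    also have "\<dots> \<in> sets M"
      using 1 by measurable
    finally show ?thesis .
  qed
  then show "(\<lambda>x. f x (g x)) \<in> space M \<rightarrow> UNIV \<and> (\<forall>a\<in>UNIV. (\<lambda>x. f x (g x)) -` {a} \<inter> space M \<in> sets M)"
    by auto
qed

section \<open>Delaying and concatenating paths; lifetime of a spindle\<close>

text \<open>Used in two ways: with c = [] it raises a clade to its birth level s, and with c the
  present state it puts the first holding time s in front of the continuation.\<close>

definition jn :: "'a \<Rightarrow> real \<Rightarrow> (real \<Rightarrow> 'a) \<Rightarrow> real \<Rightarrow> 'a" where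
  "jn c s p y = (if y < s then c else p (y - s))"

definition cat :: "(real \<Rightarrow> 'a list) \<Rightarrow> (real \<Rightarrow> 'a list) \<Rightarrow> real \<Rightarrow> 'a list" where
  "cat p q y = p y @ q y"

abbreviation nil :: "real \<Rightarrow> 'a list" where "nil \<equiv> (\<lambda>_. [])"

lemma rc_jn [simp]: assumes "rc p" shows "rc (jn c s p)"
proof (rule rcI)
  fix t
  obtain d where d: "d > 0" "\<And>u. t - s \<le> u \<Longrightarrow> u < t - s + d \<Longrightarrow> p u = p (t - s)" using rcD[OF assms] by blast
  show "\<exists>d>0. \<forall>u. t \<le> u \<and> u < t + d \<longrightarrow> jn c s p u = jn c s p t"
  proof (cases "t < s")
    case True
    then show ?thesis by (intro exI[of _ "s - t"]) (auto simp: jn_def)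
  next
    case False
    have "jn c s p u = jn c s p t" if "t \<le> u" "u < t + d" for u
    proof -
      have "p (u - s) = p (t - s)" using that by (intro d(2)) auto
      with that False show ?thesis unfolding jn_def by simp
    qed
    then show ?thesis using d(1) by blast
  qed
qed

lemma rc_cat [simp]: "rc p \<Longrightarrow> rc q \<Longrightarrow> rc (cat p q)"
  unfolding cat_def by (rule rc_comp2)

lemma measurable_jn [measurable (raw)]:
  fixes p :: "'b \<Rightarrow> real \<Rightarrow> 'a::countable"
  assumes s [measurable]: "s \<in> borel_measurable M" and p [measurable]: "p \<in> M \<rightarrow>\<^sub>M path_space"
    and c [measurable]: "c \<in> M \<rightarrow>\<^sub>M count_space UNIV"
  shows "(\<lambda>x. jn (c x) (s x) (p x)) \<in> M \<rightarrow>\<^sub>M path_space"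
  using measurable_space[OF p]
  by (intro measurable_path_spaceI) (auto simp: jn_def)

lemma measurable_cat [measurable (raw)]:
  fixes p :: "'b \<Rightarrow> real \<Rightarrow> 'a::countable list"
  assumes p [measurable]: "p \<in> M \<rightarrow>\<^sub>M path_space" and q [measurable]: "q \<in> M \<rightarrow>\<^sub>M path_space"
  shows "(\<lambda>x. cat (p x) (q x)) \<in> M \<rightarrow>\<^sub>M path_space"
  using measurable_space[OF p] measurable_space[OF q]
  by (intro measurable_path_spaceI) (auto simp: cat_def[abs_def] intro: rc_comp2)

lemma cat_nil [simp]: "cat nil p = p" "cat p nil = p"
  by (auto simp: cat_def)

lemma cat_assoc: "cat (cat p q) r = cat p (cat q r)"
  by (auto simp: cat_def)

lemma jn_nil [simp]: "jn [] s nil = nil"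
  by (auto simp: jn_def)

lemma cat_jn: "cat (jn a s p) (jn b s q) = jn (a @ b) s (cat p q)"
  by (auto simp: cat_def jn_def)

lemma jn_jn: "0 \<le> t \<Longrightarrow> jn c s (jn c t p) = jn c (s + t) p"
  by (auto simp: jn_def fun_eq_iff algebra_simps)

text \<open>Path form of competing clocks: the earlier event, at time s, is split off from the
  concatenation, and the other component keeps waiting for its residual time t.\<close>

lemma cat_jn_less: "0 \<le> t \<Longrightarrow> cat (jn a s p) (jn b (s + t) q) = jn (a @ b) s (cat p (jn b t q))"
  "0 \<le> t \<Longrightarrow> cat (jn a (s + t) p) (jn b s q) = jn (a @ b) s (cat (jn a t p) q)"
  by (simp_all add: jn_jn[symmetric] cat_jn)

text \<open>On right-continuous paths zeta is hit0; the infimum over rational times makes it measurable.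
  Its value is 0 if the path does not hit 0.\<close>

definition hits :: "(real \<Rightarrow> nat) \<Rightarrow> bool" where "hits z \<longleftrightarrow> (\<exists>q\<in>\<rat> \<inter> {0..}. z q = 0)"

definition zeta :: "(real \<Rightarrow> nat) \<Rightarrow> real" where
  "zeta z = enn2real (INF q\<in>\<rat> \<inter> {0..}. if z q = 0 then ennreal q else \<top>)"

text \<open>The skewer of a single spindle rooted at level 0. A spindle that never dies has
  \<open>zeta\<close> 0 by convention and contributes no block at times y \<ge> 0.\<close>

definition rp :: "(real \<Rightarrow> nat) \<Rightarrow> real \<Rightarrow> nat list" where
  "rp z y = (if y < zeta z then [z y] else [])"

lemma countable_Rats_nonneg [simp]: "countable (\<rat> \<inter> {0::real..})"
  using countable_rat by (rule countable_Int1)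

lemma measurable_hits [measurable]: "Measurable.pred path_space hits"
  unfolding hits_def[abs_def]
  by (rule measurable_pred_countable(2)) auto

lemma measurable_zeta [measurable]: "zeta \<in> borel_measurable path_space"
proof -
  have "(\<lambda>z. INF q\<in>\<rat> \<inter> {0..}. if z q = (0::nat) then ennreal q else \<top>) \<in> borel_measurable path_space"
    by (intro borel_measurable_INF countable_Rats_nonneg) measurable
  then show ?thesis unfolding zeta_def[abs_def] by measurable
qed

lemma zeta_nonneg [simp]: "0 \<le> zeta z"
  by (simp add: zeta_def)

lemma rc_rp [simp]: assumes "rc z" shows "rc (rp z)"
proof (rule rcI)
  fix t
  obtain d where d: "d > 0" "\<And>u. t \<le> u \<Longrightarrow> u < t + d \<Longrightarrow> z u = z t" using rcD[OF assms] by blast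
  show "\<exists>d>0. \<forall>u. t \<le> u \<and> u < t + d \<longrightarrow> rp z u = rp z t"
  proof (cases "t < zeta z")
    case True
    define e where "e = min d (zeta z - t)"
    have "rp z u = rp z t" if "t \<le> u" "u < t + e" for u
    proof -
      have "z u = z t" using that by (intro d(2)) (auto simp: e_def)
      with that True show ?thesis unfolding rp_def e_def by simp
    qed
    moreover have "e > 0" using True d(1) by (simp add: e_def)
    ultimately show ?thesis by blast
  next
    case False
    have "rp z u = rp z t" if "t \<le> u" for u
      using that False unfolding rp_def by simp
    then show ?thesis using zero_less_one by blast
  qed
qed

lemma measurable_rp [measurable (raw)]:
  assumes z [measurable]: "z \<in> M \<rightarrow>\<^sub>M path_space"
  shows "(\<lambda>x. rp (z x)) \<in> M \<rightarrow>\<^sub>M path_space"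
  using measurable_space[OF z]
  by (intro measurable_path_spaceI) (auto simp: rp_def)

text \<open>By right-continuity the path remains at 0 for a positive time after s, so there are
  rational zeros arbitrarily close to the right of s, and the rational infimum is s.\<close>

lemma zeta_char:
  assumes "rc z" "0 \<le> s" "z s = 0" "\<And>t. 0 \<le> t \<Longrightarrow> t < s \<Longrightarrow> z t \<noteq> 0"
  shows "zeta z = s" "hits z"
proof -
  obtain d where d: "d > 0" "\<And>u. s \<le> u \<Longrightarrow> u < s + d \<Longrightarrow> z u = z s" using rcD[OF assms(1)] by blast
  have q: "\<exists>q\<in>\<rat> \<inter> {0..}. z q = 0 \<and> q < s + e \<and> s \<le> q" if "e > 0" for e
  proof -
    obtain q where "q \<in> \<rat>" "s < q" "q < s + min d e"
      using Rats_dense_in_real[of s "s + min d e"] d(1) \<open>e > 0\<close> by auto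
    then show ?thesis using d(2)[of q] assms by (intro bexI[of _ q]) auto
  qed
  from q[of 1] show "hits z" unfolding hits_def by auto
  have "(INF q\<in>\<rat> \<inter> {0..}. if z q = 0 then ennreal q else \<top>) = ennreal s"
  proof (rule antisym)
    show "(INF q\<in>\<rat> \<inter> {0..}. if z q = 0 then ennreal q else \<top>) \<le> ennreal s"
    proof (rule ennreal_le_epsilon)
      fix e :: real assume "e > 0"
      obtain q where q: "q\<in>\<rat> \<inter> {0..}" "z q = 0" "q < s + e" using q[OF \<open>e>0\<close>] by auto
      have "(INF q\<in>\<rat> \<inter> {0..}. if z q = 0 then ennreal q else \<top>) \<le> ennreal q"
        using q by (intro INF_lower2[OF q(1)]) auto
      also have "\<dots> \<le> ennreal s + ennreal e" using q assms \<open>e>0\<close> by (simp flip: ennreal_plus)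
      finally show "(INF q\<in>\<rat> \<inter> {0..}. if z q = 0 then ennreal q else \<top>) \<le> ennreal s + ennreal e" .
    qed
    show "ennreal s \<le> (INF q\<in>\<rat> \<inter> {0..}. if z q = 0 then ennreal q else \<top>)"
      using assms by (intro INF_greatest) (force intro: leI)
  qed
  then show "zeta z = s" using assms by (simp add: zeta_def)
qed

text \<open>The infimum of the zeros is itself a zero: right-continuity forbids the value to change
  between the infimum and zeros just after it.\<close>

lemma hits_obtain:
  assumes "rc z" "hits z"
  obtains s where "0 \<le> s" "z s = 0" "\<And>t. 0 \<le> t \<Longrightarrow> t < s \<Longrightarrow> z t \<noteq> 0"
proof -
  define A where "A = {s. 0 \<le> s \<and> z s = 0}"
  have ne: "A \<noteq> {}" using assms unfolding hits_def A_def by auto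
  have bb: "bdd_below A" unfolding A_def by (intro bdd_belowI[of _ 0]) auto
  define s where "s = Inf A"
  have "0 \<le> s" unfolding s_def using ne by (intro cInf_greatest) (auto simp: A_def)
  moreover have "z t \<noteq> 0" if "0 \<le> t" "t < s" for t
    using cInf_lower[OF _ bb, of t] that unfolding s_def A_def by auto
  moreover have "z s = 0"
  proof -
    obtain d where d: "d > 0" "\<And>u. s \<le> u \<Longrightarrow> u < s + d \<Longrightarrow> z u = z s" using rcD[OF assms(1)] by blast
    obtain a where "a \<in> A" "a < s + d" using cInf_lessD[OF ne, of "s + d"] d(1) unfolding s_def by auto
    moreover have "s \<le> a" using \<open>a \<in> A\<close> bb unfolding s_def by (rule cInf_lower)
    ultimately show ?thesis using d(2)[of a] unfolding A_def by auto
  qed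
  ultimately show thesis using that by auto
qed

lemma hit0_eq_zeta:
  assumes "rc z" "hits z" shows "hit0 z = zeta z"
proof -
  obtain s where s: "0 \<le> s" "z s = 0" "\<And>t. 0 \<le> t \<Longrightarrow> t < s \<Longrightarrow> z t \<noteq> 0"
    using hits_obtain[OF assms] by blast
  have "hit0 z = s" unfolding hit0_def
  proof (intro cInf_eq_minimum)
    show "s \<le> x" if "x \<in> {s. 0 \<le> s \<and> z s = 0}" for x
      using s(3)[of x] that by (cases "x < s") auto
  qed (use s in auto)
  then show ?thesis using zeta_char[OF assms(1) s] by simp
qed

text \<open>A stretch at a nonzero state only postpones death. The assumption \<open>hits z\<close>
  matters: for an immortal path \<open>zeta\<close> is 0 with or without the prefix.\<close>

lemma hits_jn:
  assumes "rc z" "hits z" "c \<noteq> 0" "0 \<le> s"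
  shows "hits (jn c s z)" "zeta (jn c s z) = s + zeta z" "rp (jn c s z) = jn [c] s (rp z)"
proof -
  obtain u where u: "0 \<le> u" "z u = 0" "\<And>t. 0 \<le> t \<Longrightarrow> t < u \<Longrightarrow> z t \<noteq> 0"
    using hits_obtain[OF assms(1,2)] by blast
  have 1: "zeta z = u" using zeta_char[OF assms(1) u] by simp
  have "zeta (jn c s z) = s + u \<and> hits (jn c s z)"
    using zeta_char[of "jn c s z" "s + u"] u assms by (auto simp: jn_def)
  then show "hits (jn c s z)" "zeta (jn c s z) = s + zeta z" by (auto simp: 1)
  then show "rp (jn c s z) = jn [c] s (rp z)"
    using zeta_nonneg[of z] by (auto simp: rp_def jn_def fun_eq_iff simp del: zeta_nonneg)
qed

lemma zeta_pos:
  assumes "rc z" "hits z" "z 0 \<noteq> 0" shows "0 < zeta z"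
proof -
  obtain u where u: "0 \<le> u" "z u = 0" "\<And>t. 0 \<le> t \<Longrightarrow> t < u \<Longrightarrow> z t \<noteq> 0"
    using hits_obtain[OF assms(1,2)] by blast
  then show ?thesis using zeta_char[OF assms(1) u] assms(3) by (metis order_le_less)
qed

section \<open>Exponential laws and a Laplace criterion for divergence\<close>

lemma nn_integral_exp_tail:
  fixes a l :: real assumes "0 < l"
  shows "(\<integral>\<^sup>+x. ennreal (exp (- l * x)) * indicator {a..} x \<partial>lborel) = ennreal (exp (- l * a) / l)"
proof -
  have "(\<integral>\<^sup>+x. ennreal (exp (- l * x)) * indicator {a..} x \<partial>lborel) = ennreal (0 - (- exp (- l * a) / l))"
  proof (rule nn_integral_FTC_atLeast)
    show "((\<lambda>x. - exp (- l * x) / l) \<longlongrightarrow> 0) at_top" using assms by real_asymp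
    show "DERIV (\<lambda>x. - exp (- l * x) / l) x :> exp (- l * x)" for x
      using assms by (auto intro!: derivative_eq_intros)
  qed auto
  then show ?thesis by simp
qed

text \<open>The exponential law with rate r on [0, \<infinity>]; rate 0 gives the point mass at \<infinity>.\<close>

definition expo :: "real \<Rightarrow> ennreal measure" where
  "expo r = (if r \<le> 0 then return borel top else distr (density lborel (exponential_density r)) borel ennreal)"

lemma sets_expo [measurable_cong, simp]: "sets (expo r) = sets borel"
  by (simp add: expo_def)

lemma space_expo [simp]: "space (expo r) = UNIV"
  by (simp add: expo_def)

lemma prob_space_expo: "prob_space (expo r)"
  unfolding expo_def using prob_space_exponential_density[of r]
  by (auto intro!: prob_space_return prob_space.prob_space_distr)

lemma nn_integral_expo:
  assumes r: "0 < r" and g [measurable]: "g \<in> borel_measurable borel"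
  shows "(\<integral>\<^sup>+x. g x \<partial>expo r) = (\<integral>\<^sup>+x. ennreal (r * exp (- r * x)) * indicator {0..} x * g (ennreal x) \<partial>lborel)"
proof -
  have "(\<integral>\<^sup>+x. g x \<partial>expo r) = (\<integral>\<^sup>+x. ennreal (exponential_density r x) * g (ennreal x) \<partial>lborel)"
    using r by (simp add: expo_def nn_integral_distr nn_integral_density)
  also have "\<dots> = (\<integral>\<^sup>+x. ennreal (r * exp (- r * x)) * indicator {0..} x * g (ennreal x) \<partial>lborel)"
    by (intro nn_integral_cong) (auto simp: exponential_density_def indicator_def mult.commute)
  finally show ?thesis .
qed

lemma AE_expo_finite: assumes "0 < r" shows "AE e in expo r. e < top"
proof -
  have "(\<integral>\<^sup>+e. (if e < top then 0 else 1) \<partial>expo r) = 0"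
    by (subst nn_integral_expo[OF assms]) auto
  then have "AE e in expo r. (if e < top then 0 else 1) = (0::ennreal)"
    by (subst (asm) nn_integral_0_iff_AE) auto
  then show ?thesis by eventually_elim (auto split: if_splits)
qed

lemma nn_integral_expo0: "g \<in> borel_measurable borel \<Longrightarrow> (\<integral>\<^sup>+x. g x \<partial>expo 0) = g top"
  by (simp add: expo_def nn_integral_return)

text \<open>In the application e is the gap below height h: either it exceeds h and the descent
  ends, or it ends at a level b = h - e. The reflection x = h - b turns the density of the gap into
  that of the level. The tie e = h has mass 0 and is given the value 0, as in \<open>stn\<close>,
  where it counts as not stopping.\<close>

lemma nn_integral_expo_split:
  assumes r: "0 \<le> r" and h: "0 \<le> h" and g [measurable]: "g \<in> borel_measurable borel"
  shows "(\<integral>\<^sup>+e. (if ennreal h < e then A else if e < ennreal h then g (enn2real e) else 0) \<partial>expo r)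
     = ennreal (exp (- r * h)) * A
       + (\<integral>\<^sup>+b. ennreal (r * exp (- r * (h - b))) * indicator {0<..<h} b * g (h - b) \<partial>lborel)"
proof (cases "r = 0")
  case True
  then show ?thesis using h by (simp add: nn_integral_expo0)
next
  case False
  then have r: "0 < r" using r by simp
  have tail: "(\<integral>\<^sup>+x. ennreal (r * exp (- r * x)) * indicator {h..} x \<partial>lborel) = ennreal (exp (- r * h))"
  proof -
    have "(\<integral>\<^sup>+x. ennreal (r * exp (- r * x)) * indicator {h..} x \<partial>lborel)
        = (\<integral>\<^sup>+x. ennreal r * (ennreal (exp (- r * x)) * indicator {h..} x) \<partial>lborel)"
      using r by (intro nn_integral_cong) (simp add: ennreal_mult mult.assoc)
    also have "\<dots> = ennreal r * ennreal (exp (- r * h) / r)"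
      unfolding nn_integral_exp_tail[OF r, of h, symmetric] by (rule nn_integral_cmult) measurable
    also have "\<dots> = ennreal (exp (- r * h))" using r by (subst ennreal_mult[symmetric]) auto
    finally show ?thesis .
  qed
  have "(\<integral>\<^sup>+e. (if ennreal h < e then A else if e < ennreal h then g (enn2real e) else 0) \<partial>expo r)
     = (\<integral>\<^sup>+x. ennreal (r * exp (- r * x)) * indicator {h..} x * A
         + ennreal (r * exp (- r * x)) * indicator {0<..<h} x * g x \<partial>lborel)"
    unfolding nn_integral_expo[OF r, of "\<lambda>e. if ennreal h < e then A else if e < ennreal h then g (enn2real e) else 0", simplified]
    by (rule nn_integral_cong_AE, use AE_lborel_singleton[of 0] AE_lborel_singleton[of h] in eventually_elim)
       (use h in \<open>auto simp: indicator_def ennreal_less_iff split: if_splits\<close>)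
  also have "\<dots> = (\<integral>\<^sup>+x. ennreal (r * exp (- r * x)) * indicator {h..} x * A \<partial>lborel)
      + (\<integral>\<^sup>+x. ennreal (r * exp (- r * x)) * indicator {0<..<h} x * g x \<partial>lborel)"
    by (intro nn_integral_add) auto
  also have "(\<integral>\<^sup>+x. ennreal (r * exp (- r * x)) * indicator {h..} x * A \<partial>lborel) = ennreal (exp (- r * h)) * A"
    by (subst nn_integral_multc) (auto simp: tail[simplified])
  also have "(\<integral>\<^sup>+x. ennreal (r * exp (- r * x)) * indicator {0<..<h} x * g x \<partial>lborel)
    = (\<integral>\<^sup>+b. ennreal (r * exp (- r * (h - b))) * indicator {0<..<h} b * g (h - b) \<partial>lborel)"
    by (subst nn_integral_real_affine[where c="-1" and t=h])
       (auto intro!: nn_integral_cong simp: indicator_def)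
  finally show ?thesis .
qed

lemma emeasure_expo_gt:
  assumes "0 \<le> r" "0 \<le> s" shows "emeasure (expo r) {e. ennreal s < e} = ennreal (exp (- r * s))"
proof -
  have "emeasure (expo r) {e. ennreal s < e} = (\<integral>\<^sup>+e. indicator {e. ennreal s < e} e \<partial>expo r)"
    by (subst nn_integral_indicator) auto
  also have "\<dots> = (\<integral>\<^sup>+e. (if ennreal s < e then 1 else if e < ennreal s then (\<lambda>_. 0) (enn2real e) else 0) \<partial>expo r)"
    by (intro nn_integral_cong) (auto simp: indicator_def)
  also have "\<dots> = ennreal (exp (- r * s))"
    by (subst nn_integral_expo_split[OF assms]) auto
  finally show ?thesis .
qed

text \<open>The Laplace parameter 2 equals the largest growth of the total rate per jump. Then the
  factor r / (r + 2) of one holding time cancels against the numerator of the bound for the chain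
  after the jump, and the bounds telescope to c / (c + 2 * k).\<close>

definition eexp :: "ennreal \<Rightarrow> ennreal" where
  "eexp h = (if h = top then 0 else ennreal (exp (- 2 * enn2real h)))"

lemma measurable_eexp [measurable]: "eexp \<in> borel_measurable borel"
  unfolding eexp_def[abs_def] by measurable

lemma eexp_le_1: "eexp h \<le> 1"
  by (auto simp: eexp_def intro!: ennreal_le_1)

lemma nn_integral_eexp:
  assumes "0 \<le> r" shows "(\<integral>\<^sup>+h. eexp h \<partial>expo r) = ennreal (r / (r + 2))"
proof (cases "r = 0")
  case False
  then have r: "0 < r" using assms by simp
  have "(\<integral>\<^sup>+h. eexp h \<partial>expo r) = (\<integral>\<^sup>+x. ennreal r * (ennreal (exp (- (r + 2) * x)) * indicator {0..} x) \<partial>lborel)"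
    unfolding nn_integral_expo[OF r measurable_eexp]
  proof (intro nn_integral_cong)
    fix x :: real
    show "ennreal (r * exp (- r * x)) * indicator {0..} x * eexp (ennreal x) =
      ennreal r * (ennreal (exp (- (r + 2) * x)) * indicator {0..} x)"
    proof (cases "0 \<le> x")
      case True
      have "exp (- (r + 2) * x) = exp (- r * x) * exp (- 2 * x)"
        by (simp add: exp_add[symmetric] algebra_simps)
      with True r show ?thesis
        by (simp add: eexp_def ennreal_mult mult.assoc)
    qed (simp add: indicator_def)
  qed
  also have "\<dots> = ennreal r * ennreal (1 / (r + 2))"
    using nn_integral_exp_tail[of "r + 2" 0] r by (subst nn_integral_cmult) auto
  finally show ?thesis using r by (simp flip: ennreal_mult)
qed (simp add: nn_integral_expo0 eexp_def)

lemma eexp_add: "eexp (a + b) = eexp a * eexp b"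
proof (cases "a = top \<or> b = top")
  case False
  then obtain x y where "a = ennreal x" "0 \<le> x" "b = ennreal y" "0 \<le> y"
    by (metis ennreal_cases)
  then show ?thesis
    by (simp add: eexp_def exp_add[symmetric] algebra_simps flip: ennreal_plus ennreal_mult)
qed (auto simp: eexp_def)

lemma eexp_sum: "eexp (\<Sum>i<k. h i) = (\<Prod>i<k::nat. eexp (h i))"
  by (induction k) (auto simp: eexp_add, simp add: eexp_def)

lemma eexp_antimono: "a \<le> b \<Longrightarrow> eexp b \<le> eexp a"
  by (cases a; cases b) (auto simp: eexp_def top_unique intro!: ennreal_leI)

text \<open>Non-explosion: the bound is that of a pure birth process whose rate grows by 2 per jump.\<close>

lemma AE_suminf_top:
  fixes H :: "'w \<Rightarrow> nat \<Rightarrow> ennreal" and c :: real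
  assumes [measurable]: "\<And>i. (\<lambda>\<omega>. H \<omega> i) \<in> borel_measurable M" and "0 < c"
    and le: "\<And>k. (\<integral>\<^sup>+\<omega>. (\<Prod>i<k. eexp (H \<omega> i)) \<partial>M) \<le> ennreal (c / (c + 2 * real k))"
  shows "AE \<omega> in M. (\<Sum>i. H \<omega> i) = top"
proof -
  \<comment> \<open>Each partial sum is below the series and \<open>eexp\<close> is decreasing, so
    every k bounds the transform of the whole series, which must then be 0.\<close>
  have "(\<integral>\<^sup>+\<omega>. eexp (\<Sum>i. H \<omega> i) \<partial>M) \<le> ennreal (c / (c + 2 * real k))" for k
  proof -
    have "(\<integral>\<^sup>+\<omega>. eexp (\<Sum>i. H \<omega> i) \<partial>M) \<le> (\<integral>\<^sup>+\<omega>. eexp (\<Sum>i<k. H \<omega> i) \<partial>M)"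
      by (intro nn_integral_mono eexp_antimono sum_le_suminf) auto
    also have "\<dots> \<le> ennreal (c / (c + 2 * real k))" using le[of k] by (simp add: eexp_sum)
    finally show ?thesis .
  qed
  moreover have "(\<lambda>k. ennreal (c / (c + 2 * real k))) \<longlonglongrightarrow> ennreal 0"
    by (intro tendsto_ennrealI) real_asymp
  ultimately have "(\<integral>\<^sup>+\<omega>. eexp (\<Sum>i. H \<omega> i) \<partial>M) \<le> 0"
    by (intro LIMSEQ_le_const[of _ 0]) auto
  then have "(\<integral>\<^sup>+\<omega>. eexp (\<Sum>i. H \<omega> i) \<partial>M) = 0" by simp
  then have "AE \<omega> in M. eexp (\<Sum>i. H \<omega> i) = 0"
    by (subst (asm) nn_integral_0_iff_AE) auto
  then show ?thesis
    by eventually_elim (auto simp: eexp_def split: if_splits)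
qed

section \<open>Jump chain and holding times of a right-continuous path\<close>

text \<open>Rational times suffice to detect the first change, since by right-continuity a new value
  persists for a positive time. A path that never changes gets the value top.\<close>

definition H0 :: "(real \<Rightarrow> 'a) \<Rightarrow> ennreal" where
  "H0 p = (INF q\<in>\<rat> \<inter> {0..}. if p q \<noteq> p 0 then ennreal q else top)"

text \<open>A path that has stopped moving is its own successor, so the iteration is total and an
  absorbed path has holding times top from then on.\<close>

definition nxt :: "(real \<Rightarrow> 'a) \<Rightarrow> real \<Rightarrow> 'a" where
  "nxt p = (if H0 p = top then p else (\<lambda>t. p (t + enn2real (H0 p))))"

definition YE :: "(real \<Rightarrow> 'a) \<Rightarrow> nat \<Rightarrow> 'a" where "YE p n = (nxt ^^ n) p 0"
definition HE :: "(real \<Rightarrow> 'a) \<Rightarrow> nat \<Rightarrow> ennreal" where "HE p n = H0 ((nxt ^^ n) p)"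

lemma measurable_H0 [measurable]: "H0 \<in> borel_measurable (path_space :: (real \<Rightarrow> 'a::countable) measure)"
  unfolding H0_def[abs_def] by (intro borel_measurable_INF countable_Rats_nonneg) measurable

lemma measurable_nxt [measurable]: "nxt \<in> path_space \<rightarrow>\<^sub>M (path_space :: (real \<Rightarrow> 'a::countable) measure)"
proof (rule measurable_path_spaceI)
  show "rc (nxt \<omega>)" if "\<omega> \<in> space path_space" for \<omega> :: "real \<Rightarrow> 'a"
    using that by (auto simp: nxt_def rc_shift)
  show "(\<lambda>\<omega>. nxt \<omega> t) \<in> path_space \<rightarrow>\<^sub>M (count_space UNIV :: 'a measure)" for t
  proof -
    have "(\<lambda>\<omega>. if H0 \<omega> = top then \<omega> t else \<omega> (t + enn2real (H0 \<omega>))) \<in> path_space \<rightarrow>\<^sub>M (count_space UNIV :: 'a measure)"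
      by measurable
    then show ?thesis by (simp add: nxt_def if_distrib[where f="\<lambda>p. p t"] cong: if_cong)
  qed
qed

lemma measurable_YE [measurable]: "(\<lambda>p. YE p n) \<in> path_space \<rightarrow>\<^sub>M (count_space UNIV :: 'a::countable measure)"
  unfolding YE_def by measurable

lemma measurable_HE [measurable]: "(\<lambda>p :: real \<Rightarrow> 'a::countable. HE p n) \<in> borel_measurable path_space"
  unfolding HE_def by measurable

lemma YE_0 [simp]: "YE p 0 = p 0" and HE_0 [simp]: "HE p 0 = H0 p"
  and YE_Suc: "YE p (Suc n) = YE (nxt p) n" and HE_Suc: "HE p (Suc n) = HE (nxt p) n"
  by (simp_all add: YE_def HE_def funpow_swap1)

lemma rc_nxt: "rc p \<Longrightarrow> rc (nxt p)"
  by (auto simp: nxt_def rc_shift)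

text \<open>A rational time slightly after t and still below \<open>H0 p\<close> carries the value p
  t by right-continuity, and the value p 0 by definition of the infimum.\<close>

lemma H0_less:
  assumes "rc p" "0 \<le> t" "ennreal t < H0 p" shows "p t = p 0"
proof -
  obtain d where d: "d > 0" "\<And>u. t \<le> u \<Longrightarrow> u < t + d \<Longrightarrow> p u = p t" using rcD[OF assms(1)] by blast
  obtain r where r: "t < r" "ennreal r \<le> H0 p"
  proof (cases "H0 p")
    case (real x)
    then show ?thesis using that[of x] assms by (auto simp: ennreal_less_iff)
  next
    case top
    then show ?thesis using that[of "t+1"] by simp
  qed
  obtain q where q: "q \<in> \<rat>" "t < q" "q < min r (t + d)"
    using Rats_dense_in_real[of t "min r (t+d)"] d(1) r(1) by auto
  have "p q = p 0"
  proof (rule ccontr)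
    assume "p q \<noteq> p 0"
    then have "H0 p \<le> ennreal q"
      unfolding H0_def using q assms by (intro INF_lower2[of q]) auto
    with r have "ennreal r \<le> ennreal q" by simp
    with q assms show False by (simp add: ennreal_le_iff)
  qed
  moreover have "p q = p t" using d(2)[of q] q by simp
  ultimately show ?thesis by simp
qed

lemma H0_cong: "(\<And>t. 0 \<le> t \<Longrightarrow> p t = p' t) \<Longrightarrow> H0 p = H0 p'"
  unfolding H0_def by (intro INF_cong) auto

lemma nxt_pow_cong:
  assumes "\<And>t. 0 \<le> t \<Longrightarrow> p t = p' t" "0 \<le> t" shows "(nxt ^^ n) p t = (nxt ^^ n) p' t"
  using assms
proof (induction n arbitrary: p p' t)
  case (Suc n)
  have "H0 p = H0 p'" by (rule H0_cong) (rule Suc)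
  then have "nxt p t = nxt p' t" if "0 \<le> t" for t
    using that Suc.prems(1) by (auto simp: nxt_def)
  then show ?case using Suc.IH[of "nxt p" "nxt p'" t] Suc.prems(2) by (simp add: funpow_swap1)
qed auto

lemma YE_HE_cong:
  assumes "\<And>t. 0 \<le> t \<Longrightarrow> p t = p' t" shows "YE p = YE p'" "HE p = HE p'"
  using nxt_pow_cong[of p p'] assms
  by (auto simp: YE_def HE_def fun_eq_iff intro!: H0_cong)

lemma H0_jn:
  assumes "rc p" "0 < s" "p 0 \<noteq> c" shows "H0 (jn c s p) = ennreal s"
proof (rule antisym)
  show "ennreal s \<le> H0 (jn c s p)"
    unfolding H0_def using assms by (intro INF_greatest) (auto simp: jn_def intro!: ennreal_leI)
  show "H0 (jn c s p) \<le> ennreal s"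
  proof (rule ennreal_le_epsilon)
    fix e :: real assume e: "0 < e"
    obtain d where d: "d > 0" "\<And>u. 0 \<le> u \<Longrightarrow> u < 0 + d \<Longrightarrow> p u = p 0" using rcD[OF assms(1)] by blast
    obtain q where q: "q \<in> \<rat>" "s < q" "q < s + min d e"
      using Rats_dense_in_real[of s "s + min d e"] d(1) e by auto
    have "H0 (jn c s p) \<le> ennreal q"
      unfolding H0_def using q assms d(2)[of "q - s"] by (intro INF_lower2[of q]) (auto simp: jn_def)
    also have "\<dots> \<le> ennreal s + ennreal e" using q e assms by (simp flip: ennreal_plus)
    finally show "H0 (jn c s p) \<le> ennreal s + ennreal e" .
  qed
qed

text \<open>The bridge from first-event equations to jump chains. The condition p 0 \<noteq> c makes
  time s a visible jump; otherwise two stretches would merge into one holding time.\<close>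

lemma ext_jn:
  assumes "rc p" "0 < s" "p 0 \<noteq> c"
  shows "YE (jn c s p) = case_nat c (YE p)" "HE (jn c s p) = case_nat (ennreal s) (HE p)"
proof -
  have "nxt (jn c s p) t = p t" if "0 \<le> t" for t
    using that assms H0_jn[OF assms] by (simp add: nxt_def jn_def)
  from YE_HE_cong[OF this] have "YE (nxt (jn c s p)) = YE p" "HE (nxt (jn c s p)) = HE p" by auto
  then show "YE (jn c s p) = case_nat c (YE p)" "HE (jn c s p) = case_nat (ennreal s) (HE p)"
    using H0_jn[OF assms] assms
    by (auto simp: fun_eq_iff YE_Suc HE_Suc jn_def split: nat.split)
qed

lemma path_of_first: "ennreal t < h 0 \<Longrightarrow> path_of y h t = y 0"
  unfolding path_of_def by (subst Least_eq_0) auto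

lemma path_of_rec:
  assumes "\<exists>n. ennreal t < (\<Sum>i\<le>n. h i)" "h 0 \<le> ennreal t" "0 \<le> t"
  shows "path_of y h t = path_of (\<lambda>n. y (Suc n)) (\<lambda>n. h (Suc n)) (t - enn2real (h 0))"
    and "\<exists>n. ennreal (t - enn2real (h 0)) < (\<Sum>i\<le>n. h (Suc i))"
proof -
  obtain r where r: "h 0 = ennreal r" "0 \<le> r" "r \<le> t"
    using assms(2,3) by (cases "h 0") (auto simp: top_unique)
  have eq: "ennreal t < (\<Sum>i\<le>Suc n. h i) \<longleftrightarrow> ennreal (t - enn2real (h 0)) < (\<Sum>i\<le>n. h (Suc i))" for n
  proof -
    have "ennreal t = ennreal r + ennreal (t - r)" using r by (simp flip: ennreal_plus)
    then show ?thesis unfolding sum.atMost_Suc_shift using r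
      by (simp add: ennreal_add_left_cancel_less)
  qed
  have n0: "\<not> ennreal t < (\<Sum>i\<le>0. h i)" using assms by (simp add: leD)
  obtain n where n: "ennreal t < (\<Sum>i\<le>n. h i)" using assms by auto
  have "(LEAST n. ennreal t < (\<Sum>i\<le>n. h i)) = Suc (LEAST m. ennreal t < (\<Sum>i\<le>Suc m. h i))"
    using Least_Suc[OF n n0] .
  then show "path_of y h t = path_of (\<lambda>n. y (Suc n)) (\<lambda>n. h (Suc n)) (t - enn2real (h 0))"
    unfolding path_of_def eq by simp
  from n n0 show "\<exists>n. ennreal (t - enn2real (h 0)) < (\<Sum>i\<le>n. h (Suc i))"
    using eq by (metis not0_implies_Suc)
qed

lemma suminf_top_ex:
  assumes "(\<Sum>i. h i) = (top::ennreal)" shows "\<exists>n. ennreal t < (\<Sum>i\<le>n. h i)"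
proof -
  have "ennreal t < (SUP n. \<Sum>i<n. h i)" using assms by (simp add: suminf_eq_SUP[symmetric])
  then obtain n where "ennreal t < (\<Sum>i<n. h i)" unfolding less_SUP_iff by auto
  also have "\<dots> \<le> (\<Sum>i\<le>n. h i)" by (intro sum_mono2) auto
  finally show ?thesis by auto
qed

text \<open>Jumps of a right-continuous path may accumulate from the left, so jump chain and holding
  times determine it only before the explosion time; hence the assumption on the partial
  sum.\<close>

lemma path_eq_path_of:
  assumes "rc p" "0 \<le> t" "ennreal t < (\<Sum>i\<le>n. HE p i)"
  shows "p t = path_of (YE p) (HE p) t"
  using assms
proof (induction n arbitrary: p t)
  case 0
  then show ?case using H0_less by (auto simp: path_of_first)
next
  case (Suc n)
  show ?case
  proof (cases "ennreal t < H0 p")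
    case True
    then show ?thesis using H0_less Suc.prems by (auto simp: path_of_first)
  next
    case False
    then have le: "HE p 0 \<le> ennreal t" by simp
    then obtain r where r: "H0 p = ennreal r" "0 \<le> r" "r \<le> t"
      using Suc.prems(2) by (cases "H0 p") (auto simp: top_unique)
    have ex: "\<exists>n. ennreal t < (\<Sum>i\<le>n. HE p i)" using Suc.prems by blast
    have "path_of (YE p) (HE p) t = path_of (YE (nxt p)) (HE (nxt p)) (t - r)"
      using path_of_rec(1)[OF ex le Suc.prems(2), of "YE p"] r by (simp add: YE_Suc[abs_def] HE_Suc[abs_def])
    also have "\<dots> = nxt p (t - r)"
    proof (rule Suc.IH[symmetric])
      have "ennreal t = ennreal r + ennreal (t - r)" using r by (simp flip: ennreal_plus)
      then show "ennreal (t - r) < (\<Sum>i\<le>n. HE (nxt p) i)"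
        using Suc.prems(3) r unfolding sum.atMost_Suc_shift
        by (simp add: HE_Suc ennreal_add_left_cancel_less)
    qed (use Suc.prems r in \<open>auto intro: rc_nxt\<close>)
    also have "\<dots> = p t" using r by (simp add: nxt_def)
    finally show ?thesis by simp
  qed
qed

lemma rc_path_of:
  assumes "\<And>t. \<exists>n. ennreal t < (\<Sum>i\<le>n. h i)" shows "rc (path_of y h)"
proof (rule rcI)
  fix t :: real
  define S where "S n = (\<Sum>i\<le>n. h i)" for n
  define n where "n = (LEAST n. ennreal t < S n)"
  have n: "ennreal t < S n" unfolding n_def using assms[of t] unfolding S_def by (rule LeastI_ex)
  have m: "S m \<le> ennreal t" if "m < n" for m using not_less_Least[of m] that unfolding n_def by (meson leI)
  \<comment> \<open>\<open>ennreal\<close> sends negative times to 0, so b has to be positive for u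
    < b to imply \<open>ennreal u < ennreal b\<close>.\<close>
  obtain b where b: "t < b" "0 < b" "ennreal b \<le> S n"
  proof (cases "S n")
    case (real x)
    then have "t < x \<and> 0 < x" using n by (cases "0 \<le> t") (auto simp: ennreal_less_iff ennreal_neg order_le_less)
    then show ?thesis using that[of x] real by auto
  next
    case top
    then show ?thesis using that[of "\<bar>t\<bar>+1"] by simp
  qed
  have "path_of y h u = path_of y h t" if "t \<le> u" "u < t + (b - t)" for u
  proof -
    have "ennreal u < S n" using b that by (intro less_le_trans[OF _ b(3)]) (auto simp: ennreal_lessI)
    then have "(LEAST n. ennreal u < S n) = n"
    proof (rule Least_equality)
      fix k assume "ennreal u < S k"
      then have "ennreal t < S k" using that by (meson ennreal_leI le_less_trans)
      then show "n \<le> k" using m[of k] by (meson leD leI)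
    qed
    then show ?thesis unfolding path_of_def S_def[symmetric] n_def by simp
  qed
  then show "\<exists>d>0. \<forall>u. t \<le> u \<and> u < t + d \<longrightarrow> path_of y h u = path_of y h t"
    using b(1) by (meson diff_gt_0_iff_gt)
qed

text \<open>The constant default on explosion makes every value right-continuous, so that the map
  goes into \<open>path_space\<close>. Testing only natural numbers k keeps the case distinction
  countable.\<close>

definition pth :: "(nat \<Rightarrow> 'a) \<times> (nat \<Rightarrow> ennreal) \<Rightarrow> real \<Rightarrow> 'a" where
  "pth w = (if \<forall>k::nat. \<exists>n. ennreal (real k) < (\<Sum>i\<le>n. snd w i) then path_of (fst w) (snd w) else (\<lambda>_. fst w 0))"

abbreviation JH :: "((nat \<Rightarrow> 'a) \<times> (nat \<Rightarrow> ennreal)) measure" where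
  "JH \<equiv> PiM UNIV (\<lambda>_. count_space UNIV) \<Otimes>\<^sub>M PiM UNIV (\<lambda>_. borel)"

lemma nonexpl_nat_real:
  assumes "\<forall>k::nat. \<exists>n. ennreal (real k) < (\<Sum>i\<le>n. h i)"
  shows "\<exists>n. ennreal t < (\<Sum>i\<le>n::nat. h i)"
proof -
  obtain n where "ennreal (real (nat \<lceil>t\<rceil>)) < (\<Sum>i\<le>n. h i)" using assms by blast
  moreover have "ennreal t \<le> ennreal (real (nat \<lceil>t\<rceil>))" by (intro ennreal_leI) linarith
  ultimately show ?thesis using le_less_trans by blast
qed

lemma pth_eq: "(\<Sum>i. h i) = top \<Longrightarrow> pth (y, h) = path_of y h"
  using suminf_top_ex[of h] by (auto simp: pth_def)

lemma measurable_pth [measurable]: "pth \<in> JH \<rightarrow>\<^sub>M (path_space :: (real \<Rightarrow> 'a::countable) measure)"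
proof (rule measurable_path_spaceI)
  show "rc (pth w)" for w :: "(nat \<Rightarrow> 'a) \<times> (nat \<Rightarrow> ennreal)"
    using nonexpl_nat_real[of "snd w"] by (auto simp: pth_def intro!: rc_path_of)
  show "(\<lambda>w. pth w t) \<in> JH \<rightarrow>\<^sub>M (count_space UNIV :: 'a measure)" for t
  proof -
    have [measurable]: "(\<lambda>w. fst w i) \<in> JH \<rightarrow>\<^sub>M (count_space UNIV :: 'a measure)" for i
      by measurable
    have [measurable]: "(\<lambda>w. LEAST n. ennreal t < (\<Sum>i\<le>n. snd w i)) \<in> (JH :: ((nat \<Rightarrow> 'a) \<times> _) measure) \<rightarrow>\<^sub>M count_space UNIV"
      by measurable
    have [measurable]: "(\<lambda>w. path_of (fst w) (snd w) t) \<in> JH \<rightarrow>\<^sub>M (count_space UNIV :: 'a measure)"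
      unfolding path_of_def
      by (rule measurable_compose_countable[where f="\<lambda>i w. fst w i"]) measurable
    have "(\<lambda>w. if \<forall>k::nat. \<exists>n. ennreal (real k) < (\<Sum>i\<le>n. snd w i) then path_of (fst w) (snd w) t else fst w 0) \<in> JH \<rightarrow>\<^sub>M (count_space UNIV :: 'a measure)"
      by measurable
    then show ?thesis by (simp add: pth_def if_distrib[where f="\<lambda>p. p t"] cong: if_cong)
  qed
qed

lemma pth_jn:
  assumes "(\<Sum>i. h i) = top" "0 < s"
  shows "pth (case_nat x y, case_nat (ennreal s) h) = jn x s (pth (y, h))"
proof -
  let ?h = "case_nat (ennreal s) h"
  have ex: "\<exists>n. ennreal t < (\<Sum>i\<le>n. ?h i)" for t
  proof -
    obtain n where "ennreal t < (\<Sum>i\<le>n. h i)" using suminf_top_ex[OF assms(1)] by blast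
    also have "(\<Sum>i\<le>n. h i) \<le> (\<Sum>i\<le>Suc n. ?h i)" unfolding sum.atMost_Suc_shift by simp
    finally show ?thesis by blast
  qed
  have "path_of (case_nat x y) ?h t = jn x s (path_of y h) t" for t
  proof (cases "t < s")
    case True
    then have "ennreal t < ?h 0" using assms(2) by (cases "0 \<le> t") (auto simp: ennreal_less_iff ennreal_neg)
    then show ?thesis using True path_of_first[of t ?h "case_nat x y"] by (simp add: jn_def)
  next
    case False
    then show ?thesis using path_of_rec(1)[OF ex, of t "case_nat x y"] assms(2)
      by (simp add: jn_def ennreal_leI)
  qed
  moreover have "pth (case_nat x y, ?h) = path_of (case_nat x y) ?h" using ex by (auto simp: pth_def)
  ultimately show ?thesis unfolding pth_eq[OF assms(1)] by auto
qed

lemma suminf_top_tail: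
  fixes h :: "nat \<Rightarrow> ennreal"
  assumes "(\<Sum>i. h i) = top" "h 0 \<noteq> top" shows "(\<Sum>i. h (Suc i)) = top"
proof -
  have "h sums ((\<Sum>i. h (Suc i)) + h 0)"
    by (rule sums_Suc) (rule summable_sums, simp)
  then have "(\<Sum>i. h i) = (\<Sum>i. h (Suc i)) + h 0" by (rule sums_unique[symmetric])
  then show ?thesis using assms by (metis ennreal_add_eq_top)
qed

lemma HE_path_of_step:
  assumes "\<And>i. 0 < h i" "\<And>i. h i < top" "\<And>i. y (Suc i) \<noteq> y i" "(\<Sum>i. h i) = top"
  shows "HE (pth (y, h)) = case_nat (h 0) (HE (pth (\<lambda>n. y (Suc n), \<lambda>n. h (Suc n))))"
proof -
  obtain s where s: "h 0 = ennreal s" "0 < s" using assms(1,2)[of 0] by (cases "h 0") auto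
  have tl: "(\<Sum>i. h (Suc i)) = top"
    using suminf_top_tail[OF assms(4)] assms(2)[of 0] by simp
  have "case_nat (y 0) (\<lambda>n. y (Suc n)) = y" "case_nat (ennreal s) (\<lambda>n. h (Suc n)) = h"
    using s by (auto simp: fun_eq_iff split: nat.split)
  then have eq: "pth (y, h) = jn (y 0) s (pth (\<lambda>n. y (Suc n), \<lambda>n. h (Suc n)))"
    using pth_jn[OF tl s(2), of "y 0" "\<lambda>n. y (Suc n)"] by simp
  have "path_of (\<lambda>n. y (Suc n)) (\<lambda>n. h (Suc n)) 0 = y (Suc 0)"
    using assms(1)[of "Suc 0"] by (intro path_of_first) simp
  then have ne: "pth (\<lambda>n. y (Suc n), \<lambda>n. h (Suc n)) 0 \<noteq> y 0"
    using assms(3)[of 0] tl by (simp add: pth_eq)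
  have rc: "rc (pth (\<lambda>n. y (Suc n), \<lambda>n. h (Suc n)))"
    using suminf_top_ex[OF tl] by (simp add: pth_eq[OF tl] rc_path_of)
  show ?thesis unfolding eq s(1) by (rule ext_jn(2)[OF rc s(2) ne])
qed

text \<open>Positive holding times and distinct successive states make every prescribed jump visible
  on the path, so that reading the path returns the prescribed data.\<close>

lemma HE_path_of:
  assumes "\<And>i. 0 < h i" "\<And>i. h i < top" "\<And>i. y (Suc i) \<noteq> y i" "(\<Sum>i. h i) = top"
  shows "HE (pth (y, h)) n = h n"
  using assms
proof (induction n arbitrary: y h)
  case (0 y h)
  show ?case using HE_path_of_step[where h=h and y=y, OF 0] by simp
next
  case (Suc n y h)
  have "HE (pth (\<lambda>n. y (Suc n), \<lambda>n. h (Suc n))) n = h (Suc n)"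
    using Suc.prems suminf_top_tail[where h=h, OF Suc.prems(4)] Suc.prems(2)[of 0] by (intro Suc.IH) (auto simp: less_top)
  then show ?case using HE_path_of_step[where h=h and y=y, OF Suc.prems] by simp
qed

text \<open>This is the case of a Poisson clock of rate 0, which occurs for \<alpha> = 0.\<close>

lemma HE_path_of_absorbed:
  assumes "\<And>i. h i = top"
  shows "HE (pth (y, h)) n = top"
proof -
  have "h 0 \<le> suminf h" using sum_le_suminf[of h "{0}"] by simp
  then have "suminf h = top" using assms[of 0] by (metis top_unique)
  then have p: "pth (y, h) = (\<lambda>_. y 0)"
    using path_of_first[of _ h y] assms unfolding pth_eq[OF \<open>suminf h = top\<close>] by (auto simp: fun_eq_iff)
  have "H0 (\<lambda>_. y 0) = top" by (simp add: H0_def)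
  then have "nxt (\<lambda>_. y 0) = (\<lambda>_. y 0)" by (simp add: nxt_def)
  then have "(nxt ^^ n) (\<lambda>_. y 0) = (\<lambda>_. y 0)" by (induction n) auto
  then show ?thesis using p \<open>H0 (\<lambda>_. y 0) = top\<close> by (simp add: HE_def)
qed

section \<open>The law of jump chain and holding times\<close>

text \<open>The distributional half of \<open>is_ctmc\<close>, detached from the path, so that a
  given chain can be compared with a canonical model.\<close>

definition jump_hold :: "'w measure \<Rightarrow> ('s \<Rightarrow> 's \<Rightarrow> real) \<Rightarrow> 's \<Rightarrow> ('w \<Rightarrow> nat \<Rightarrow> 's) \<Rightarrow> ('w \<Rightarrow> nat \<Rightarrow> ennreal) \<Rightarrow> bool" where
  "jump_hold M q x0 Y H \<longleftrightarrow>
       (\<forall>i. (\<lambda>\<omega>. Y \<omega> i) \<in> M \<rightarrow>\<^sub>M count_space UNIV) \<and>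
       (\<forall>i. (\<lambda>\<omega>. H \<omega> i) \<in> borel_measurable M) \<and>
       (\<forall>(n::nat) (y :: nat \<Rightarrow> 's) (s :: nat \<Rightarrow> real). (\<forall>i<n. 0 \<le> s i) \<longrightarrow>
          measure M {\<omega> \<in> space M. (\<forall>i\<le>n. Y \<omega> i = y i) \<and> (\<forall>i<n. ennreal (s i) < H \<omega> i)}
          = (if y 0 = x0 then 1 else 0) *
            (\<Prod>i<n. jump_prob q (y i) (y (Suc i)) * exp (- qtot q (y i) * s i)))"

lemma is_ctmc_iff:
  "is_ctmc M q x0 X \<longleftrightarrow> (\<exists>Y H. jump_hold M q x0 Y H \<and>
     (AE \<omega> in M. (\<Sum>i. H \<omega> i) = top \<and> (\<forall>t\<ge>0. X \<omega> t = path_of (Y \<omega>) (H \<omega>) t)))"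
  by (simp add: is_ctmc_def jump_hold_def)

text \<open>Negative thresholds impose no constraint; they are needed for the cylinders to generate the
  product sigma-algebra, as the last holding time of a cylinder cannot otherwise be left free.\<close>

definition cyl :: "nat \<Rightarrow> (nat \<Rightarrow> 's) \<Rightarrow> (nat \<Rightarrow> real) \<Rightarrow> ((nat \<Rightarrow> 's) \<times> (nat \<Rightarrow> ennreal)) set" where
  "cyl n y s = {w. (\<forall>i\<le>n. fst w i = y i) \<and> (\<forall>i<n. s i < 0 \<or> ennreal (s i) < snd w i)}"

lemma space_JH [simp]: "space (JH :: ((nat \<Rightarrow> 's) \<times> _) measure) = UNIV"
  by (simp add: space_pair_measure space_PiM)

lemma cyl_case_nat:
  "0 \<le> s 0 \<Longrightarrow> indicator (cyl (Suc n) y s) (case_nat x Y, case_nat h H) =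
    (indicator {x} (y 0) * indicator {h. ennreal (s 0) < h} h * indicator (cyl n (\<lambda>i. y (Suc i)) (\<lambda>i. s (Suc i))) (Y, H) :: ennreal)"
proof -
  assume "0 \<le> s 0"
  then have "(case_nat x Y, case_nat h H) \<in> cyl (Suc n) y s \<longleftrightarrow> y 0 = x \<and> ennreal (s 0) < h \<and>
    (Y, H) \<in> cyl n (\<lambda>i. y (Suc i)) (\<lambda>i. s (Suc i))"
    unfolding cyl_def less_Suc_eq_le[symmetric] All_less_Suc2 by (auto simp: leD)
  then show ?thesis by (auto simp: indicator_def)
qed

lemma sets_cyl: "cyl n y s \<in> sets (JH :: ((nat \<Rightarrow> 's::countable) \<times> _) measure)"
proof -
  have [measurable]: "Measurable.pred JH (\<lambda>w. fst w i = (y i :: 's))" for i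
    by (rule measurable_compose[of "\<lambda>w. fst w i" _ "count_space UNIV"]) measurable
  have "Measurable.pred JH (\<lambda>w. (\<forall>i\<le>n. fst w i = y i) \<and> (\<forall>i<n. s i < 0 \<or> ennreal (s i) < snd w i))"
    by measurable
  then show ?thesis by (simp add: cyl_def pred_def)
qed

text \<open>Two thresholds for one holding time combine into their maximum, and two state prefixes
  are compatible only if the longer extends the shorter. Thus cylinders form a pi-system.\<close>

lemma cyl_Int:
  assumes "n \<le> m"
  shows "cyl n y s \<inter> cyl m z r = (if \<forall>i\<le>n. y i = z i
    then cyl m z (\<lambda>i. if i < n then max (s i) (r i) else r i) else {})"
proof -
  have *: "((s i < 0 \<or> ennreal (s i) < b) \<and> (r i < 0 \<or> ennreal (r i) < b)) \<longleftrightarrow>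
     (max (s i) (r i) < 0 \<or> ennreal (max (s i) (r i)) < b)" for i b
  proof -
    have "ennreal (r i) < b" if "r i \<le> s i" "ennreal (s i) < b"
      using that by (meson ennreal_leI le_less_trans)
    moreover have "ennreal (s i) < b" if "s i \<le> r i" "ennreal (r i) < b"
      using that by (meson ennreal_leI le_less_trans)
    ultimately show ?thesis by (auto simp: max_def)
  qed
  show ?thesis
  proof (cases "\<forall>i\<le>n. y i = z i")
    case True
    have "w \<in> cyl n y s \<inter> cyl m z r \<longleftrightarrow> w \<in> cyl m z (\<lambda>i. if i < n then max (s i) (r i) else r i)" for w
    proof -
      define P where "P i \<longleftrightarrow> s i < 0 \<or> ennreal (s i) < snd w i" for i
      define Q where "Q i \<longleftrightarrow> r i < 0 \<or> ennreal (r i) < snd w i" for i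
      have 1: "((if i < n then max (s i) (r i) else r i) < 0 \<or> ennreal (if i < n then max (s i) (r i) else r i) < snd w i)
        \<longleftrightarrow> (i < n \<longrightarrow> P i) \<and> Q i" for i
        using *[of i "snd w i"] by (cases "i < n") (simp_all add: P_def Q_def)
      have 2: "(\<forall>i\<le>n. fst w i = y i) \<and> (\<forall>i\<le>m. fst w i = z i) \<longleftrightarrow> (\<forall>i\<le>m. fst w i = z i)"
        using True assms by (metis order_trans)
      have 3: "(\<forall>i<n. P i) \<and> (\<forall>i<m. Q i) \<longleftrightarrow> (\<forall>i<m. (i < n \<longrightarrow> P i) \<and> Q i)"
        using assms by (meson order_less_le_trans)
      show ?thesis unfolding Int_iff cyl_def mem_Collect_eq 1 P_def[symmetric] Q_def[symmetric] using 2 3 by blast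
    qed
    then show ?thesis using True by auto
  qed (auto simp: cyl_def assms, metis assms le_trans)
qed

text \<open>A cylinder prescribes a whole prefix of states. Since there are only countably many
  prefixes, an event about a single coordinate is a countable union of cylinders.\<close>

lemma sets_JH_eq_sigma_cyl:
  "sets (JH :: ((nat \<Rightarrow> 's::countable) \<times> _) measure) = sigma_sets UNIV (insert {} (range (\<lambda>(n, y, s). cyl n y s)))"
    (is "_ = sigma_sets UNIV ?E")
proof (rule antisym)
  show "sigma_sets UNIV ?E \<subseteq> sets (JH :: ((nat \<Rightarrow> 's) \<times> _) measure)"
  proof -
    have "?E \<subseteq> sets (JH :: ((nat \<Rightarrow> 's) \<times> _) measure)" using sets_cyl by auto
    from sets.sigma_sets_subset[OF this] show ?thesis by simp
  qed
  define S where "S = sigma UNIV ?E"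
  have S: "space S = UNIV" "sets S = sigma_sets UNIV ?E" by (auto simp: S_def)
  have cyl: "cyl n y s \<in> sets S" for n y s unfolding S by (intro sigma_sets.Basic) auto
  have "(\<lambda>w. fst w i) \<in> S \<rightarrow>\<^sub>M count_space UNIV" for i
  proof (rule measurable_count_space_eq2_countable[THEN iffD2], safe)
    fix c :: 's
    have "(\<lambda>w. fst w i) -` {c} \<inter> space S = (\<Union>l\<in>{l::'s list. length l = Suc i \<and> l ! i = c}. cyl i (\<lambda>j. l ! j) (\<lambda>_. -1))"
      (is "?L = ?R")
    proof (rule set_eqI)
      fix w :: "(nat \<Rightarrow> 's) \<times> (nat \<Rightarrow> ennreal)"
      have "w \<in> ?R" if "fst w i = c"
        using that by (intro UN_I[of "map (fst w) [0..<Suc i]"]) (auto simp: cyl_def nth_append simp del: upt_Suc)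
      then show "w \<in> ?L \<longleftrightarrow> w \<in> ?R" by (auto simp: cyl_def S)
    qed
    also have "\<dots> \<in> sets S" by (intro sets.countable_UN'' cyl) auto
    finally show "(\<lambda>w. fst w i) -` {c} \<inter> space S \<in> sets S" .
  qed auto
  moreover have "(\<lambda>w. snd w i) \<in> borel_measurable S" for i
  proof (rule borel_measurableI_greater)
    fix a :: ennreal
    show "{w \<in> space S. a < snd w i} \<in> sets S"
    proof (cases a)
      case (real r)
      have "{w \<in> space S. a < snd w i} = (\<Union>l\<in>{l::'s list. length l = Suc (Suc i)}. cyl (Suc i) (\<lambda>j. l ! j) (\<lambda>j. if j = i then r else -1))"
        (is "?L = ?R")
      proof (rule set_eqI)
        fix w :: "(nat \<Rightarrow> 's) \<times> (nat \<Rightarrow> ennreal)"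
        have "w \<in> ?R" if "a < snd w i"
          using that real by (intro UN_I[of "map (fst w) [0..<Suc (Suc i)]"]) (auto simp: cyl_def simp del: upt_Suc)
        then show "w \<in> ?L \<longleftrightarrow> w \<in> ?R" using real by (auto simp: cyl_def S)
      qed
      also have "\<dots> \<in> sets S" by (intro sets.countable_UN'' cyl) auto
      finally show ?thesis .
    qed auto
  qed
  ultimately have "(\<lambda>w. (fst w, snd w)) \<in> S \<rightarrow>\<^sub>M JH"
    by (intro measurable_Pair measurable_PiM_single') (auto simp: S)
  then have "(\<lambda>w. w) \<in> S \<rightarrow>\<^sub>M (JH :: ((nat \<Rightarrow> 's) \<times> _) measure)" by simp
  from measurable_sets[OF this] show "sets (JH :: ((nat \<Rightarrow> 's) \<times> _) measure) \<subseteq> sigma_sets UNIV ?E"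
    using S by auto
qed

lemma measurable_jump_hold:
  assumes "jump_hold M q x0 Y H" shows "(\<lambda>\<omega>. (Y \<omega>, H \<omega>)) \<in> M \<rightarrow>\<^sub>M JH"
  using assms unfolding jump_hold_def
  by (intro measurable_Pair measurable_PiM_single') auto

text \<open>\<open>jump_hold\<close> prescribes the masses of cylinders with nonnegative thresholds
  only. Positivity of the holding times is first carried over from the second model to the first;
  afterwards a negative threshold may be replaced by 0, all cylinders have equal mass, and
  uniqueness on a pi-system applies.\<close>

lemma jump_hold_law_unique:
  fixes Y :: "'w \<Rightarrow> nat \<Rightarrow> 's::countable" and Y' :: "'v \<Rightarrow> nat \<Rightarrow> 's"
  assumes M: "prob_space M" and M': "prob_space M'"
    and J: "jump_hold M q x0 Y H" and J': "jump_hold M' q x0 Y' H'"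
    and pos: "AE \<omega> in M'. \<forall>i. 0 < H' \<omega> i"
  shows "distr M JH (\<lambda>\<omega>. (Y \<omega>, H \<omega>)) = distr M' JH (\<lambda>\<omega>. (Y' \<omega>, H' \<omega>))"
proof -
  interpret M: prob_space M by fact
  interpret M': prob_space M' by fact
  define L where "L = distr M JH (\<lambda>\<omega>. (Y \<omega>, H \<omega>))"
  define L' where "L' = distr M' JH (\<lambda>\<omega>. (Y' \<omega>, H' \<omega>))"
  note [measurable] = measurable_jump_hold[OF J] measurable_jump_hold[OF J'] sets_cyl
  interpret L: prob_space L unfolding L_def by (rule M.prob_space_distr) measurable
  interpret L': prob_space L' unfolding L'_def by (rule M'.prob_space_distr) measurable
  have sets [measurable_cong, simp]: "sets L = sets JH" "sets L' = sets JH" by (auto simp: L_def L'_def)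
  have sp [simp]: "space L = UNIV" "space L' = UNIV" by (auto simp: L_def L'_def)
  have nn: "emeasure L (cyl n y s) = emeasure L' (cyl n y s)" if s: "\<forall>i<n. 0 \<le> s i" for n y s
  proof -
    have "emeasure L (cyl n y s) = emeasure M {\<omega> \<in> space M. (\<forall>i\<le>n. Y \<omega> i = y i) \<and> (\<forall>i<n. ennreal (s i) < H \<omega> i)}"
      unfolding L_def using s
      by (subst emeasure_distr) (auto intro!: arg_cong[where f="emeasure M"] sets_cyl, auto simp: cyl_def leD)
    also have "\<dots> = emeasure M' {\<omega> \<in> space M'. (\<forall>i\<le>n. Y' \<omega> i = y i) \<and> (\<forall>i<n. ennreal (s i) < H' \<omega> i)}"
      using J J' s unfolding jump_hold_def by (simp add: M.emeasure_eq_measure M'.emeasure_eq_measure)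
    also have "\<dots> = emeasure L' (cyl n y s)"
      unfolding L'_def using s
      by (subst emeasure_distr) (auto intro!: arg_cong[where f="emeasure M'"] sets_cyl, auto simp: cyl_def leD)
    finally show ?thesis .
  qed
  have pos': "AE w in L'. \<forall>i. 0 < snd w i"
  proof -
    have "Measurable.pred (JH :: ((nat \<Rightarrow> 's) \<times> _) measure) (\<lambda>w. \<forall>i. 0 < snd w i)" by measurable
    then show ?thesis
      unfolding L'_def by (subst AE_distr_iff) (auto intro: pos simp: pred_def)
  qed
  have pos: "AE w in L. \<forall>i. 0 < snd w i"
    unfolding AE_all_countable
  proof
    fix i
    define T where "T = {w :: (nat \<Rightarrow> 's) \<times> (nat \<Rightarrow> ennreal). \<forall>j<Suc i. 0 < snd w j}"
    define I where "I = {l::'s list. length l = Suc (Suc i)}"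
    define C where "C l = cyl (Suc i) (\<lambda>j. l ! j :: 's) (\<lambda>_. 0)" for l
    \<comment> \<open>Positivity of the first i + 1 holding times is a countable disjoint union of
      cylinders with threshold 0, so both laws give it the same mass.\<close>
    have T: "T = (\<Union>l\<in>I. C l)"
    proof (rule set_eqI)
      fix w :: "(nat \<Rightarrow> 's) \<times> (nat \<Rightarrow> ennreal)"
      have "w \<in> (\<Union>l\<in>I. C l)" if "w \<in> T"
        using that unfolding I_def C_def T_def
        by (intro UN_I[of "map (fst w) [0..<Suc (Suc i)]"]) (auto simp: cyl_def simp del: upt_Suc)
      then show "w \<in> T \<longleftrightarrow> w \<in> (\<Union>l\<in>I. C l)" by (auto simp: T_def I_def C_def cyl_def)
    qed
    have disj: "disjoint_family_on C I"
      unfolding disjoint_family_on_def I_def C_def cyl_def by (auto simp: list_eq_iff_nth_eq less_Suc_eq_le)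
    have C: "C l \<in> sets JH" for l by (simp add: C_def sets_cyl)
    have "emeasure L T = (\<integral>\<^sup>+l. emeasure L (C l) \<partial>count_space I)"
      unfolding T using disj C by (intro emeasure_UN_countable) auto
    also have "\<dots> = (\<integral>\<^sup>+l. emeasure L' (C l) \<partial>count_space I)"
      unfolding C_def by (intro nn_integral_cong nn) auto
    also have "\<dots> = emeasure L' T"
      unfolding T using disj C by (intro emeasure_UN_countable[symmetric]) auto
    also have "\<dots> = emeasure L' (space L')"
    proof (rule emeasure_eq_AE)
      show "AE w in L'. w \<in> T \<longleftrightarrow> w \<in> space L'" using pos' by eventually_elim (auto simp: T_def)
      have "T \<in> sets JH" unfolding T using C by (intro sets.countable_UN'') auto
      then show "T \<in> sets L'" by simp
      show "space L' \<in> sets L'" by (rule sets.top)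
    qed
    also have "\<dots> = 1" by (rule L'.emeasure_space_1)
    finally have "L.prob T = 1" by (simp add: L.emeasure_eq_measure ennreal_eq_1)
    moreover have "T \<in> sets L" unfolding T using C by (intro sets.countable_UN'') auto
    ultimately have "AE w in L. w \<in> T"
      by (subst L.AE_in_set_eq_1) auto
    then show "AE w in L. 0 < snd w i" by eventually_elim (auto simp: T_def)
  qed
  have eq: "emeasure L (cyl n y s) = emeasure L' (cyl n y s)" for n y s
  proof -
    have *: "AE w in K. (w \<in> cyl n y s) = (w \<in> cyl n y (\<lambda>i. max 0 (s i)))" if "AE w in K. \<forall>i. 0 < snd w i" for K :: "((nat \<Rightarrow> 's) \<times> (nat \<Rightarrow> ennreal)) measure"
      using that
    proof eventually_elim
      case (elim w)
      have "(s i < 0 \<or> ennreal (s i) < snd w i) \<longleftrightarrow> ennreal (max 0 (s i)) < snd w i" for i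
        using elim by (cases "s i < 0") (auto simp: max_def)
      then show ?case by (auto simp: cyl_def not_less)
    qed
    have "emeasure L (cyl n y s) = emeasure L (cyl n y (\<lambda>i. max 0 (s i)))"
      using *[OF pos] by (intro emeasure_eq_AE) (auto intro: sets_cyl)
    also have "\<dots> = emeasure L' (cyl n y (\<lambda>i. max 0 (s i)))" by (rule nn) auto
    also have "\<dots> = emeasure L' (cyl n y s)"
      using *[OF pos'] by (intro emeasure_eq_AE) (auto intro: sets_cyl)
    finally show ?thesis .
  qed
  have "L = L'"
  proof (rule measure_eqI_generator_eq_countable)
    show "Int_stable (insert {} (range (\<lambda>(n, y, s). cyl n y s)) :: ((nat \<Rightarrow> 's) \<times> (nat \<Rightarrow> ennreal)) set set)"
    proof (rule Int_stableI)
      have *: "cyl n y s \<inter> cyl m z r \<in> insert {} (range (\<lambda>(n, y, s). cyl n y s))" if "n \<le> m"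
        for n m and y z :: "nat \<Rightarrow> 's" and s r
        unfolding cyl_Int[OF that] by (auto simp: image_iff)
      fix a b :: "((nat \<Rightarrow> 's) \<times> (nat \<Rightarrow> ennreal)) set"
      assume "a \<in> insert {} (range (\<lambda>(n, y, s). cyl n y s))" "b \<in> insert {} (range (\<lambda>(n, y, s). cyl n y s))"
      then consider "a \<inter> b = {}" | n y s m z r where "a = cyl n y s" "b = cyl m z r" by auto
      then show "a \<inter> b \<in> insert {} (range (\<lambda>(n, y, s). cyl n y s))"
      proof cases
        case 2
        then show ?thesis using *[of n m y s z r] *[of m n z r y s] by (metis Int_commute nle_le)
      qed auto
    qed
    show "(\<Union> (range (\<lambda>c. cyl 0 (\<lambda>_. c) (\<lambda>_. 0)))) = (UNIV :: ((nat \<Rightarrow> 's) \<times> (nat \<Rightarrow> ennreal)) set)"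
      by (auto simp: cyl_def)
    show "sets L = sigma_sets UNIV (insert {} (range (\<lambda>(n, y, s). cyl n y s)))"
      "sets L' = sigma_sets UNIV (insert {} (range (\<lambda>(n, y, s). cyl n y s)))"
      using sets_JH_eq_sigma_cyl by auto
  qed (auto simp: eq)
  then show ?thesis by (simp add: L_def L'_def)
qed

lemma AE_expo_pos: assumes "0 \<le> r" shows "AE e in expo r. 0 < e"
proof -
  interpret prob_space "expo r" by (rule prob_space_expo)
  have "emeasure (expo r) {e. ennreal 0 < e} = 1" using emeasure_expo_gt[OF assms, of 0] by simp
  then have "prob {e. 0 < e} = 1" by (simp add: emeasure_eq_measure ennreal_eq_1)
  then have "AE e in expo r. e \<in> {e. 0 < e}" by (subst AE_in_set_eq_1) auto
  then show ?thesis by simp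
qed

text \<open>\<open>is_ctmc\<close> links the process to its jump data only off a null set and at
  times t \<ge> 0. A version that is right-continuous for every outcome is needed before path
  functionals can be applied.\<close>

lemma is_ctmc_version:
  fixes X :: "'w \<Rightarrow> real \<Rightarrow> 's::countable"
  assumes X: "is_ctmc M q x0 X" and [measurable]: "\<And>t. (\<lambda>\<omega>. X \<omega> t) \<in> M \<rightarrow>\<^sub>M count_space UNIV"
  obtains X' Y H where "X' \<in> M \<rightarrow>\<^sub>M path_space" "jump_hold M q x0 Y H"
    "AE \<omega> in M. (\<Sum>i. H \<omega> i) = top" "AE \<omega> in M. X' \<omega> = pth (Y \<omega>, H \<omega>)"
    "AE \<omega> in M. \<forall>t\<ge>0. X \<omega> t = X' \<omega> t"
proof -
  obtain Y H where J: "jump_hold M q x0 Y H"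
    and ae: "AE \<omega> in M. (\<Sum>i. H \<omega> i) = top \<and> (\<forall>t\<ge>0. X \<omega> t = path_of (Y \<omega>) (H \<omega>) t)"
    using X unfolding is_ctmc_iff by blast
  obtain N where N: "N \<in> null_sets M"
    "\<And>\<omega>. \<omega> \<in> space M - N \<Longrightarrow> (\<Sum>i. H \<omega> i) = top \<and> (\<forall>t\<ge>0. X \<omega> t = path_of (Y \<omega>) (H \<omega>) t)"
    using ae by (auto elim!: AE_E3)
  have [measurable]: "N \<in> sets M" using N by auto
  \<comment> \<open>On the null set the path is constant. Negative times carry the value at 0, in
    agreement with \<open>path_of\<close>, where \<open>ennreal\<close> identifies them with
    0.\<close>
  define X' where "X' \<omega> = (if \<omega> \<in> N then \<lambda>_. x0 else (\<lambda>t. X \<omega> (max 0 t)))" for \<omega>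
  have eq: "X' \<omega> = pth (Y \<omega>, H \<omega>)" if "\<omega> \<in> space M - N" for \<omega>
  proof -
    note N = N(2)[OF that]
    have "X \<omega> (max 0 t) = path_of (Y \<omega>) (H \<omega>) t" for t
    proof -
      have "X \<omega> (max 0 t) = path_of (Y \<omega>) (H \<omega>) (max 0 t)" using N by auto
      also have "\<dots> = path_of (Y \<omega>) (H \<omega>) t" by (cases "0 \<le> t") (auto simp: path_of_def ennreal_neg max_def)
      finally show ?thesis .
    qed
    then show ?thesis using N that by (auto simp: X'_def pth_eq)
  qed
  have m: "X' \<in> M \<rightarrow>\<^sub>M path_space"
  proof (rule measurable_path_spaceI)
    fix \<omega> assume "\<omega> \<in> space M"
    show "rc (X' \<omega>)"
    proof (cases "\<omega> \<in> N")
      case False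
      then have "\<omega> \<in> space M - N" using \<open>\<omega> \<in> space M\<close> by auto
      from eq[OF this] N(2)[OF this] show ?thesis
        by (simp add: pth_eq rc_path_of suminf_top_ex)
    qed (simp add: X'_def)
  next
    fix t
    have "(\<lambda>\<omega>. if \<omega> \<in> N then x0 else X \<omega> (max 0 t)) \<in> M \<rightarrow>\<^sub>M count_space UNIV" by measurable
    then show "(\<lambda>\<omega>. X' \<omega> t) \<in> M \<rightarrow>\<^sub>M count_space UNIV"
      by (simp add: X'_def if_distrib[where f="\<lambda>p. p t"] cong: if_cong)
  qed
  have ae': "AE \<omega> in M. \<omega> \<in> space M - N" using AE_not_in[OF N(1)] AE_space by eventually_elim auto
  show thesis
  proof (rule that[OF m J])
    show "AE \<omega> in M. (\<Sum>i. H \<omega> i) = top" using ae by eventually_elim auto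
    show "AE \<omega> in M. X' \<omega> = pth (Y \<omega>, H \<omega>)" using ae' by eventually_elim (rule eq)
    show "AE \<omega> in M. \<forall>t\<ge>0. X \<omega> t = X' \<omega> t" using ae' by eventually_elim (auto simp: X'_def max_def)
  qed
qed

section \<open>Canonical model of a chain with given rates\<close>

lemma frac_add_mono:
  fixes b d K :: real
  assumes "0 < b" "b \<le> d" "0 \<le> K" shows "b / (b + K) \<le> d / (d + K)"
proof -
  have "b * K \<le> d * K" using assms by (intro mult_right_mono)
  then show ?thesis using assms by (simp add: divide_le_eq pos_le_divide_eq add_pos_nonneg) (simp add: field_simps add_pos_nonneg)
qed

text \<open>The Lyapunov function R grows by at most 1 per jump and dominates the rates, which excludes
  explosion.\<close>

locale jump_chain =
  fixes J :: "'s::countable \<Rightarrow> 's pmf" and r :: "'s \<Rightarrow> real" and R :: "'s \<Rightarrow> real" and c0 :: real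
  assumes r_nonneg: "0 \<le> r x" and R_nonneg: "0 \<le> R x" and c0_pos: "0 < c0"
    and r_le: "r x \<le> 2 * R x + c0" and R_step: "y \<in> set_pmf (J x) \<Longrightarrow> R y \<le> R x + 1"
begin

text \<open>The chain is driven by IID random maps: u n x is the next state and the holding time when the
  n-th state is x.\<close>

definition "W1 x = measure_pmf (J x) \<Otimes>\<^sub>M expo (r x)"

lemma sets_W1 [measurable_cong, simp]: "sets (W1 x) = sets (count_space UNIV \<Otimes>\<^sub>M borel)"
  unfolding W1_def by (intro sets_pair_measure_cong) auto

definition "W = PiM UNIV W1"
definition "MC = PiM UNIV (\<lambda>_::nat. W)"

lemma sets_W [measurable_cong]: "sets W = sets (PiM UNIV (\<lambda>_. count_space UNIV \<Otimes>\<^sub>M borel))"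
  unfolding W_def by (intro sets_PiM_cong) auto

lemma sets_MC [measurable_cong]: "sets MC = sets (PiM UNIV (\<lambda>_. PiM UNIV (\<lambda>_. count_space UNIV \<Otimes>\<^sub>M borel)))"
  unfolding MC_def by (intro sets_PiM_cong) (auto simp: sets_W)

lemma prob_space_W1: "prob_space (W1 x)"
proof -
  interpret A: prob_space "measure_pmf (J x)" by (rule measure_pmf.prob_space_axioms)
  interpret B: prob_space "expo (r x)" by (rule prob_space_expo)
  interpret X: pair_prob_space "measure_pmf (J x)" "expo (r x)" ..
  show ?thesis unfolding W1_def by (rule X.P.prob_space_axioms)
qed

lemma prob_space_W: "prob_space W" unfolding W_def by (intro prob_space_PiM prob_space_W1)

lemma prob_space_MC: "prob_space MC" unfolding MC_def by (intro prob_space_PiM prob_space_W)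

primrec Yc :: "nat \<Rightarrow> 's \<Rightarrow> (nat \<Rightarrow> 's \<Rightarrow> 's \<times> ennreal) \<Rightarrow> 's" where
  "Yc 0 x u = x" | "Yc (Suc n) x u = Yc n (fst (u 0 x)) (\<lambda>i. u (Suc i))"

primrec Hc :: "nat \<Rightarrow> 's \<Rightarrow> (nat \<Rightarrow> 's \<Rightarrow> 's \<times> ennreal) \<Rightarrow> ennreal" where
  "Hc 0 x u = snd (u 0 x)" | "Hc (Suc n) x u = Hc n (fst (u 0 x)) (\<lambda>i. u (Suc i))"

definition "YH x u = ((\<lambda>n. Yc n x u), (\<lambda>n. Hc n x u))"

lemma measurable_MC_at:
  assumes f: "f \<in> N \<rightarrow>\<^sub>M count_space UNIV" and g: "g \<in> N \<rightarrow>\<^sub>M MC"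
  shows "(\<lambda>\<omega>. g \<omega> i (f \<omega>)) \<in> N \<rightarrow>\<^sub>M count_space UNIV \<Otimes>\<^sub>M borel"
proof (rule measurable_compose_countable[where f="\<lambda>x \<omega>. g \<omega> i x" and g=f, OF _ f])
  have "g \<in> N \<rightarrow>\<^sub>M PiM UNIV (\<lambda>_. PiM UNIV (\<lambda>_. count_space UNIV \<Otimes>\<^sub>M borel))"
    using g unfolding measurable_cong_sets[OF refl sets_MC] .
  then have "(\<lambda>\<omega>. g \<omega> i) \<in> N \<rightarrow>\<^sub>M PiM UNIV (\<lambda>_. count_space UNIV \<Otimes>\<^sub>M borel)"
    by (rule measurable_compose[OF _ measurable_component_singleton]) auto
  then show "(\<lambda>\<omega>. g \<omega> i x) \<in> N \<rightarrow>\<^sub>M count_space UNIV \<Otimes>\<^sub>M borel" for x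
    by (rule measurable_compose[OF _ measurable_component_singleton]) auto
qed

lemma measurable_Yc_Hc:
  assumes "f \<in> N \<rightarrow>\<^sub>M count_space UNIV" "g \<in> N \<rightarrow>\<^sub>M MC"
  shows "(\<lambda>\<omega>. Yc n (f \<omega>) (g \<omega>)) \<in> N \<rightarrow>\<^sub>M count_space UNIV"
    and "(\<lambda>\<omega>. Hc n (f \<omega>) (g \<omega>)) \<in> borel_measurable N"
proof -
  have sh: "(\<lambda>\<omega> i. g \<omega> (Suc i)) \<in> N \<rightarrow>\<^sub>M MC" if g: "g \<in> N \<rightarrow>\<^sub>M MC" for g
    unfolding measurable_cong_sets[OF refl sets_MC]
  proof (rule measurable_PiM_single')
    have "g \<in> N \<rightarrow>\<^sub>M PiM UNIV (\<lambda>_. PiM UNIV (\<lambda>_. count_space UNIV \<Otimes>\<^sub>M borel))"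
      using g unfolding measurable_cong_sets[OF refl sets_MC] .
    then show "(\<lambda>\<omega>. g \<omega> (Suc i)) \<in> N \<rightarrow>\<^sub>M PiM UNIV (\<lambda>_. count_space UNIV \<Otimes>\<^sub>M borel)" for i
      by (rule measurable_compose[OF _ measurable_component_singleton]) auto
  qed (auto simp: space_PiM space_pair_measure)
  have "(\<lambda>\<omega>. Yc n (f \<omega>) (g \<omega>)) \<in> N \<rightarrow>\<^sub>M count_space UNIV \<and> (\<lambda>\<omega>. Hc n (f \<omega>) (g \<omega>)) \<in> borel_measurable N"
    using assms
  proof (induction n arbitrary: f g)
    case 0
    then show ?case using measurable_MC_at[OF 0, of 0] by (auto intro: measurable_compose[OF _ measurable_snd])
  next
    case (Suc n)
    have "(\<lambda>\<omega>. fst (g \<omega> 0 (f \<omega>))) \<in> N \<rightarrow>\<^sub>M count_space UNIV"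
      using measurable_MC_at[OF Suc.prems, of 0] by (rule measurable_compose[OF _ measurable_fst])
    from Suc.IH[OF this sh[OF Suc.prems(2)]] show ?case by simp
  qed
  then show "(\<lambda>\<omega>. Yc n (f \<omega>) (g \<omega>)) \<in> N \<rightarrow>\<^sub>M count_space UNIV"
    and "(\<lambda>\<omega>. Hc n (f \<omega>) (g \<omega>)) \<in> borel_measurable N" by auto
qed

lemma measurable_YH [measurable (raw)]:
  assumes "f \<in> N \<rightarrow>\<^sub>M count_space UNIV" "g \<in> N \<rightarrow>\<^sub>M MC"
  shows "(\<lambda>\<omega>. YH (f \<omega>) (g \<omega>)) \<in> N \<rightarrow>\<^sub>M JH"
  unfolding YH_def
  by (intro measurable_Pair measurable_PiM_single') (auto intro: measurable_Yc_Hc[OF assms])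

text \<open>Of the first random map only its value at x matters, which has law \<open>W1 x\<close>;
  the remaining maps are again IID and independent of it, and drive the chain from the new state
  y.\<close>

lemma nn_integral_YH:
  assumes F [measurable]: "F \<in> borel_measurable JH"
  shows "(\<integral>\<^sup>+u. F (YH x u) \<partial>MC) =
    (\<integral>\<^sup>+y. \<integral>\<^sup>+h. \<integral>\<^sup>+u. F (case_nat x (fst (YH y u)), case_nat h (snd (YH y u))) \<partial>MC \<partial>expo (r x) \<partial>J x)"
proof -
  interpret W: prob_space W by (rule prob_space_W)
  interpret MC: prob_space MC by (rule prob_space_MC)
  interpret E: prob_space "expo (r x)" by (rule prob_space_expo)
  interpret S: sequence_space W ..
  have [measurable]: "(\<lambda>w. case_nat x (fst w)) \<in> JH \<rightarrow>\<^sub>M PiM UNIV (\<lambda>_. count_space UNIV)" for x :: 's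
    by measurable
  have m1 [measurable]: "(\<lambda>(v, u). F (case_nat x (fst (YH (fst v) u)), case_nat (snd v) (snd (YH (fst v) u))))
      \<in> borel_measurable ((count_space UNIV \<Otimes>\<^sub>M borel) \<Otimes>\<^sub>M MC)"
    by measurable
  have YH: "YH x (case_nat w u) = (case_nat x (fst (YH (fst (w x)) u)), case_nat (snd (w x)) (snd (YH (fst (w x)) u)))" for w u
    by (auto simp: YH_def fun_eq_iff split: nat.split)
  have "(\<integral>\<^sup>+u. F (YH x u) \<partial>MC) = (\<integral>\<^sup>+u. F (YH x u) \<partial>distr (W \<Otimes>\<^sub>M MC) MC (\<lambda>(w, u). case_nat w u))"
    using S.PiM_iter unfolding MC_def by simp
  also have "\<dots> = (\<integral>\<^sup>+(w, u). F (YH x (case_nat w u)) \<partial>(W \<Otimes>\<^sub>M MC))"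
    unfolding MC_def by (subst nn_integral_distr) (auto simp: split_beta' simp flip: MC_def)
  also have "\<dots> = (\<integral>\<^sup>+w. \<integral>\<^sup>+u. F (YH x (case_nat w u)) \<partial>MC \<partial>W)"
    unfolding YH by (subst MC.nn_integral_fst[symmetric]) (auto simp: split_beta')
  also have "\<dots> = (\<integral>\<^sup>+w. (\<lambda>v. \<integral>\<^sup>+u. F (case_nat x (fst (YH (fst v) u)), case_nat (snd v) (snd (YH (fst v) u))) \<partial>MC) (w x) \<partial>W)"
    unfolding YH ..
  also have "\<dots> = (\<integral>\<^sup>+v. \<integral>\<^sup>+u. F (case_nat x (fst (YH (fst v) u)), case_nat (snd v) (snd (YH (fst v) u))) \<partial>MC \<partial>distr W (W1 x) (\<lambda>w. w x))"
    by (subst nn_integral_distr) (auto simp: W_def)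
  also have "distr W (W1 x) (\<lambda>w. w x) = W1 x"
    unfolding W_def by (intro distr_PiM_component prob_space_W1) auto
  also have "(\<integral>\<^sup>+v. \<integral>\<^sup>+u. F (case_nat x (fst (YH (fst v) u)), case_nat (snd v) (snd (YH (fst v) u))) \<partial>MC \<partial>W1 x)
    = (\<integral>\<^sup>+y. \<integral>\<^sup>+h. \<integral>\<^sup>+u. F (case_nat x (fst (YH y u)), case_nat h (snd (YH y u))) \<partial>MC \<partial>expo (r x) \<partial>J x)"
    unfolding W1_def by (subst E.nn_integral_fst[symmetric]) (auto simp: W1_def[symmetric])
  finally show ?thesis .
qed

lemma YH_fst_0 [simp]: "fst (YH x u) 0 = x"
  by (simp add: YH_def)

lemma emeasure_cyl:
  assumes "\<forall>i<n. 0 \<le> s i"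
  shows "(\<integral>\<^sup>+u. indicator (cyl n y s) (YH x u) \<partial>MC) =
    ennreal ((if y 0 = x then 1 else 0) * (\<Prod>i<n. pmf (J (y i)) (y (Suc i)) * exp (- r (y i) * s i)))"
  using assms
proof (induction n arbitrary: x y s)
  case 0
  interpret MC: prob_space MC by (rule prob_space_MC)
  have "indicator (cyl 0 y s) (YH x u) = (if y 0 = x then 1 else 0 :: ennreal)" for u
    by (auto simp: cyl_def indicator_def)
  then show ?case by (auto simp: MC.emeasure_space_1)
next
  case (Suc n)
  note [measurable] = sets_cyl
  let ?c = "ennreal (\<Prod>i<n. pmf (J (y (Suc i))) (y (Suc (Suc i))) * exp (- r (y (Suc i)) * s (Suc i)))"
  have IH: "(\<integral>\<^sup>+u. indicator (cyl n (\<lambda>i. y (Suc i)) (\<lambda>i. s (Suc i))) (YH x u) \<partial>MC) = ?c * indicator {y (Suc 0)} x" for x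
    using Suc.IH[of "\<lambda>i. s (Suc i)" "\<lambda>i. y (Suc i)" x] Suc.prems by (auto simp: indicator_def)
  have s0: "0 \<le> s 0" using Suc.prems by auto
  have "(\<integral>\<^sup>+u. indicator (cyl (Suc n) y s) (YH x u) \<partial>MC) =
    (\<integral>\<^sup>+y'. \<integral>\<^sup>+h. \<integral>\<^sup>+u. indicator {x} (y 0) * indicator {h. ennreal (s 0) < h} h *
      indicator (cyl n (\<lambda>i. y (Suc i)) (\<lambda>i. s (Suc i))) (fst (YH y' u), snd (YH y' u)) \<partial>MC \<partial>expo (r x) \<partial>J x)"
    by (subst nn_integral_YH) (auto simp: cyl_case_nat[where s=s, OF s0])
  also have "\<dots> = (\<integral>\<^sup>+y'. \<integral>\<^sup>+h. indicator {x} (y 0) * indicator {h. ennreal (s 0) < h} h * (?c * indicator {y (Suc 0)} y') \<partial>expo (r x) \<partial>J x)"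
    by (subst nn_integral_cmult) (auto simp: IH)
  also have "\<dots> = (\<integral>\<^sup>+y'. (indicator {x} (y 0) * ennreal (exp (- r x * s 0)) * ?c) * indicator {y (Suc 0)} y' \<partial>J x)"
  proof (intro nn_integral_cong)
    fix y'
    have "(\<integral>\<^sup>+h. indicator {x} (y 0) * indicator {h. ennreal (s 0) < h} h * (?c * indicator {y (Suc 0)} y') \<partial>expo (r x))
      = (\<integral>\<^sup>+h. (indicator {x} (y 0) * (?c * indicator {y (Suc 0)} y')) * indicator {h. ennreal (s 0) < h} h \<partial>expo (r x))"
      by (simp add: ac_simps)
    also have "\<dots> = (indicator {x} (y 0) * (?c * indicator {y (Suc 0)} y')) * emeasure (expo (r x)) {h. ennreal (s 0) < h}"
      by (subst nn_integral_cmult_indicator) auto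
    finally show "(\<integral>\<^sup>+h. indicator {x} (y 0) * indicator {h. ennreal (s 0) < h} h * (?c * indicator {y (Suc 0)} y') \<partial>expo (r x))
      = (indicator {x} (y 0) * ennreal (exp (- r x * s 0)) * ?c) * indicator {y (Suc 0)} y'"
      unfolding emeasure_expo_gt[OF r_nonneg s0] by (simp add: ac_simps)
  qed
  also have "\<dots> = (indicator {x} (y 0) * ennreal (exp (- r x * s 0)) * ?c) * ennreal (pmf (J x) (y (Suc 0)))"
    by (subst nn_integral_cmult_indicator) (auto simp: emeasure_pmf_single)
  also have "\<dots> = ennreal ((if y 0 = x then 1 else 0) * (\<Prod>i<Suc n. pmf (J (y i)) (y (Suc i)) * exp (- r (y i) * s i)))"
    unfolding prod.lessThan_Suc_shift
    by (auto simp: indicator_def ennreal_mult'[symmetric] ennreal_mult[symmetric] prod_nonneg ac_simps)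
  finally show ?case .
qed

lemma jump_hold_MC:
  assumes "\<And>x y. jump_prob q x y = pmf (J x) y" "\<And>x. qtot q x = r x"
  shows "jump_hold MC q x (\<lambda>u. fst (YH x u)) (\<lambda>u. snd (YH x u))"
  unfolding jump_hold_def
proof (intro conjI allI impI)
  interpret MC: prob_space MC by (rule prob_space_MC)
  show "(\<lambda>u. fst (YH x u) i) \<in> MC \<rightarrow>\<^sub>M count_space UNIV" "(\<lambda>u. snd (YH x u) i) \<in> borel_measurable MC" for i
    by measurable
  fix n :: nat and y :: "nat \<Rightarrow> 's" and s :: "nat \<Rightarrow> real" assume s: "\<forall>i<n. 0 \<le> s i"
  let ?A = "{u \<in> space MC. (\<forall>i\<le>n. fst (YH x u) i = y i) \<and> (\<forall>i<n. ennreal (s i) < snd (YH x u) i)}"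
  have "emeasure MC ?A = (\<integral>\<^sup>+u. indicator (cyl n y s) (YH x u) \<partial>MC)"
  proof -
    have A: "?A = (\<lambda>u. YH x u) -` cyl n y s \<inter> space MC"
      using s by (auto simp: cyl_def leD)
    have "?A \<in> sets MC" unfolding A using sets_cyl by measurable
    then have "emeasure MC ?A = (\<integral>\<^sup>+u. indicator ?A u \<partial>MC)" by simp
    also have "\<dots> = (\<integral>\<^sup>+u. indicator (cyl n y s) (YH x u) \<partial>MC)"
      by (intro nn_integral_cong) (unfold A, auto simp: indicator_def)
    finally show ?thesis .
  qed
  then have "MC.prob ?A = (if y 0 = x then 1 else 0) * (\<Prod>i<n. pmf (J (y i)) (y (Suc i)) * exp (- r (y i) * s i))"
    unfolding emeasure_cyl[OF s] MC.emeasure_eq_measure by (subst (asm) ennreal_inj) (auto intro!: prod_nonneg)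
  then show "MC.prob ?A = (if y 0 = x then 1 else 0) * (\<Prod>i<n. jump_prob q (y i) (y (Suc i)) * exp (- qtot q (y i) * s i))"
    by (simp add: assms)
qed

lemma AE_YH_pos: "AE u in MC. \<forall>i. 0 < snd (YH x u) i"
  unfolding AE_all_countable
proof
  fix i
  have "(\<integral>\<^sup>+u. (if snd (YH x u) i = 0 then 1 else 0) \<partial>MC) = 0"
  proof (induction i arbitrary: x)
    case 0
    have "AE h in expo (r x). \<not> h = 0" using AE_expo_pos[OF r_nonneg[of x]] by eventually_elim auto
    then have "(\<integral>\<^sup>+h. (if h = 0 then 1 else 0) * emeasure MC (space MC) \<partial>expo (r x)) = (\<integral>\<^sup>+h. 0 \<partial>expo (r x))"
      by (intro nn_integral_cong_AE) auto
    then show ?case by (subst nn_integral_YH) auto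
  next
    case (Suc i)
    then show ?case by (subst nn_integral_YH) auto
  qed
  then have "AE u in MC. (if snd (YH x u) i = 0 then 1 else 0) = (0::ennreal)"
    by (subst (asm) nn_integral_0_iff_AE) auto
  then show "AE u in MC. 0 < snd (YH x u) i"
    by eventually_elim (auto simp: zero_less_iff_neq_zero split: if_splits)
qed

lemma AE_YH_nonexplosive: "AE u in MC. (\<Sum>i. snd (YH x u) i) = top"
proof (rule AE_suminf_top[where c="2 * R x + c0"])
  show "0 < 2 * R x + c0" using R_nonneg[of x] c0_pos by simp
  show "(\<integral>\<^sup>+u. (\<Prod>i<k. eexp (snd (YH x u) i)) \<partial>MC) \<le> ennreal ((2 * R x + c0) / (2 * R x + c0 + 2 * real k))" for k
  proof (induction k arbitrary: x)
    case 0
    interpret MC: prob_space MC by (rule prob_space_MC)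
    show ?case using R_nonneg[of x] c0_pos by (simp add: MC.emeasure_space_1)
  next
    case (Suc k)
    \<comment> \<open>This majorant of the rate grows by at most 2 per jump, and t / (t + 2) as well
      as t / (t + 2 * k) increases with t, so the rates can be replaced by majorants
      throughout.\<close>
    define a where "a = 2 * R x + c0"
    have a: "0 < a" "r x \<le> a" using R_nonneg[of x] c0_pos r_le[of x] by (auto simp: a_def)
    have "(\<integral>\<^sup>+u. (\<Prod>i<Suc k. eexp (snd (YH x u) i)) \<partial>MC) =
      (\<integral>\<^sup>+y. \<integral>\<^sup>+h. \<integral>\<^sup>+u. eexp h * (\<Prod>i<k. eexp (snd (YH y u) i)) \<partial>MC \<partial>expo (r x) \<partial>J x)"
      by (subst nn_integral_YH) (auto simp del: prod.lessThan_Suc simp add: prod.lessThan_Suc_shift)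
    also have "\<dots> = (\<integral>\<^sup>+y. \<integral>\<^sup>+h. eexp h * (\<integral>\<^sup>+u. (\<Prod>i<k. eexp (snd (YH y u) i)) \<partial>MC) \<partial>expo (r x) \<partial>J x)"
      by (subst nn_integral_cmult) auto
    also have "\<dots> = (\<integral>\<^sup>+y. ennreal (r x / (r x + 2)) * (\<integral>\<^sup>+u. (\<Prod>i<k. eexp (snd (YH y u) i)) \<partial>MC) \<partial>J x)"
      by (subst nn_integral_multc) (auto simp: nn_integral_eexp r_nonneg)
    also have "\<dots> \<le> (\<integral>\<^sup>+y. ennreal (r x / (r x + 2)) * ennreal ((a + 2) / (a + 2 + 2 * real k)) \<partial>J x)"
    proof (intro nn_integral_mono_AE, unfold AE_measure_pmf_iff, intro ballI mult_left_mono order_trans[OF Suc.IH] ennreal_leI)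
      fix y assume "y \<in> set_pmf (J x)"
      then have "2 * R y + c0 \<le> a + 2" "0 < 2 * R y + c0" using R_step R_nonneg[of y] c0_pos by (fastforce simp: a_def)+
      then show "(2 * R y + c0) / (2 * R y + c0 + 2 * real k) \<le> (a + 2) / (a + 2 + 2 * real k)"
        by (intro frac_add_mono) auto
    qed auto
    also have "\<dots> = ennreal (r x / (r x + 2) * ((a + 2) / (a + 2 + 2 * real k)))"
      using a r_nonneg[of x] by (subst ennreal_mult) (auto simp: measure_pmf.emeasure_space_1)
    also have "\<dots> \<le> ennreal (a / (a + 2) * ((a + 2) / (a + 2 + 2 * real k)))"
      using a r_nonneg[of x] by (intro ennreal_leI mult_right_mono) (auto simp: field_simps)
    also have "a / (a + 2) * ((a + 2) / (a + 2 + 2 * real k)) = a / (a + 2 * real (Suc k))"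
    proof -
      have "a + 2 \<noteq> 0" using a by simp
      moreover have "a + 2 + 2 * real k = a + 2 * real (Suc k)" by simp
      ultimately show ?thesis by (simp only: times_divide_times_eq) (simp add: mult.commute)
    qed
    finally show ?case by (simp add: a_def)
  qed
qed auto

definition PL :: "'s \<Rightarrow> (real \<Rightarrow> 's) measure" where
  "PL x = distr MC path_space (\<lambda>u. pth (YH x u))"

lemma sets_PL [measurable_cong, simp]: "sets (PL x) = sets path_space"
  by (simp add: PL_def)

lemma space_PL [simp]: "space (PL x) = {p. rc p}"
  by (simp add: PL_def)

lemma prob_space_PL: "prob_space (PL x)"
proof -
  interpret MC: prob_space MC by (rule prob_space_MC)
  show ?thesis unfolding PL_def by (rule MC.prob_space_distr) measurable
qed

lemma AE_PL_start: "AE p in PL x. p 0 = x"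
proof -
  have m: "{p \<in> space path_space. p 0 = x} \<in> sets path_space"
    using measurable_sets[OF measurable_path_eval_fixed, of "{x}" 0] by (simp add: vimage_def Int_def conj_commute)
  show ?thesis unfolding PL_def
  proof (subst AE_distr_iff[OF _ m])
    show "AE u in MC. pth (YH x u) 0 = x"
      using AE_YH_pos[of x] AE_YH_nonexplosive[of x]
    proof eventually_elim
      case (elim u)
      have "pth (fst (YH x u), snd (YH x u)) 0 = x"
        unfolding pth_eq[OF elim(2)] using elim(1) by (subst path_of_first) auto
      then show ?case by simp
    qed
  qed measurable
qed

text \<open>The Markov property at the first jump, in the form that is used for all recursions of
  the spindle.\<close>

lemma PL_first_jump:
  assumes "0 < r x" and f [measurable]: "f \<in> borel_measurable path_space"
  shows "(\<integral>\<^sup>+p. f p \<partial>PL x) = (\<integral>\<^sup>+s. ennreal (r x * exp (- r x * s)) * indicator {0..} s *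
     (\<integral>\<^sup>+y. \<integral>\<^sup>+p. f (jn x s p) \<partial>PL y \<partial>J x) \<partial>lborel)"
proof -
  interpret MC: prob_space MC by (rule prob_space_MC)
  interpret E: prob_space "expo (r x)" by (rule prob_space_expo)
  interpret P: pair_sigma_finite "expo (r x)" "measure_pmf (J x)" ..
  have m [measurable]: "(\<lambda>(y, h, u). f (pth (case_nat x (fst (YH y u)), case_nat h (snd (YH y u)))))
    \<in> borel_measurable (count_space UNIV \<Otimes>\<^sub>M borel \<Otimes>\<^sub>M MC)"
    by measurable
  have "(\<integral>\<^sup>+p. f p \<partial>PL x) = (\<integral>\<^sup>+u. f (pth (YH x u)) \<partial>MC)"
    unfolding PL_def by (subst nn_integral_distr) auto
  also have "\<dots> = (\<integral>\<^sup>+y. \<integral>\<^sup>+h. \<integral>\<^sup>+u. f (pth (case_nat x (fst (YH y u)), case_nat h (snd (YH y u)))) \<partial>MC \<partial>expo (r x) \<partial>J x)"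
    by (subst nn_integral_YH) auto
  also have "\<dots> = (\<integral>\<^sup>+h. \<integral>\<^sup>+y. \<integral>\<^sup>+u. f (pth (case_nat x (fst (YH y u)), case_nat h (snd (YH y u)))) \<partial>MC \<partial>J x \<partial>expo (r x))"
    by (rule P.Fubini') measurable
  also have "\<dots> = (\<integral>\<^sup>+s. ennreal (r x * exp (- r x * s)) * indicator {0..} s *
     (\<integral>\<^sup>+y. \<integral>\<^sup>+u. f (pth (case_nat x (fst (YH y u)), case_nat (ennreal s) (snd (YH y u)))) \<partial>MC \<partial>J x) \<partial>lborel)"
    by (subst nn_integral_expo[OF assms(1)]) auto
  also have "\<dots> = (\<integral>\<^sup>+s. ennreal (r x * exp (- r x * s)) * indicator {0..} s *
     (\<integral>\<^sup>+y. \<integral>\<^sup>+p. f (jn x s p) \<partial>PL y \<partial>J x) \<partial>lborel)"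
  \<comment> \<open>A holding time 0 is discarded as a null set, since only a positive one can be
    prefixed to a path by \<open>pth_jn\<close>.\<close>
  proof (rule nn_integral_cong_AE, use AE_lborel_singleton[of 0] in eventually_elim)
    fix s :: real assume s: "s \<noteq> 0"
    show "ennreal (r x * exp (- r x * s)) * indicator {0..} s *
     (\<integral>\<^sup>+y. \<integral>\<^sup>+u. f (pth (case_nat x (fst (YH y u)), case_nat (ennreal s) (snd (YH y u)))) \<partial>MC \<partial>J x)
     = ennreal (r x * exp (- r x * s)) * indicator {0..} s * (\<integral>\<^sup>+y. \<integral>\<^sup>+p. f (jn x s p) \<partial>PL y \<partial>J x)"
    proof (cases "0 < s")
      case True
      have "(\<integral>\<^sup>+u. f (pth (case_nat x (fst (YH y u)), case_nat (ennreal s) (snd (YH y u)))) \<partial>MC)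
        = (\<integral>\<^sup>+p. f (jn x s p) \<partial>PL y)" for y
      proof -
        have "(\<integral>\<^sup>+p. f (jn x s p) \<partial>PL y) = (\<integral>\<^sup>+u. f (jn x s (pth (YH y u))) \<partial>MC)"
          unfolding PL_def by (subst nn_integral_distr) auto
        also have "\<dots> = (\<integral>\<^sup>+u. f (pth (case_nat x (fst (YH y u)), case_nat (ennreal s) (snd (YH y u)))) \<partial>MC)"
        proof (rule nn_integral_cong_AE, use AE_YH_nonexplosive[of y] in eventually_elim)
          case (elim u)
          then show ?case using pth_jn[OF elim True, of x "fst (YH y u)"] by simp
        qed
        finally show ?thesis by simp
      qed
      then show ?thesis by simp
    qed (use s in auto)
  qed
  finally show ?thesis .
qed

lemma PL_absorbed:
  assumes "r x = 0" and f [measurable]: "f \<in> borel_measurable path_space"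
  shows "(\<integral>\<^sup>+p. f p \<partial>PL x) = f (\<lambda>_. x)"
proof -
  interpret MC: prob_space MC by (rule prob_space_MC)
  have "pth (case_nat x Y, case_nat top H) = (\<lambda>_. x)" for Y H
  proof -
    have "top = case_nat top H 0" by simp
    also have "case_nat top H 0 \<le> suminf (case_nat top H)" using sum_le_suminf[of "case_nat top H" "{0}"] by simp
    finally have "suminf (case_nat top H) = top" by (metis top_unique)
    then show ?thesis using path_of_first[of _ "case_nat top H" "case_nat x Y"] by (auto simp: pth_eq fun_eq_iff)
  qed
  then have "(\<integral>\<^sup>+u. f (pth (YH x u)) \<partial>MC) = f (\<lambda>_. x)"
    by (subst nn_integral_YH) (auto simp: assms nn_integral_expo0 MC.emeasure_space_1 measure_pmf.emeasure_space_1)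
  then show ?thesis unfolding PL_def by (subst nn_integral_distr) auto
qed

text \<open>By uniqueness of the law of jump chain and holding times, any chain with these rates may
  be replaced by the canonical model.\<close>

lemma law_eq_PL:
  assumes M: "prob_space M" and q: "\<And>x y. jump_prob q x y = pmf (J x) y" "\<And>x. qtot q x = r x"
    and J: "jump_hold M q x Y H" and X: "X \<in> M \<rightarrow>\<^sub>M path_space" "AE \<omega> in M. X \<omega> = pth (Y \<omega>, H \<omega>)"
  shows "distr M path_space X = PL x"
proof -
  note [measurable] = measurable_jump_hold[OF J] X(1)
  have "distr M path_space X = distr M path_space (\<lambda>\<omega>. pth (Y \<omega>, H \<omega>))"
    using X(2) by (intro distr_cong_AE) auto
  also have "\<dots> = distr (distr M JH (\<lambda>\<omega>. (Y \<omega>, H \<omega>))) path_space pth"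
    by (subst distr_distr) (auto simp: comp_def)
  also have "distr M JH (\<lambda>\<omega>. (Y \<omega>, H \<omega>)) = distr MC JH (\<lambda>u. (fst (YH x u), snd (YH x u)))"
    using AE_YH_pos by (intro jump_hold_law_unique[OF M prob_space_MC J jump_hold_MC[OF q]]) auto
  also have "distr \<dots> path_space pth = PL x"
    unfolding PL_def by (subst distr_distr) (auto simp: comp_def)
  finally show ?thesis .
qed

end

section \<open>The spindle chain\<close>

lemma hits_iff: assumes "rc z" shows "hits z \<longleftrightarrow> (\<exists>t\<ge>0. z t = 0)"
proof
  assume "\<exists>t\<ge>0. z t = 0"
  then obtain t where t: "0 \<le> t" "z t = 0" by auto
  obtain d where d: "d > 0" "\<And>u. t \<le> u \<Longrightarrow> u < t + d \<Longrightarrow> z u = z t" using rcD[OF assms] by blast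
  obtain q where "q \<in> \<rat>" "t < q" "q < t + d" using Rats_dense_in_real[of t "t + d"] d(1) by auto
  then show "hits z" using d(2)[of q] t unfolding hits_def by (intro bexI[of _ q]) auto
qed (auto simp: hits_def)

lemma hits_jn_iff: assumes "rc z" "c \<noteq> 0" "0 \<le> s" shows "hits (jn c s z) \<longleftrightarrow> hits z"
proof
  assume "hits (jn c s z)"
  then obtain t where "0 \<le> t" "jn c s z t = 0" using hits_iff[of "jn c s z"] assms by auto
  then show "hits z" unfolding hits_iff[OF assms(1)] using assms
    by (auto simp: jn_def split: if_splits intro!: exI[of _ "t - s"])
qed (use hits_jn assms in auto)

definition spJ :: "real \<Rightarrow> nat \<Rightarrow> nat pmf" where
  "spJ \<alpha> n = (if n = 0 then return_pmf 0
     else map_pmf (\<lambda>b. if b then n + 1 else n - 1) (bernoulli_pmf ((real n - \<alpha>) / (2 * real n - \<alpha>))))"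

definition spr :: "real \<Rightarrow> nat \<Rightarrow> real" where
  "spr \<alpha> n = (if n = 0 then 0 else 2 * real n - \<alpha>)"

locale spindle =
  fixes \<alpha> :: real
  assumes \<alpha>0: "0 \<le> \<alpha>" and \<alpha>1: "\<alpha> \<le> 1"

text \<open>The total rate 2 * n - \<alpha> is at most 2 * n, so the state itself is a Lyapunov
  function; the last parameter 1 only makes the bound positive at the absorbing state 0.\<close>

sublocale spindle \<subseteq> sp: jump_chain "spJ \<alpha>" "spr \<alpha>" real 1
proof
  fix x y :: nat
  show "0 \<le> spr \<alpha> x" "spr \<alpha> x \<le> 2 * real x + 1"
    using \<alpha>0 \<alpha>1 by (cases x; simp add: spr_def)+
  show "y \<in> set_pmf (spJ \<alpha> x) \<Longrightarrow> real y \<le> real x + 1"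
    by (auto simp: spJ_def split: if_splits)
qed auto

context spindle
begin

abbreviation Q :: "nat \<Rightarrow> (real \<Rightarrow> nat) measure" where "Q \<equiv> sp.PL"

lemma real_ge: "1 \<le> n \<Longrightarrow> \<alpha> \<le> real n" "1 \<le> n \<Longrightarrow> 0 < 2 * real n - \<alpha>"
  using \<alpha>1 by auto

lemma qtot_qQ: "qtot (qQ \<alpha>) n = spr \<alpha> n"
proof (cases "n = 0")
  case False
  have "qtot (qQ \<alpha>) n = (\<Sum>y\<in>{n + 1, n - 1}. qQ \<alpha> n y)"
    unfolding qtot_def using False by (intro sum.mono_neutral_left) (auto simp: qQ_def split: if_splits)
  then show ?thesis using False by (auto simp: qQ_def spr_def)
qed (simp add: qtot_def qQ_def spr_def)

lemma jump_prob_qQ: "jump_prob (qQ \<alpha>) x y = pmf (spJ \<alpha> x) y"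
proof (cases "x = 0")
  case True
  then show ?thesis by (simp add: jump_prob_def qtot_qQ spr_def spJ_def)
next
  case False
  define p where "p = (real x - \<alpha>) / (2 * real x - \<alpha>)"
  have x: "0 < 2 * real x - \<alpha>" "\<alpha> \<le> real x" using real_ge[of x] False by auto
  have p: "0 \<le> p" "p \<le> 1" "1 - p = real x / (2 * real x - \<alpha>)" using x by (auto simp: p_def field_simps)
  have "pmf (spJ \<alpha> x) y = measure (bernoulli_pmf p) ((\<lambda>b. if b then x + 1 else x - 1) -` {y})"
    using False by (simp add: spJ_def p_def pmf_map)
  also have "(\<lambda>b. if b then x + 1 else x - 1) -` {y} = (if y = x + 1 then {True} else if Suc y = x then {False} else {})"
    using False by (auto split: if_splits)
  also have "measure (bernoulli_pmf p) \<dots> = (if y = x + 1 then p else if Suc y = x then 1 - p else 0)"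
    using p by (auto simp: measure_pmf_single)
  also have "\<dots> = jump_prob (qQ \<alpha>) x y"
    using False x unfolding p(3) by (auto simp: jump_prob_def qtot_qQ spr_def qQ_def p_def)
  finally show ?thesis ..
qed

lemma nn_integral_spJ:
  assumes "1 \<le> n"
  shows "ennreal (spr \<alpha> n) * (\<integral>\<^sup>+y. A y \<partial>spJ \<alpha> n) = ennreal (real n - \<alpha>) * A (n + 1) + ennreal (real n) * A (n - 1)"
proof -
  define l where "l = 2 * real n - \<alpha>"
  have l: "0 < l" "0 \<le> real n - \<alpha>" using real_ge[OF assms] by (auto simp: l_def)
  have le: "real n - \<alpha> \<le> l" by (simp add: l_def)
  have "(\<integral>\<^sup>+y. A y \<partial>spJ \<alpha> n) = ennreal ((real n - \<alpha>) / l) * A (n + 1) + ennreal (1 - (real n - \<alpha>) / l) * A (n - 1)"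
  proof -
    have "0 \<le> (real n - \<alpha>) / l" "(real n - \<alpha>) / l \<le> 1" using l le by auto
    moreover have "spJ \<alpha> n = map_pmf (\<lambda>b. if b then n + 1 else n - 1) (bernoulli_pmf ((real n - \<alpha>) / l))"
      using assms by (simp add: spJ_def l_def)
    ultimately show ?thesis by (simp add: nn_integral_bernoulli_pmf mult.commute)
  qed
  moreover have "l * ((real n - \<alpha>) / l) = real n - \<alpha>" "l * (1 - (real n - \<alpha>) / l) = real n" "0 \<le> 1 - (real n - \<alpha>) / l" "0 \<le> (real n - \<alpha>) / l"
    using l by (auto simp: field_simps l_def)
  ultimately show ?thesis using l assms
    by (simp add: spr_def l_def[symmetric] distrib_left mult.assoc[symmetric] ennreal_mult[symmetric])
qed

lemma Q_first_jump:
  assumes n: "1 \<le> n" and f [measurable]: "f \<in> borel_measurable path_space"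
  shows "(\<integral>\<^sup>+p. f p \<partial>Q n) = (\<integral>\<^sup>+s. ennreal (exp (- (2 * real n - \<alpha>) * s)) * indicator {0..} s *
     (ennreal (real n - \<alpha>) * (\<integral>\<^sup>+p. f (jn n s p) \<partial>Q (n + 1)) + ennreal (real n) * (\<integral>\<^sup>+p. f (jn n s p) \<partial>Q (n - 1))) \<partial>lborel)"
proof -
  have r: "spr \<alpha> n = 2 * real n - \<alpha>" "0 < spr \<alpha> n" using n real_ge[OF n] by (auto simp: spr_def)
  have "(\<integral>\<^sup>+p. f p \<partial>Q n) = (\<integral>\<^sup>+s. ennreal (exp (- (2 * real n - \<alpha>) * s)) * indicator {0..} s *
     (ennreal (spr \<alpha> n) * (\<integral>\<^sup>+y. \<integral>\<^sup>+p. f (jn n s p) \<partial>Q y \<partial>spJ \<alpha> n)) \<partial>lborel)"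
    unfolding sp.PL_first_jump[OF r(2) f] using r
    by (intro nn_integral_cong) (simp add: ennreal_mult ac_simps)
  then show ?thesis unfolding nn_integral_spJ[OF n] .
qed

lemma Q_0: "f \<in> borel_measurable path_space \<Longrightarrow> (\<integral>\<^sup>+p. f p \<partial>Q 0) = f (\<lambda>_. 0)"
  by (rule sp.PL_absorbed) (simp add: spr_def)

text \<open>A functional that picks up the factor exp(-x s) from a prefix of length s satisfies the
  difference equation of the generator with killing rate x. It is applied with x = 0 to the event of
  never dying, and with x > 0 to the Laplace transform of \<open>zeta\<close>.\<close>

lemma Q_first_jump_weight:
  assumes n: "1 \<le> n" and "0 \<le> x" and f [measurable]: "f \<in> borel_measurable path_space" and g [measurable]: "g \<in> borel_measurable path_space"
    and fg: "\<And>s m. 0 \<le> s \<Longrightarrow> AE p in Q m. f (jn n s p) = ennreal (exp (- x * s)) * f p"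
    and fin: "\<And>m. (\<integral>\<^sup>+p. f p \<partial>Q m) = ennreal (a m)" "\<And>m. 0 \<le> a m"
  shows "(2 * real n - \<alpha> + x) * a n = (real n - \<alpha>) * a (n + 1) + real n * a (n - 1)"
proof -
  have l: "0 < 2 * real n - \<alpha> + x" "0 \<le> real n - \<alpha>" using real_ge[OF n] assms(2) by auto
  let ?B = "(real n - \<alpha>) * a (n + 1) + real n * a (n - 1)"
  have B: "0 \<le> ?B" using l fin by auto
  have "ennreal (a n) = (\<integral>\<^sup>+s. ennreal (exp (- (2 * real n - \<alpha>) * s)) * indicator {0..} s *
     (ennreal (real n - \<alpha>) * (\<integral>\<^sup>+p. f (jn n s p) \<partial>Q (n + 1)) + ennreal (real n) * (\<integral>\<^sup>+p. f (jn n s p) \<partial>Q (n - 1))) \<partial>lborel)"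
    unfolding fin(1)[symmetric] by (rule Q_first_jump[OF n f])
  also have "\<dots> = (\<integral>\<^sup>+s. ennreal (exp (- (2 * real n - \<alpha> + x) * s)) * indicator {0..} s * ennreal ?B \<partial>lborel)"
  proof (intro nn_integral_cong)
    fix s :: real
    show "ennreal (exp (- (2 * real n - \<alpha>) * s)) * indicator {0..} s *
     (ennreal (real n - \<alpha>) * (\<integral>\<^sup>+p. f (jn n s p) \<partial>Q (n + 1)) + ennreal (real n) * (\<integral>\<^sup>+p. f (jn n s p) \<partial>Q (n - 1)))
     = ennreal (exp (- (2 * real n - \<alpha> + x) * s)) * indicator {0..} s * ennreal ?B"
    proof (cases "0 \<le> s")
      case True
      have "(\<integral>\<^sup>+p. f (jn n s p) \<partial>Q m) = ennreal (exp (- x * s) * a m)" for m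
      proof -
        have "(\<integral>\<^sup>+p. f (jn n s p) \<partial>Q m) = (\<integral>\<^sup>+p. ennreal (exp (- x * s)) * f p \<partial>Q m)"
          by (intro nn_integral_cong_AE fg True)
        also have "\<dots> = ennreal (exp (- x * s)) * (\<integral>\<^sup>+p. f p \<partial>Q m)" by (rule nn_integral_cmult) measurable
        finally show ?thesis using fin by (simp add: ennreal_mult)
      qed
      moreover have "exp (- (2 * real n - \<alpha> + x) * s) = exp (- (2 * real n - \<alpha>) * s) * exp (- x * s)"
        by (simp add: exp_add[symmetric] algebra_simps)
      ultimately show ?thesis using True l fin B
        by (simp add: ennreal_mult[symmetric] ennreal_plus[symmetric] del: ennreal_plus) (simp add: algebra_simps)
    qed simp
  qed
  also have "\<dots> = ennreal (1 / (2 * real n - \<alpha> + x)) * ennreal ?B"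
    using nn_integral_exp_tail[OF l(1), of 0] by (subst nn_integral_multc) auto
  also have "\<dots> = ennreal (?B / (2 * real n - \<alpha> + x))" using l B by (simp add: ennreal_mult[symmetric])
  finally have "a n = ?B / (2 * real n - \<alpha> + x)" using B l fin by (subst (asm) ennreal_inj) auto
  then show ?thesis using l by simp
qed

lemma AE_Q_start: "AE p in Q n. p 0 = n" by (rule sp.AE_PL_start)

lemma AE_Q_rc: "AE p in Q n. rc p" using AE_space[of "Q n"] by simp

text \<open>Let a n be the probability of never reaching 0 from n. Its increments satisfy (m + 1 -
  \<alpha>) d (m + 1) = (m + 1) d m, so they keep their sign and do not shrink in absolute value. As
  a is bounded, all increments vanish, and a 0 = 0.\<close>

lemma AE_Q_hits: "AE p in Q n. hits p"
proof -
  define f where "f p = (if hits p then 0 else 1 :: ennreal)" for p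
  have f [measurable]: "f \<in> borel_measurable path_space" unfolding f_def[abs_def] by measurable
  define a where "a m = enn2real (\<integral>\<^sup>+p. f p \<partial>Q m)" for m
  have le: "(\<integral>\<^sup>+p. f p \<partial>Q m) \<le> 1" for m
  proof -
    interpret prob_space "Q m" by (rule sp.prob_space_PL)
    have "(\<integral>\<^sup>+p. f p \<partial>Q m) \<le> (\<integral>\<^sup>+p. 1 \<partial>Q m)" by (intro nn_integral_mono) (auto simp: f_def)
    then show ?thesis using emeasure_space_1 by simp
  qed
  have fin: "(\<integral>\<^sup>+p. f p \<partial>Q m) = ennreal (a m)" "0 \<le> a m" "a m \<le> 1" for m
    using le[of m] by (auto simp: a_def enn2real_leI intro!: ennreal_enn2real[symmetric] intro: le_less_trans)
  have rec: "(2 * real n - \<alpha>) * a n = (real n - \<alpha>) * a (n + 1) + real n * a (n - 1)" if n: "1 \<le> n" for n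
  proof -
    have "AE p in Q m. f (jn n s p) = ennreal (exp (- 0 * s)) * f p" if "0 \<le> s" for s m
      using AE_Q_rc[of m] by eventually_elim (use n that in \<open>simp add: f_def hits_jn_iff\<close>)
    from Q_first_jump_weight[OF n order_refl f f this fin(1,2)] show ?thesis by simp
  qed
  define d where "d m = a (Suc m) - a m" for m
  have rec': "(real (Suc m) - \<alpha>) * d (Suc m) = real (Suc m) * d m" for m
    using rec[of "Suc m"] by (simp add: d_def algebra_simps)
  have mono: "\<bar>d m\<bar> \<le> \<bar>d (Suc m)\<bar> \<and> sgn (d (Suc m)) = sgn (d m) \<or> d m = 0" for m
  proof (cases "d m = 0")
    case False
    have pos: "0 \<le> real (Suc m) - \<alpha>" using \<alpha>1 by simp
    have ne: "real (Suc m) - \<alpha> \<noteq> 0" using rec'[of m] False by auto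
    have "real (Suc m) * \<bar>d m\<bar> = (real (Suc m) - \<alpha>) * \<bar>d (Suc m)\<bar>"
      using arg_cong[OF rec'[of m], of abs] pos by (simp add: abs_mult)
    also have "\<dots> \<le> real (Suc m) * \<bar>d (Suc m)\<bar>" using \<alpha>0 by (intro mult_right_mono) auto
    finally have "\<bar>d m\<bar> \<le> \<bar>d (Suc m)\<bar>" by simp
    moreover have "sgn (d (Suc m)) = sgn (d m)"
      using arg_cong[OF rec'[of m], of sgn] pos ne by (simp add: sgn_mult)
    ultimately show ?thesis by simp
  qed simp
  have d0: "d m = 0" for m
  proof (rule ccontr)
    assume nz: "d m \<noteq> 0"
    have *: "\<bar>d m\<bar> \<le> \<bar>d (m + k)\<bar> \<and> sgn (d (m + k)) = sgn (d m)" for k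
    proof (induction k)
      case (Suc k)
      have "d (m + k) \<noteq> 0" using Suc nz by (metis sgn_zero_iff)
      then show ?case using mono[of "m + k"] Suc by auto
    qed simp
    \<comment> \<open>A nonzero increment would make a change linearly from m on, contradicting its
      range in [0, 1].\<close>
    have **: "real k * \<bar>d m\<bar> \<le> sgn (d m) * (a (m + k) - a m)" for k
    proof (induction k)
      case (Suc k)
      have "\<bar>d m\<bar> \<le> sgn (d m) * d (m + k)" using *[of k] by (metis abs_sgn mult.commute)
      with Suc show ?case by (simp add: d_def algebra_simps)
    qed simp
    obtain k where "1 < real k * \<bar>d m\<bar>" using nz ex_less_of_nat_mult[of "\<bar>d m\<bar>" 1] by auto
    moreover have "sgn (d m) * (a (m + k) - a m) \<le> 1"
      using fin(2,3)[of m] fin(2,3)[of "m + k"] by (cases "d m" "0 :: real" rule: linorder_cases) auto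
    ultimately show False using **[of k] by linarith
  qed
  have "hits (\<lambda>_. 0)" by (auto simp: hits_def)
  then have "a 0 = 0" using Q_0[OF f] by (simp add: a_def f_def)
  then have "a n = 0" using d0 by (induction n) (auto simp: d_def)
  then have "(\<integral>\<^sup>+p. f p \<partial>Q n) = 0" using fin(1)[of n] by simp
  then have "AE p in Q n. f p = 0" by (subst (asm) nn_integral_0_iff_AE) auto
  then show ?thesis by eventually_elim (auto simp: f_def split: if_splits)
qed

text \<open>A maximum principle. The function n / \<alpha> is the linear solution of the equation
  for mean lifetimes, so 1 - n x / \<alpha> satisfies the recursion of the Laplace transform a up to
  the defect x * (n * x / \<alpha>). The difference d of the two cannot have a nonnegative maximum
  on n \<ge> 1.\<close>

lemma Q_laplace_gt:
  assumes \<alpha>: "0 < \<alpha>" and x: "0 < x" "x \<le> \<alpha>"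
  shows "ennreal (1 - x / \<alpha>) < (\<integral>\<^sup>+p. ennreal (exp (- x * zeta p)) \<partial>Q 1)"
proof -
  define f where "f p = ennreal (exp (- x * zeta p))" for p
  have f [measurable]: "f \<in> borel_measurable path_space" unfolding f_def[abs_def] by measurable
  define a where "a m = enn2real (\<integral>\<^sup>+p. f p \<partial>Q m)" for m
  have le: "(\<integral>\<^sup>+p. f p \<partial>Q m) \<le> 1" for m
  proof -
    interpret prob_space "Q m" by (rule sp.prob_space_PL)
    have "(\<integral>\<^sup>+p. f p \<partial>Q m) \<le> (\<integral>\<^sup>+p. 1 \<partial>Q m)" using x by (intro nn_integral_mono) (auto simp: f_def intro!: ennreal_le_1)
    then show ?thesis using emeasure_space_1 by simp
  qed
  have fin: "(\<integral>\<^sup>+p. f p \<partial>Q m) = ennreal (a m)" "0 \<le> a m" "a m \<le> 1" for m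
    using le[of m] by (auto simp: a_def enn2real_leI intro!: ennreal_enn2real[symmetric] intro: le_less_trans)
  have rec: "(2 * real n - \<alpha> + x) * a n = (real n - \<alpha>) * a (n + 1) + real n * a (n - 1)" if n: "1 \<le> n" for n
  proof -
    have "AE p in Q m. f (jn n s p) = ennreal (exp (- x * s)) * f p" if "0 \<le> s" for s m
      using AE_Q_rc[of m] AE_Q_hits[of m]
    proof eventually_elim
      case (elim p)
      then show ?case using hits_jn(2)[OF elim, of n s] n that
        by (simp add: f_def ennreal_mult[symmetric] exp_add[symmetric] algebra_simps)
    qed
    from Q_first_jump_weight[OF n less_imp_le[OF x(1)] f f this fin(1,2)] show ?thesis by simp
  qed
  define d where "d n = 1 - real n * x / \<alpha> - a n" for n
  have drec: "(2 * real n - \<alpha> + x) * d n = (real n - \<alpha>) * d (n + 1) + real n * d (n - 1) - x * (real n * x / \<alpha>)" if n: "1 \<le> n" for n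
  proof -
    have "real (n - 1) = real n - 1" using n by simp
    define y where "y = x / \<alpha>"
    have y: "x = \<alpha> * y" "k * x / \<alpha> = k * y" for k using \<alpha> by (auto simp: y_def)
    have "(2 * real n - \<alpha> + x) * d n = (2 * real n - \<alpha> + x) * (1 - real n * y) - (2 * real n - \<alpha> + x) * a n"
      unfolding d_def y(2) by (simp add: algebra_simps)
    also have "(2 * real n - \<alpha> + x) * (1 - real n * y) =
      (real n - \<alpha>) * (1 - real (n + 1) * y) + real n * (1 - real (n - 1) * y) - x * (real n * y)"
      unfolding \<open>real (n - 1) = real n - 1\<close> unfolding y(1) by (simp add: algebra_simps)
    finally show ?thesis unfolding rec[OF n] d_def y(2) by (simp only: algebra_simps)
  qed
  have bdd: "d n \<le> 1 - real n * x / \<alpha>" for n using fin[of n] by (simp add: d_def)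
  obtain N where N: "1 < real N * (x / \<alpha>)" using ex_less_of_nat_mult[of "x / \<alpha>" 1] x \<alpha> by auto
  have neg: "d n < 0" if "N \<le> n" for n
  proof -
    have "real N * (x / \<alpha>) \<le> real n * (x / \<alpha>)" using that x \<alpha> by (intro mult_right_mono) auto
    then show ?thesis using bdd[of n] N by simp
  qed
  have "d n < 0" if n: "1 \<le> n" for n
  proof (rule ccontr)
    assume "\<not> d n < 0"
    \<comment> \<open>From N on already a \<ge> 0 forces d < 0, so a maximum over this finite window
      is one over all n.\<close>
    define S where "S = {m. 1 \<le> m \<and> m \<le> N + n}"
    have "finite S" "S \<noteq> {}" using n by (auto simp: S_def)
    then obtain m where m: "m \<in> S" "\<And>k. k \<in> S \<Longrightarrow> d k \<le> d m"
    proof -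
      have "Max (d ` S) \<in> d ` S" using \<open>finite S\<close> \<open>S \<noteq> {}\<close> by (intro Max_in) auto
      then obtain m where "m \<in> S" "Max (d ` S) = d m" by blast
      then show thesis using that[of m] \<open>finite S\<close> Max_ge[of "d ` S"] by simp
    qed
    have dm: "0 \<le> d m" using m(2)[of n] n \<open>\<not> d n < 0\<close> by (auto simp: S_def)
      have "zeta (\<lambda>_. 0) = 0" using zeta_char(1)[of "\<lambda>_. 0" 0] by simp
    then have "a 0 = 1" using Q_0[OF f] by (simp add: a_def f_def)
    then have d0: "d 0 = 0" by (simp add: d_def)
    have max: "d k \<le> d m" for k
    proof -
      consider "k = 0" | "k \<in> S" | "N \<le> k" by (auto simp: S_def) linarith
      then show ?thesis using d0 dm m(2)[of k] neg[of k] by cases auto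
    qed
    have m1: "1 \<le> m" using m by (auto simp: S_def)
    \<comment> \<open>At the maximum both neighbours are at most d m. After cancellation x * d m is
      bounded by minus the defect, which is negative.\<close>
    have "(2 * real m - \<alpha> + x) * d m \<le> (real m - \<alpha>) * d m + real m * d m - x * (real m * x / \<alpha>)"
      unfolding drec[OF m1] using max[of "m+1"] max[of "m-1"] real_ge[OF m1]
      by (intro diff_right_mono add_mono mult_left_mono) auto
    then have "x * d m \<le> - (x * (real m * x / \<alpha>))" by (simp add: algebra_simps)
    moreover have "0 \<le> x * d m" "0 < x * (real m * x / \<alpha>)" using dm x \<alpha> m1 by auto
    ultimately show False by linarith
  qed
  from this[of 1] have "1 - x / \<alpha> < a 1" by (simp add: d_def)
  then have "ennreal (1 - x / \<alpha>) < ennreal (a 1)"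
    using x \<alpha> by (subst ennreal_less_iff) auto
  then show ?thesis unfolding fin(1)[symmetric] f_def .
qed

end

section \<open>Forests explored depth-first\<close>

text \<open>Starting from height h and moving down, the gaps e separate the successive birth levels and
  z are the spindles; the exploration stops when the next gap exceeds the current height. In stn K
  it does so after fewer than K births; the skewer sk is nil if it never stops.\<close>

primrec stn :: "nat \<Rightarrow> real \<Rightarrow> (nat \<Rightarrow> ennreal) \<Rightarrow> (nat \<Rightarrow> real \<Rightarrow> nat) \<Rightarrow> bool" where
  "stn 0 h e z = False"
| "stn (Suc K) h e z = (ennreal h < e 0 \<or> (e 0 < ennreal h \<and>
     stn K (h - enn2real (e 0) + zeta (z 0)) (\<lambda>i. e (Suc i)) (\<lambda>i. z (Suc i))))"

primrec skn :: "nat \<Rightarrow> real \<Rightarrow> (nat \<Rightarrow> ennreal) \<Rightarrow> (nat \<Rightarrow> real \<Rightarrow> nat) \<Rightarrow> real \<Rightarrow> nat list" where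
  "skn 0 h e z = nil"
| "skn (Suc K) h e z = (if e 0 < ennreal h then cat (jn [] (h - enn2real (e 0)) (rp (z 0)))
     (skn K (h - enn2real (e 0) + zeta (z 0)) (\<lambda>i. e (Suc i)) (\<lambda>i. z (Suc i))) else nil)"

definition st :: "real \<Rightarrow> (nat \<Rightarrow> ennreal) \<Rightarrow> (nat \<Rightarrow> real \<Rightarrow> nat) \<Rightarrow> bool" where
  "st h e z \<longleftrightarrow> (\<exists>K. stn K h e z)"

definition sk :: "real \<Rightarrow> (nat \<Rightarrow> ennreal) \<Rightarrow> (nat \<Rightarrow> real \<Rightarrow> nat) \<Rightarrow> real \<Rightarrow> nat list" where
  "sk h e z = (if st h e z then skn (LEAST K. stn K h e z) h e z else nil)"

lemma stn_Suc_mono: "stn K h e z \<Longrightarrow> stn (Suc K) h e z \<and> skn (Suc K) h e z = skn K h e z"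
proof (induction K arbitrary: h e z)
  case (Suc K)
  show ?case
  proof (cases "e 0 < ennreal h")
    case True
    then have "stn K (h - enn2real (e 0) + zeta (z 0)) (\<lambda>i. e (Suc i)) (\<lambda>i. z (Suc i))"
      using Suc.prems by auto
    from Suc.IH[OF this] True show ?thesis
      by (subst (1 2) skn.simps(2), subst stn.simps(2)) simp
  qed (use Suc.prems in auto)
qed simp

lemma stn_mono:
  assumes "stn K h e z" "K \<le> K'" shows "stn K' h e z \<and> skn K' h e z = skn K h e z"
  using assms(2,1) by (induction rule: dec_induct) (use stn_Suc_mono in metis)+

lemma sk_eq: assumes "stn K h e z" shows "sk h e z = skn K h e z"
proof -
  have "stn (LEAST K. stn K h e z) h e z" using assms by (rule LeastI)
  moreover have "(LEAST K. stn K h e z) \<le> K" using assms by (rule Least_le)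
  ultimately have "skn K h e z = skn (LEAST K. stn K h e z) h e z" using stn_mono by blast
  then show ?thesis using assms by (auto simp: sk_def st_def)
qed

lemma st_sk_stop: assumes "ennreal h < e 0" shows "st h e z" "sk h e z = nil"
proof -
  have "stn 1 h e z" using assms by simp
  then show "st h e z" unfolding st_def by blast
  show "sk h e z = nil" using sk_eq[OF \<open>stn 1 h e z\<close>] assms by (auto simp: leD less_imp_le)
qed

lemma st_sk_step:
  assumes "e 0 < ennreal h"
  shows "st h e z \<longleftrightarrow> st (h - enn2real (e 0) + zeta (z 0)) (\<lambda>i. e (Suc i)) (\<lambda>i. z (Suc i))" (is "_ \<longleftrightarrow> ?st")
    and "st h e z \<Longrightarrow> sk h e z = cat (jn [] (h - enn2real (e 0)) (rp (z 0)))
      (sk (h - enn2real (e 0) + zeta (z 0)) (\<lambda>i. e (Suc i)) (\<lambda>i. z (Suc i)))"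
proof -
  have 1: "stn (Suc K) h e z \<longleftrightarrow> stn K (h - enn2real (e 0) + zeta (z 0)) (\<lambda>i. e (Suc i)) (\<lambda>i. z (Suc i))" for K
    using assms by auto
  then show "st h e z \<longleftrightarrow> ?st" unfolding st_def by (metis stn.simps(1) not0_implies_Suc)
  assume "st h e z"
  then obtain K where K: "stn (Suc K) h e z" unfolding st_def by (metis stn.simps(1) not0_implies_Suc)
  show "sk h e z = cat (jn [] (h - enn2real (e 0)) (rp (z 0)))
      (sk (h - enn2real (e 0) + zeta (z 0)) (\<lambda>i. e (Suc i)) (\<lambda>i. z (Suc i)))"
    using sk_eq[OF K] sk_eq[OF K[unfolded 1]] assms by simp
qed

abbreviation SP :: "(nat \<Rightarrow> real \<Rightarrow> nat) measure" where "SP \<equiv> PiM UNIV (\<lambda>_. path_space)"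
abbreviation SE :: "(nat \<Rightarrow> ennreal) measure" where "SE \<equiv> PiM UNIV (\<lambda>_. borel)"

lemma measurable_seq_tail [measurable (raw)]:
  "f \<in> N \<rightarrow>\<^sub>M PiM UNIV (\<lambda>_::nat. M) \<Longrightarrow> (\<lambda>x i. f x (Suc i)) \<in> N \<rightarrow>\<^sub>M PiM UNIV (\<lambda>_. M)"
proof (rule measurable_PiM_single')
  assume f: "f \<in> N \<rightarrow>\<^sub>M PiM UNIV (\<lambda>_::nat. M)"
  show "(\<lambda>x i. f x (Suc i)) \<in> space N \<rightarrow> (UNIV \<rightarrow>\<^sub>E space M)"
    using measurable_space[OF f] by (auto simp: space_PiM PiE_iff)
  show "(\<lambda>x. f x (Suc i)) \<in> N \<rightarrow>\<^sub>M M" for i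
    using f by (rule measurable_compose[OF _ measurable_component_singleton]) auto
qed

lemma measurable_stn_skn:
  assumes "h \<in> borel_measurable N" "e \<in> N \<rightarrow>\<^sub>M SE" "z \<in> N \<rightarrow>\<^sub>M SP"
  shows "Measurable.pred N (\<lambda>x. stn K (h x) (e x) (z x)) \<and> (\<lambda>x. skn K (h x) (e x) (z x)) \<in> N \<rightarrow>\<^sub>M path_space"
  using assms
proof (induction K arbitrary: h e z)
  case 0
  then show ?case by (auto intro: measurable_path_spaceI)
next
  case (Suc K)
  note [measurable] = Suc.prems
  have [measurable]: "(\<lambda>x. e x 0) \<in> borel_measurable N" "(\<lambda>x. z x 0) \<in> N \<rightarrow>\<^sub>M path_space" by measurable
  have "(\<lambda>x. h x - enn2real (e x 0) + zeta (z x 0)) \<in> borel_measurable N" by measurable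
  note IH = Suc.IH[OF this measurable_seq_tail[OF Suc.prems(2)] measurable_seq_tail[OF Suc.prems(3)]]
  note [measurable] = IH[THEN conjunct1] IH[THEN conjunct2]
  have [measurable]: "(\<lambda>x. nil) \<in> N \<rightarrow>\<^sub>M path_space" by (auto intro: measurable_path_spaceI)
  show ?case unfolding stn.simps skn.simps by (intro conjI) measurable
qed

lemma measurable_stn [measurable (raw)]:
  assumes "h \<in> borel_measurable N" "e \<in> N \<rightarrow>\<^sub>M SE" "z \<in> N \<rightarrow>\<^sub>M SP"
  shows "Measurable.pred N (\<lambda>x. stn K (h x) (e x) (z x))"
  using measurable_stn_skn[OF assms] by blast

lemma measurable_st [measurable (raw)]:
  assumes [measurable]: "h \<in> borel_measurable N" "e \<in> N \<rightarrow>\<^sub>M SE" "z \<in> N \<rightarrow>\<^sub>M SP"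
  shows "Measurable.pred N (\<lambda>x. st (h x) (e x) (z x))"
  unfolding st_def by measurable

lemma measurable_nil [measurable (raw)]: "(\<lambda>x. nil) \<in> N \<rightarrow>\<^sub>M path_space"
  by (auto intro: measurable_path_spaceI)

lemma measurable_sk [measurable (raw)]:
  assumes [measurable]: "h \<in> borel_measurable N" "e \<in> N \<rightarrow>\<^sub>M SE" "z \<in> N \<rightarrow>\<^sub>M SP"
  shows "(\<lambda>x. sk (h x) (e x) (z x)) \<in> N \<rightarrow>\<^sub>M path_space"
proof -
  have [measurable]: "(\<lambda>x. skn K (h x) (e x) (z x)) \<in> N \<rightarrow>\<^sub>M path_space" for K
    using measurable_stn_skn[OF assms] by blast
  have [measurable]: "(\<lambda>x. LEAST K. stn K (h x) (e x) (z x)) \<in> N \<rightarrow>\<^sub>M count_space UNIV" by measurable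
  have [measurable]: "(\<lambda>x. skn (LEAST K. stn K (h x) (e x) (z x)) (h x) (e x) (z x)) \<in> N \<rightarrow>\<^sub>M path_space"
    by (rule measurable_compose_countable[where f="\<lambda>K x. skn K (h x) (e x) (z x)"]) measurable
  show ?thesis unfolding sk_def by measurable
qed

lemma nn_integral_seq_split:
  assumes A: "prob_space A" and F [measurable]: "F \<in> borel_measurable (PiM UNIV (\<lambda>_::nat. A))"
  shows "(\<integral>\<^sup>+e. F e \<partial>PiM UNIV (\<lambda>_. A)) = (\<integral>\<^sup>+e0. \<integral>\<^sup>+e. F (case_nat e0 e) \<partial>PiM UNIV (\<lambda>_. A) \<partial>A)"
proof -
  interpret A: prob_space A by fact
  interpret PM: prob_space "PiM UNIV (\<lambda>_::nat. A)" by (intro prob_space_PiM A)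
  interpret S: sequence_space A ..
  have "(\<integral>\<^sup>+e. F e \<partial>PiM UNIV (\<lambda>_. A)) = (\<integral>\<^sup>+e. F e \<partial>distr (A \<Otimes>\<^sub>M PiM UNIV (\<lambda>_. A)) (PiM UNIV (\<lambda>_. A)) (\<lambda>(s, \<omega>). case_nat s \<omega>))"
    by (simp only: S.PiM_iter)
  also have "\<dots> = (\<integral>\<^sup>+(s, \<omega>). F (case_nat s \<omega>) \<partial>(A \<Otimes>\<^sub>M PiM UNIV (\<lambda>_. A)))"
    by (subst nn_integral_distr) (auto simp: split_beta')
  also have "\<dots> = (\<integral>\<^sup>+e0. \<integral>\<^sup>+e. F (case_nat e0 e) \<partial>PiM UNIV (\<lambda>_. A) \<partial>A)"
    by (subst PM.nn_integral_fst[symmetric]) (auto simp: split_beta')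
  finally show ?thesis .
qed

section \<open>Kernels of the exploration and the branching property\<close>

context spindle
begin

definition "PE = PiM UNIV (\<lambda>_::nat. expo \<alpha>)"
definition "PZ = PiM UNIV (\<lambda>_::nat. Q 1)"

lemma sets_PE [measurable_cong]: "sets PE = sets SE" unfolding PE_def by (intro sets_PiM_cong) auto
lemma sets_PZ [measurable_cong]: "sets PZ = sets SP" unfolding PZ_def by (intro sets_PiM_cong) auto

lemma prob_space_PE: "prob_space PE" unfolding PE_def by (intro prob_space_PiM prob_space_expo)
lemma prob_space_PZ: "prob_space PZ" unfolding PZ_def by (intro prob_space_PiM sp.prob_space_PL)

lemma nn_integral_PE_PZ:
  assumes F [measurable]: "(\<lambda>(e, z). F e z) \<in> borel_measurable (SE \<Otimes>\<^sub>M SP)"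
  shows "(\<integral>\<^sup>+e. \<integral>\<^sup>+z. F e z \<partial>PZ \<partial>PE) =
    (\<integral>\<^sup>+e0. \<integral>\<^sup>+z0. \<integral>\<^sup>+e. \<integral>\<^sup>+z. F (case_nat e0 e) (case_nat z0 z) \<partial>PZ \<partial>PE \<partial>Q 1 \<partial>expo \<alpha>)"
proof -
  interpret E: prob_space PE by (rule prob_space_PE)
  interpret Z: prob_space PZ by (rule prob_space_PZ)
  interpret Q: prob_space "Q 1" by (rule sp.prob_space_PL)
  interpret P: pair_sigma_finite PE "Q 1" ..
  have [measurable]: "F e \<in> borel_measurable SP" for e
    using measurable_Pair2[OF F, of e] by (simp add: space_PiM)
  have m: "(\<lambda>(e0, e, z0, z). F (case_nat e0 e) (case_nat z0 z)) \<in> borel_measurable (borel \<Otimes>\<^sub>M SE \<Otimes>\<^sub>M path_space \<Otimes>\<^sub>M SP)"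
    by measurable
  note [measurable] = m
  have "(\<integral>\<^sup>+e. \<integral>\<^sup>+z. F e z \<partial>PZ \<partial>PE) = (\<integral>\<^sup>+e0. \<integral>\<^sup>+e. \<integral>\<^sup>+z. F (case_nat e0 e) z \<partial>PZ \<partial>PE \<partial>expo \<alpha>)"
    unfolding PE_def by (subst nn_integral_seq_split[OF prob_space_expo]) (auto simp flip: PE_def)
  also have "\<dots> = (\<integral>\<^sup>+e0. \<integral>\<^sup>+e. \<integral>\<^sup>+z0. \<integral>\<^sup>+z. F (case_nat e0 e) (case_nat z0 z) \<partial>PZ \<partial>Q 1 \<partial>PE \<partial>expo \<alpha>)"
    unfolding PZ_def by (subst nn_integral_seq_split[OF sp.prob_space_PL]) (auto simp flip: PZ_def)
  also have "\<dots> = (\<integral>\<^sup>+e0. \<integral>\<^sup>+z0. \<integral>\<^sup>+e. \<integral>\<^sup>+z. F (case_nat e0 e) (case_nat z0 z) \<partial>PZ \<partial>PE \<partial>Q 1 \<partial>expo \<alpha>)"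
    by (intro nn_integral_cong P.Fubini'[symmetric]) measurable
  finally show ?thesis .
qed

text \<open>Sub-probability kernels: stopping enters as a weight, because it has probability one
  only by \<open>kap_mass_1\<close>, whose proof already uses the branching property. The truncated
  kernels supply the induction and increase to \<open>kap\<close>.\<close>

definition kapn :: "nat \<Rightarrow> real \<Rightarrow> ((real \<Rightarrow> nat list) \<Rightarrow> ennreal) \<Rightarrow> ennreal" where
  "kapn K h f = (\<integral>\<^sup>+e. \<integral>\<^sup>+z. (if stn K h e z then f (sk h e z) else 0) \<partial>PZ \<partial>PE)"

definition kap :: "real \<Rightarrow> ((real \<Rightarrow> nat list) \<Rightarrow> ennreal) \<Rightarrow> ennreal" where
  "kap h f = (\<integral>\<^sup>+e. \<integral>\<^sup>+z. (if st h e z then f (sk h e z) else 0) \<partial>PZ \<partial>PE)"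

lemma sigma_finite_PE: "sigma_finite_measure PE" and sigma_finite_PZ: "sigma_finite_measure PZ"
  and sigma_finite_Q: "sigma_finite_measure (Q n)"
  using prob_space_PE prob_space_PZ sp.prob_space_PL prob_space_imp_sigma_finite by auto

lemma borel_measurable_nn_integral_PE [measurable (raw)]:
  "(\<lambda>(x, y). f x y) \<in> borel_measurable (N \<Otimes>\<^sub>M PE) \<Longrightarrow> (\<lambda>x. \<integral>\<^sup>+y. f x y \<partial>PE) \<in> borel_measurable N"
  by (rule sigma_finite_measure.borel_measurable_nn_integral[OF sigma_finite_PE])

lemma borel_measurable_nn_integral_PZ [measurable (raw)]:
  "(\<lambda>(x, y). f x y) \<in> borel_measurable (N \<Otimes>\<^sub>M PZ) \<Longrightarrow> (\<lambda>x. \<integral>\<^sup>+y. f x y \<partial>PZ) \<in> borel_measurable N"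
  by (rule sigma_finite_measure.borel_measurable_nn_integral[OF sigma_finite_PZ])

lemma borel_measurable_nn_integral_Q [measurable (raw)]:
  "(\<lambda>(x, y). f x y) \<in> borel_measurable (N \<Otimes>\<^sub>M Q n) \<Longrightarrow> (\<lambda>x. \<integral>\<^sup>+y. f x y \<partial>Q n) \<in> borel_measurable N"
  by (rule sigma_finite_measure.borel_measurable_nn_integral[OF sigma_finite_Q])

lemma measurable_kapn [measurable (raw)]:
  assumes [measurable]: "h \<in> borel_measurable N" "(\<lambda>(x, p). f x p) \<in> borel_measurable (N \<Otimes>\<^sub>M path_space)"
  shows "(\<lambda>x. kapn K (h x) (f x)) \<in> borel_measurable N"
  unfolding kapn_def by measurable

lemma measurable_kap [measurable (raw)]:
  assumes [measurable]: "h \<in> borel_measurable N" "(\<lambda>(x, p). f x p) \<in> borel_measurable (N \<Otimes>\<^sub>M path_space)"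
  shows "(\<lambda>x. kap (h x) (f x)) \<in> borel_measurable N"
  unfolding kap_def by measurable

lemma kapn_0 [simp]: "kapn 0 h f = 0"
  by (simp add: kapn_def)

end

lemma measurable_const_SE [measurable]: "(\<lambda>x. e) \<in> N \<rightarrow>\<^sub>M SE"
  by (simp add: space_PiM)

context spindle
begin

lemma measurable_if_stn:
  assumes [measurable]: "f \<in> borel_measurable path_space"
  shows "(\<lambda>z. if stn K h e z then f (sk h e z) else 0) \<in> borel_measurable PZ"
    and "(\<lambda>z. if st h e z then f (sk h e z) else 0) \<in> borel_measurable PZ"
    and "(\<lambda>e. \<integral>\<^sup>+z. (if stn K h e z then f (sk h e z) else 0) \<partial>PZ) \<in> borel_measurable PE"
    and "(\<lambda>e. \<integral>\<^sup>+z. (if st h e z then f (sk h e z) else 0) \<partial>PZ) \<in> borel_measurable PE"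
  by measurable

text \<open>Density of the topmost root birth level below h; gapr below is that of the lowest one.\<close>

definition gapd :: "real \<Rightarrow> real \<Rightarrow> ennreal" where
  "gapd h b = ennreal (\<alpha> * exp (- \<alpha> * (h - b))) * indicator {0<..<h} b"

lemma measurable_gapd [measurable (raw)]:
  assumes [measurable]: "s \<in> borel_measurable N" "b \<in> borel_measurable N"
  shows "(\<lambda>x. gapd (s x) (b x)) \<in> borel_measurable N"
proof -
  have "gapd s b = (if 0 < b \<and> b < s then ennreal (\<alpha> * exp (- \<alpha> * (s - b))) else 0)" for s b
    by (auto simp: gapd_def)
  then show ?thesis by simp
qed

text \<open>The effect of a birth at level b: the exploration resumes, by the kernel A, from the top
  of the newborn spindle, and what it finds stands to the right of that spindle.\<close>

definition brn :: "(real \<Rightarrow> ((real \<Rightarrow> nat list) \<Rightarrow> ennreal) \<Rightarrow> ennreal) \<Rightarrow> real \<Rightarrow> ((real \<Rightarrow> nat list) \<Rightarrow> ennreal) \<Rightarrow> ennreal" where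
  "brn A b f = (\<integral>\<^sup>+z. A (b + zeta z) (\<lambda>p. f (cat (jn [] b (rp z)) p)) \<partial>Q 1)"

lemma measurable_brn_kapn [measurable (raw)]:
  assumes [measurable]: "b \<in> borel_measurable N" "(\<lambda>(x, p). f x p) \<in> borel_measurable (N \<Otimes>\<^sub>M path_space)"
  shows "(\<lambda>x. brn (kapn K) (b x) (f x)) \<in> borel_measurable N"
  unfolding brn_def by measurable

lemma measurable_brn_kap [measurable (raw)]:
  assumes [measurable]: "b \<in> borel_measurable N" "(\<lambda>(x, p). f x p) \<in> borel_measurable (N \<Otimes>\<^sub>M path_space)"
  shows "(\<lambda>x. brn kap (b x) (f x)) \<in> borel_measurable N"
  unfolding brn_def by measurable

text \<open>Common core of the one-step equations of \<open>kapn\<close> and \<open>kap\<close>. S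
  is the integrand, and G b z0 is what remains of it after a first birth at level b with spindle
  z0.\<close>

lemma one_step_aux:
  assumes h: "0 \<le> h" and f [measurable]: "f \<in> borel_measurable path_space"
    and S [measurable]: "(\<lambda>(e, z). S e z) \<in> borel_measurable (SE \<Otimes>\<^sub>M SP)"
    and stop: "\<And>e z. ennreal h < e 0 \<Longrightarrow> S e z = f nil"
    and step: "\<And>e0 e z0 z. e0 < ennreal h \<Longrightarrow> S (case_nat e0 e) (case_nat z0 z) = G (h - enn2real e0) z0 e z"
    and eq: "\<And>e z. e 0 = ennreal h \<Longrightarrow> S e z = 0"
    and B: "\<And>b z0. B b z0 = (\<integral>\<^sup>+e. \<integral>\<^sup>+z. G b z0 e z \<partial>PZ \<partial>PE)"
    and mB [measurable]: "(\<lambda>b. \<integral>\<^sup>+z0. B b z0 \<partial>Q 1) \<in> borel_measurable borel"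
  shows "(\<integral>\<^sup>+e. \<integral>\<^sup>+z. S e z \<partial>PZ \<partial>PE) = ennreal (exp (- \<alpha> * h)) * f nil + (\<integral>\<^sup>+b. gapd h b * (\<integral>\<^sup>+z0. B b z0 \<partial>Q 1) \<partial>lborel)"
proof -
  interpret E: prob_space PE by (rule prob_space_PE)
  interpret Z: prob_space PZ by (rule prob_space_PZ)
  interpret Q: prob_space "Q 1" by (rule sp.prob_space_PL)
  have "(\<integral>\<^sup>+e. \<integral>\<^sup>+z. S e z \<partial>PZ \<partial>PE) =
    (\<integral>\<^sup>+e0. \<integral>\<^sup>+z0. \<integral>\<^sup>+e. \<integral>\<^sup>+z. S (case_nat e0 e) (case_nat z0 z) \<partial>PZ \<partial>PE \<partial>Q 1 \<partial>expo \<alpha>)"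
    by (rule nn_integral_PE_PZ) measurable
  also have "\<dots> = (\<integral>\<^sup>+e0. (if ennreal h < e0 then f nil else if e0 < ennreal h then
      (\<lambda>x. \<integral>\<^sup>+z0. B (h - x) z0 \<partial>Q 1) (enn2real e0) else 0) \<partial>expo \<alpha>)"
  proof (intro nn_integral_cong)
    fix e0 :: ennreal
    consider "ennreal h < e0" | "e0 < ennreal h" | "e0 = ennreal h" by (cases e0 "ennreal h" rule: linorder_cases)
    then show "(\<integral>\<^sup>+z0. \<integral>\<^sup>+e. \<integral>\<^sup>+z. S (case_nat e0 e) (case_nat z0 z) \<partial>PZ \<partial>PE \<partial>Q 1) =
      (if ennreal h < e0 then f nil else if e0 < ennreal h then
      (\<lambda>x. \<integral>\<^sup>+z0. B (h - x) z0 \<partial>Q 1) (enn2real e0) else 0)"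
    proof cases
      case 1
      then show ?thesis using E.emeasure_space_1 Z.emeasure_space_1 Q.emeasure_space_1
        by (simp add: stop)
    next
      case 2
      have "(\<integral>\<^sup>+z0. \<integral>\<^sup>+e. \<integral>\<^sup>+z. S (case_nat e0 e) (case_nat z0 z) \<partial>PZ \<partial>PE \<partial>Q 1) = (\<integral>\<^sup>+z0. B (h - enn2real e0) z0 \<partial>Q 1)"
        by (intro nn_integral_cong) (simp add: step[OF 2] B)
      then show ?thesis using 2 by (auto dest: less_asym)
    next
      case 3
      then show ?thesis by (simp add: eq)
    qed
  qed
  also have "\<dots> = ennreal (exp (- \<alpha> * h)) * f nil + (\<integral>\<^sup>+b. gapd h b * (\<integral>\<^sup>+z0. B b z0 \<partial>Q 1) \<partial>lborel)"
  proof -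
    have "(\<lambda>x. \<integral>\<^sup>+z0. B (h - x) z0 \<partial>Q 1) \<in> borel_measurable borel"
      by (rule measurable_compose[OF _ mB]) measurable
    from nn_integral_expo_split[OF \<alpha>0 h this, of "f nil"] show ?thesis by (simp add: gapd_def)
  qed
  finally show ?thesis .
qed

lemma measurable_brn_aux [measurable]:
  assumes [measurable]: "f \<in> borel_measurable path_space"
  shows "(\<lambda>b. brn (kapn K) b f) \<in> borel_measurable borel" "(\<lambda>b. brn kap b f) \<in> borel_measurable borel"
  by measurable

lemma kapn_Suc:
  assumes h: "0 \<le> h" and f [measurable]: "f \<in> borel_measurable path_space"
  shows "kapn (Suc K) h f = ennreal (exp (- \<alpha> * h)) * f nil + (\<integral>\<^sup>+b. gapd h b * brn (kapn K) b f \<partial>lborel)"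
  unfolding brn_def kapn_def[of "Suc K"]
proof (rule one_step_aux[OF h f])
  show "(\<lambda>(e, z). if stn (Suc K) h e z then f (sk h e z) else 0) \<in> borel_measurable (SE \<Otimes>\<^sub>M SP)"
    by measurable
  show "(if stn (Suc K) h e z then f (sk h e z) else 0) = f nil" if "ennreal h < e 0" for e z
    using that st_sk_stop[of h e z] by simp
  show "(if stn (Suc K) h e z then f (sk h e z) else 0) = 0" if "e 0 = ennreal h" for e z
    using that by simp
  show "kapn K (b + zeta z0) (\<lambda>p. f (cat (jn [] b (rp z0)) p)) =
    (\<integral>\<^sup>+e. \<integral>\<^sup>+z. (if stn K (b + zeta z0) e z then f (cat (jn [] b (rp z0)) (sk (b + zeta z0) e z)) else 0) \<partial>PZ \<partial>PE)" for b z0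
    unfolding kapn_def ..
  show "(if stn (Suc K) h (case_nat e0 e) (case_nat z0 z) then f (sk h (case_nat e0 e) (case_nat z0 z)) else 0) =
    (if stn K (h - enn2real e0 + zeta z0) e z then f (cat (jn [] (h - enn2real e0) (rp z0)) (sk (h - enn2real e0 + zeta z0) e z)) else 0)"
    if "e0 < ennreal h" for e0 e z0 z
  proof (cases "stn K (h - enn2real e0 + zeta z0) e z")
    case True
    then have "stn (Suc K) h (case_nat e0 e) (case_nat z0 z)" using that by simp
    moreover from this have "st h (case_nat e0 e) (case_nat z0 z)" unfolding st_def by blast
    ultimately show ?thesis using st_sk_step(2)[of "case_nat e0 e" h "case_nat z0 z"] that True by simp
  qed (use that in auto)
  show "(\<lambda>b. \<integral>\<^sup>+z0. kapn K (b + zeta z0) (\<lambda>p. f (cat (jn [] b (rp z0)) p)) \<partial>Q 1) \<in> borel_measurable borel"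
    using measurable_brn_aux(1)[OF f, of K] unfolding brn_def .
qed

lemma kap_step:
  assumes h: "0 \<le> h" and f [measurable]: "f \<in> borel_measurable path_space"
  shows "kap h f = ennreal (exp (- \<alpha> * h)) * f nil + (\<integral>\<^sup>+b. gapd h b * brn kap b f \<partial>lborel)"
  unfolding brn_def kap_def[of h]
proof (rule one_step_aux[OF h f])
  show "(\<lambda>(e, z). if st h e z then f (sk h e z) else 0) \<in> borel_measurable (SE \<Otimes>\<^sub>M SP)"
    by measurable
  show "(if st h e z then f (sk h e z) else 0) = f nil" if "ennreal h < e 0" for e z
    using that st_sk_stop[of h e z] by simp
  show "(if st h e z then f (sk h e z) else 0) = 0" if "e 0 = ennreal h" for e z
  proof -
    have "\<not> stn K h e z" for K using that by (cases K) auto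
    then show ?thesis by (simp add: st_def)
  qed
  show "kap (b + zeta z0) (\<lambda>p. f (cat (jn [] b (rp z0)) p)) =
    (\<integral>\<^sup>+e. \<integral>\<^sup>+z. (if st (b + zeta z0) e z then f (cat (jn [] b (rp z0)) (sk (b + zeta z0) e z)) else 0) \<partial>PZ \<partial>PE)" for b z0
    unfolding kap_def ..
  show "(if st h (case_nat e0 e) (case_nat z0 z) then f (sk h (case_nat e0 e) (case_nat z0 z)) else 0) =
    (if st (h - enn2real e0 + zeta z0) e z then f (cat (jn [] (h - enn2real e0) (rp z0)) (sk (h - enn2real e0 + zeta z0) e z)) else 0)"
    if "e0 < ennreal h" for e0 e z0 z
    using st_sk_step[of "case_nat e0 e" h "case_nat z0 z"] that by simp
  show "(\<lambda>b. \<integral>\<^sup>+z0. kap (b + zeta z0) (\<lambda>p. f (cat (jn [] b (rp z0)) p)) \<partial>Q 1) \<in> borel_measurable borel"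
    using measurable_brn_aux(2)[OF f] unfolding brn_def .
qed

lemma kap_mono_f: "(\<And>p. f p \<le> g p) \<Longrightarrow> kap h f \<le> kap h g"
  unfolding kap_def by (intro nn_integral_mono) auto

lemma kapn_le_Suc: "kapn K h f \<le> kapn (Suc K) h f"
  unfolding kapn_def by (intro nn_integral_mono) (auto dest: stn_Suc_mono simp del: stn.simps)

lemma kapn_le_kap: "kapn K h f \<le> kap h f"
  unfolding kapn_def kap_def by (intro nn_integral_mono) (auto simp: st_def)

lemma kap_SUP:
  assumes [measurable]: "f \<in> borel_measurable path_space"
  shows "kap h f = (SUP K. kapn K h f)"
proof -
  have pt: "(if st h e z then f (sk h e z) else 0) = (SUP K. if stn K h e z then f (sk h e z) else 0)" for e z
  proof (cases "st h e z")
    case True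
    then obtain K where "stn K h e z" by (auto simp: st_def)
    then show ?thesis using True by (intro antisym SUP_upper2[of K] SUP_least) auto
  next
    case False
    then show ?thesis by (auto simp: st_def)
  qed
  have inc: "incseq (\<lambda>K z. if stn K h e z then f (sk h e z) else 0)" for e
    by (intro incseq_SucI le_funI) (auto dest: stn_Suc_mono simp del: stn.simps)
  have "kap h f = (\<integral>\<^sup>+e. (SUP K. \<integral>\<^sup>+z. (if stn K h e z then f (sk h e z) else 0) \<partial>PZ) \<partial>PE)"
    unfolding kap_def pt
    by (intro nn_integral_cong nn_integral_monotone_convergence_SUP inc measurable_if_stn assms)
  also have "\<dots> = (SUP K. kapn K h f)" unfolding kapn_def
    by (intro nn_integral_monotone_convergence_SUP measurable_if_stn assms)
       (auto intro!: incseq_SucI le_funI nn_integral_mono dest: stn_Suc_mono simp del: stn.simps)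
  finally show ?thesis .
qed

text \<open>Memorylessness of the gap: the first birth below s + h lies above s, or the upper part
  of length h is passed with probability exp(-\<alpha> h) and the search starts afresh at s.\<close>

lemma gapd_split: "0 \<le> s \<Longrightarrow> 0 \<le> h \<Longrightarrow> b \<noteq> s \<Longrightarrow>
  gapd (s + h) b = ennreal (exp (- \<alpha> * h)) * gapd s b + gapd h (b - s)"
proof -
  assume "0 \<le> s" "0 \<le> h" "b \<noteq> s"
  moreover have "\<alpha> * exp (- \<alpha> * (s + h - b)) = exp (- \<alpha> * h) * (\<alpha> * exp (- \<alpha> * (s - b)))"
    by (simp add: exp_add[symmetric] algebra_simps)
  moreover have "h - (b - s) = s + h - b" by simp
  ultimately show ?thesis using \<alpha>0
    by (cases "b < s") (auto simp: gapd_def indicator_def ennreal_mult[symmetric])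
qed

text \<open>Turns a one-step equation from height s + h into one that stops at level s, where A s
  takes over. Abstract in A and B since it serves both \<open>kapn\<close> and
  \<open>kap\<close>.\<close>

lemma step_split:
  assumes A: "\<And>h. 0 \<le> h \<Longrightarrow> A h f = ennreal (exp (- \<alpha> * h)) * f nil + (\<integral>\<^sup>+b. gapd h b * B b \<partial>lborel)"
    and [measurable]: "B \<in> borel_measurable borel" and s: "0 \<le> s" and h: "0 \<le> h"
  shows "A (s + h) f = ennreal (exp (- \<alpha> * h)) * A s f + (\<integral>\<^sup>+b. gapd h b * B (s + b) \<partial>lborel)"
proof -
  have "(\<integral>\<^sup>+b. gapd (s + h) b * B b \<partial>lborel) = (\<integral>\<^sup>+b. ennreal (exp (- \<alpha> * h)) * (gapd s b * B b) + gapd h (b - s) * B b \<partial>lborel)"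
    by (rule nn_integral_cong_AE, use AE_lborel_singleton[of s] in eventually_elim)
       (simp add: gapd_split s h distrib_right mult.assoc)
  also have "\<dots> = ennreal (exp (- \<alpha> * h)) * (\<integral>\<^sup>+b. gapd s b * B b \<partial>lborel) + (\<integral>\<^sup>+b. gapd h (b - s) * B b \<partial>lborel)"
    by (subst nn_integral_add) (auto simp: nn_integral_cmult)
  also have "(\<integral>\<^sup>+b. gapd h (b - s) * B b \<partial>lborel) = (\<integral>\<^sup>+b. gapd h b * B (s + b) \<partial>lborel)"
    by (subst nn_integral_real_affine[where c=1 and t=s]) auto
  finally have "A (s + h) f = ennreal (exp (- \<alpha> * (s + h))) * f nil +
    (ennreal (exp (- \<alpha> * h)) * (\<integral>\<^sup>+b. gapd s b * B b \<partial>lborel) + (\<integral>\<^sup>+b. gapd h b * B (s + b) \<partial>lborel))"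
    using A[of "s + h"] s h by simp
  moreover have "ennreal (exp (- \<alpha> * (s + h))) = ennreal (exp (- \<alpha> * h)) * ennreal (exp (- \<alpha> * s))"
    by (simp add: ennreal_mult[symmetric] exp_add[symmetric] algebra_simps)
  ultimately show ?thesis using A[OF s] by (simp add: distrib_left mult.assoc add.assoc)
qed

lemma kap_mass_le_1: "kap h (\<lambda>_. 1) \<le> 1"
proof -
  interpret E: prob_space PE by (rule prob_space_PE)
  interpret Z: prob_space PZ by (rule prob_space_PZ)
  have "kap h (\<lambda>_. 1) \<le> (\<integral>\<^sup>+e. \<integral>\<^sup>+z. 1 \<partial>PZ \<partial>PE)" unfolding kap_def by (intro nn_integral_mono) auto
  then show ?thesis using E.emeasure_space_1 Z.emeasure_space_1 by simp
qed

text \<open>Level bookkeeping: a birth at level s + b is a birth at level b relative to s, so it can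
  be absorbed into the part of the forest that is raised by s.\<close>

lemma cat_up: "0 \<le> b \<Longrightarrow> cat (jn [] (s + b) r) (cat (jn [] s p) q) = cat (jn [] s (cat (jn [] b r) p)) q"
proof -
  assume "0 \<le> b"
  then have "jn [] (s + b) r = jn [] s (jn [] b r)" by (simp add: jn_jn)
  then show ?thesis by (simp add: cat_assoc[symmetric] cat_jn)
qed

text \<open>Stopping after few births overall implies few births in the part below s, but the number
  used above s is random. Truncation levels therefore do not match, and only inequalities hold
  before the limit.\<close>

lemma kapn_branch_le:
  assumes "0 \<le> s" "0 \<le> h" and f [measurable]: "f \<in> borel_measurable path_space"
  shows "kapn K (s + h) f \<le> kap h (\<lambda>p. kapn K s (\<lambda>q. f (cat (jn [] s p) q)))"
  using assms(2,3)
proof (induction K arbitrary: h f)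
  case (Suc K)
  note [measurable] = Suc.prems(2)
  let ?G = "\<lambda>p. kapn (Suc K) s (\<lambda>q. f (cat (jn [] s p) q))"
  have "kapn (Suc K) (s + h) f = ennreal (exp (- \<alpha> * h)) * kapn (Suc K) s f + (\<integral>\<^sup>+b. gapd h b * brn (kapn K) (s + b) f \<partial>lborel)"
    by (rule step_split[where B="\<lambda>b. brn (kapn K) b f"]) (use kapn_Suc assms Suc.prems in auto)
  also have "\<dots> \<le> ennreal (exp (- \<alpha> * h)) * ?G nil + (\<integral>\<^sup>+b. gapd h b * brn kap b ?G \<partial>lborel)"
  proof (intro add_mono nn_integral_mono)
    show "ennreal (exp (- \<alpha> * h)) * kapn (Suc K) s f \<le> ennreal (exp (- \<alpha> * h)) * ?G nil" by simp
    fix b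
    show "gapd h b * brn (kapn K) (s + b) f \<le> gapd h b * brn kap b ?G"
    proof (cases "0 < b")
      case True
      have "brn (kapn K) (s + b) f \<le> brn kap b ?G"
        unfolding brn_def
      proof (rule nn_integral_mono)
        fix z assume "z \<in> space (Q 1)"
        then have [simp]: "rc z" by simp
        have m [measurable]: "(\<lambda>p. f (cat (jn [] (s + b) (rp z)) p)) \<in> borel_measurable path_space"
          by measurable
        have "kapn K (s + b + zeta z) (\<lambda>p. f (cat (jn [] (s + b) (rp z)) p)) \<le>
          kap (b + zeta z) (\<lambda>p. kapn K s (\<lambda>q. f (cat (jn [] (s + b) (rp z)) (cat (jn [] s p) q))))"
          using Suc.IH[of "b + zeta z", OF _ m] True by (simp add: add.assoc)
        also have "\<dots> \<le> kap (b + zeta z) (\<lambda>p. kapn (Suc K) s (\<lambda>q. f (cat (jn [] (s + b) (rp z)) (cat (jn [] s p) q))))"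
          by (intro kap_mono_f kapn_le_Suc)
        finally show "kapn K (s + b + zeta z) (\<lambda>p. f (cat (jn [] (s + b) (rp z)) p)) \<le>
          kap (b + zeta z) (\<lambda>p. ?G (cat (jn [] b (rp z)) p))"
          using True by (simp add: cat_up)
      qed
      then show ?thesis by (intro mult_left_mono) auto
    qed (simp add: gapd_def)
  qed
  also have "\<dots> = kap h ?G" by (rule kap_step[symmetric]) (use Suc.prems in measurable)
  finally show ?case .
qed simp

text \<open>The converse half: here the truncation is on the part above s, again by induction over
  the first birth, with a fresh descent from s if there is none above s.\<close>

lemma kap_branch_ge:
  assumes "0 \<le> s" "0 \<le> h" and f [measurable]: "f \<in> borel_measurable path_space"
  shows "kapn K h (\<lambda>p. kap s (\<lambda>q. f (cat (jn [] s p) q))) \<le> kap (s + h) f"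
  using assms(2,3)
proof (induction K arbitrary: h f)
  case (Suc K)
  note [measurable] = Suc.prems(2)
  let ?G = "\<lambda>p. kap s (\<lambda>q. f (cat (jn [] s p) q))"
  have "kapn (Suc K) h ?G = ennreal (exp (- \<alpha> * h)) * ?G nil + (\<integral>\<^sup>+b. gapd h b * brn (kapn K) b ?G \<partial>lborel)"
    by (rule kapn_Suc) (use Suc.prems in measurable)
  also have "\<dots> \<le> ennreal (exp (- \<alpha> * h)) * kap s f + (\<integral>\<^sup>+b. gapd h b * brn kap (s + b) f \<partial>lborel)"
  proof (intro add_mono nn_integral_mono)
    show "ennreal (exp (- \<alpha> * h)) * ?G nil \<le> ennreal (exp (- \<alpha> * h)) * kap s f" by simp
    fix b
    show "gapd h b * brn (kapn K) b ?G \<le> gapd h b * brn kap (s + b) f"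
    proof (cases "0 < b")
      case True
      have "brn (kapn K) b ?G \<le> brn kap (s + b) f"
        unfolding brn_def
      proof (rule nn_integral_mono)
        fix z assume "z \<in> space (Q 1)"
        then have [simp]: "rc z" by simp
        have m [measurable]: "(\<lambda>p. f (cat (jn [] (s + b) (rp z)) p)) \<in> borel_measurable path_space"
          by measurable
        have "kapn K (b + zeta z) (\<lambda>p. ?G (cat (jn [] b (rp z)) p)) =
          kapn K (b + zeta z) (\<lambda>p. kap s (\<lambda>q. f (cat (jn [] (s + b) (rp z)) (cat (jn [] s p) q))))"
          using True by (simp add: cat_up)
        also have "\<dots> \<le> kap (s + (b + zeta z)) (\<lambda>p. f (cat (jn [] (s + b) (rp z)) p))"
          using Suc.IH[of "b + zeta z", OF _ m] True by simp
        finally show "kapn K (b + zeta z) (\<lambda>p. ?G (cat (jn [] b (rp z)) p)) \<le>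
          kap (s + b + zeta z) (\<lambda>p. f (cat (jn [] (s + b) (rp z)) p))"
          by (simp add: add.assoc)
      qed
      then show ?thesis by (intro mult_left_mono) auto
    qed (simp add: gapd_def)
  qed
  also have "\<dots> = kap (s + h) f"
    by (rule step_split[symmetric, where B="\<lambda>b. brn kap b f"]) (use kap_step assms Suc.prems in auto)
  finally show ?case .
qed simp

text \<open>The branching property. All that descends from births between s and s + h is explored
  first and stands left of the independent exploration that continues from s.\<close>

lemma kap_branch:
  assumes "0 \<le> s" "0 \<le> h" and f [measurable]: "f \<in> borel_measurable path_space"
  shows "kap (s + h) f = kap h (\<lambda>p. kap s (\<lambda>q. f (cat (jn [] s p) q)))"
proof (rule antisym)
  show "kap (s + h) f \<le> kap h (\<lambda>p. kap s (\<lambda>q. f (cat (jn [] s p) q)))"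
    unfolding kap_SUP[OF f, of "s + h"]
    by (intro SUP_least order_trans[OF kapn_branch_le[OF assms]] kap_mono_f kapn_le_kap)
  have m: "(\<lambda>p. kap s (\<lambda>q. f (cat (jn [] s p) q))) \<in> borel_measurable path_space" by measurable
  show "kap h (\<lambda>p. kap s (\<lambda>q. f (cat (jn [] s p) q))) \<le> kap (s + h) f"
    unfolding kap_SUP[OF m, of h] by (intro SUP_least kap_branch_ge assms)
qed

lemma kap_const: "kap h (\<lambda>_. c) = c * kap h (\<lambda>_. 1)"
proof -
  have "(if st h e z then c else 0) = c * (if st h e z then 1 else 0)" for e z by simp
  then have "kap h (\<lambda>_. c) = (\<integral>\<^sup>+e. \<integral>\<^sup>+z. c * (if st h e z then 1 else 0) \<partial>PZ \<partial>PE)" unfolding kap_def by simp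
  also have "\<dots> = (\<integral>\<^sup>+e. c * (\<integral>\<^sup>+z. (if st h e z then 1 else 0) \<partial>PZ) \<partial>PE)"
    by (intro nn_integral_cong nn_integral_cmult measurable_if_stn(2)[of "\<lambda>_. 1"]) simp
  also have "\<dots> = c * kap h (\<lambda>_. 1)" unfolding kap_def
    by (intro nn_integral_cmult measurable_if_stn(4)[of "\<lambda>_. 1"]) simp
  finally show ?thesis .
qed

lemma kap_mass_1:
  assumes h: "0 \<le> h" shows "kap h (\<lambda>_. 1) = 1"
proof -
  interpret Q: prob_space "Q 1" by (rule sp.prob_space_PL)
  define u where "u s = kap s (\<lambda>_. 1)" for s
  have u_mult: "u (s + t) = u s * u t" if "0 \<le> s" "0 \<le> t" for s t
    using kap_branch[OF that, of "\<lambda>_. 1"] kap_const[of t "kap s (\<lambda>_. 1)"] by (simp add: u_def)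
  have [measurable]: "u \<in> borel_measurable borel" unfolding u_def[abs_def] by measurable
  have u1: "u s \<le> 1" for s unfolding u_def by (rule kap_mass_le_1)
  \<comment> \<open>The probability that the exploration below one whole spindle of law
    \<open>Q 1\<close> stops.\<close>
  define qq where "qq = (\<integral>\<^sup>+z. u (zeta z) \<partial>Q 1)"
  have "qq \<le> (\<integral>\<^sup>+z. 1 \<partial>Q 1)" unfolding qq_def by (intro nn_integral_mono u1)
  then have "qq \<le> 1" using Q.emeasure_space_1 by simp
  then obtain q where q: "qq = ennreal q" "0 \<le> q" "q \<le> 1"
    by (cases qq) (auto simp: top_unique)
  have step: "u s = ennreal (exp (- \<alpha> * s)) + (\<integral>\<^sup>+b. gapd s b * (u b * qq) \<partial>lborel)" if s: "0 \<le> s" for s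
  proof -
    have "brn kap b (\<lambda>_. 1) = u b * qq" if "0 < b" for b
    proof -
      have "brn kap b (\<lambda>_. 1) = (\<integral>\<^sup>+z. u b * u (zeta z) \<partial>Q 1)"
        unfolding brn_def u_def[symmetric] using that by (intro nn_integral_cong u_mult) auto
      then show ?thesis unfolding qq_def by (simp add: nn_integral_cmult)
    qed
    then have "gapd s b * brn kap b (\<lambda>_. 1) = gapd s b * (u b * qq)" for b
      by (cases "0 < b") (auto simp: gapd_def)
    then show ?thesis using kap_step[OF s, of "\<lambda>_. 1"] by (simp add: u_def)
  qed
  have u_ge0: "ennreal (exp (- \<alpha> * s)) \<le> u s" if "0 \<le> s" for s
    using step[OF that] by (metis le_iff_add)
  \<comment> \<open>Only explorations with at most one root birth are kept: no birth, or one birth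
    whose clade stops with probability q, followed by none.\<close>
  have u_ge: "ennreal (exp (- \<alpha> * s) * (1 + \<alpha> * q * s)) \<le> u s" if s: "0 \<le> s" for s
  proof -
    have "ennreal (\<alpha> * q * s * exp (- \<alpha> * s)) = (\<integral>\<^sup>+b. ennreal (\<alpha> * q * exp (- \<alpha> * s)) * indicator {0<..<s} b \<partial>lborel)"
      using s \<alpha>0 q by (subst nn_integral_cmult_indicator) (auto simp: ennreal_mult[symmetric] ac_simps)
    also have "\<dots> \<le> (\<integral>\<^sup>+b. gapd s b * (u b * qq) \<partial>lborel)"
    proof (rule nn_integral_mono)
      fix b
      show "ennreal (\<alpha> * q * exp (- \<alpha> * s)) * indicator {0<..<s} b \<le> gapd s b * (u b * qq)"
      proof (cases "0 < b \<and> b < s")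
        case True
        have "ennreal (\<alpha> * q * exp (- \<alpha> * s)) = ennreal (\<alpha> * exp (- \<alpha> * (s - b))) * (ennreal (exp (- \<alpha> * b)) * ennreal q)"
          using \<alpha>0 q by (simp add: ennreal_mult[symmetric] exp_add[symmetric] algebra_simps)
        also have "\<dots> \<le> ennreal (\<alpha> * exp (- \<alpha> * (s - b))) * (u b * ennreal q)"
          using True by (intro mult_left_mono mult_right_mono u_ge0) auto
        finally show ?thesis using True by (simp add: gapd_def q)
      qed (auto simp: indicator_def)
    qed
    finally have "ennreal (exp (- \<alpha> * s)) + ennreal (\<alpha> * q * s * exp (- \<alpha> * s)) \<le> u s"
      unfolding step[OF s] by (intro add_left_mono)
    then show ?thesis using s \<alpha>0 q by (simp add: ennreal_plus[symmetric] algebra_simps del: ennreal_plus)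
  qed
  \<comment> \<open>By multiplicativity the bound can be used on n pieces of length s / n; the n-th
    power of 1 + \<alpha> q s / n tends to exp(\<alpha> q s).\<close>
  have u_exp: "ennreal (exp (- \<alpha> * (1 - q) * s)) \<le> u s" if s: "0 \<le> s" for s
  proof (rule LIMSEQ_le_const2)
    show "(\<lambda>n. ennreal (exp (- \<alpha> * s) * (1 + (\<alpha> * q * s) / real n) ^ n)) \<longlonglongrightarrow> ennreal (exp (- \<alpha> * (1 - q) * s))"
    proof -
      have "(\<lambda>n. exp (- \<alpha> * s) * (1 + (\<alpha> * q * s) / real n) ^ n) \<longlonglongrightarrow> exp (- \<alpha> * s) * exp (\<alpha> * q * s)"
        by (intro tendsto_mult tendsto_const tendsto_exp_limit_sequentially)
      also have "exp (- \<alpha> * s) * exp (\<alpha> * q * s) = exp (- \<alpha> * (1 - q) * s)"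
        by (simp add: exp_add[symmetric] algebra_simps)
      finally show ?thesis by (rule tendsto_ennrealI)
    qed
    show "\<exists>N. \<forall>n\<ge>N. ennreal (exp (- \<alpha> * s) * (1 + (\<alpha> * q * s) / real n) ^ n) \<le> u s"
    proof (intro exI[of _ 1] allI impI)
      fix n :: nat assume n: "1 \<le> n"
      have pow: "u (real k * (s / real n)) \<ge> ennreal ((exp (- \<alpha> * (s / real n)) * (1 + \<alpha> * q * (s / real n))) ^ k)" for k
      proof (induction k)
        case 0
        then show ?case using u_ge0[of 0] by simp
      next
        case (Suc k)
        have "u (real (Suc k) * (s / real n)) = u (s / real n) * u (real k * (s / real n))"
          using u_mult[of "s / real n" "real k * (s / real n)"] s by (simp add: algebra_simps add_divide_distrib)
        moreover have "ennreal ((exp (- \<alpha> * (s / real n)) * (1 + \<alpha> * q * (s / real n))) ^ Suc k) =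
          ennreal (exp (- \<alpha> * (s / real n)) * (1 + \<alpha> * q * (s / real n))) * ennreal ((exp (- \<alpha> * (s / real n)) * (1 + \<alpha> * q * (s / real n))) ^ k)"
          using s \<alpha>0 q by (subst ennreal_mult[symmetric]) auto
        ultimately show ?case using Suc u_ge[of "s / real n"] s by (simp only:) (intro mult_mono, auto)
      qed
      have "(exp (- \<alpha> * (s / real n)) * (1 + \<alpha> * q * (s / real n))) ^ n = exp (- \<alpha> * s) * (1 + (\<alpha> * q * s) / real n) ^ n"
        using n by (simp add: power_mult_distrib exp_of_nat_mult[symmetric])
      then show "ennreal (exp (- \<alpha> * s) * (1 + (\<alpha> * q * s) / real n) ^ n) \<le> u s"
        using pow[of n] n by simp
    qed
  qed
  have "q = 1 \<or> \<alpha> = 0"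
  proof (rule ccontr)
    assume "\<not> (q = 1 \<or> \<alpha> = 0)"
    then have a: "0 < \<alpha>" "q < 1" using \<alpha>0 q by auto
    \<comment> \<open>The exponent for which \<open>u_exp\<close> gives q \<ge> E exp(-x zeta), and
      for which the strict bound of \<open>Q_laplace_gt\<close> reads E exp(-x zeta) > q.\<close>
    define x where "x = \<alpha> * (1 - q)"
    have x: "0 < x" "x \<le> \<alpha>" "1 - x / \<alpha> = q" using a q by (auto simp: x_def field_simps)
    have "ennreal q < (\<integral>\<^sup>+z. ennreal (exp (- x * zeta z)) \<partial>Q 1)"
      using Q_laplace_gt[OF a(1) x(1,2)] x(3) by simp
    also have "\<dots> \<le> qq" unfolding qq_def
      by (intro nn_integral_mono) (use u_exp in \<open>simp add: x_def\<close>)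
    finally show False using q by simp
  qed
  then have "ennreal (exp 0) \<le> u h" using u_exp[OF h] by auto
  then show ?thesis using u1[of h] by (simp add: u_def antisym)
qed

end

lemma nn_integral_translate:
  "F \<in> borel_measurable borel \<Longrightarrow> (\<integral>\<^sup>+x. F x \<partial>lborel) = (\<integral>\<^sup>+u. F (t + u) \<partial>lborel)" for t :: real
  using nn_integral_real_affine[of F 1 t] by simp

lemma rc_skn: "(\<And>i. rc (z i)) \<Longrightarrow> rc (skn K h e z)"
  by (induction K arbitrary: h e z) auto

section \<open>Laws of clades and the lowest root birth\<close>

context spindle
begin

lemma rc_sk_PZ: "z \<in> space PZ \<Longrightarrow> rc (sk h e z)"
  by (auto simp: sk_def PZ_def space_PiM PiE_iff intro!: rc_skn)

lemma not_st_mass: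
  assumes "0 \<le> h" shows "(\<integral>\<^sup>+e. \<integral>\<^sup>+z. (if st h e z then 0 else 1) \<partial>PZ \<partial>PE) = 0"
proof -
  interpret E: prob_space PE by (rule prob_space_PE)
  interpret Z: prob_space PZ by (rule prob_space_PZ)
  have m: "(\<lambda>z. if st h e z then 1 else 0 :: ennreal) \<in> borel_measurable PZ"
    "(\<lambda>z. if st h e z then 0 else 1 :: ennreal) \<in> borel_measurable PZ"
    "(\<lambda>e. \<integral>\<^sup>+z. (if st h e z then 1 else 0) \<partial>PZ) \<in> borel_measurable PE"
    "(\<lambda>e. \<integral>\<^sup>+z. (if st h e z then 0 else 1) \<partial>PZ) \<in> borel_measurable PE" for e
    by measurable
  have "1 = (\<integral>\<^sup>+e. \<integral>\<^sup>+z. 1 \<partial>PZ \<partial>PE)" using E.emeasure_space_1 Z.emeasure_space_1 by simp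
  also have "\<dots> = (\<integral>\<^sup>+e. \<integral>\<^sup>+z. (if st h e z then 1 else 0) + (if st h e z then 0 else 1) \<partial>PZ \<partial>PE)"
    by (intro nn_integral_cong) simp
  also have "\<dots> = (\<integral>\<^sup>+e. (\<integral>\<^sup>+z. (if st h e z then 1 else 0) \<partial>PZ) + (\<integral>\<^sup>+z. (if st h e z then 0 else 1) \<partial>PZ) \<partial>PE)"
    by (intro nn_integral_cong nn_integral_add m)
  also have "\<dots> = kap h (\<lambda>_. 1) + (\<integral>\<^sup>+e. \<integral>\<^sup>+z. (if st h e z then 0 else 1) \<partial>PZ \<partial>PE)"
    unfolding kap_def by (intro nn_integral_add m)
  finally have "1 + 0 = 1 + (\<integral>\<^sup>+e. \<integral>\<^sup>+z. (if st h e z then 0 else 1 :: ennreal) \<partial>PZ \<partial>PE)"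
    unfolding kap_mass_1[OF assms] by simp
  then show ?thesis unfolding ennreal_add_left_cancel by simp
qed

lemma kap_eq:
  assumes h: "0 \<le> h" and f [measurable]: "f \<in> borel_measurable path_space"
  shows "kap h f = (\<integral>\<^sup>+e. \<integral>\<^sup>+z. f (sk h e z) \<partial>PZ \<partial>PE)"
proof -
  have [measurable]: "(\<lambda>z. if st h e z then 0 else c) \<in> borel_measurable PZ"
    "(\<lambda>e. \<integral>\<^sup>+z. (if st h e z then 0 else c) \<partial>PZ) \<in> borel_measurable PE" for e and c :: ennreal
    by measurable
  have [measurable]: "(\<lambda>z. if st h e z then f (sk h e z) else 0) \<in> borel_measurable PZ"
    "(\<lambda>e. \<integral>\<^sup>+z. (if st h e z then f (sk h e z) else 0) \<partial>PZ) \<in> borel_measurable PE" for e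
    using measurable_if_stn(2,4)[OF f] by blast+
  have "(\<integral>\<^sup>+e. \<integral>\<^sup>+z. f (sk h e z) \<partial>PZ \<partial>PE) =
    (\<integral>\<^sup>+e. \<integral>\<^sup>+z. (if st h e z then f (sk h e z) else 0) + f nil * (if st h e z then 0 else 1) \<partial>PZ \<partial>PE)"
    by (intro nn_integral_cong) (auto simp: sk_def)
  also have "\<dots> = kap h f + f nil * (\<integral>\<^sup>+e. \<integral>\<^sup>+z. (if st h e z then 0 else 1) \<partial>PZ \<partial>PE)"
    unfolding kap_def by (simp add: nn_integral_add nn_integral_cmult)
  finally show ?thesis by (simp add: not_st_mass[OF h])
qed

lemma AE_st: assumes "0 \<le> h" shows "AE e in PE. AE z in PZ. st h e z"
proof -
  have [measurable]: "(\<lambda>z. if st h e z then 0 else c) \<in> borel_measurable PZ"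
    "(\<lambda>e. \<integral>\<^sup>+z. (if st h e z then 0 else c) \<partial>PZ) \<in> borel_measurable PE" for e and c :: ennreal
    by measurable
  have "(\<integral>\<^sup>+e. \<integral>\<^sup>+z. (if st h e z then 0 else 1) \<partial>PZ \<partial>PE) = 0" by (rule not_st_mass) fact
  then have "AE e in PE. (\<integral>\<^sup>+z. (if st h e z then 0 else 1) \<partial>PZ) = 0"
    by (subst (asm) nn_integral_0_iff_AE) auto
  then show ?thesis
  proof eventually_elim
    case (elim e)
    then have "AE z in PZ. (if st h e z then 0 else 1) = (0::ennreal)"
      by (subst (asm) nn_integral_0_iff_AE) auto
    then show ?case by eventually_elim (auto split: if_splits)
  qed
qed

text \<open>The law of the skewer under the marked path law with n individuals at the root: the root
  spindle stands leftmost, and the exploration starts from its top.\<close>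

definition cl :: "nat \<Rightarrow> (real \<Rightarrow> nat list) measure" where
  "cl n = distr (Q n \<Otimes>\<^sub>M (PE \<Otimes>\<^sub>M PZ)) path_space (\<lambda>(z0, e, z). cat (rp z0) (sk (zeta z0) e z))"

lemma sets_cl [measurable_cong, simp]: "sets (cl n) = sets path_space"
  by (simp add: cl_def)

lemma prob_space_PEZ: "prob_space (PE \<Otimes>\<^sub>M PZ)"
proof -
  interpret E: prob_space PE by (rule prob_space_PE)
  interpret Z: prob_space PZ by (rule prob_space_PZ)
  interpret X: pair_prob_space PE PZ ..
  show ?thesis by (rule X.P.prob_space_axioms)
qed

lemma prob_space_QPEZ: "prob_space (Q n \<Otimes>\<^sub>M (PE \<Otimes>\<^sub>M PZ))"
proof -
  interpret E: prob_space "Q n" by (rule sp.prob_space_PL)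
  interpret Z: prob_space "PE \<Otimes>\<^sub>M PZ" by (rule prob_space_PEZ)
  interpret X: pair_prob_space "Q n" "PE \<Otimes>\<^sub>M PZ" ..
  show ?thesis by (rule X.P.prob_space_axioms)
qed

lemma prob_space_cl: "prob_space (cl n)"
  unfolding cl_def by (rule prob_space.prob_space_distr[OF prob_space_QPEZ]) measurable

lemma sigma_finite_cl: "sigma_finite_measure (cl n)"
  using prob_space_cl prob_space_imp_sigma_finite by auto

lemma borel_measurable_nn_integral_cl [measurable (raw)]:
  "(\<lambda>(x, y). f x y) \<in> borel_measurable (N \<Otimes>\<^sub>M cl n) \<Longrightarrow> (\<lambda>x. \<integral>\<^sup>+y. f x y \<partial>cl n) \<in> borel_measurable N"
  by (rule sigma_finite_measure.borel_measurable_nn_integral[OF sigma_finite_cl])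

lemma nn_integral_cl:
  assumes f [measurable]: "f \<in> borel_measurable path_space"
  shows "(\<integral>\<^sup>+p. f p \<partial>cl n) = (\<integral>\<^sup>+z. kap (zeta z) (\<lambda>p. f (cat (rp z) p)) \<partial>Q n)"
proof -
  interpret E: prob_space PE by (rule prob_space_PE)
  interpret Z: prob_space PZ by (rule prob_space_PZ)
  interpret EZ: prob_space "PE \<Otimes>\<^sub>M PZ" by (rule prob_space_PEZ)
  have "(\<integral>\<^sup>+p. f p \<partial>cl n) = (\<integral>\<^sup>+(z0, e, z). f (cat (rp z0) (sk (zeta z0) e z)) \<partial>(Q n \<Otimes>\<^sub>M (PE \<Otimes>\<^sub>M PZ)))"
    unfolding cl_def by (subst nn_integral_distr) (auto simp: split_beta')
  also have "\<dots> = (\<integral>\<^sup>+z0. \<integral>\<^sup>+(e, z). f (cat (rp z0) (sk (zeta z0) e z)) \<partial>(PE \<Otimes>\<^sub>M PZ) \<partial>Q n)"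
    by (subst EZ.nn_integral_fst[symmetric]) (auto simp: split_beta')
  also have "\<dots> = (\<integral>\<^sup>+z0. \<integral>\<^sup>+e. \<integral>\<^sup>+z. f (cat (rp z0) (sk (zeta z0) e z)) \<partial>PZ \<partial>PE \<partial>Q n)"
  proof (intro nn_integral_cong)
    fix z0 assume "z0 \<in> space (Q n)"
    then have [simp]: "rc z0" by simp
    show "(\<integral>\<^sup>+(e, z). f (cat (rp z0) (sk (zeta z0) e z)) \<partial>(PE \<Otimes>\<^sub>M PZ)) = (\<integral>\<^sup>+e. \<integral>\<^sup>+z. f (cat (rp z0) (sk (zeta z0) e z)) \<partial>PZ \<partial>PE)"
      by (subst Z.nn_integral_fst[symmetric]) (auto simp: split_beta')
  qed
  also have "\<dots> = (\<integral>\<^sup>+z. kap (zeta z) (\<lambda>p. f (cat (rp z) p)) \<partial>Q n)"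
    by (intro nn_integral_cong) (auto intro!: kap_eq[symmetric])
  finally show ?thesis .
qed

definition gapr :: "real \<Rightarrow> real \<Rightarrow> ennreal" where
  "gapr s b = ennreal (\<alpha> * exp (- \<alpha> * b)) * indicator {0<..<s} b"

lemma measurable_gapr [measurable (raw)]:
  assumes [measurable]: "s \<in> borel_measurable N" "b \<in> borel_measurable N"
  shows "(\<lambda>x. gapr (s x) (b x)) \<in> borel_measurable N"
proof -
  have "gapr s b = (if 0 < b \<and> b < s then ennreal (\<alpha> * exp (- \<alpha> * b)) else 0)" for s b
    by (auto simp: gapr_def)
  then show ?thesis by simp
qed

text \<open>Decomposition of a forest at its lowest root birth, at level b.\<close>

definition last_dec :: "real \<Rightarrow> ((real \<Rightarrow> nat list) \<Rightarrow> ennreal) \<Rightarrow> ennreal" where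
  "last_dec s f = ennreal (exp (- \<alpha> * s)) * f nil +
    (\<integral>\<^sup>+b. gapr s b * kap (s - b) (\<lambda>p. \<integral>\<^sup>+r. f (cat (jn [] b p) (jn [] b r)) \<partial>cl 1) \<partial>lborel)"

lemma measurable_last_dec [measurable (raw)]:
  assumes [measurable]: "s \<in> borel_measurable N" "(\<lambda>(x, p). f x p) \<in> borel_measurable (N \<Otimes>\<^sub>M path_space)"
  shows "(\<lambda>x. last_dec (s x) (f x)) \<in> borel_measurable N"
  unfolding last_dec_def by measurable

lemma cat_cat_jn: "cat (jn [] b r) (cat (jn [] b p) q) = cat (jn [] b (cat r p)) q"
  by (simp add: cat_assoc[symmetric] cat_jn)

text \<open>After the topmost birth, at level b, the exploration restarts from the top of the new
  spindle. Branching at b splits it into the clade of that birth and an exploration from b, which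
  leaves a renewal equation in the level alone.\<close>

lemma kap_renewal:
  assumes s: "0 \<le> s" and f [measurable]: "f \<in> borel_measurable path_space"
  shows "kap s f = ennreal (exp (- \<alpha> * s)) * f nil +
    (\<integral>\<^sup>+b. gapd s b * (\<integral>\<^sup>+r. kap b (\<lambda>q. f (cat (jn [] b r) q)) \<partial>cl 1) \<partial>lborel)"
proof -
  have "gapd s b * brn kap b f = gapd s b * (\<integral>\<^sup>+r. kap b (\<lambda>q. f (cat (jn [] b r) q)) \<partial>cl 1)" for b
  proof (cases "0 < b")
    case True
    have "brn kap b f = (\<integral>\<^sup>+z. kap (zeta z) (\<lambda>p. kap b (\<lambda>q. f (cat (jn [] b (cat (rp z) p)) q))) \<partial>Q 1)"
      unfolding brn_def
    proof (rule nn_integral_cong)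
      fix z assume "z \<in> space (Q 1)"
      then have [simp]: "rc z" by simp
      show "kap (b + zeta z) (\<lambda>p. f (cat (jn [] b (rp z)) p)) =
        kap (zeta z) (\<lambda>p. kap b (\<lambda>q. f (cat (jn [] b (cat (rp z) p)) q)))"
        using True by (subst kap_branch) (auto simp: cat_cat_jn)
    qed
    also have "\<dots> = (\<integral>\<^sup>+r. kap b (\<lambda>q. f (cat (jn [] b r) q)) \<partial>cl 1)"
      by (rule nn_integral_cl[symmetric]) measurable
    finally show ?thesis by simp
  qed (simp add: gapd_def)
  then show ?thesis unfolding kap_step[OF s f] by simp
qed

text \<open>Both the topmost birth b and the lowest birth b' are prescribed. Either they coincide
  (term X), or b > b' (term Y), and integrating out b first, as b' + u, gives the renewal equation
  for the births above b'.\<close>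

lemma last_dec_fix:
  assumes s: "0 \<le> s" and f [measurable]: "f \<in> borel_measurable path_space"
  shows "ennreal (exp (- \<alpha> * s)) * f nil +
    (\<integral>\<^sup>+b. gapd s b * (\<integral>\<^sup>+r. last_dec b (\<lambda>q. f (cat (jn [] b r) q)) \<partial>cl 1) \<partial>lborel) = last_dec s f"
proof -
  interpret C: prob_space "cl 1" by (rule prob_space_cl)
  interpret P: pair_sigma_finite lborel "cl 1" ..
  define X where "X b = (\<integral>\<^sup>+r. f (jn [] b r) \<partial>cl 1)" for b
  define G where "G b p = (\<integral>\<^sup>+r. f (cat (jn [] b p) (jn [] b r)) \<partial>cl 1)" for b p
  define Y where "Y b b' = (\<integral>\<^sup>+r. kap (b - b') (\<lambda>p. \<integral>\<^sup>+r'. f (cat (jn [] b r) (cat (jn [] b' p) (jn [] b' r'))) \<partial>cl 1) \<partial>cl 1)" for b b'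
  have [measurable]: "X \<in> borel_measurable borel" unfolding X_def[abs_def] by measurable
  have [measurable]: "G b \<in> borel_measurable path_space" for b unfolding G_def[abs_def] by measurable
  have [measurable]: "(\<lambda>(b, p). G b p) \<in> borel_measurable (borel \<Otimes>\<^sub>M path_space)" unfolding G_def[abs_def] by measurable
  have [measurable]: "(\<lambda>(b, b'). Y b b') \<in> borel_measurable (borel \<Otimes>\<^sub>M borel)" unfolding Y_def[abs_def] by measurable
  have 1: "gapd s b * (\<integral>\<^sup>+r. last_dec b (\<lambda>q. f (cat (jn [] b r) q)) \<partial>cl 1) =
    gapd s b * ennreal (exp (- \<alpha> * b)) * X b + (\<integral>\<^sup>+b'. gapd s b * gapr b b' * Y b b' \<partial>lborel)" for b
  proof -
    have "(\<integral>\<^sup>+r. last_dec b (\<lambda>q. f (cat (jn [] b r) q)) \<partial>cl 1) = ennreal (exp (- \<alpha> * b)) * X b +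
      (\<integral>\<^sup>+r. \<integral>\<^sup>+b'. gapr b b' * kap (b - b') (\<lambda>p. \<integral>\<^sup>+r'. f (cat (jn [] b r) (cat (jn [] b' p) (jn [] b' r'))) \<partial>cl 1) \<partial>lborel \<partial>cl 1)"
      unfolding last_dec_def X_def by (simp add: nn_integral_add nn_integral_cmult)
    also have "(\<integral>\<^sup>+r. \<integral>\<^sup>+b'. gapr b b' * kap (b - b') (\<lambda>p. \<integral>\<^sup>+r'. f (cat (jn [] b r) (cat (jn [] b' p) (jn [] b' r'))) \<partial>cl 1) \<partial>lborel \<partial>cl 1)
      = (\<integral>\<^sup>+b'. \<integral>\<^sup>+r. gapr b b' * kap (b - b') (\<lambda>p. \<integral>\<^sup>+r'. f (cat (jn [] b r) (cat (jn [] b' p) (jn [] b' r'))) \<partial>cl 1) \<partial>cl 1 \<partial>lborel)"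
      by (rule P.Fubini') measurable
    also have "\<dots> = (\<integral>\<^sup>+b'. gapr b b' * Y b b' \<partial>lborel)"
      unfolding Y_def by (intro nn_integral_cong nn_integral_cmult) measurable
    finally show ?thesis by (simp add: distrib_left mult.assoc nn_integral_cmult)
  qed
  have 2: "(\<integral>\<^sup>+b. \<integral>\<^sup>+b'. gapd s b * gapr b b' * Y b b' \<partial>lborel \<partial>lborel) =
    (\<integral>\<^sup>+b'. gapr s b' * (\<integral>\<^sup>+u. gapd (s - b') u * (\<integral>\<^sup>+r. kap u (\<lambda>q. G b' (cat (jn [] u r) q)) \<partial>cl 1) \<partial>lborel) \<partial>lborel)"
  proof -
    have "(\<integral>\<^sup>+b. \<integral>\<^sup>+b'. gapd s b * gapr b b' * Y b b' \<partial>lborel \<partial>lborel) = (\<integral>\<^sup>+b'. \<integral>\<^sup>+b. gapd s b * gapr b b' * Y b b' \<partial>lborel \<partial>lborel)"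
      by (rule lborel_pair.Fubini') measurable
    \<comment> \<open>The topmost birth is measured from the lowest one, so that the upper part
      becomes an exploration of the interval of length s - b'.\<close>
    also have "\<dots> = (\<integral>\<^sup>+b'. \<integral>\<^sup>+u. gapd s (b' + u) * gapr (b' + u) b' * Y (b' + u) b' \<partial>lborel \<partial>lborel)"
      by (intro nn_integral_cong nn_integral_translate) measurable
    also have "\<dots> = (\<integral>\<^sup>+b'. \<integral>\<^sup>+u. gapr s b' * (gapd (s - b') u * (\<integral>\<^sup>+r. kap u (\<lambda>q. G b' (cat (jn [] u r) q)) \<partial>cl 1)) \<partial>lborel \<partial>lborel)"
    proof (intro nn_integral_cong)
      fix b' u :: real
      have w: "gapd s (b' + u) * gapr (b' + u) b' = gapr s b' * gapd (s - b') u"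
        by (auto simp: gapd_def gapr_def indicator_def algebra_simps)
      show "gapd s (b' + u) * gapr (b' + u) b' * Y (b' + u) b' =
        gapr s b' * (gapd (s - b') u * (\<integral>\<^sup>+r. kap u (\<lambda>q. G b' (cat (jn [] u r) q)) \<partial>cl 1))"
      proof (cases "0 < u")
        case True
        then have "Y (b' + u) b' = (\<integral>\<^sup>+r. kap u (\<lambda>q. G b' (cat (jn [] u r) q)) \<partial>cl 1)"
          unfolding Y_def G_def by (simp add: cat_up)
        then show ?thesis by (simp add: w mult.assoc)
      qed (simp add: gapd_def gapr_def indicator_def)
    qed
    also have "\<dots> = (\<integral>\<^sup>+b'. gapr s b' * (\<integral>\<^sup>+u. gapd (s - b') u * (\<integral>\<^sup>+r. kap u (\<lambda>q. G b' (cat (jn [] u r) q)) \<partial>cl 1) \<partial>lborel) \<partial>lborel)"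
      by (intro nn_integral_cong nn_integral_cmult) measurable
    finally show ?thesis .
  qed
  have 3: "gapr s b * kap (s - b) (G b) = gapd s b * ennreal (exp (- \<alpha> * b)) * X b +
    gapr s b * (\<integral>\<^sup>+u. gapd (s - b) u * (\<integral>\<^sup>+r. kap u (\<lambda>q. G b (cat (jn [] u r) q)) \<partial>cl 1) \<partial>lborel)" for b
  proof (cases "b < s")
    case True
    \<comment> \<open>A single birth at b is topmost and lowest at once: both sides are \<alpha>
      exp(-\<alpha> s) on 0 < b < s.\<close>
    have "gapr s b * ennreal (exp (- \<alpha> * (s - b))) = gapd s b * ennreal (exp (- \<alpha> * b))"
      using \<alpha>0 by (auto simp: gapr_def gapd_def indicator_def ennreal_mult[symmetric] ac_simps)
    moreover have "G b nil = X b" by (simp add: G_def X_def)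
    ultimately show ?thesis using True by (subst kap_renewal) (auto simp: distrib_left mult.assoc[symmetric])
  qed (simp add: gapr_def gapd_def)
  have "last_dec s f = ennreal (exp (- \<alpha> * s)) * f nil + (\<integral>\<^sup>+b. gapr s b * kap (s - b) (G b) \<partial>lborel)"
    by (simp add: last_dec_def G_def[abs_def])
  also have "(\<integral>\<^sup>+b. gapr s b * kap (s - b) (G b) \<partial>lborel) = (\<integral>\<^sup>+b. gapd s b * ennreal (exp (- \<alpha> * b)) * X b \<partial>lborel) +
    (\<integral>\<^sup>+b. gapr s b * (\<integral>\<^sup>+u. gapd (s - b) u * (\<integral>\<^sup>+r. kap u (\<lambda>q. G b (cat (jn [] u r) q)) \<partial>cl 1) \<partial>lborel) \<partial>lborel)"
    unfolding 3 by (rule nn_integral_add) measurable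
  also have "\<dots> = (\<integral>\<^sup>+b. gapd s b * ennreal (exp (- \<alpha> * b)) * X b + (\<integral>\<^sup>+b'. gapd s b * gapr b b' * Y b b' \<partial>lborel) \<partial>lborel)"
    unfolding 2[symmetric] by (rule nn_integral_add[symmetric]) measurable
  finally show ?thesis unfolding 1 by simp
qed

text \<open>Induction over the number of births: \<open>last_dec\<close> solves the renewal
  equation, and a truncated exploration, starting from 0 at K = 0, stays below a nonnegative
  solution.\<close>

lemma kapn_le_last_dec:
  assumes "0 \<le> s" and "f \<in> borel_measurable path_space"
  shows "kapn K s f \<le> last_dec s f"
  using assms
proof (induction K arbitrary: s f)
  case (Suc K)
  note [measurable] = Suc.prems(2)
  have "kapn (Suc K) s f = ennreal (exp (- \<alpha> * s)) * f nil + (\<integral>\<^sup>+b. gapd s b * brn (kapn K) b f \<partial>lborel)"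
    by (rule kapn_Suc[OF Suc.prems])
  also have "\<dots> \<le> ennreal (exp (- \<alpha> * s)) * f nil +
    (\<integral>\<^sup>+b. gapd s b * (\<integral>\<^sup>+r. last_dec b (\<lambda>q. f (cat (jn [] b r) q)) \<partial>cl 1) \<partial>lborel)"
  proof (intro add_left_mono nn_integral_mono)
    fix b
    show "gapd s b * brn (kapn K) b f \<le> gapd s b * (\<integral>\<^sup>+r. last_dec b (\<lambda>q. f (cat (jn [] b r) q)) \<partial>cl 1)"
    proof (cases "0 < b")
      case True
      have "brn (kapn K) b f \<le> (\<integral>\<^sup>+z. kap (zeta z) (\<lambda>p. last_dec b (\<lambda>q. f (cat (jn [] b (cat (rp z) p)) q))) \<partial>Q 1)"
        unfolding brn_def
      proof (rule nn_integral_mono)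
        fix z assume "z \<in> space (Q 1)"
        then have [simp]: "rc z" by simp
        have [measurable]: "(\<lambda>p. f (cat (jn [] b (rp z)) p)) \<in> borel_measurable path_space" by measurable
        have "kapn K (b + zeta z) (\<lambda>p. f (cat (jn [] b (rp z)) p)) \<le>
          kap (zeta z) (\<lambda>p. kapn K b (\<lambda>q. f (cat (jn [] b (rp z)) (cat (jn [] b p) q))))"
          using True by (intro kapn_branch_le) auto
        also have "\<dots> = (\<integral>\<^sup>+e. \<integral>\<^sup>+z'. (if st (zeta z) e z' then kapn K b (\<lambda>q. f (cat (jn [] b (cat (rp z) (sk (zeta z) e z'))) q)) else 0) \<partial>PZ \<partial>PE)"
          by (simp add: cat_cat_jn kap_def)
        also have "\<dots> \<le> (\<integral>\<^sup>+e. \<integral>\<^sup>+z'. (if st (zeta z) e z' then last_dec b (\<lambda>q. f (cat (jn [] b (cat (rp z) (sk (zeta z) e z'))) q)) else 0) \<partial>PZ \<partial>PE)"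
        proof (intro nn_integral_mono)
          fix e z' assume "e \<in> space PE" "z' \<in> space PZ"
          have [simp]: "rc (sk (zeta z) e z')" using \<open>z' \<in> space PZ\<close> by (rule rc_sk_PZ)
          have "(\<lambda>q. f (cat (jn [] b (cat (rp z) (sk (zeta z) e z'))) q)) \<in> borel_measurable path_space"
            by measurable
          then show "(if st (zeta z) e z' then kapn K b (\<lambda>q. f (cat (jn [] b (cat (rp z) (sk (zeta z) e z'))) q)) else 0) \<le>
            (if st (zeta z) e z' then last_dec b (\<lambda>q. f (cat (jn [] b (cat (rp z) (sk (zeta z) e z'))) q)) else 0)"
            using Suc.IH[of b] True by auto
        qed
        finally show "kapn K (b + zeta z) (\<lambda>p. f (cat (jn [] b (rp z)) p)) \<le>
          kap (zeta z) (\<lambda>p. last_dec b (\<lambda>q. f (cat (jn [] b (cat (rp z) p)) q)))"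
          by (simp add: kap_def)
      qed
      also have "\<dots> = (\<integral>\<^sup>+r. last_dec b (\<lambda>q. f (cat (jn [] b r) q)) \<partial>cl 1)"
        by (rule nn_integral_cl[symmetric]) measurable
      finally show ?thesis by (intro mult_left_mono) auto
    qed (simp add: gapd_def)
  qed
  also have "\<dots> = last_dec s f" by (rule last_dec_fix[OF Suc.prems])
  finally show ?case .
qed simp

text \<open>The reflection of b at the midpoint of the interval exchanges the densities of topmost
  and lowest birth, so both decompositions have the same total mass.\<close>

lemma last_dec_mass: "0 \<le> s \<Longrightarrow> last_dec s (\<lambda>_. 1) = 1"
proof -
  interpret C: prob_space "cl 1" by (rule prob_space_cl)
  assume s: "0 \<le> s"
  have "(\<integral>\<^sup>+b. gapr s b * kap (s - b) (\<lambda>_. 1) \<partial>lborel) = (\<integral>\<^sup>+b. gapr s b \<partial>lborel)"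
  proof (intro nn_integral_cong)
    show "gapr s b * kap (s - b) (\<lambda>_. 1) = gapr s b" for b
      by (cases "b < s") (auto simp: kap_mass_1 gapr_def)
  qed
  also have "\<dots> = (\<integral>\<^sup>+b. gapd s b \<partial>lborel)"
    by (subst nn_integral_real_affine[where c="-1" and t=s])
       (auto intro!: nn_integral_cong simp: gapr_def gapd_def indicator_def)
  also have "\<dots> = (\<integral>\<^sup>+b. gapd s b * brn kap b (\<lambda>_. 1) \<partial>lborel)"
  proof (intro nn_integral_cong)
    interpret Q: prob_space "Q 1" by (rule sp.prob_space_PL)
    show "gapd s b = gapd s b * brn kap b (\<lambda>_. 1)" for b
    proof (cases "0 < b")
      case True
      then have "brn kap b (\<lambda>_. 1) = (\<integral>\<^sup>+z. 1 \<partial>Q 1)"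
        unfolding brn_def by (intro nn_integral_cong) (simp add: kap_mass_1)
      then show ?thesis using Q.emeasure_space_1 by simp
    qed (simp add: gapd_def)
  qed
  finally have "last_dec s (\<lambda>_. 1) = kap s (\<lambda>_. 1)"
    unfolding last_dec_def using kap_step[OF s, of "\<lambda>_. 1"] C.emeasure_space_1 by simp
  then show ?thesis using kap_mass_1[OF s] by simp
qed

text \<open>The inequality holds for f and for 1 - f, and on either side the two values add up to 1;
  so both are equalities. This is why f is bounded by 1.\<close>

lemma kap_eq_last_dec:
  assumes s: "0 \<le> s" and f [measurable]: "f \<in> borel_measurable path_space" and f1: "\<And>p. f p \<le> 1"
  shows "kap s f = last_dec s f"
proof -
  interpret C: prob_space "cl 1" by (rule prob_space_cl)
  have le: "kap s g \<le> last_dec s g" if "g \<in> borel_measurable path_space" for g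
    unfolding kap_SUP[OF that] by (intro SUP_least kapn_le_last_dec s that)
  define g where "g p = 1 - f p" for p
  have [measurable]: "g \<in> borel_measurable path_space" unfolding g_def[abs_def] by measurable
  have fg: "f p + g p = 1" for p using f1[of p] by (simp add: g_def)
  have fin: "\<not> top \<le> (1 :: ennreal)" by (simp add: top_unique)
  have "kap s f + kap s g = kap s (\<lambda>p. f p + g p)"
  proof -
    have m: "(\<lambda>e. \<integral>\<^sup>+z. h (sk s e z) \<partial>PZ) \<in> borel_measurable PE" "(\<lambda>z. h (sk s e z)) \<in> borel_measurable PZ"
      if [measurable]: "h \<in> borel_measurable path_space" for h e
      by measurable
    show ?thesis
      by (simp add: kap_eq[OF s] nn_integral_add m)
  qed
  also have "\<dots> = 1" using kap_mass_1[OF s] by (simp add: fg)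
  finally have 1: "kap s f + kap s g = 1" .
  have kadd: "kap t (\<lambda>p. h p + k p) = kap t h + kap t k" if "0 \<le> t" "h \<in> borel_measurable path_space" "k \<in> borel_measurable path_space" for t h k
  proof -
    note [measurable] = that(2,3)
    have m: "(\<lambda>e. \<integral>\<^sup>+z. h (sk t e z) \<partial>PZ) \<in> borel_measurable PE" "(\<lambda>z. h (sk t e z)) \<in> borel_measurable PZ"
      if [measurable]: "h \<in> borel_measurable path_space" for h e
      by measurable
    show ?thesis by (simp add: kap_eq that nn_integral_add m)
  qed
  have "last_dec s f + last_dec s g = last_dec s (\<lambda>p. f p + g p)"
  proof -
    have eq: "gapr s b * kap (s - b) (\<lambda>p. \<integral>\<^sup>+r. f (cat (jn [] b p) (jn [] b r)) + g (cat (jn [] b p) (jn [] b r)) \<partial>cl 1)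
      = gapr s b * kap (s - b) (\<lambda>p. \<integral>\<^sup>+r. f (cat (jn [] b p) (jn [] b r)) \<partial>cl 1)
      + gapr s b * kap (s - b) (\<lambda>p. \<integral>\<^sup>+r. g (cat (jn [] b p) (jn [] b r)) \<partial>cl 1)" for b
    proof (cases "b < s")
      case True
      have "kap (s - b) (\<lambda>p. \<integral>\<^sup>+r. f (cat (jn [] b p) (jn [] b r)) + g (cat (jn [] b p) (jn [] b r)) \<partial>cl 1)
        = kap (s - b) (\<lambda>p. (\<integral>\<^sup>+r. f (cat (jn [] b p) (jn [] b r)) \<partial>cl 1) + (\<integral>\<^sup>+r. g (cat (jn [] b p) (jn [] b r)) \<partial>cl 1))"
      proof -
        have "(\<integral>\<^sup>+r. f (cat (jn [] b p) (jn [] b r)) + g (cat (jn [] b p) (jn [] b r)) \<partial>cl 1) =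
          (\<integral>\<^sup>+r. f (cat (jn [] b p) (jn [] b r)) \<partial>cl 1) + (\<integral>\<^sup>+r. g (cat (jn [] b p) (jn [] b r)) \<partial>cl 1)" if "rc p" for p
          using that by (intro nn_integral_add) auto
        then show ?thesis unfolding kap_def by (intro nn_integral_cong) (auto dest: rc_sk_PZ)
      qed
      also have "\<dots> = kap (s - b) (\<lambda>p. \<integral>\<^sup>+r. f (cat (jn [] b p) (jn [] b r)) \<partial>cl 1) + kap (s - b) (\<lambda>p. \<integral>\<^sup>+r. g (cat (jn [] b p) (jn [] b r)) \<partial>cl 1)"
        using True by (intro kadd) auto
      finally show ?thesis by (simp add: distrib_left)
    qed (simp add: gapr_def)
    show ?thesis unfolding last_dec_def eq
      by (simp add: nn_integral_add distrib_left ac_simps)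
  qed
  also have "\<dots> = 1" using last_dec_mass[OF s] by (simp add: fg)
  finally have 2: "last_dec s f + last_dec s g = 1" .
  show ?thesis
  proof (rule antisym)
    show "kap s f \<le> last_dec s f" by (rule le) fact
    have "last_dec s f + kap s g \<le> kap s f + kap s g" unfolding 1 2[symmetric] by (intro add_left_mono le) measurable
    moreover have "kap s g \<noteq> top" using 1 by (auto simp: top_add)
    ultimately show "last_dec s f \<le> kap s f" by (simp add: ennreal_add_left_cancel_le add.commute)
  qed
qed

text \<open>At the first jump of the root spindle, at level s, the forest is cut by
  \<open>kap_branch\<close>: above s it is a clade with the new root size, and below s an
  independent exploration descends from s.\<close>

lemma cl_first_jump:
  assumes n: "1 \<le> n" and f [measurable]: "f \<in> borel_measurable path_space"
  shows "(\<integral>\<^sup>+p. f p \<partial>cl n) = (\<integral>\<^sup>+s. ennreal (exp (- (2 * real n - \<alpha>) * s)) * indicator {0..} s *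
     (ennreal (real n - \<alpha>) * (\<integral>\<^sup>+r. kap s (\<lambda>q. f (cat (jn [n] s r) q)) \<partial>cl (n + 1))
      + ennreal (real n) * (\<integral>\<^sup>+r. kap s (\<lambda>q. f (cat (jn [n] s r) q)) \<partial>cl (n - 1))) \<partial>lborel)"
proof -
  have eq: "(\<integral>\<^sup>+z. kap (zeta (jn n s z)) (\<lambda>p. f (cat (rp (jn n s z)) p)) \<partial>Q m) =
    (\<integral>\<^sup>+r. kap s (\<lambda>q. f (cat (jn [n] s r) q)) \<partial>cl m)" if s: "0 \<le> s" for s m
  proof -
    have "(\<integral>\<^sup>+z. kap (zeta (jn n s z)) (\<lambda>p. f (cat (rp (jn n s z)) p)) \<partial>Q m) =
      (\<integral>\<^sup>+z. kap (zeta z) (\<lambda>p. kap s (\<lambda>q. f (cat (jn [n] s (cat (rp z) p)) q))) \<partial>Q m)"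
    proof (rule nn_integral_cong_AE, use AE_Q_hits[of m] AE_Q_rc[of m] in eventually_elim)
      case (elim z)
      note [simp] = elim(2)
      have p: "cat (jn [n] s (rp z)) (cat (jn [] s p) q) = cat (jn [n] s (cat (rp z) p)) q" for p q
        by (simp add: cat_assoc[symmetric] cat_jn)
      have "kap (s + zeta z) (\<lambda>p. f (cat (jn [n] s (rp z)) p)) =
        kap (zeta z) (\<lambda>p. kap s (\<lambda>q. f (cat (jn [n] s (cat (rp z) p)) q)))"
        using s by (subst kap_branch) (auto simp: p)
      then show ?case using hits_jn[OF elim(2,1), of n s] n s by simp
    qed
    also have "\<dots> = (\<integral>\<^sup>+r. kap s (\<lambda>q. f (cat (jn [n] s r) q)) \<partial>cl m)"
      by (rule nn_integral_cl[symmetric]) measurable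
    finally show ?thesis .
  qed
  have "(\<integral>\<^sup>+p. f p \<partial>cl n) = (\<integral>\<^sup>+z. kap (zeta z) (\<lambda>p. f (cat (rp z) p)) \<partial>Q n)" by (rule nn_integral_cl) fact
  also have "\<dots> = (\<integral>\<^sup>+s. ennreal (exp (- (2 * real n - \<alpha>) * s)) * indicator {0..} s *
     (ennreal (real n - \<alpha>) * (\<integral>\<^sup>+z. kap (zeta (jn n s z)) (\<lambda>p. f (cat (rp (jn n s z)) p)) \<partial>Q (n + 1))
      + ennreal (real n) * (\<integral>\<^sup>+z. kap (zeta (jn n s z)) (\<lambda>p. f (cat (rp (jn n s z)) p)) \<partial>Q (n - 1))) \<partial>lborel)"
    by (rule Q_first_jump[OF n]) measurable
  also have "\<dots> = (\<integral>\<^sup>+s. ennreal (exp (- (2 * real n - \<alpha>) * s)) * indicator {0..} s *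
     (ennreal (real n - \<alpha>) * (\<integral>\<^sup>+r. kap s (\<lambda>q. f (cat (jn [n] s r) q)) \<partial>cl (n + 1))
      + ennreal (real n) * (\<integral>\<^sup>+r. kap s (\<lambda>q. f (cat (jn [n] s r) q)) \<partial>cl (n - 1))) \<partial>lborel)"
    by (intro nn_integral_cong) (auto simp: eq indicator_def)
  finally show ?thesis .
qed

end

section \<open>First-event equations and superposition\<close>

type_synonym 'a pathlaw = "(real \<Rightarrow> 'a) measure"

definition path_law :: "'a pathlaw \<Rightarrow> bool" where
  "path_law A \<longleftrightarrow> prob_space A \<and> sets A = sets path_space"

lemma path_lawD: "path_law A \<Longrightarrow> prob_space A" "path_law A \<Longrightarrow> sets A = sets path_space"
  "path_law A \<Longrightarrow> space A = {p. rc p}" "path_law A \<Longrightarrow> sigma_finite_measure A"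
  using sets_eq_imp_space_eq[of A path_space] prob_space_imp_sigma_finite
  by (auto simp: path_law_def)

definition cv :: "'a::countable list pathlaw \<Rightarrow> 'a list pathlaw \<Rightarrow> 'a list pathlaw" where
  "cv A B = distr (A \<Otimes>\<^sub>M B) path_space (\<lambda>(p, q). cat p q)"

lemma measurable_cat_pair:
  fixes A B :: "'a::countable list pathlaw"
  assumes "path_law A" "path_law B"
  shows "(\<lambda>(p, q). cat p q) \<in> (A \<Otimes>\<^sub>M B) \<rightarrow>\<^sub>M path_space"
proof -
  have s: "sets (A \<Otimes>\<^sub>M B) = sets (path_space \<Otimes>\<^sub>M path_space)"
    using assms by (intro sets_pair_measure_cong) (auto simp: path_law_def)
  have "(\<lambda>(p, q). cat p q) \<in> (path_space \<Otimes>\<^sub>M path_space) \<rightarrow>\<^sub>M (path_space :: 'a list pathlaw)" by measurable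
  then show ?thesis by (simp add: measurable_cong_sets[OF s refl])
qed

lemma path_law_cv: assumes "path_law A" "path_law B" shows "path_law (cv A B)"
proof -
  interpret A: prob_space A using assms path_lawD by auto
  interpret B: prob_space B using assms path_lawD by auto
  interpret X: pair_prob_space A B ..
  have "prob_space (cv A B)" unfolding cv_def
    by (rule X.P.prob_space_distr) (rule measurable_cat_pair[OF assms])
  then show ?thesis by (simp add: path_law_def cv_def)
qed

lemma nn_integral_path_law_measurable [measurable (raw)]:
  assumes "path_law A" "(\<lambda>(x, p). f x p) \<in> borel_measurable (N \<Otimes>\<^sub>M path_space)"
  shows "(\<lambda>x. \<integral>\<^sup>+p. f x p \<partial>A) \<in> borel_measurable N"
proof -
  have "sets (N \<Otimes>\<^sub>M A) = sets (N \<Otimes>\<^sub>M path_space)"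
    using path_lawD(2)[OF assms(1)] by (intro sets_pair_measure_cong) auto
  then show ?thesis using assms(2) path_lawD(4)[OF assms(1)]
    by (intro sigma_finite_measure.borel_measurable_nn_integral) (auto cong: measurable_cong_sets)
qed

lemma nn_integral_cv:
  fixes f :: "(real \<Rightarrow> 'a::countable list) \<Rightarrow> ennreal"
  assumes A: "path_law A" and B: "path_law B" and f [measurable]: "f \<in> borel_measurable path_space"
  shows "(\<integral>\<^sup>+p. f p \<partial>cv A B) = (\<integral>\<^sup>+p. \<integral>\<^sup>+q. f (cat p q) \<partial>B \<partial>A)"
proof -
  interpret B: sigma_finite_measure B by (rule path_lawD(4)[OF B])
  note [measurable_cong] = path_lawD(2)[OF A] path_lawD(2)[OF B]
  have "(\<integral>\<^sup>+p. f p \<partial>cv A B) = (\<integral>\<^sup>+(p, q). f (cat p q) \<partial>(A \<Otimes>\<^sub>M B))"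
    unfolding cv_def by (subst nn_integral_distr[OF measurable_cat_pair[OF A B]]) (auto simp: split_beta')
  also have "\<dots> = (\<integral>\<^sup>+p. \<integral>\<^sup>+q. f (cat p q) \<partial>B \<partial>A)"
    by (subst B.nn_integral_fst[symmetric]) (auto simp: split_beta')
  finally show ?thesis .
qed

lemma path_law_eqI:
  assumes "path_law A" "path_law B"
    and "\<And>f. f \<in> borel_measurable path_space \<Longrightarrow> (\<And>p. f p \<le> (1::ennreal)) \<Longrightarrow> (\<integral>\<^sup>+p. f p \<partial>A) = (\<integral>\<^sup>+p. f p \<partial>B)"
  shows "A = B"
proof (rule measure_eqI)
  show "sets A = sets B" using assms by (auto simp: path_law_def)
  fix X assume X: "X \<in> sets A"
  then have "X \<in> sets path_space" "X \<in> sets B" using assms by (auto simp: path_law_def)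
  moreover have "(\<integral>\<^sup>+p. indicator X p \<partial>A) = (\<integral>\<^sup>+p. indicator X p \<partial>B)"
    using \<open>X \<in> sets path_space\<close> by (intro assms(3)) (auto split: split_indicator)
  ultimately show "emeasure A X = emeasure B X" using X by simp
qed

lemma cv_assoc:
  fixes A B C :: "'a::countable list pathlaw"
  assumes "path_law A" "path_law B" "path_law C"
  shows "cv (cv A B) C = cv A (cv B C)"
proof (rule path_law_eqI)
  fix f :: "(real \<Rightarrow> 'a list) \<Rightarrow> ennreal" assume [measurable]: "f \<in> borel_measurable path_space"
  note [measurable] = assms
  have "(\<integral>\<^sup>+p. f p \<partial>cv A (cv B C)) = (\<integral>\<^sup>+p. \<integral>\<^sup>+q. f (cat p q) \<partial>cv B C \<partial>A)"
    using assms by (intro nn_integral_cv path_law_cv) auto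
  also have "\<dots> = (\<integral>\<^sup>+p. \<integral>\<^sup>+q. \<integral>\<^sup>+r. f (cat p (cat q r)) \<partial>C \<partial>B \<partial>A)"
    using assms by (intro nn_integral_cong nn_integral_cv) (auto simp: path_lawD)
  also have "\<dots> = (\<integral>\<^sup>+p. \<integral>\<^sup>+r. f (cat p r) \<partial>C \<partial>cv A B)"
    using assms by (subst nn_integral_cv) (auto simp: cat_assoc)
  also have "\<dots> = (\<integral>\<^sup>+p. f p \<partial>cv (cv A B) C)"
    using assms by (intro nn_integral_cv[symmetric] path_law_cv) auto
  finally show "(\<integral>\<^sup>+p. f p \<partial>cv (cv A B) C) = (\<integral>\<^sup>+p. f p \<partial>cv A (cv B C))" ..
qed (intro path_law_cv assms)+

definition Nx :: "(real \<times> 'a pathlaw) list \<Rightarrow> ((real \<Rightarrow> 'a) \<Rightarrow> ennreal) \<Rightarrow> ennreal" where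
  "Nx L g = (\<Sum>(r, K)\<leftarrow>L. ennreal r * (\<integral>\<^sup>+p. g p \<partial>K))"

definition rates :: "(real \<times> 'a pathlaw) list \<Rightarrow> bool" where
  "rates L \<longleftrightarrow> (\<forall>(r, K)\<in>set L. 0 \<le> r \<and> path_law K)"

abbreviation tot :: "(real \<times> 'b) list \<Rightarrow> real" where "tot L \<equiv> sum_list (map fst L)"

lemma Nx_Nil [simp]: "Nx [] g = 0" and Nx_Cons [simp]: "Nx ((r, K) # L) g = ennreal r * (\<integral>\<^sup>+p. g p \<partial>K) + Nx L g"
  and Nx_append: "Nx (L @ L') g = Nx L g + Nx L' g"
  by (simp_all add: Nx_def)

lemma rates_simps [simp]: "rates []" "rates (x # L) \<longleftrightarrow> 0 \<le> fst x \<and> path_law (snd x) \<and> rates L"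
  "rates (L @ L') \<longleftrightarrow> rates L \<and> rates L'"
  by (auto simp: rates_def)

lemma Nx_cong: "rates L \<Longrightarrow> (\<And>p. rc p \<Longrightarrow> f p = g p) \<Longrightarrow> Nx L f = Nx L g"
proof (induction L)
  case (Cons x L)
  have "(\<integral>\<^sup>+p. f p \<partial>snd x) = (\<integral>\<^sup>+p. g p \<partial>snd x)"
    using Cons.prems path_lawD(3)[of "snd x"] by (intro nn_integral_cong) auto
  then show ?case using Cons by (cases x) auto
qed simp

lemma measurable_Nx [measurable (raw)]:
  assumes "rates L" "(\<lambda>(x, p). f x p) \<in> borel_measurable (N \<Otimes>\<^sub>M path_space)"
  shows "(\<lambda>x. Nx L (f x)) \<in> borel_measurable N"
  using assms(1)
proof (induction L)
  case (Cons x L)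
  then have "path_law (snd x)" by auto
  from nn_integral_path_law_measurable[OF this assms(2)] Cons show ?case by (cases x) auto
qed simp

lemma Nx_cmult:
  "rates L \<Longrightarrow> G \<in> borel_measurable path_space \<Longrightarrow> Nx L (\<lambda>p. c * G p) = c * Nx L G"
proof (induction L)
  case (Cons y L)
  obtain r K where y: "y = (r, K)" by (cases y)
  have [measurable_cong]: "sets K = sets path_space" using Cons y path_lawD by auto
  note [measurable] = Cons.prems(2)
  show ?case using Cons by (simp add: y nn_integral_cmult distrib_left ac_simps)
qed simp

lemma Nx_swap:
  assumes M: "sigma_finite_measure M" and L: "rates L"
    and f: "(\<lambda>(x, p). f x p) \<in> borel_measurable (M \<Otimes>\<^sub>M path_space)"
  shows "(\<integral>\<^sup>+x. Nx L (f x) \<partial>M) = Nx L (\<lambda>p. \<integral>\<^sup>+x. f x p \<partial>M)"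
  using L
proof (induction L)
  case (Cons y L)
  obtain r K where y: "y = (r, K)" by (cases y)
  interpret M: sigma_finite_measure M by fact
  have K: "path_law K" using Cons y by auto
  interpret K: sigma_finite_measure K by (rule path_lawD(4)[OF K])
  interpret P: pair_sigma_finite M K ..
  have s: "sets (M \<Otimes>\<^sub>M K) = sets (M \<Otimes>\<^sub>M path_space)"
    using path_lawD(2)[OF K] by (intro sets_pair_measure_cong) auto
  have m: "(\<lambda>x. \<integral>\<^sup>+p. f x p \<partial>K) \<in> borel_measurable M" by (rule nn_integral_path_law_measurable[OF K f])
  have "(\<integral>\<^sup>+x. Nx (y # L) (f x) \<partial>M) = (\<integral>\<^sup>+x. ennreal r * (\<integral>\<^sup>+p. f x p \<partial>K) \<partial>M) + (\<integral>\<^sup>+x. Nx L (f x) \<partial>M)"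
    unfolding y Nx_Cons using Cons.prems m measurable_Nx[of L f M] f by (intro nn_integral_add) auto
  also have "(\<integral>\<^sup>+x. ennreal r * (\<integral>\<^sup>+p. f x p \<partial>K) \<partial>M) = ennreal r * (\<integral>\<^sup>+x. \<integral>\<^sup>+p. f x p \<partial>K \<partial>M)"
    by (rule nn_integral_cmult) (rule m)
  also have "(\<integral>\<^sup>+x. \<integral>\<^sup>+p. f x p \<partial>K \<partial>M) = (\<integral>\<^sup>+p. \<integral>\<^sup>+x. f x p \<partial>M \<partial>K)"
    using f by (intro P.Fubini'[symmetric]) (simp add: measurable_cong_sets[OF s refl])
  finally show ?case using Cons by (simp add: y)
qed simp

lemma Nx_Nx_swap:
  assumes L: "rates L" "rates L'" and f: "(\<lambda>(p, q). f p q) \<in> borel_measurable (path_space \<Otimes>\<^sub>M path_space)"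
  shows "Nx L (\<lambda>p. Nx L' (\<lambda>q. f p q)) = Nx L' (\<lambda>q. Nx L (\<lambda>p. f p q))"
  using L(1)
proof (induction L)
  case Nil
  then show ?case by (induction L') auto
next
  case (Cons y L)
  obtain r K where y: "y = (r, K)" by (cases y)
  have K: "path_law K" using Cons y by auto
  have s: "sets (K \<Otimes>\<^sub>M path_space) = sets (path_space \<Otimes>\<^sub>M path_space)"
    using path_lawD(2)[OF K] by (intro sets_pair_measure_cong) auto
  have f1: "(\<lambda>(q, p). f p q) \<in> borel_measurable (path_space \<Otimes>\<^sub>M path_space)"
    using measurable_pair_swap[OF f] by (simp add: split_beta')
  have "Nx (y # L) (\<lambda>p. Nx L' (f p)) = ennreal r * Nx L' (\<lambda>q. \<integral>\<^sup>+p. f p q \<partial>K) + Nx L' (\<lambda>q. Nx L (\<lambda>p. f p q))"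
    unfolding y Nx_Cons using Cons
    by (subst Nx_swap[OF path_lawD(4)[OF K] L(2)]) (use f in \<open>auto simp: measurable_cong_sets[OF s refl]\<close>)
  also have "\<dots> = Nx L' (\<lambda>q. ennreal r * (\<integral>\<^sup>+p. f p q \<partial>K) + Nx L (\<lambda>p. f p q))"
  proof -
    have m1 [measurable]: "(\<lambda>q. \<integral>\<^sup>+p. f p q \<partial>K) \<in> borel_measurable path_space"
      by (rule nn_integral_path_law_measurable[OF K f1])
    have m2 [measurable]: "(\<lambda>q. Nx L (\<lambda>p. f p q)) \<in> borel_measurable path_space"
      using Cons.prems by (intro measurable_Nx f1) auto
    show ?thesis using L(2)
    proof (induction L')
      case (Cons z L')
      obtain t H where z: "z = (t, H)" by (cases z)
      have [measurable_cong]: "sets H = sets path_space" using Cons z path_lawD by auto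
      have "(\<integral>\<^sup>+q. ennreal r * (\<integral>\<^sup>+p. f p q \<partial>K) + Nx L (\<lambda>p. f p q) \<partial>H) =
        ennreal r * (\<integral>\<^sup>+q. \<integral>\<^sup>+p. f p q \<partial>K \<partial>H) + (\<integral>\<^sup>+q. Nx L (\<lambda>p. f p q) \<partial>H)"
        by (subst nn_integral_add) (auto simp: nn_integral_cmult)
      then show ?case using Cons by (simp add: z distrib_left ac_simps)
    qed simp
  qed
  finally show ?case by (simp add: y)
qed

lemma Nx_map_cv_left:
  assumes "rates L" "path_law B" and [measurable]: "g \<in> borel_measurable path_space"
  shows "Nx (map (\<lambda>(r, K). (r, cv K B)) L) g = Nx L (\<lambda>p. \<integral>\<^sup>+q. g (cat p q) \<partial>B)"
  using assms(1)
proof (induction L)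
  case (Cons y L)
  then show ?case using assms by (cases y) (simp add: nn_integral_cv)
qed simp

text \<open>The integral over A is pulled inside the sum over L, so that left and right components
  of a concatenation can be treated alike.\<close>

lemma Nx_map_cv_right:
  assumes L: "rates L" and A: "path_law A" and g [measurable]: "g \<in> borel_measurable path_space"
  shows "Nx (map (\<lambda>(r, K). (r, cv A K)) L) g = Nx L (\<lambda>q. \<integral>\<^sup>+p. g (cat p q) \<partial>A)"
proof -
  have "Nx (map (\<lambda>(r, K). (r, cv A K)) L) g = (\<integral>\<^sup>+p. Nx L (\<lambda>q. g (cat p q)) \<partial>A)"
    using L
  proof (induction L)
    case (Cons y L)
    obtain r K where y: "y = (r, K)" by (cases y)
    note [measurable_cong] = path_lawD(2)[OF A]
    have [measurable]: "path_law K" "rates L" using Cons y by auto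
    have "(\<integral>\<^sup>+p. Nx (y # L) (\<lambda>q. g (cat p q)) \<partial>A) = (\<integral>\<^sup>+p. ennreal r * (\<integral>\<^sup>+q. g (cat p q) \<partial>K) \<partial>A) + (\<integral>\<^sup>+p. Nx L (\<lambda>q. g (cat p q)) \<partial>A)"
      unfolding y Nx_Cons by (rule nn_integral_add) measurable
    also have "(\<integral>\<^sup>+p. ennreal r * (\<integral>\<^sup>+q. g (cat p q) \<partial>K) \<partial>A) = ennreal r * (\<integral>\<^sup>+p. \<integral>\<^sup>+q. g (cat p q) \<partial>K \<partial>A)"
      by (rule nn_integral_cmult) measurable
    finally show ?case using Cons A by (simp add: y nn_integral_cv)
  qed simp
  also have "\<dots> = Nx L (\<lambda>q. \<integral>\<^sup>+p. g (cat p q) \<partial>A)"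
  proof (rule Nx_swap[OF path_lawD(4)[OF A] L])
    note [measurable_cong] = path_lawD(2)[OF A]
    show "(\<lambda>(p, q). g (cat p q)) \<in> borel_measurable (A \<Otimes>\<^sub>M path_space)" by measurable
  qed
  finally show ?thesis .
qed

text \<open>The exponential density without its factor l: the rates in \<open>Nx\<close> are not
  normalised and supply it.\<close>

definition wt :: "real \<Rightarrow> real \<Rightarrow> ennreal" where
  "wt l s = ennreal (exp (- l * s)) * indicator {0..} s"

lemma measurable_wt [measurable]: "wt l \<in> borel_measurable borel"
  unfolding wt_def[abs_def] by measurable

text \<open>The path stays at a for an exponential time with rate tot L and is continued by a path of law K
  with probability proportional to r, for (r, K) in L.\<close>

definition first_event :: "'a pathlaw \<Rightarrow> 'a \<Rightarrow> (real \<times> 'a pathlaw) list \<Rightarrow> bool" where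
  "first_event A a L \<longleftrightarrow> (\<forall>f\<in>borel_measurable path_space. (\<forall>p. f p \<le> 1) \<longrightarrow>
     (\<integral>\<^sup>+p. f p \<partial>A) = (\<integral>\<^sup>+s. wt (tot L) s * Nx L (\<lambda>p. f (jn a s p)) \<partial>lborel))"

lemma first_eventD:
  "first_event A a L \<Longrightarrow> f \<in> borel_measurable path_space \<Longrightarrow> (\<And>p. f p \<le> 1) \<Longrightarrow>
    (\<integral>\<^sup>+p. f p \<partial>A) = (\<integral>\<^sup>+s. wt (tot L) s * Nx L (\<lambda>p. f (jn a s p)) \<partial>lborel)"
  by (auto simp: first_event_def)

lemma tot_map: "tot (map (\<lambda>(r, K). (r, F K)) L) = tot L"
  by (induction L) auto

text \<open>The second of two competing clocks rings either after s, with residual time u, or before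
  s; the tie is a null set.\<close>

lemma nn_integral_split_lt:
  fixes s :: real
  assumes [measurable]: "F \<in> borel_measurable borel"
  shows "(\<integral>\<^sup>+t. F t \<partial>lborel) = (\<integral>\<^sup>+u. indicator {0<..} u * F (s + u) \<partial>lborel) + (\<integral>\<^sup>+t. indicator {0<..} (s - t) * F t \<partial>lborel)"
proof -
  have "(\<integral>\<^sup>+t. F t \<partial>lborel) = (\<integral>\<^sup>+t. indicator {0<..} (t - s) * F t + indicator {0<..} (s - t) * F t \<partial>lborel)"
  proof (rule nn_integral_cong_AE, use AE_lborel_singleton[of s] in eventually_elim)
    case (elim t)
    then show ?case by (cases "s < t") (auto simp: indicator_def)
  qed
  also have "\<dots> = (\<integral>\<^sup>+t. indicator {0<..} (t - s) * F t \<partial>lborel) + (\<integral>\<^sup>+t. indicator {0<..} (s - t) * F t \<partial>lborel)"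
    by (rule nn_integral_add) measurable
  also have "(\<integral>\<^sup>+t. indicator {0<..} (t - s) * F t \<partial>lborel) = (\<integral>\<^sup>+u. indicator {0<..} u * F (s + u) \<partial>lborel)"
    by (subst nn_integral_translate[of _ s]) auto
  finally show ?thesis .
qed

lemma wt_pos_cong: "(\<integral>\<^sup>+u. indicator {0<..} u * (wt l u * F u) \<partial>lborel) = (\<integral>\<^sup>+u. wt l u * F u \<partial>lborel)"
  by (rule nn_integral_cong_AE, use AE_lborel_singleton[of 0] in eventually_elim) (auto simp: wt_def indicator_def)

lemma wt_add: "0 < u \<Longrightarrow> wt l' s * wt l (s + u) = wt (l' + l) s * wt l u"
  by (auto simp: wt_def indicator_def ennreal_mult[symmetric] exp_add[symmetric] algebra_simps)

text \<open>Competing exponential clocks. If the left component moves first, at time s, the residual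
  clock of the right one has the original exponential law, so the right component is still
  distributed as B; the other case is symmetric. Hence the rate lists are joined.\<close>

lemma first_event_cv:
  fixes A B :: "'a::countable list pathlaw"
  assumes A: "path_law A" "rates L" "first_event A a L" and B: "path_law B" "rates L'" "first_event B b L'"
  shows "first_event (cv A B) (a @ b) (map (\<lambda>(r, K). (r, cv K B)) L @ map (\<lambda>(r, K). (r, cv A K)) L')"
  unfolding first_event_def
proof (intro ballI impI)
  fix f :: "(real \<Rightarrow> 'a list) \<Rightarrow> ennreal"
  assume f [measurable]: "f \<in> borel_measurable path_space" and f1: "\<forall>p. f p \<le> 1"
  note [measurable] = A(1,2) B(1,2)
  interpret A: prob_space A using A path_lawD by auto
  interpret B: prob_space B using B path_lawD by auto
  define l where "l = tot L"
  define l' where "l' = tot L'"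
  have F1: "(\<integral>\<^sup>+q. f (g q) \<partial>B) \<le> 1" for g
  proof -
    have "(\<integral>\<^sup>+q. f (g q) \<partial>B) \<le> (\<integral>\<^sup>+q. 1 \<partial>B)" using f1 by (intro nn_integral_mono) auto
    then show ?thesis by (simp add: B.emeasure_space_1)
  qed
  \<comment> \<open>The mean of f given that the two clocks ring at s and t.\<close>
  define Z where "Z s t = Nx L (\<lambda>p. Nx L' (\<lambda>q. f (cat (jn a s p) (jn b t q))))" for s t
  have Zm [measurable]: "(\<lambda>(s, t). Z s t) \<in> borel_measurable (borel \<Otimes>\<^sub>M borel)"
    unfolding Z_def by measurable
  have "(\<integral>\<^sup>+p. f p \<partial>cv A B) = (\<integral>\<^sup>+p. \<integral>\<^sup>+q. f (cat p q) \<partial>B \<partial>A)" by (rule nn_integral_cv) fact+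
  also have "\<dots> = (\<integral>\<^sup>+s. wt l s * Nx L (\<lambda>p. \<integral>\<^sup>+q. f (cat (jn a s p) q) \<partial>B) \<partial>lborel)"
    unfolding l_def by (rule first_eventD[OF A(3) _ F1]) measurable
  also have "\<dots> = (\<integral>\<^sup>+s. wt l s * (\<integral>\<^sup>+t. wt l' t * Z s t \<partial>lborel) \<partial>lborel)"
  proof (intro nn_integral_cong arg_cong2[where f="(*)"] refl)
    fix s
    have "Nx L (\<lambda>p. \<integral>\<^sup>+q. f (cat (jn a s p) q) \<partial>B) = Nx L (\<lambda>p. \<integral>\<^sup>+t. wt l' t * Nx L' (\<lambda>q. f (cat (jn a s p) (jn b t q))) \<partial>lborel)"
    proof (rule Nx_cong[OF A(2)])
      fix p :: "real \<Rightarrow> 'a list" assume [simp]: "rc p"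
      show "(\<integral>\<^sup>+q. f (cat (jn a s p) q) \<partial>B) = (\<integral>\<^sup>+t. wt l' t * Nx L' (\<lambda>q. f (cat (jn a s p) (jn b t q))) \<partial>lborel)"
        unfolding l'_def by (rule first_eventD[OF B(3)]) (use f1 in auto)
    qed
    also have "\<dots> = (\<integral>\<^sup>+t. Nx L (\<lambda>p. wt l' t * Nx L' (\<lambda>q. f (cat (jn a s p) (jn b t q)))) \<partial>lborel)"
      by (rule Nx_swap[symmetric, OF lborel.sigma_finite_measure_axioms A(2)]) measurable
    also have "\<dots> = (\<integral>\<^sup>+t. wt l' t * Z s t \<partial>lborel)"
    proof (intro nn_integral_cong)
      fix t
      show "Nx L (\<lambda>p. wt l' t * Nx L' (\<lambda>q. f (cat (jn a s p) (jn b t q)))) = wt l' t * Z s t"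
        unfolding Z_def by (rule Nx_cmult[OF A(2)]) measurable
    qed
    finally show "Nx L (\<lambda>p. \<integral>\<^sup>+q. f (cat (jn a s p) q) \<partial>B) = (\<integral>\<^sup>+t. wt l' t * Z s t \<partial>lborel)" .
  qed
  also have "\<dots> = (\<integral>\<^sup>+s. wt l s * (\<integral>\<^sup>+u. indicator {0<..} u * (wt l' (s + u) * Z s (s + u)) \<partial>lborel)
      + wt l s * (\<integral>\<^sup>+t. indicator {0<..} (s - t) * (wt l' t * Z s t) \<partial>lborel) \<partial>lborel)"
  proof (intro nn_integral_cong)
    fix s
    have "(\<integral>\<^sup>+t. wt l' t * Z s t \<partial>lborel) = (\<integral>\<^sup>+u. indicator {0<..} u * (wt l' (s + u) * Z s (s + u)) \<partial>lborel)
      + (\<integral>\<^sup>+t. indicator {0<..} (s - t) * (wt l' t * Z s t) \<partial>lborel)"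
      by (rule nn_integral_split_lt) measurable
    then show "wt l s * (\<integral>\<^sup>+t. wt l' t * Z s t \<partial>lborel) = wt l s * (\<integral>\<^sup>+u. indicator {0<..} u * (wt l' (s + u) * Z s (s + u)) \<partial>lborel)
      + wt l s * (\<integral>\<^sup>+t. indicator {0<..} (s - t) * (wt l' t * Z s t) \<partial>lborel)"
      by (simp add: distrib_left)
  qed
  also have "\<dots> = (\<integral>\<^sup>+s. wt l s * (\<integral>\<^sup>+u. indicator {0<..} u * (wt l' (s + u) * Z s (s + u)) \<partial>lborel) \<partial>lborel)
      + (\<integral>\<^sup>+s. wt l s * (\<integral>\<^sup>+t. indicator {0<..} (s - t) * (wt l' t * Z s t) \<partial>lborel) \<partial>lborel)"
    by (rule nn_integral_add) measurable
  also have "(\<integral>\<^sup>+s. wt l s * (\<integral>\<^sup>+u. indicator {0<..} u * (wt l' (s + u) * Z s (s + u)) \<partial>lborel) \<partial>lborel)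
    = (\<integral>\<^sup>+s. wt (l + l') s * Nx (map (\<lambda>(r, K). (r, cv K B)) L) (\<lambda>p. f (jn (a @ b) s p)) \<partial>lborel)"
  proof (intro nn_integral_cong)
    fix s
    have "wt l s * (\<integral>\<^sup>+u. indicator {0<..} u * (wt l' (s + u) * Z s (s + u)) \<partial>lborel)
      = (\<integral>\<^sup>+u. wt l s * (indicator {0<..} u * (wt l' (s + u) * Z s (s + u))) \<partial>lborel)"
      by (rule nn_integral_cmult[symmetric]) measurable
    also have "\<dots> = (\<integral>\<^sup>+u. wt (l + l') s * (indicator {0<..} u * (wt l' u * Z s (s + u))) \<partial>lborel)"
    proof (intro nn_integral_cong)
      fix u
      show "wt l s * (indicator {0<..} u * (wt l' (s + u) * Z s (s + u))) = wt (l + l') s * (indicator {0<..} u * (wt l' u * Z s (s + u)))"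
      proof (cases "0 < u")
        case True
        then show ?thesis using wt_add[OF True, of l s l'] by (simp add: mult.assoc[symmetric])
      qed simp
    qed
    also have "\<dots> = wt (l + l') s * (\<integral>\<^sup>+u. indicator {0<..} u * (wt l' u * Z s (s + u)) \<partial>lborel)"
      by (rule nn_integral_cmult) measurable
    also have "(\<integral>\<^sup>+u. indicator {0<..} u * (wt l' u * Z s (s + u)) \<partial>lborel) = (\<integral>\<^sup>+u. indicator {0<..} u *
       (wt l' u * Nx L (\<lambda>p. Nx L' (\<lambda>q. f (jn (a @ b) s (cat p (jn b u q)))))) \<partial>lborel)"
      unfolding Z_def by (intro nn_integral_cong) (auto simp: cat_jn_less indicator_def)
    also have "\<dots> = (\<integral>\<^sup>+u. wt l' u * Nx L (\<lambda>p. Nx L' (\<lambda>q. f (jn (a @ b) s (cat p (jn b u q))))) \<partial>lborel)"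
      by (rule wt_pos_cong)
    also have "\<dots> = (\<integral>\<^sup>+u. Nx L (\<lambda>p. wt l' u * Nx L' (\<lambda>q. f (jn (a @ b) s (cat p (jn b u q))))) \<partial>lborel)"
    proof (intro nn_integral_cong)
      fix u
      show "wt l' u * Nx L (\<lambda>p. Nx L' (\<lambda>q. f (jn (a @ b) s (cat p (jn b u q))))) = Nx L (\<lambda>p. wt l' u * Nx L' (\<lambda>q. f (jn (a @ b) s (cat p (jn b u q)))))"
        by (rule Nx_cmult[symmetric, OF A(2)]) measurable
    qed
    also have "\<dots> = Nx L (\<lambda>p. \<integral>\<^sup>+u. wt l' u * Nx L' (\<lambda>q. f (jn (a @ b) s (cat p (jn b u q)))) \<partial>lborel)"
      by (rule Nx_swap[OF lborel.sigma_finite_measure_axioms A(2)]) measurable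
    \<comment> \<open>The first-event equation of B is read backwards: a fresh wait u followed by a
      continuation is again a path of law B.\<close>
    also have "\<dots> = Nx L (\<lambda>p. \<integral>\<^sup>+q. f (jn (a @ b) s (cat p q)) \<partial>B)"
    proof (rule Nx_cong[OF A(2)])
      fix p :: "real \<Rightarrow> 'a list" assume [simp]: "rc p"
      show "(\<integral>\<^sup>+u. wt l' u * Nx L' (\<lambda>q. f (jn (a @ b) s (cat p (jn b u q)))) \<partial>lborel) = (\<integral>\<^sup>+q. f (jn (a @ b) s (cat p q)) \<partial>B)"
        unfolding l'_def by (rule first_eventD[OF B(3), symmetric]) (use f1 in auto)
    qed
    also have "\<dots> = Nx (map (\<lambda>(r, K). (r, cv K B)) L) (\<lambda>p. f (jn (a @ b) s p))"
      by (rule Nx_map_cv_left[symmetric, OF A(2) B(1)]) measurable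
    finally show "wt l s * (\<integral>\<^sup>+u. indicator {0<..} u * (wt l' (s + u) * Z s (s + u)) \<partial>lborel) =
      wt (l + l') s * Nx (map (\<lambda>(r, K). (r, cv K B)) L) (\<lambda>p. f (jn (a @ b) s p))" .
  qed
  also have "(\<integral>\<^sup>+s. wt l s * (\<integral>\<^sup>+t. indicator {0<..} (s - t) * (wt l' t * Z s t) \<partial>lborel) \<partial>lborel)
    = (\<integral>\<^sup>+t. wt (l + l') t * Nx (map (\<lambda>(r, K). (r, cv A K)) L') (\<lambda>p. f (jn (a @ b) t p)) \<partial>lborel)"
  proof -
    have "(\<integral>\<^sup>+s. wt l s * (\<integral>\<^sup>+t. indicator {0<..} (s - t) * (wt l' t * Z s t) \<partial>lborel) \<partial>lborel)
      = (\<integral>\<^sup>+s. \<integral>\<^sup>+t. wt l s * (indicator {0<..} (s - t) * (wt l' t * Z s t)) \<partial>lborel \<partial>lborel)"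
      by (subst nn_integral_cmult[symmetric]) (auto intro!: nn_integral_cong simp: indicator_def)
    also have "\<dots> = (\<integral>\<^sup>+t. \<integral>\<^sup>+s. wt l s * (indicator {0<..} (s - t) * (wt l' t * Z s t)) \<partial>lborel \<partial>lborel)"
      by (rule lborel_pair.Fubini') measurable
    also have "\<dots> = (\<integral>\<^sup>+t. wt (l + l') t * Nx (map (\<lambda>(r, K). (r, cv A K)) L') (\<lambda>p. f (jn (a @ b) t p)) \<partial>lborel)"
    proof (intro nn_integral_cong)
      fix t
      have "(\<integral>\<^sup>+s. wt l s * (indicator {0<..} (s - t) * (wt l' t * Z s t)) \<partial>lborel) =
        (\<integral>\<^sup>+u. wt l (t + u) * (indicator {0<..} (t + u - t) * (wt l' t * Z (t + u) t)) \<partial>lborel)"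
        by (rule nn_integral_translate) measurable
      also have "\<dots> = (\<integral>\<^sup>+u. wt (l + l') t * (indicator {0<..} u * (wt l u * Z (t + u) t)) \<partial>lborel)"
      proof (intro nn_integral_cong)
        fix u
        show "wt l (t + u) * (indicator {0<..} (t + u - t) * (wt l' t * Z (t + u) t)) = wt (l + l') t * (indicator {0<..} u * (wt l u * Z (t + u) t))"
        proof (cases "0 < u")
          case True
          have "wt l (t + u) * (wt l' t * Z (t + u) t) = wt l' t * wt l (t + u) * Z (t + u) t" by (simp add: ac_simps)
          also have "\<dots> = wt (l + l') t * wt l u * Z (t + u) t" unfolding wt_add[OF True] by (simp add: add.commute)
          finally show ?thesis using True by (simp add: mult.assoc)
        qed simp
      qed
      also have "\<dots> = wt (l + l') t * (\<integral>\<^sup>+u. indicator {0<..} u * (wt l u * Z (t + u) t) \<partial>lborel)"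
        by (rule nn_integral_cmult) measurable
      also have "(\<integral>\<^sup>+u. indicator {0<..} u * (wt l u * Z (t + u) t) \<partial>lborel) = (\<integral>\<^sup>+u. indicator {0<..} u *
         (wt l u * Nx L' (\<lambda>q. Nx L (\<lambda>p. f (jn (a @ b) t (cat (jn a u p) q))))) \<partial>lborel)"
      proof (intro nn_integral_cong)
        fix u
        have "Z (t + u) t = Nx L' (\<lambda>q. Nx L (\<lambda>p. f (jn (a @ b) t (cat (jn a u p) q))))" if "0 < u"
          unfolding Z_def using that
          by (subst Nx_Nx_swap[OF A(2) B(2)]) (auto simp: cat_jn_less)
        then show "indicator {0<..} u * (wt l u * Z (t + u) t) = indicator {0<..} u *
         (wt l u * Nx L' (\<lambda>q. Nx L (\<lambda>p. f (jn (a @ b) t (cat (jn a u p) q)))))"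
          by (simp add: indicator_def)
      qed
      also have "\<dots> = (\<integral>\<^sup>+u. wt l u * Nx L' (\<lambda>q. Nx L (\<lambda>p. f (jn (a @ b) t (cat (jn a u p) q)))) \<partial>lborel)"
        by (rule wt_pos_cong)
      also have "\<dots> = (\<integral>\<^sup>+u. Nx L' (\<lambda>q. wt l u * Nx L (\<lambda>p. f (jn (a @ b) t (cat (jn a u p) q)))) \<partial>lborel)"
      proof (intro nn_integral_cong)
        fix u
        show "wt l u * Nx L' (\<lambda>q. Nx L (\<lambda>p. f (jn (a @ b) t (cat (jn a u p) q)))) = Nx L' (\<lambda>q. wt l u * Nx L (\<lambda>p. f (jn (a @ b) t (cat (jn a u p) q))))"
          by (rule Nx_cmult[symmetric, OF B(2)]) measurable
      qed
      also have "\<dots> = Nx L' (\<lambda>q. \<integral>\<^sup>+u. wt l u * Nx L (\<lambda>p. f (jn (a @ b) t (cat (jn a u p) q))) \<partial>lborel)"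
        by (rule Nx_swap[OF lborel.sigma_finite_measure_axioms B(2)]) measurable
      \<comment> \<open>Likewise, with the right component moving first and the law A restored on
        the left.\<close>
      also have "\<dots> = Nx L' (\<lambda>q. \<integral>\<^sup>+p. f (jn (a @ b) t (cat p q)) \<partial>A)"
      proof (rule Nx_cong[OF B(2)])
        fix q :: "real \<Rightarrow> 'a list" assume [simp]: "rc q"
        show "(\<integral>\<^sup>+u. wt l u * Nx L (\<lambda>p. f (jn (a @ b) t (cat (jn a u p) q))) \<partial>lborel) = (\<integral>\<^sup>+p. f (jn (a @ b) t (cat p q)) \<partial>A)"
          unfolding l_def by (rule first_eventD[OF A(3), symmetric]) (use f1 in auto)
      qed
      also have "\<dots> = Nx (map (\<lambda>(r, K). (r, cv A K)) L') (\<lambda>p. f (jn (a @ b) t p))"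
        by (rule Nx_map_cv_right[symmetric, OF B(2) A(1)]) measurable
      finally show "(\<integral>\<^sup>+s. wt l s * (indicator {0<..} (s - t) * (wt l' t * Z s t)) \<partial>lborel) =
        wt (l + l') t * Nx (map (\<lambda>(r, K). (r, cv A K)) L') (\<lambda>p. f (jn (a @ b) t p))" .
    qed
    finally show ?thesis .
  qed
  finally show "(\<integral>\<^sup>+p. f p \<partial>cv A B) = (\<integral>\<^sup>+s. wt (tot (map (\<lambda>(r, K). (r, cv K B)) L @ map (\<lambda>(r, K). (r, cv A K)) L')) s *
     Nx (map (\<lambda>(r, K). (r, cv K B)) L @ map (\<lambda>(r, K). (r, cv A K)) L') (\<lambda>p. f (jn (a @ b) s p)) \<partial>lborel)"
  proof -
    have r: "rates (map (\<lambda>(r, K). (r, cv K B)) L)" "rates (map (\<lambda>(r, K). (r, cv A K)) L')"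
      using A B by (auto simp: rates_def intro!: path_law_cv)
    note [measurable] = r
    assume "(\<integral>\<^sup>+p. f p \<partial>cv A B) = (\<integral>\<^sup>+s. wt (l + l') s * Nx (map (\<lambda>(r, K). (r, cv K B)) L) (\<lambda>p. f (jn (a @ b) s p)) \<partial>lborel)
      + (\<integral>\<^sup>+t. wt (l + l') t * Nx (map (\<lambda>(r, K). (r, cv A K)) L') (\<lambda>p. f (jn (a @ b) t p)) \<partial>lborel)"
    moreover have "tot (map (\<lambda>(r, K). (r, cv K B)) L @ map (\<lambda>(r, K). (r, cv A K)) L') = l + l'"
      unfolding map_append sum_list_append tot_map l_def l'_def ..
    ultimately show ?thesis
      by (simp only: Nx_append distrib_left) (simp add: nn_integral_add)
  qed
qed

lemma Nx_add:
  "rates L \<Longrightarrow> F \<in> borel_measurable path_space \<Longrightarrow> G \<in> borel_measurable path_space \<Longrightarrow>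
    Nx L (\<lambda>p. F p + G p) = Nx L F + Nx L G"
proof (induction L)
  case (Cons y L)
  obtain r K where y: "y = (r, K)" by (cases y)
  have [measurable_cong]: "sets K = sets path_space" using Cons y path_lawD by auto
  note [measurable] = Cons.prems(2,3)
  show ?case using Cons by (simp add: y nn_integral_add distrib_left ac_simps)
qed simp

text \<open>Continuations matter only through their values at times \<ge> 0. Laws that differ before
  time 0 may be exchanged, which is how an emptied clade is removed.\<close>

lemma first_event_Nx_cong:
  assumes "first_event A a L" "tot L = tot L'"
    and "\<And>f s. f \<in> borel_measurable path_space \<Longrightarrow> Nx L (\<lambda>p. f (jn a s p)) = Nx L' (\<lambda>p. f (jn a s p))"
  shows "first_event A a L'"
  using assms unfolding first_event_def by simp

lemma sum_list_mset_cong: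
  fixes h :: "'a \<Rightarrow> 'b::comm_monoid_add"
  assumes "mset L = mset L'" shows "sum_list (map h L) = sum_list (map h L')"
  unfolding sum_mset_sum_list[symmetric] mset_map assms ..

lemma first_event_mset:
  assumes "mset L = mset L'" "first_event A a L" shows "first_event A a L'"
  using assms(2) sum_list_mset_cong[OF assms(1)]
  by (rule first_event_Nx_cong) (simp add: Nx_def sum_list_mset_cong[OF assms(1)])

section \<open>First-event equation of a clade\<close>

context spindle
begin

lemma path_law_cl: "path_law (cl n)"
  using prob_space_cl by (simp add: path_law_def)

text \<open>Below the first root jump at s there is either no root birth, or a lowest one at b < s.
  The probability exp(-\<alpha> s) of the former raises the rate 2 * n - \<alpha> of the root to 2 *
  n; in the latter case the birth at b is the first event, and what is left of it, seen from b, is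
  again a clade with root size n.\<close>

lemma first_event_cl:
  assumes n: "1 \<le> n"
  shows "first_event (cl n) [n] [(real n - \<alpha>, cl (n + 1)), (real n, cl (n - 1)), (\<alpha>, cv (cl n) (cl 1))]"
  unfolding first_event_def
proof (intro ballI impI)
  fix f :: "(real \<Rightarrow> nat list) \<Rightarrow> ennreal"
  assume f [measurable]: "f \<in> borel_measurable path_space" and f1: "\<forall>p. f p \<le> 1"
  define N where "N = [(real n - \<alpha>, cl (n + 1)), (real n, cl (n - 1))]"
  define l where "l = 2 * real n - \<alpha>"
  have N: "rates N" using real_ge[OF n] by (auto simp: N_def path_law_cl)
  note [measurable] = N path_law_cl
  have first: "(\<integral>\<^sup>+p. g p \<partial>cl n) = (\<integral>\<^sup>+s. wt l s * Nx N (\<lambda>r. kap s (\<lambda>q. g (cat (jn [n] s r) q))) \<partial>lborel)"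
    if "g \<in> borel_measurable path_space" for g
    using cl_first_jump[OF n that] by (simp add: wt_def l_def N_def)
  define Y where "Y s b = Nx N (\<lambda>r. kap (s - b) (\<lambda>p. \<integral>\<^sup>+r'. f (cat (jn [n] s r) (cat (jn [] b p) (jn [] b r'))) \<partial>cl 1))" for s b
  have [measurable]: "(\<lambda>(s, b). Y s b) \<in> borel_measurable (borel \<Otimes>\<^sub>M borel)" unfolding Y_def by measurable
  define G where "G b p = (\<integral>\<^sup>+r'. f (jn [n] b (cat p r')) \<partial>cl 1)" for b p
  have Gm [measurable]: "G b \<in> borel_measurable path_space" for b unfolding G_def by measurable
  have dec: "Nx N (\<lambda>r. kap s (\<lambda>q. f (cat (jn [n] s r) q))) = ennreal (exp (- \<alpha> * s)) * Nx N (\<lambda>r. f (jn [n] s r)) +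
      (\<integral>\<^sup>+b. gapr s b * Y s b \<partial>lborel)" if s: "0 \<le> s" for s
  proof -
    have "Nx N (\<lambda>r. kap s (\<lambda>q. f (cat (jn [n] s r) q))) = Nx N (\<lambda>r. last_dec s (\<lambda>q. f (cat (jn [n] s r) q)))"
      by (intro Nx_cong N kap_eq_last_dec s) (use f1 in auto)
    also have "\<dots> = ennreal (exp (- \<alpha> * s)) * Nx N (\<lambda>r. f (jn [n] s r)) +
      Nx N (\<lambda>r. \<integral>\<^sup>+b. gapr s b * kap (s - b) (\<lambda>p. \<integral>\<^sup>+r'. f (cat (jn [n] s r) (cat (jn [] b p) (jn [] b r'))) \<partial>cl 1) \<partial>lborel)"
      unfolding last_dec_def by (simp add: Nx_add[OF N] Nx_cmult[OF N])
    also have "Nx N (\<lambda>r. \<integral>\<^sup>+b. gapr s b * kap (s - b) (\<lambda>p. \<integral>\<^sup>+r'. f (cat (jn [n] s r) (cat (jn [] b p) (jn [] b r'))) \<partial>cl 1) \<partial>lborel)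
      = (\<integral>\<^sup>+b. Nx N (\<lambda>r. gapr s b * kap (s - b) (\<lambda>p. \<integral>\<^sup>+r'. f (cat (jn [n] s r) (cat (jn [] b p) (jn [] b r'))) \<partial>cl 1)) \<partial>lborel)"
      by (rule Nx_swap[symmetric, OF lborel.sigma_finite_measure_axioms N]) measurable
    also have "\<dots> = (\<integral>\<^sup>+b. gapr s b * Y s b \<partial>lborel)"
      unfolding Y_def by (intro nn_integral_cong Nx_cmult[OF N]) measurable
    finally show ?thesis .
  qed
  have "(\<integral>\<^sup>+p. f p \<partial>cl n) = (\<integral>\<^sup>+s. wt (2 * real n) s * Nx N (\<lambda>r. f (jn [n] s r)) + (\<integral>\<^sup>+b. wt l s * gapr s b * Y s b \<partial>lborel) \<partial>lborel)"
    unfolding first[OF f]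
  proof (intro nn_integral_cong)
    fix s
    show "wt l s * Nx N (\<lambda>r. kap s (\<lambda>q. f (cat (jn [n] s r) q))) =
      wt (2 * real n) s * Nx N (\<lambda>r. f (jn [n] s r)) + (\<integral>\<^sup>+b. wt l s * gapr s b * Y s b \<partial>lborel)"
    proof (cases "0 \<le> s")
      case True
      \<comment> \<open>The root clock has rate 2 * n - \<alpha>; surviving the birth clock of rate
        \<alpha> adds up to the total rate.\<close>
      have "wt l s * ennreal (exp (- \<alpha> * s)) = wt (2 * real n) s"
        using True by (simp add: wt_def l_def ennreal_mult[symmetric] exp_add[symmetric] algebra_simps)
      moreover have "(\<integral>\<^sup>+b. wt l s * gapr s b * Y s b \<partial>lborel) = wt l s * (\<integral>\<^sup>+b. gapr s b * Y s b \<partial>lborel)"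
        by (simp add: mult.assoc nn_integral_cmult)
      ultimately show ?thesis unfolding dec[OF True] by (simp add: distrib_left mult.assoc[symmetric])
    qed (simp add: wt_def)
  qed
  also have "\<dots> = (\<integral>\<^sup>+s. wt (2 * real n) s * Nx N (\<lambda>r. f (jn [n] s r)) \<partial>lborel) + (\<integral>\<^sup>+s. \<integral>\<^sup>+b. wt l s * gapr s b * Y s b \<partial>lborel \<partial>lborel)"
    by (rule nn_integral_add) measurable
  also have "(\<integral>\<^sup>+s. \<integral>\<^sup>+b. wt l s * gapr s b * Y s b \<partial>lborel \<partial>lborel) = (\<integral>\<^sup>+b. \<integral>\<^sup>+s. wt l s * gapr s b * Y s b \<partial>lborel \<partial>lborel)"
    by (rule lborel_pair.Fubini') measurable
  also have "\<dots> = (\<integral>\<^sup>+b. indicator {0<..} b * (wt (2 * real n) b * (ennreal \<alpha> * (\<integral>\<^sup>+p. f (jn [n] b p) \<partial>cv (cl n) (cl 1)))) \<partial>lborel)"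
  proof (intro nn_integral_cong)
    fix b :: real
    have "(\<integral>\<^sup>+s. wt l s * gapr s b * Y s b \<partial>lborel) = (\<integral>\<^sup>+u. wt l (b + u) * gapr (b + u) b * Y (b + u) b \<partial>lborel)"
      by (rule nn_integral_translate) measurable
    also have "\<dots> = (\<integral>\<^sup>+u. (indicator {0<..} b * (wt (2 * real n) b * ennreal \<alpha>)) *
       (indicator {0<..} u * (wt l u * Nx N (\<lambda>r. kap u (\<lambda>q. G b (cat (jn [n] u r) q))))) \<partial>lborel)"
    proof (intro nn_integral_cong)
      fix u :: real
      show "wt l (b + u) * gapr (b + u) b * Y (b + u) b = (indicator {0<..} b * (wt (2 * real n) b * ennreal \<alpha>)) *
       (indicator {0<..} u * (wt l u * Nx N (\<lambda>r. kap u (\<lambda>q. G b (cat (jn [n] u r) q)))))"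
      proof (cases "0 < u \<and> 0 < b")
        case True
        \<comment> \<open>With s = b + u the weight factorises: the first event is a birth at b
          under total rate 2 * n, and the residual root clock u has its original rate l.\<close>
        have "exp (- l * (b + u)) * (\<alpha> * exp (- \<alpha> * b)) = (exp (- (2 * real n) * b) * \<alpha>) * exp (- l * u)"
          by (simp add: l_def exp_add[symmetric] algebra_simps)
        then have w: "wt l (b + u) * gapr (b + u) b = wt (2 * real n) b * ennreal \<alpha> * wt l u"
          using True \<alpha>0 by (simp add: wt_def gapr_def ennreal_mult[symmetric])
        \<comment> \<open>All three pieces rest in state n with nothing to the right until b; from
          there the older forest stands left of the new clade r'.\<close>
        have path: "cat (jn [n] (b + u) r) (cat (jn [] b p) (jn [] b r')) = jn [n] b (cat (cat (jn [n] u r) p) r')" for r p r'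
          using True by (simp add: jn_jn[symmetric] cat_jn cat_assoc)
        have "Y (b + u) b = Nx N (\<lambda>r. kap u (\<lambda>q. G b (cat (jn [n] u r) q)))"
          unfolding Y_def G_def path by simp
        then show ?thesis using True w by (simp add: mult.assoc)
      qed (auto simp: gapr_def indicator_def)
    qed
    also have "\<dots> = (indicator {0<..} b * (wt (2 * real n) b * ennreal \<alpha>)) *
       (\<integral>\<^sup>+u. indicator {0<..} u * (wt l u * Nx N (\<lambda>r. kap u (\<lambda>q. G b (cat (jn [n] u r) q)))) \<partial>lborel)"
      by (rule nn_integral_cmult) measurable
    \<comment> \<open>The decomposition at the root jump is read backwards from level b on, which
      reassembles a full clade of root size n.\<close>
    also have "(\<integral>\<^sup>+u. indicator {0<..} u * (wt l u * Nx N (\<lambda>r. kap u (\<lambda>q. G b (cat (jn [n] u r) q)))) \<partial>lborel) = (\<integral>\<^sup>+p. G b p \<partial>cl n)"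
      unfolding wt_pos_cong by (rule first[symmetric]) measurable
    also have "(\<integral>\<^sup>+p. G b p \<partial>cl n) = (\<integral>\<^sup>+p. f (jn [n] b p) \<partial>cv (cl n) (cl 1))"
      unfolding G_def by (rule nn_integral_cv[symmetric]) (auto simp: path_law_cl)
    finally show "(\<integral>\<^sup>+s. wt l s * gapr s b * Y s b \<partial>lborel) =
      indicator {0<..} b * (wt (2 * real n) b * (ennreal \<alpha> * (\<integral>\<^sup>+p. f (jn [n] b p) \<partial>cv (cl n) (cl 1))))"
      by (simp add: mult.assoc)
  qed
  also have "\<dots> = (\<integral>\<^sup>+b. wt (2 * real n) b * (ennreal \<alpha> * (\<integral>\<^sup>+p. f (jn [n] b p) \<partial>cv (cl n) (cl 1))) \<partial>lborel)"
    by (rule wt_pos_cong)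
  finally have "(\<integral>\<^sup>+p. f p \<partial>cl n) = (\<integral>\<^sup>+s. wt (2 * real n) s * Nx N (\<lambda>r. f (jn [n] s r)) +
      wt (2 * real n) s * (ennreal \<alpha> * (\<integral>\<^sup>+p. f (jn [n] s p) \<partial>cv (cl n) (cl 1))) \<partial>lborel)"
    using path_law_cv[OF path_law_cl[of n] path_law_cl[of 1]]
    by (subst nn_integral_add) auto
  then show "(\<integral>\<^sup>+p. f p \<partial>cl n) = (\<integral>\<^sup>+s. wt (tot [(real n - \<alpha>, cl (n + 1)), (real n, cl (n - 1)), (\<alpha>, cv (cl n) (cl 1))]) s *
     Nx [(real n - \<alpha>, cl (n + 1)), (real n, cl (n - 1)), (\<alpha>, cv (cl n) (cl 1))] (\<lambda>p. f (jn [n] s p)) \<partial>lborel)"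
    by (simp add: N_def distrib_left add.assoc)
qed

text \<open>A birth occurs only if the gap is strictly shorter than the height, hence at a strictly
  positive level.\<close>

lemma sk_at_0: "sk h e z 0 = []"
proof -
  have "skn K h e z 0 = []" for K
  proof (induction K arbitrary: h e z)
    case (Suc K)
    have "0 < h - enn2real (e 0)" if "e 0 < ennreal h"
    proof (cases "e 0")
      case (real x)
      then show ?thesis using that by (cases "0 \<le> h") (auto simp: ennreal_less_iff ennreal_neg)
    qed (use that in auto)
    then show ?case using Suc by (auto simp: cat_def jn_def)
  qed simp
  then show ?thesis by (simp add: sk_def)
qed

lemma cl_start:
  assumes n: "1 \<le> n" shows "(\<integral>\<^sup>+p. (if p 0 = [n] then 0 else 1) \<partial>cl n) = 0"
proof -
  have "(\<integral>\<^sup>+p. (if p 0 = [n] then 0 else 1) \<partial>cl n) =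
    (\<integral>\<^sup>+z. kap (zeta z) (\<lambda>p. if cat (rp z) p 0 = [n] then 0 else 1) \<partial>Q n)"
    by (rule nn_integral_cl) measurable
  also have "\<dots> = (\<integral>\<^sup>+z. 0 \<partial>Q n)"
  proof (rule nn_integral_cong_AE, use AE_Q_hits[of n] AE_Q_start[of n] AE_Q_rc[of n] in eventually_elim)
    case (elim z)
    then have "rp z 0 = [n]" using zeta_pos[of z] n by (simp add: rp_def)
    then have "cat (rp z) (sk (zeta z) e z') 0 = [n]" for e z' by (simp add: cat_def sk_at_0)
    then show ?case unfolding kap_def by (simp cong: if_cong)
  qed
  finally show ?thesis by simp
qed

text \<open>The root has lifetime 0 and no births. Before time 0 an entry 0 remains, because
  \<open>rp\<close> only compares y with the lifetime; hence not simply \<open>nil\<close>.\<close>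

lemma cl_0:
  assumes [measurable]: "f \<in> borel_measurable path_space"
  shows "(\<integral>\<^sup>+p. f p \<partial>cl 0) = f (\<lambda>y. if y < 0 then [0] else [])"
proof -
  have z: "zeta (\<lambda>_. 0) = 0" using zeta_char(1)[of "\<lambda>_. 0" 0] by simp
  then have rp: "rp (\<lambda>_. 0) = (\<lambda>y. if y < 0 then [0] else [])" by (auto simp: rp_def fun_eq_iff)
  have rc: "rc (\<lambda>y::real. if y < 0 then [0] else [] :: nat list)" using rc_rp[of "\<lambda>_. 0"] by (simp add: rp)
  have "(\<integral>\<^sup>+p. f p \<partial>cl 0) = (\<integral>\<^sup>+z. kap (zeta z) (\<lambda>p. f (cat (rp z) p)) \<partial>Q 0)"
    by (rule nn_integral_cl) measurable
  also have "\<dots> = kap 0 (\<lambda>p. f (cat (rp (\<lambda>_. 0)) p))"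
    by (subst Q_0) (auto simp: z)
  also have "\<dots> = f (\<lambda>y. if y < 0 then [0] else [])"
    using rc by (subst kap_step) (auto simp: rp gapd_def)
  finally show ?thesis .
qed

text \<open>A prefix of the form \<open>jn a s\<close> hides what happens before time 0, so the
  deleted block leaves no trace.\<close>

lemma Nx_cv_cl_0:
  assumes A: "path_law A" and f [measurable]: "f \<in> borel_measurable path_space"
  shows "(\<integral>\<^sup>+p. f (jn a s p) \<partial>cv A (cl 0)) = (\<integral>\<^sup>+p. f (jn a s p) \<partial>A)"
proof -
  have eq: "jn a s (cat p (\<lambda>y. if y < 0 then [0] else [])) = jn a s p" for p
    by (auto simp: jn_def cat_def fun_eq_iff)
  have "(\<integral>\<^sup>+p. f (jn a s p) \<partial>cv A (cl 0)) = (\<integral>\<^sup>+p. \<integral>\<^sup>+q. f (jn a s (cat p q)) \<partial>cl 0 \<partial>A)"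
    by (rule nn_integral_cv) (auto simp: A path_law_cl)
  also have "\<dots> = (\<integral>\<^sup>+p. f (jn a s p) \<partial>A)"
  proof (intro nn_integral_cong)
    fix p assume "p \<in> space A"
    then have [simp]: "rc p" using path_lawD(3)[OF A] by simp
    show "(\<integral>\<^sup>+q. f (jn a s (cat p q)) \<partial>cl 0) = f (jn a s p)"
      by (subst cl_0) (auto simp: eq)
  qed
  finally show ?thesis .
qed

end

section \<open>Immigration\<close>

text \<open>a are the gaps between the immigration levels and p the immigrating clade paths; the most recent
  immigrant comes first.\<close>

primrec imn :: "nat \<Rightarrow> (nat \<Rightarrow> ennreal) \<Rightarrow> (nat \<Rightarrow> real \<Rightarrow> nat list) \<Rightarrow> real \<Rightarrow> nat list" where
  "imn 0 a p = nil"
| "imn (Suc K) a p = jn [] (enn2real (a 0)) (cat (imn K (\<lambda>i. a (Suc i)) (\<lambda>i. p (Suc i))) (p 0))"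

definition imgood :: "(nat \<Rightarrow> ennreal) \<Rightarrow> bool" where
  "imgood a \<longleftrightarrow> (\<forall>i. 0 < a i \<and> a i < top) \<and> (\<Sum>i. a i) = top"

text \<open>The immigration levels tend to infinity, so at level y the immigrants beyond a finite
  index, depending on y, are not yet visible; one finite truncation gives the value. Ill-behaved
  gaps, a null set, get the default \<open>nil\<close>.\<close>

definition imp :: "(nat \<Rightarrow> ennreal) \<Rightarrow> (nat \<Rightarrow> real \<Rightarrow> nat list) \<Rightarrow> real \<Rightarrow> nat list" where
  "imp a p = (if imgood a then (\<lambda>y. imn (LEAST K. ennreal y < (\<Sum>i\<le>K. a i)) a p y) else nil)"

lemma imgood_tl: "imgood a \<Longrightarrow> imgood (\<lambda>i. a (Suc i))"
  unfolding imgood_def using suminf_top_tail[of a] by (auto simp: less_top)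

lemma imn_before: "y < enn2real (a 0) \<Longrightarrow> imn K a p y = []"
  by (cases K) (auto simp: jn_def)

lemma imn_stable:
  assumes "\<And>i. a i < top" "ennreal y < (\<Sum>i\<le>K. a i)" "K \<le> K'"
  shows "imn K' a p y = imn K a p y"
  using assms
proof (induction K arbitrary: a p y K')
  case 0
  obtain x where x: "a 0 = ennreal x" "0 \<le> x" using 0(1)[of 0] by (cases "a 0") auto
  have "y < x" using 0 x by (cases "0 \<le> y") (auto simp: ennreal_less_iff)
  then show ?case using imn_before[of y a] x by simp
next
  case (Suc K)
  obtain x where x: "a 0 = ennreal x" "0 \<le> x" using Suc.prems(1)[of 0] by (cases "a 0") auto
  obtain K2 where K': "K' = Suc K2" "K \<le> K2" using Suc.prems(3) by (cases K') auto
  show ?case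
  proof (cases "y < x")
    case True
    then show ?thesis using imn_before[of y a] x by (simp del: imn.simps)
  next
    case False
    then have "ennreal y = ennreal x + ennreal (y - x)" using x by (simp flip: ennreal_plus)
    then have "ennreal (y - x) < (\<Sum>i\<le>K. a (Suc i))"
      using Suc.prems(2) x unfolding sum.atMost_Suc_shift by (simp add: ennreal_add_left_cancel_less)
    from Suc.IH[OF Suc.prems(1) this K'(2), of "\<lambda>i. p (Suc i)"] show ?thesis
      using x False by (simp add: K' jn_def cat_def)
  qed
qed

lemma imp_eq:
  assumes "imgood a" "ennreal y < (\<Sum>i\<le>K. a i)" shows "imp a p y = imn K a p y"
proof -
  let ?K = "LEAST K. ennreal y < (\<Sum>i\<le>K. a i)"
  have "ennreal y < (\<Sum>i\<le>?K. a i)" "?K \<le> K" using assms(2) by (auto intro: LeastI Least_le)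
  then have "imn K a p y = imn ?K a p y" using assms(1) by (intro imn_stable) (auto simp: imgood_def)
  then show ?thesis using assms by (simp add: imp_def)
qed

text \<open>Renewal at the first immigration level: up to it the skewer is empty, and from it on the
  immigrant's clade stands right of a fresh immigration process, as later immigrants arrive on the
  left.\<close>

lemma imp_rec:
  assumes "imgood a" shows "imp a p = jn [] (enn2real (a 0)) (cat (imp (\<lambda>i. a (Suc i)) (\<lambda>i. p (Suc i))) (p 0))"
proof
  fix y
  obtain x where x: "a 0 = ennreal x" "0 \<le> x" using assms by (cases "a 0") (auto simp: imgood_def less_top dest: spec[of _ 0])
  obtain K where K: "ennreal (y - x) < (\<Sum>i\<le>K. a (Suc i))"
    using imgood_tl[OF assms] suminf_top_ex[of "\<lambda>i. a (Suc i)" "y - x"] unfolding imgood_def by blast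
  have "ennreal y < (\<Sum>i\<le>Suc K. a i)"
  proof (cases "x \<le> y")
    case True
    then have "ennreal y = ennreal x + ennreal (y - x)" using x by (simp flip: ennreal_plus)
    then show ?thesis using K x unfolding sum.atMost_Suc_shift by (simp add: ennreal_add_left_cancel_less)
  next
    case False
    have "0 < a 0" using assms by (auto simp: imgood_def)
    then have "ennreal y < a 0" using False x by (cases "0 \<le> y") (auto simp: ennreal_less_iff ennreal_neg)
    also have "a 0 \<le> (\<Sum>i\<le>Suc K. a i)" unfolding sum.atMost_Suc_shift by simp
    finally show ?thesis .
  qed
  then have "imp a p y = imn (Suc K) a p y" by (rule imp_eq[OF assms])
  also have "\<dots> = jn [] (enn2real (a 0)) (cat (imp (\<lambda>i. a (Suc i)) (\<lambda>i. p (Suc i))) (p 0)) y"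
    using imp_eq[OF imgood_tl[OF assms] K, of "\<lambda>i. p (Suc i)"] x by (simp add: jn_def cat_def)
  finally show "imp a p y = jn [] (enn2real (a 0)) (cat (imp (\<lambda>i. a (Suc i)) (\<lambda>i. p (Suc i))) (p 0)) y" .
qed

lemma rc_imn: "(\<And>i. rc (p i)) \<Longrightarrow> rc (imn K a p)"
  by (induction K arbitrary: a p) auto

lemma rc_imp: assumes "\<And>i. rc (p i)" shows "rc (imp a p)"
proof (cases "imgood a")
  case True
  show ?thesis
  proof (rule rcI)
    fix t
    obtain K where K: "ennreal (t + 1) < (\<Sum>i\<le>K. a i)" using True suminf_top_ex[of a "t + 1"] unfolding imgood_def by blast
    obtain d where d: "d > 0" "\<And>u. t \<le> u \<Longrightarrow> u < t + d \<Longrightarrow> imn K a p u = imn K a p t"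
      using rcD[OF rc_imn[of p K a, OF assms], of t] by blast
    have eq: "imp a p u = imn K a p u" if "u \<le> t + 1" for u
      using that K by (intro imp_eq True) (meson ennreal_leI le_less_trans)
    have "imp a p u = imp a p t" if "t \<le> u" "u < t + min d 1" for u
    proof -
      have "imn K a p u = imn K a p t" using that by (intro d(2)) auto
      then show ?thesis using eq[of u] eq[of t] that by simp
    qed
    moreover have "0 < min d 1" using d(1) by simp
    ultimately show "\<exists>d>0. \<forall>u. t \<le> u \<and> u < t + d \<longrightarrow> imp a p u = imp a p t" by blast
  qed
qed (simp add: imp_def)

abbreviation SL :: "(nat \<Rightarrow> real \<Rightarrow> nat list) measure" where "SL \<equiv> PiM UNIV (\<lambda>_. path_space)"

lemma measurable_imn:
  assumes "a \<in> N \<rightarrow>\<^sub>M SE" "p \<in> N \<rightarrow>\<^sub>M SL"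
  shows "(\<lambda>x. imn K (a x) (p x)) \<in> N \<rightarrow>\<^sub>M path_space"
  using assms
proof (induction K arbitrary: a p)
  case (Suc K)
  note [measurable] = Suc.prems
  have [measurable]: "(\<lambda>x. a x 0) \<in> borel_measurable N" "(\<lambda>x. p x 0) \<in> N \<rightarrow>\<^sub>M path_space" by measurable
  note [measurable] = Suc.IH[OF measurable_seq_tail[OF Suc.prems(1)] measurable_seq_tail[OF Suc.prems(2)]]
  show ?case unfolding imn.simps by measurable
qed (simp add: measurable_nil)

lemma measurable_imgood [measurable (raw)]:
  assumes [measurable]: "a \<in> N \<rightarrow>\<^sub>M SE" shows "Measurable.pred N (\<lambda>x. imgood (a x))"
  unfolding imgood_def by measurable

lemma measurable_imp [measurable (raw)]:
  assumes a [measurable]: "a \<in> N \<rightarrow>\<^sub>M SE" and p [measurable]: "p \<in> N \<rightarrow>\<^sub>M SL"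
  shows "(\<lambda>x. imp (a x) (p x)) \<in> N \<rightarrow>\<^sub>M path_space"
proof (rule measurable_path_spaceI)
  show "rc (imp (a x) (p x))" if "x \<in> space N" for x
    using measurable_space[OF p that] by (intro rc_imp) (auto simp: space_PiM PiE_iff)
  fix y
  have [measurable]: "(\<lambda>x. imn K (a x) (p x) y) \<in> N \<rightarrow>\<^sub>M count_space UNIV" for K
    using measurable_imn[OF a p] by (rule measurable_compose) (rule measurable_path_eval_fixed)
  have [measurable]: "(\<lambda>x. LEAST K. ennreal y < (\<Sum>i\<le>K. a x i)) \<in> N \<rightarrow>\<^sub>M count_space UNIV" by measurable
  have [measurable]: "(\<lambda>x. imn (LEAST K. ennreal y < (\<Sum>i\<le>K. a x i)) (a x) (p x) y) \<in> N \<rightarrow>\<^sub>M count_space UNIV"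
    by (rule measurable_compose_countable[where f="\<lambda>K x. imn K (a x) (p x) y"]) measurable
  have "(\<lambda>x. if imgood (a x) then imn (LEAST K. ennreal y < (\<Sum>i\<le>K. a x i)) (a x) (p x) y else []) \<in> N \<rightarrow>\<^sub>M count_space UNIV"
    by measurable
  then show "(\<lambda>x. imp (a x) (p x) y) \<in> N \<rightarrow>\<^sub>M count_space UNIV"
    by (simp add: imp_def if_distrib[where f="\<lambda>p. p y"] cong: if_cong)
qed

locale immigration = spindle +
  fixes \<theta> :: real
  assumes \<theta>: "0 < \<theta>"
begin

definition "PA = PiM UNIV (\<lambda>_::nat. expo \<theta>)"
definition "PC = PiM UNIV (\<lambda>_::nat. cl 1)"

lemma sets_PA [measurable_cong]: "sets PA = sets SE" unfolding PA_def by (intro sets_PiM_cong) auto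
lemma sets_PC [measurable_cong]: "sets PC = sets SL" unfolding PC_def by (intro sets_PiM_cong) auto
lemma prob_space_PA: "prob_space PA" unfolding PA_def by (intro prob_space_PiM prob_space_expo)
lemma prob_space_PC: "prob_space PC" unfolding PC_def by (intro prob_space_PiM prob_space_cl)

definition im :: "(real \<Rightarrow> nat list) measure" where
  "im = distr (PA \<Otimes>\<^sub>M PC) path_space (\<lambda>(a, p). imp a p)"

lemma path_law_im: "path_law im"
proof -
  interpret A: prob_space PA by (rule prob_space_PA)
  interpret C: prob_space PC by (rule prob_space_PC)
  interpret X: pair_prob_space PA PC ..
  have "prob_space im" unfolding im_def by (rule X.P.prob_space_distr) measurable
  then show ?thesis by (simp add: path_law_def im_def)
qed

lemma nn_integral_im:
  assumes [measurable]: "f \<in> borel_measurable path_space"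
  shows "(\<integral>\<^sup>+p. f p \<partial>im) = (\<integral>\<^sup>+a. \<integral>\<^sup>+p. f (imp a p) \<partial>PC \<partial>PA)"
proof -
  interpret C: prob_space PC by (rule prob_space_PC)
  have "(\<integral>\<^sup>+p. f p \<partial>im) = (\<integral>\<^sup>+(a, p). f (imp a p) \<partial>(PA \<Otimes>\<^sub>M PC))"
    unfolding im_def by (subst nn_integral_distr) (auto simp: split_beta')
  also have "\<dots> = (\<integral>\<^sup>+a. \<integral>\<^sup>+p. f (imp a p) \<partial>PC \<partial>PA)"
    by (subst C.nn_integral_fst[symmetric]) (auto simp: split_beta')
  finally show ?thesis .
qed

lemma AE_imgood: "AE a in PA. imgood a"
proof -
  interpret A: prob_space PA by (rule prob_space_PA)
  have comp: "AE a in PA. P (a i)" if "AE e in expo \<theta>. P e" for P i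
    unfolding PA_def using AE_PiM_component[of UNIV "\<lambda>_. expo \<theta>" i P] that prob_space_expo by simp
  have 1: "AE a in PA. \<forall>i. 0 < a i \<and> a i < top"
    unfolding AE_all_countable using AE_expo_pos[of \<theta>] AE_expo_finite[OF \<theta>] \<theta> by (intro allI AE_conjI comp) auto
  have "AE a in PA. (\<Sum>i. a i) = top"
  proof (rule AE_suminf_top[OF _ \<theta>])
    fix k
    have E: "(\<integral>\<^sup>+a. (\<Prod>i<k. eexp (a i)) \<partial>PA) = ennreal ((\<theta> / (\<theta> + 2)) ^ k)"
    proof (induction k)
      case 0
      then show ?case by (simp add: A.emeasure_space_1)
    next
      case (Suc k)
      have "(\<integral>\<^sup>+a. (\<Prod>i<Suc k. eexp (a i)) \<partial>PA) = (\<integral>\<^sup>+e. \<integral>\<^sup>+a. eexp e * (\<Prod>i<k. eexp (a i)) \<partial>PA \<partial>expo \<theta>)"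
        unfolding PA_def
        by (subst nn_integral_seq_split[OF prob_space_expo]) (auto simp del: prod.lessThan_Suc simp add: prod.lessThan_Suc_shift)
      also have "\<dots> = (\<integral>\<^sup>+e. eexp e * ennreal ((\<theta> / (\<theta> + 2)) ^ k) \<partial>expo \<theta>)"
        by (subst nn_integral_cmult) (auto simp: Suc)
      also have "\<dots> = ennreal (\<theta> / (\<theta> + 2)) * ennreal ((\<theta> / (\<theta> + 2)) ^ k)"
        using \<theta> by (subst nn_integral_multc) (auto simp: nn_integral_eexp)
      finally show ?case using \<theta> by (simp add: ennreal_mult[symmetric])
    qed
    \<comment> \<open>Bernoulli's inequality brings the geometric bound into the form c / (c + 2 *
      k) that \<open>AE_suminf_top\<close> expects, with c = \<theta>.\<close>
    have "1 + real k * (2 / \<theta>) \<le> (1 + 2 / \<theta>) ^ k" using \<theta> by (intro Bernoulli_inequality) (simp add: order_trans[of _ 0])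
    then have "1 / (1 + 2 / \<theta>) ^ k \<le> 1 / (1 + real k * (2 / \<theta>))"
      using \<theta> by (intro divide_left_mono) (auto simp: add_pos_nonneg)
    also have "1 / (1 + 2 / \<theta>) ^ k = (\<theta> / (\<theta> + 2)) ^ k"
      using \<theta> by (simp add: power_one_over[symmetric] divide_simps)
    also have "1 / (1 + real k * (2 / \<theta>)) = \<theta> / (\<theta> + 2 * real k)" using \<theta> by (simp add: field_simps)
    finally show "(\<integral>\<^sup>+a. (\<Prod>i<k. eexp (a i)) \<partial>PA) \<le> ennreal (\<theta> / (\<theta> + 2 * real k))"
      unfolding E by (intro ennreal_leI)
  qed measurable
  with 1 show ?thesis by eventually_elim (simp add: imgood_def)
qed

text \<open>The first gap is exponential with rate \<theta>. The integrations are exchanged so that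
  the continuation reads as the concatenation of the remaining immigration, on the left, with one
  new clade.\<close>

lemma first_event_im: "first_event im [] [(\<theta>, cv im (cl 1))]"
  unfolding first_event_def
proof (intro ballI impI)
  fix f :: "(real \<Rightarrow> nat list) \<Rightarrow> ennreal"
  assume f [measurable]: "f \<in> borel_measurable path_space"
  interpret A: prob_space PA by (rule prob_space_PA)
  interpret C: prob_space PC by (rule prob_space_PC)
  interpret C1: prob_space "cl 1" by (rule prob_space_cl)
  interpret P: pair_sigma_finite PA "cl 1" ..
  interpret P2: pair_sigma_finite "cl 1" im using path_law_im path_lawD(4) C1.sigma_finite_measure_axioms by (auto simp: pair_sigma_finite_def)
  note [measurable] = path_law_im
  have [measurable_cong]: "sets im = sets path_space" using path_law_im path_lawD by auto
  let ?F = "\<lambda>e q r. f (jn [] (enn2real e) (cat q r))"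
  have "(\<integral>\<^sup>+p. f p \<partial>im) = (\<integral>\<^sup>+a. \<integral>\<^sup>+p. f (jn [] (enn2real (a 0)) (cat (imp (\<lambda>i. a (Suc i)) (\<lambda>i. p (Suc i))) (p 0))) \<partial>PC \<partial>PA)"
    unfolding nn_integral_im[OF f]
    by (rule nn_integral_cong_AE, use AE_imgood in eventually_elim) (simp add: imp_rec)
  also have "\<dots> = (\<integral>\<^sup>+e. \<integral>\<^sup>+a. \<integral>\<^sup>+p. f (jn [] (enn2real e) (cat (imp a (\<lambda>i. p (Suc i))) (p 0))) \<partial>PC \<partial>PA \<partial>expo \<theta>)"
    unfolding PA_def
    by (subst nn_integral_seq_split[OF prob_space_expo]) (auto simp flip: PA_def)
  also have "\<dots> = (\<integral>\<^sup>+e. \<integral>\<^sup>+a. \<integral>\<^sup>+r. \<integral>\<^sup>+p. ?F e (imp a p) r \<partial>PC \<partial>cl 1 \<partial>PA \<partial>expo \<theta>)"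
  proof (intro nn_integral_cong)
    fix e a
    have [measurable]: "(\<lambda>p. f (jn [] (enn2real e) (cat (imp a (\<lambda>i. p (Suc i))) (p 0)))) \<in> borel_measurable (PiM UNIV (\<lambda>_. cl 1))"
      by measurable
    show "(\<integral>\<^sup>+p. f (jn [] (enn2real e) (cat (imp a (\<lambda>i. p (Suc i))) (p 0))) \<partial>PC) = (\<integral>\<^sup>+r. \<integral>\<^sup>+p. ?F e (imp a p) r \<partial>PC \<partial>cl 1)"
      unfolding PC_def by (subst nn_integral_seq_split[OF prob_space_cl]) auto
  qed
  also have "\<dots> = (\<integral>\<^sup>+e. \<integral>\<^sup>+r. \<integral>\<^sup>+a. \<integral>\<^sup>+p. ?F e (imp a p) r \<partial>PC \<partial>PA \<partial>cl 1 \<partial>expo \<theta>)"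
    by (intro nn_integral_cong P.Fubini'[symmetric]) measurable
  also have "\<dots> = (\<integral>\<^sup>+e. \<integral>\<^sup>+r. \<integral>\<^sup>+q. ?F e q r \<partial>im \<partial>cl 1 \<partial>expo \<theta>)"
  proof (intro nn_integral_cong nn_integral_im[symmetric])
    fix e and r :: "real \<Rightarrow> nat list" assume "r \<in> space (cl 1)"
    then have [simp]: "rc r" using path_lawD(3)[OF path_law_cl] by simp
    show "(\<lambda>q. ?F e q r) \<in> borel_measurable path_space" by measurable
  qed
  also have "\<dots> = (\<integral>\<^sup>+e. \<integral>\<^sup>+q. \<integral>\<^sup>+r. ?F e q r \<partial>cl 1 \<partial>im \<partial>expo \<theta>)"
    by (intro nn_integral_cong P2.Fubini'[symmetric]) measurable
  also have "\<dots> = (\<integral>\<^sup>+e. \<integral>\<^sup>+p. f (jn [] (enn2real e) p) \<partial>cv im (cl 1) \<partial>expo \<theta>)"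
    by (intro nn_integral_cong nn_integral_cv[symmetric] path_law_im path_law_cl) measurable
  also have "\<dots> = (\<integral>\<^sup>+s. ennreal (\<theta> * exp (- \<theta> * s)) * indicator {0..} s * (\<integral>\<^sup>+p. f (jn [] s p) \<partial>cv im (cl 1)) \<partial>lborel)"
  proof -
    have [measurable]: "path_law (cv im (cl 1))" by (intro path_law_cv path_law_im path_law_cl)
    have "(\<lambda>e. \<integral>\<^sup>+p. f (jn [] (enn2real e) p) \<partial>cv im (cl 1)) \<in> borel_measurable borel" by measurable
    then show ?thesis by (subst nn_integral_expo[OF \<theta>]) (auto intro!: nn_integral_cong simp: indicator_def)
  qed
  also have "\<dots> = (\<integral>\<^sup>+s. wt (tot [(\<theta>, cv im (cl 1))]) s * Nx [(\<theta>, cv im (cl 1))] (\<lambda>p. f (jn [] s p)) \<partial>lborel)"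
    using \<theta> by (intro nn_integral_cong) (simp add: wt_def ennreal_mult ac_simps)
  finally show "(\<integral>\<^sup>+p. f p \<partial>im) = (\<integral>\<^sup>+s. wt (tot [(\<theta>, cv im (cl 1))]) s * Nx [(\<theta>, cv im (cl 1))] (\<lambda>p. f (jn [] s p)) \<partial>lborel)" .
qed

lemma im_start: "(\<integral>\<^sup>+p. (if p 0 = [] then 0 else 1) \<partial>im) = 0"
proof -
  have "(\<integral>\<^sup>+p. (if p 0 = [] then 0 else 1) \<partial>im) = (\<integral>\<^sup>+a. \<integral>\<^sup>+p. (if imp a p 0 = [] then 0 else 1) \<partial>PC \<partial>PA)"
    by (rule nn_integral_im) measurable
  also have "\<dots> = (\<integral>\<^sup>+a. 0 \<partial>PA)"
  proof (rule nn_integral_cong_AE, use AE_imgood in eventually_elim)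
    case (elim a)
    then have "0 < enn2real (a 0)" by (simp add: imgood_def enn2real_positive_iff)
    then show ?case using imp_rec[OF elim] by (simp add: jn_def)
  qed
  finally show ?thesis by simp
qed

section \<open>The law of the concatenated skewer process\<close>

text \<open>The law expected in state c: immigration on the far left, then one independent clade per
  block. Bracketing to the left fits the induction that adds a block on the right.\<close>

definition Lam :: "nat list \<Rightarrow> (real \<Rightarrow> nat list) measure" where
  "Lam c = foldl (\<lambda>A n. cv A (cl n)) im c"

lemma Lam_Nil [simp]: "Lam [] = im" and Lam_snoc [simp]: "Lam (c @ [n]) = cv (Lam c) (cl n)"
  by (simp_all add: Lam_def)

lemma path_law_Lam: "path_law (Lam c)"
  by (induction c rule: rev_induct) (auto intro: path_law_cv path_law_im path_law_cl)

lemma ocrp_moves_Nil: "ocrp_moves \<alpha> \<theta> [] = [(\<theta>, [1])]"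
  by (simp add: ocrp_moves_def)

text \<open>Every move concerns either c alone or the last block. The equality is one of multisets
  because \<open>ocrp_moves\<close> lists the moves by type and not by block.\<close>

lemma mset_ocrp_moves_snoc:
  "mset (ocrp_moves \<alpha> \<theta> (c @ [n])) = mset (map (\<lambda>(r, c'). (r, c' @ [n])) (ocrp_moves \<alpha> \<theta> c) @
    [(real n - \<alpha>, c @ [n + 1]), (real n, if n = 1 then c else c @ [n - 1]), (\<alpha>, c @ [n, 1])])"
proof -
  let ?S = "\<lambda>(r :: real, c'). (r, c' @ [n])"
  have 1: "map (\<lambda>i. (real ((c @ [n]) ! i) - \<alpha>, (c @ [n])[i := (c @ [n]) ! i + 1])) [0..<length (c @ [n])]
    = map ?S (map (\<lambda>i. (real (c ! i) - \<alpha>, c[i := c ! i + 1])) [0..<length c]) @ [(real n - \<alpha>, c @ [n + 1])]"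
    by (auto simp: list_update_append nth_append)
  have 2: "map (\<lambda>i. (\<alpha>, take (Suc i) (c @ [n]) @ [1] @ drop (Suc i) (c @ [n]))) [0..<length (c @ [n])]
    = map ?S (map (\<lambda>i. (\<alpha>, take (Suc i) c @ [1] @ drop (Suc i) c)) [0..<length c]) @ [(\<alpha>, c @ [n, 1])]"
    by auto
  have 3: "map (\<lambda>i. (real ((c @ [n]) ! i), if (c @ [n]) ! i = 1 then take i (c @ [n]) @ drop (Suc i) (c @ [n]) else (c @ [n])[i := (c @ [n]) ! i - 1]))
         [0..<length (c @ [n])]
    = map ?S (map (\<lambda>i. (real (c ! i), if c ! i = 1 then take i c @ drop (Suc i) c else c[i := c ! i - 1])) [0..<length c])
      @ [(real n, if n = 1 then c else c @ [n - 1])]"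
    by (auto simp: list_update_append nth_append)
  show ?thesis unfolding ocrp_moves_def 1 2 3 by simp
qed

lemma ocrp_moves_nonneg:
  assumes "composition c" "(r, c') \<in> set (ocrp_moves \<alpha> \<theta> c)" shows "0 \<le> r"
proof -
  have "1 \<le> c ! i" if "i < length c" for i using assms(1) that by (auto simp: composition_def)
  then have "\<alpha> \<le> real (c ! i)" if "i < length c" for i using that real_ge(1) by blast
  then show ?thesis using assms(2) \<alpha>0 \<theta> by (auto simp: ocrp_moves_def)
qed

text \<open>Superposition of the equations of \<open>Lam c\<close> and of the last clade. The
  continuations are then recognised as \<open>Lam\<close> of the new state.\<close>

lemma first_event_Lam:
  assumes "composition c"
  shows "first_event (Lam c) c (map (\<lambda>(r, c'). (r, Lam c')) (ocrp_moves \<alpha> \<theta> c))"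
  using assms
proof (induction c rule: rev_induct)
  case Nil
  have "Lam [1] = cv im (cl 1)" using Lam_snoc[of "[]" 1] by simp
  then show ?case using first_event_im by (simp add: ocrp_moves_Nil)
next
  case (snoc n c)
  have c: "composition c" "1 \<le> n" using snoc.prems by (auto simp: composition_def)
  let ?M = "map (\<lambda>(r, c'). (r, Lam c')) (ocrp_moves \<alpha> \<theta> c)"
  let ?N = "[(real n - \<alpha>, cl (n + 1)), (real n, cl (n - 1)), (\<alpha>, cv (cl n) (cl 1))]"
  have rM: "rates ?M"
    using ocrp_moves_nonneg[OF c(1)] by (auto simp: rates_def path_law_Lam)
  have rN: "rates ?N" using real_ge[OF c(2)] \<alpha>0 by (auto simp: path_law_cl intro: path_law_cv)
  have FE: "first_event (Lam (c @ [n])) (c @ [n]) (map (\<lambda>(r, K). (r, cv K (cl n))) ?M @ map (\<lambda>(r, K). (r, cv (Lam c) K)) ?N)"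
    unfolding Lam_snoc
    by (rule first_event_cv[OF path_law_Lam rM snoc.IH[OF c(1)] path_law_cl rN first_event_cl[OF c(2)]])
  have FE': "first_event (Lam (c @ [n])) (c @ [n]) (map (\<lambda>(r, c'). (r, Lam c')) (map (\<lambda>(r, c'). (r, c' @ [n])) (ocrp_moves \<alpha> \<theta> c) @
    [(real n - \<alpha>, c @ [n + 1]), (real n, if n = 1 then c else c @ [n - 1]), (\<alpha>, c @ [n, 1])]))"
  proof (rule first_event_Nx_cong[OF FE])
    have m: "map (\<lambda>(r, c'). (r, Lam c')) (map (\<lambda>(r, c'). (r, c' @ [n])) (ocrp_moves \<alpha> \<theta> c)) = map (\<lambda>(r, K). (r, cv K (cl n))) ?M"
      by (simp add: split_beta')
    have l: "Lam (c @ [n, 1]) = cv (Lam c) (cv (cl n) (cl 1))"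
      using Lam_snoc[of "c @ [n]" 1] by (simp add: cv_assoc path_law_Lam path_law_cl)
    show "tot (map (\<lambda>(r, K). (r, cv K (cl n))) ?M @ map (\<lambda>(r, K). (r, cv (Lam c) K)) ?N) =
      tot (map (\<lambda>(r, c'). (r, Lam c')) (map (\<lambda>(r, c'). (r, c' @ [n])) (ocrp_moves \<alpha> \<theta> c) @
        [(real n - \<alpha>, c @ [n + 1]), (real n, if n = 1 then c else c @ [n - 1]), (\<alpha>, c @ [n, 1])]))"
      by (simp only: map_append m) simp
    fix f :: "(real \<Rightarrow> nat list) \<Rightarrow> ennreal" and s
    assume f: "f \<in> borel_measurable path_space"
    \<comment> \<open>The one continuation that is not literally of the form \<open>Lam\<close>: for
      n = 1 a decrease leaves a clade of root size 0 instead of no clade.\<close>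
    have "(\<integral>\<^sup>+p. f (jn (c @ [n]) s p) \<partial>cv (Lam c) (cl (n - 1))) = (\<integral>\<^sup>+p. f (jn (c @ [n]) s p) \<partial>Lam (if n = 1 then c else c @ [n - 1]))"
      using Nx_cv_cl_0[OF path_law_Lam f] by simp
    then show "Nx (map (\<lambda>(r, K). (r, cv K (cl n))) ?M @ map (\<lambda>(r, K). (r, cv (Lam c) K)) ?N) (\<lambda>p. f (jn (c @ [n]) s p)) =
      Nx (map (\<lambda>(r, c'). (r, Lam c')) (map (\<lambda>(r, c'). (r, c' @ [n])) (ocrp_moves \<alpha> \<theta> c) @
        [(real n - \<alpha>, c @ [n + 1]), (real n, if n = 1 then c else c @ [n - 1]), (\<alpha>, c @ [n, 1])])) (\<lambda>p. f (jn (c @ [n]) s p))"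
      unfolding map_append m Nx_append list.map prod.case Nx_Cons Nx_Nil by (simp only: Lam_snoc l)
  qed
  show ?case
    by (rule first_event_mset[OF _ FE']) (simp only: mset_map mset_ocrp_moves_snoc)
qed

lemma Lam_start:
  assumes "composition c" shows "(\<integral>\<^sup>+p. (if p 0 = c then 0 else 1) \<partial>Lam c) = 0"
  using assms
proof (induction c rule: rev_induct)
  case Nil
  then show ?case using im_start by simp
next
  case (snoc n c)
  note [measurable] = path_law_Lam path_law_cl
  have c: "composition c" "1 \<le> n" using snoc.prems by (auto simp: composition_def)
  interpret C: prob_space "cl n" by (rule prob_space_cl)
  interpret L: prob_space "Lam c" using path_law_Lam path_lawD by auto
  have [measurable_cong]: "sets (Lam c) = sets path_space" using path_law_Lam path_lawD by auto
  have "(\<integral>\<^sup>+p. (if p 0 = c @ [n] then 0 else 1) \<partial>Lam (c @ [n])) = (\<integral>\<^sup>+p. \<integral>\<^sup>+q. (if cat p q 0 = c @ [n] then 0 else 1) \<partial>cl n \<partial>Lam c)"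
    unfolding Lam_snoc by (rule nn_integral_cv) (auto simp: path_law_Lam path_law_cl)
  also have "\<dots> \<le> (\<integral>\<^sup>+p. \<integral>\<^sup>+q. (if p 0 = c then 0 else 1) + (if q 0 = [n] then 0 else 1) \<partial>cl n \<partial>Lam c)"
    by (intro nn_integral_mono) (auto simp: cat_def)
  also have "\<dots> = (\<integral>\<^sup>+p. (if p 0 = c then 0 else 1) + (\<integral>\<^sup>+q. (if q 0 = [n] then 0 else 1) \<partial>cl n) \<partial>Lam c)"
    using C.emeasure_space_1 by (intro nn_integral_cong) (subst nn_integral_add, auto)
  also have "\<dots> = 0" using snoc.IH[OF c(1)] cl_start[OF c(2)] by (simp add: nn_integral_add)
  finally show ?case by simp
qed

end

section \<open>From first-event equations to the Markov chain\<close>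

lemma sum_filter_snd:
  assumes "finite S" "snd ` set L \<subseteq> S"
  shows "(\<Sum>y\<in>S. sum_list (map fst (filter (\<lambda>m. snd m = y) L))) = tot L"
  using assms(2)
proof (induction L)
  case (Cons m L)
  have "(\<Sum>y\<in>S. sum_list (map fst (filter (\<lambda>m. snd m = y) (m # L)))) =
    (\<Sum>y\<in>S. (if y = snd m then fst m else 0) + sum_list (map fst (filter (\<lambda>m. snd m = y) L)))"
    by (intro sum.cong) auto
  then show ?case using Cons assms(1) by (simp add: sum.distrib)
qed simp

context immigration
begin

abbreviation "mv \<equiv> ocrp_moves \<alpha> \<theta>"
abbreviation "qC \<equiv> qOCRP \<alpha> \<theta>"

lemma set_mv_snoc: "set (mv (c @ [n])) = (\<lambda>(r, c'). (r, c' @ [n])) ` set (mv c) \<union>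
    {(real n - \<alpha>, c @ [n + 1]), (real n, if n = 1 then c else c @ [n - 1]), (\<alpha>, c @ [n, 1])}"
  using arg_cong[OF mset_ocrp_moves_snoc[of c n], of set_mset] by (simp add: Un_commute)

text \<open>The sum of the blocks changes by exactly one. Hence no move leads back to the present
  state, every event is a visible jump, and the total rate grows by at most 2.\<close>

lemma mv_props:
  assumes "composition c" "(r, c') \<in> set (mv c)"
  shows "composition c' \<and> (sum_list c' = sum_list c + 1 \<or> sum_list c = sum_list c' + 1)"
  using assms
proof (induction c arbitrary: r c' rule: rev_induct)
  case Nil
  then show ?case by (auto simp: ocrp_moves_Nil composition_def)
next
  case (snoc n c)
  have c: "composition c" "1 \<le> n" using snoc.prems by (auto simp: composition_def)
  from snoc.prems(2) consider c'' where "(r, c'') \<in> set (mv c)" "c' = c'' @ [n]"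
    | "c' = c @ [n + 1]" | "c' = (if n = 1 then c else c @ [n - 1])" | "c' = c @ [n, 1]"
    unfolding set_mv_snoc by auto
  then show ?case
  proof cases
    case 1
    then show ?thesis using snoc.IH[OF c(1) 1(1)] c by (auto simp: composition_def)
  qed (use c in \<open>auto simp: composition_def\<close>)
qed

text \<open>A block of size n contributes (n - \<alpha>) + \<alpha> + n, so \<alpha>
  cancels.\<close>

lemma tot_mv: "tot (mv c) = 2 * real (sum_list c) + \<theta>"
proof (induction c rule: rev_induct)
  case (snoc n c)
  have "tot (mv (c @ [n])) = tot (map (\<lambda>(r, c'). (r, c' @ [n])) (mv c) @
    [(real n - \<alpha>, c @ [n + 1]), (real n, if n = 1 then c else c @ [n - 1]), (\<alpha>, c @ [n, 1])])"
    by (rule sum_list_mset_cong) (rule mset_ocrp_moves_snoc)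
  also have "\<dots> = tot (mv c) + 2 * real n"
    unfolding map_append sum_list_append tot_map by simp
  finally show ?case using snoc by simp
qed (simp add: ocrp_moves_Nil)

lemma tot_mv_pos: "0 < tot (mv c)"
  unfolding tot_mv using \<theta> by (simp add: add_nonneg_pos)

lemma mv_ne: "composition c \<Longrightarrow> (r, c') \<in> set (mv c) \<Longrightarrow> c' \<noteq> c"
  using mv_props by fastforce

lemma qC_self: "composition c \<Longrightarrow> qC c c = 0"
proof -
  assume "composition c"
  then have "filter (\<lambda>m. snd m = c) (mv c) = []" using mv_ne by (fastforce simp: filter_empty_conv)
  then show ?thesis by (simp add: qOCRP_def)
qed

lemma qC_outside: "y \<notin> snd ` set (mv c) \<Longrightarrow> qC c y = 0"
proof -
  assume "y \<notin> snd ` set (mv c)"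
  then have "filter (\<lambda>m. snd m = y) (mv c) = []" by (auto simp: filter_empty_conv)
  then show ?thesis by (simp add: qOCRP_def)
qed

lemma qtot_qC: assumes "composition c" shows "qtot qC c = tot (mv c)"
proof -
  have "qtot qC c = (\<Sum>y\<in>snd ` set (mv c). qC c y)"
    unfolding qtot_def
    using qC_outside[of _ c] qC_self[OF assms] by (intro sum.mono_neutral_left) auto
  also have "\<dots> = tot (mv c)" unfolding qOCRP_def by (rule sum_filter_snd) auto
  finally show ?thesis .
qed

lemma jump_prob_qC: assumes "composition c" shows "jump_prob qC c y = qC c y / tot (mv c)"
  using tot_mv_pos[of c] qC_self[OF assms] by (simp add: jump_prob_def qtot_qC[OF assms])

lemma measurable_YE_HE [measurable]: "(\<lambda>p. (YE p, HE p)) \<in> path_space \<rightarrow>\<^sub>M (JH :: ((nat \<Rightarrow> 'a::countable) \<times> _) measure)"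
  by (intro measurable_Pair measurable_PiM_single') auto

lemma AE_Lam_start: assumes "composition c" shows "AE p in Lam c. rc p \<and> p 0 = c"
proof -
  have [measurable_cong]: "sets (Lam c) = sets path_space" using path_law_Lam path_lawD by auto
  have "AE p in Lam c. (if p 0 = c then 0 else 1) = (0::ennreal)"
    using Lam_start[OF assms] by (subst (asm) nn_integral_0_iff_AE) auto
  then show ?thesis using AE_space by eventually_elim (auto simp: path_lawD[OF path_law_Lam] split: if_splits)
qed

text \<open>A continuation starts almost surely in a state other than c, so the first event is the
  first jump of the path, and jump chain and holding times inherit the first-event equation.\<close>

lemma ext_first_jump:
  assumes c: "composition c" and \<phi> [measurable]: "\<phi> \<in> borel_measurable JH" and \<phi>1: "\<And>w. \<phi> w \<le> 1"
  shows "(\<integral>\<^sup>+p. \<phi> (YE p, HE p) \<partial>Lam c) = (\<integral>\<^sup>+s. wt (tot (mv c)) s *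
     (\<Sum>(r, c')\<leftarrow>mv c. ennreal r * (\<integral>\<^sup>+p. \<phi> (case_nat c (YE p), case_nat (ennreal s) (HE p)) \<partial>Lam c')) \<partial>lborel)"
proof -
  have m: "(\<lambda>p. \<phi> (YE p, HE p)) \<in> borel_measurable (path_space :: (real \<Rightarrow> nat list) measure)" by measurable
  have "(\<integral>\<^sup>+p. \<phi> (YE p, HE p) \<partial>Lam c) = (\<integral>\<^sup>+s. wt (tot (map (\<lambda>(r, c'). (r, Lam c')) (mv c))) s *
     Nx (map (\<lambda>(r, c'). (r, Lam c')) (mv c)) (\<lambda>p. \<phi> (YE (jn c s p), HE (jn c s p))) \<partial>lborel)"
    by (rule first_eventD[OF first_event_Lam[OF c] m \<phi>1])
  also have "\<dots> = (\<integral>\<^sup>+s. wt (tot (mv c)) s *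
     (\<Sum>(r, c')\<leftarrow>mv c. ennreal r * (\<integral>\<^sup>+p. \<phi> (case_nat c (YE p), case_nat (ennreal s) (HE p)) \<partial>Lam c')) \<partial>lborel)"
    unfolding tot_map
  proof (rule nn_integral_cong_AE, use AE_lborel_singleton[of 0] in eventually_elim)
    fix s :: real assume s: "s \<noteq> 0"
    show "wt (tot (mv c)) s * Nx (map (\<lambda>(r, c'). (r, Lam c')) (mv c)) (\<lambda>p. \<phi> (YE (jn c s p), HE (jn c s p))) =
      wt (tot (mv c)) s * (\<Sum>(r, c')\<leftarrow>mv c. ennreal r * (\<integral>\<^sup>+p. \<phi> (case_nat c (YE p), case_nat (ennreal s) (HE p)) \<partial>Lam c'))"
    proof (cases "0 < s")
      case True
      have "(\<integral>\<^sup>+p. \<phi> (YE (jn c s p), HE (jn c s p)) \<partial>Lam c') = (\<integral>\<^sup>+p. \<phi> (case_nat c (YE p), case_nat (ennreal s) (HE p)) \<partial>Lam c')"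
        if "(r, c') \<in> set (mv c)" for r c'
      proof (rule nn_integral_cong_AE)
        have c': "composition c'" "c' \<noteq> c" using mv_props[OF c that] mv_ne[OF c that] by auto
        show "AE p in Lam c'. \<phi> (YE (jn c s p), HE (jn c s p)) = \<phi> (case_nat c (YE p), case_nat (ennreal s) (HE p))"
          using AE_Lam_start[OF c'(1)]
          by eventually_elim (use c'(2) True in \<open>simp add: ext_jn\<close>)
      qed
      then show ?thesis unfolding Nx_def map_map
        by (intro arg_cong2[where f="(*)"] arg_cong[where f=sum_list] refl map_cong) auto
    qed (use s in \<open>simp add: wt_def\<close>)
  qed
  finally show ?thesis .
qed

lemma nn_integral_wt_tail:
  assumes "0 < l" "0 \<le> a" shows "(\<integral>\<^sup>+s. wt l s * indicator {a<..} s \<partial>lborel) = ennreal (exp (- l * a) / l)"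
proof -
  have "(\<integral>\<^sup>+s. wt l s * indicator {a<..} s \<partial>lborel) = (\<integral>\<^sup>+s. ennreal (exp (- l * s)) * indicator {a..} s \<partial>lborel)"
    by (rule nn_integral_cong_AE, use AE_lborel_singleton[of a] in eventually_elim)
       (use assms in \<open>auto simp: wt_def indicator_def\<close>)
  then show ?thesis using nn_integral_exp_tail[OF assms(1)] by simp
qed

lemma sum_list_moves_indicator:
  assumes "\<forall>(r, c')\<in>set L. 0 \<le> r" "0 \<le> P"
  shows "(\<Sum>(r, c')\<leftarrow>L. ennreal r * ennreal ((if y = c' then 1 else 0) * P)) =
    ennreal (sum_list (map fst (filter (\<lambda>m. snd m = y) L)) * P)
    \<and> 0 \<le> sum_list (map fst (filter (\<lambda>m. snd m = y) L))"
  using assms(1)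
proof (induction L)
  case (Cons m L)
  obtain r c' where m: "m = (r, c')" by (cases m)
  have "0 \<le> r" using Cons.prems m by auto
  with Cons assms(2) show ?case
    by (auto simp: m ennreal_mult[symmetric] ennreal_plus[symmetric] distrib_right simp del: ennreal_plus)
qed simp

text \<open>Nonnegativity of the product is carried through the induction, because y ranges over
  arbitrary lists: outside the compositions rates can be negative, and \<open>ennreal\<close> would
  conceal that.\<close>

lemma Lam_cyl:
  assumes "composition c" "\<forall>i<n. 0 \<le> s i"
  shows "(\<integral>\<^sup>+p. indicator (cyl n y s) (YE p, HE p) \<partial>Lam c) =
    ennreal ((if y 0 = c then 1 else 0) * (\<Prod>i<n. jump_prob qC (y i) (y (Suc i)) * exp (- qtot qC (y i) * s i)))
    \<and> 0 \<le> (if y 0 = c then 1 else 0) * (\<Prod>i<n. jump_prob qC (y i) (y (Suc i)) * exp (- qtot qC (y i) * s i))"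
  using assms
proof (induction n arbitrary: c y s)
  case 0
  interpret prob_space "Lam c" using path_law_Lam path_lawD by auto
  have "(\<integral>\<^sup>+p. indicator (cyl 0 y s) (YE p, HE p) \<partial>Lam c) = (\<integral>\<^sup>+p. (if y 0 = c then 1 else 0) \<partial>Lam c)"
    by (rule nn_integral_cong_AE, use AE_Lam_start[OF 0(1)] in eventually_elim) (auto simp: cyl_def indicator_def)
  then show ?case by (auto simp: emeasure_space_1)
next
  case (Suc n)
  note [measurable] = sets_cyl
  have s0: "0 \<le> s 0" using Suc.prems by auto
  let ?P = "\<Prod>i<n. jump_prob qC (y (Suc i)) (y (Suc (Suc i))) * exp (- qtot qC (y (Suc i)) * s (Suc i))"
  let ?T = "\<lambda>p. indicator (cyl n (\<lambda>i. y (Suc i)) (\<lambda>i. s (Suc i))) (YE p, HE p) :: ennreal"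
  have IH: "(\<integral>\<^sup>+p. ?T p \<partial>Lam c') = ennreal ((if y (Suc 0) = c' then 1 else 0) * ?P) \<and> 0 \<le> (if y (Suc 0) = c' then 1 else 0) * ?P"
    if "composition c'" for c'
    using Suc.IH[OF that, of "\<lambda>i. s (Suc i)" "\<lambda>i. y (Suc i)"] Suc.prems by auto
  define q where "q = qC c (y (Suc 0))"
  have comp: "composition c'" if "(r, c') \<in> set (mv c)" for r c' using mv_props[OF Suc.prems(1) that] by simp
  have sum: "(\<Sum>(r, c')\<leftarrow>mv c. ennreal r * (\<integral>\<^sup>+p. ?T p \<partial>Lam c')) = ennreal (q * ?P) \<and> 0 \<le> q * ?P"
  \<comment> \<open>If y (Suc 0) cannot be reached in one move, q = 0 settles the claim whatever the
    sign of the remaining product; otherwise y (Suc 0) is a composition and the induction hypothesis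
    applies to it.\<close>
  proof (cases "y (Suc 0) \<in> snd ` set (mv c)")
    case True
    then have P0: "0 \<le> ?P" using IH[of "y (Suc 0)"] comp by fastforce
    have sum1: "(\<Sum>(r, c')\<leftarrow>mv c. ennreal r * (\<integral>\<^sup>+p. ?T p \<partial>Lam c')) = (\<Sum>(r, c')\<leftarrow>mv c. ennreal r * ennreal ((if y (Suc 0) = c' then 1 else 0) * ?P))"
      using comp IH by (intro arg_cong[where f=sum_list] map_cong) auto
    have "\<forall>(r, c')\<in>set (mv c). 0 \<le> r" using ocrp_moves_nonneg[OF Suc.prems(1)] by auto
    note ind = sum_list_moves_indicator[OF this P0, of "y (Suc 0)"]
    have q: "q = sum_list (map fst (filter (\<lambda>m. snd m = y (Suc 0)) (mv c)))" by (simp add: q_def qOCRP_def)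
    have "0 \<le> q * ?P" unfolding q using ind P0 by (intro mult_nonneg_nonneg) auto
    moreover have "(\<Sum>(r, c')\<leftarrow>mv c. ennreal r * (\<integral>\<^sup>+p. ?T p \<partial>Lam c')) = ennreal (q * ?P)"
      unfolding q sum1 using ind by blast
    ultimately show ?thesis by blast
  next
    case False
    have "(\<Sum>(r, c')\<leftarrow>mv c. ennreal r * (\<integral>\<^sup>+p. ?T p \<partial>Lam c')) = (\<Sum>(r, c')\<leftarrow>mv c. 0)"
    proof (intro arg_cong[where f=sum_list] map_cong refl, clarify)
      fix r c' assume *: "(r, c') \<in> set (mv c)"
      then have "y (Suc 0) \<noteq> c'" using False by force
      then show "ennreal r * (\<integral>\<^sup>+p. ?T p \<partial>Lam c') = 0" using IH[OF comp[OF *]] by simp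
    qed
    then show ?thesis using qC_outside[OF False] by (simp add: q_def)
  qed
  have l: "0 < tot (mv c)" by (rule tot_mv_pos)
  have "(\<integral>\<^sup>+p. indicator (cyl (Suc n) y s) (YE p, HE p) \<partial>Lam c) = (\<integral>\<^sup>+u. wt (tot (mv c)) u *
     (\<Sum>(r, c')\<leftarrow>mv c. ennreal r * (\<integral>\<^sup>+p. (indicator {c} (y 0) * indicator {s 0<..} u) * ?T p \<partial>Lam c')) \<partial>lborel)"
  proof (subst ext_first_jump[OF Suc.prems(1)])
    have "indicator (cyl (Suc n) y s) (case_nat c (YE p), case_nat (ennreal u) (HE p)) = (indicator {c} (y 0) * indicator {s 0<..} u) * ?T p" if "0 \<le> u" for u p
    proof -
      have "indicator {h. ennreal (s 0) < h} (ennreal u) = (indicator {s 0<..} u :: ennreal)"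
        using s0 by (auto simp: indicator_def ennreal_less_iff)
      then show ?thesis
        by (simp add: cyl_case_nat[where s=s, OF s0])
    qed
    then show "(\<integral>\<^sup>+u. wt (tot (mv c)) u * (\<Sum>(r, c')\<leftarrow>mv c. ennreal r *
       (\<integral>\<^sup>+p. indicator (cyl (Suc n) y s) (case_nat c (YE p), case_nat (ennreal u) (HE p)) \<partial>Lam c')) \<partial>lborel) =
      (\<integral>\<^sup>+u. wt (tot (mv c)) u * (\<Sum>(r, c')\<leftarrow>mv c. ennreal r *
       (\<integral>\<^sup>+p. (indicator {c} (y 0) * indicator {s 0<..} u) * ?T p \<partial>Lam c')) \<partial>lborel)"
      by (intro nn_integral_cong) (auto simp: wt_def indicator_def cong: if_cong)
  qed (auto split: split_indicator)
  also have "\<dots> = (\<integral>\<^sup>+u. (indicator {c} (y 0) * ennreal (q * ?P)) * (wt (tot (mv c)) u * indicator {s 0<..} u) \<partial>lborel)"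
  proof (intro nn_integral_cong)
    fix u
    have "(\<integral>\<^sup>+p. (indicator {c} (y 0) * indicator {s 0<..} u) * ?T p \<partial>Lam c') = (indicator {c} (y 0) * indicator {s 0<..} u) * (\<integral>\<^sup>+p. ?T p \<partial>Lam c')" for c'
    proof -
      have [measurable_cong]: "sets (Lam c') = sets path_space" using path_law_Lam path_lawD by auto
      show ?thesis by (rule nn_integral_cmult) measurable
    qed
    then have "(\<Sum>(r, c')\<leftarrow>mv c. ennreal r * (\<integral>\<^sup>+p. (indicator {c} (y 0) * indicator {s 0<..} u) * ?T p \<partial>Lam c')) =
      (\<Sum>m\<leftarrow>mv c. (indicator {c} (y 0) * indicator {s 0<..} u) * (ennreal (fst m) * (\<integral>\<^sup>+p. ?T p \<partial>Lam (snd m))))"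
      by (intro arg_cong[where f=sum_list] map_cong) (auto simp: ac_simps)
    also have "\<dots> = (indicator {c} (y 0) * indicator {s 0<..} u) * (\<Sum>(r, c')\<leftarrow>mv c. ennreal r * (\<integral>\<^sup>+p. ?T p \<partial>Lam c'))"
      by (simp add: sum_list_const_mult split_beta')
    finally show "wt (tot (mv c)) u * (\<Sum>(r, c')\<leftarrow>mv c. ennreal r * (\<integral>\<^sup>+p. (indicator {c} (y 0) * indicator {s 0<..} u) * ?T p \<partial>Lam c')) =
      (indicator {c} (y 0) * ennreal (q * ?P)) * (wt (tot (mv c)) u * indicator {s 0<..} u)"
      using sum by (simp add: ac_simps)
  qed
  also have "\<dots> = (indicator {c} (y 0) * ennreal (q * ?P)) * ennreal (exp (- tot (mv c) * s 0) / tot (mv c))"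
    using nn_integral_wt_tail[OF l s0] by (subst nn_integral_cmult) auto
  finally have *: "(\<integral>\<^sup>+p. indicator (cyl (Suc n) y s) (YE p, HE p) \<partial>Lam c) =
    (indicator {c} (y 0) * ennreal (q * ?P)) * ennreal (exp (- tot (mv c) * s 0) / tot (mv c))" .
  show ?case
  proof (cases "y 0 = c")
    case True
    have "(\<Prod>i<Suc n. jump_prob qC (y i) (y (Suc i)) * exp (- qtot qC (y i) * s i)) = (q * ?P) * (exp (- tot (mv c) * s 0) / tot (mv c))"
      unfolding prod.lessThan_Suc_shift using True Suc.prems(1) by (simp add: jump_prob_qC qtot_qC q_def)
    then show ?thesis using * True sum l by (simp add: ennreal_mult[symmetric])
  qed (simp add: *)
qed

text \<open>The telescoping bound of \<open>jump_chain\<close> once more, now derived from the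
  first-event equation, with the exact total rate in the role of the majorant.\<close>

lemma Lam_laplace:
  assumes "composition c"
  shows "(\<integral>\<^sup>+p. (\<Prod>i<k. eexp (HE p i)) \<partial>Lam c) \<le> ennreal (tot (mv c) / (tot (mv c) + 2 * real k))"
  using assms
proof (induction k arbitrary: c)
  case 0
  interpret prob_space "Lam c" using path_law_Lam path_lawD by auto
  show ?case using tot_mv_pos[of c] by (simp add: emeasure_space_1)
next
  case (Suc k)
  define l where "l = tot (mv c)"
  have l: "0 < l" unfolding l_def by (rule tot_mv_pos)
  let ?\<phi> = "\<lambda>w :: (nat \<Rightarrow> nat list) \<times> (nat \<Rightarrow> ennreal). \<Prod>i<Suc k. eexp (snd w i)"
  have "(\<integral>\<^sup>+p. ?\<phi> (YE p, HE p) \<partial>Lam c) = (\<integral>\<^sup>+s. wt l s *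
     (\<Sum>(r, c')\<leftarrow>mv c. ennreal r * (\<integral>\<^sup>+p. ?\<phi> (case_nat c (YE p), case_nat (ennreal s) (HE p)) \<partial>Lam c')) \<partial>lborel)"
    unfolding l_def
  proof (rule ext_first_jump[OF Suc.prems])
    show "?\<phi> w \<le> 1" for w by (simp only: eexp_sum[symmetric] eexp_le_1)
  qed measurable
  also have "\<dots> \<le> (\<integral>\<^sup>+s. ennreal (l * ((l + 2) / (l + 2 + 2 * real k))) * (wt (l + 2) s * indicator {0..} s) \<partial>lborel)"
  proof (rule nn_integral_mono)
    fix s :: real
    show "wt l s * (\<Sum>(r, c')\<leftarrow>mv c. ennreal r * (\<integral>\<^sup>+p. ?\<phi> (case_nat c (YE p), case_nat (ennreal s) (HE p)) \<partial>Lam c')) \<le>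
      ennreal (l * ((l + 2) / (l + 2 + 2 * real k))) * (wt (l + 2) s * indicator {0..} s)"
    proof (cases "0 \<le> s")
      case True
      \<comment> \<open>The bound of the induction hypothesis for the largest total rate, l + 2,
        that is possible after one move.\<close>
      define b where "b = (l + 2) / (l + 2 + 2 * real k)"
      have b: "0 \<le> b" using l by (simp add: b_def)
      have "(\<Sum>(r, c')\<leftarrow>mv c. ennreal r * (\<integral>\<^sup>+p. ?\<phi> (case_nat c (YE p), case_nat (ennreal s) (HE p)) \<partial>Lam c')) \<le>
        (\<Sum>(r, c')\<leftarrow>mv c. ennreal r * (eexp (ennreal s) * ennreal b))"
      proof (rule sum_list_mono, clarify)
        fix r c' assume rc: "(r, c') \<in> set (mv c)"
        have c': "composition c'" "sum_list c' \<le> sum_list c + 1" using mv_props[OF Suc.prems rc] by auto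
        have [measurable_cong]: "sets (Lam c') = sets path_space" using path_law_Lam path_lawD by auto
        have "(\<integral>\<^sup>+p. ?\<phi> (case_nat c (YE p), case_nat (ennreal s) (HE p)) \<partial>Lam c') = (\<integral>\<^sup>+p. eexp (ennreal s) * (\<Prod>i<k. eexp (HE p i)) \<partial>Lam c')"
          by (simp del: prod.lessThan_Suc add: prod.lessThan_Suc_shift)
        also have "\<dots> = eexp (ennreal s) * (\<integral>\<^sup>+p. (\<Prod>i<k. eexp (HE p i)) \<partial>Lam c')"
          by (rule nn_integral_cmult) measurable
        also have "\<dots> \<le> eexp (ennreal s) * ennreal (tot (mv c') / (tot (mv c') + 2 * real k))"
          by (intro mult_left_mono Suc.IH c') auto
        also have "\<dots> \<le> eexp (ennreal s) * ennreal b"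
        proof (intro mult_left_mono ennreal_leI)
          show "tot (mv c') / (tot (mv c') + 2 * real k) \<le> b"
            unfolding b_def using tot_mv_pos[of c'] c'(2) by (intro frac_add_mono) (auto simp: l_def tot_mv)
        qed auto
        finally show "ennreal r * (\<integral>\<^sup>+p. ?\<phi> (case_nat c (YE p), case_nat (ennreal s) (HE p)) \<partial>Lam c') \<le> ennreal r * (eexp (ennreal s) * ennreal b)"
          by (intro mult_left_mono) auto
      qed
      also have "\<dots> = ennreal l * (eexp (ennreal s) * ennreal b)"
      proof -
        have "(\<Sum>(r, c')\<leftarrow>L. ennreal r * X) = ennreal (tot L) * X \<and> 0 \<le> tot L" if "\<forall>(r, c')\<in>set L. 0 \<le> r" for L :: "(real \<times> nat list) list" and X
          using that by (induction L) (auto simp: distrib_right)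
        from this[of "mv c"] show ?thesis using ocrp_moves_nonneg[OF Suc.prems] unfolding l_def by blast
      qed
      finally have "wt l s * (\<Sum>(r, c')\<leftarrow>mv c. ennreal r * (\<integral>\<^sup>+p. ?\<phi> (case_nat c (YE p), case_nat (ennreal s) (HE p)) \<partial>Lam c')) \<le> wt l s * (ennreal l * (eexp (ennreal s) * ennreal b))"
        by (rule mult_left_mono) simp
      also have "\<dots> = ennreal (l * b) * (wt l s * eexp (ennreal s))"
        using l b by (simp add: ennreal_mult ac_simps)
      also have "wt l s * eexp (ennreal s) = wt (l + 2) s * indicator {0..} s"
        using True by (simp add: wt_def eexp_def ennreal_mult[symmetric] exp_add[symmetric] algebra_simps)
      finally show ?thesis by (simp add: b_def)
    qed (simp add: wt_def)
  qed
  also have "\<dots> = ennreal (l * ((l + 2) / (l + 2 + 2 * real k))) * ennreal (1 / (l + 2))"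
    using nn_integral_exp_tail[of "l + 2" 0] l
    by (subst nn_integral_cmult) (auto simp: wt_def mult.assoc indicator_inter_arith[symmetric])
  also have "\<dots> = ennreal (l / (l + 2 * real (Suc k)))"
  proof -
    have "l * ((l + 2) / (l + 2 + 2 * real k)) * (1 / (l + 2)) = l / (l + 2 + 2 * real k)"
    proof -
      have "l + 2 \<noteq> 0" using l by simp
      then show ?thesis by simp
    qed
    moreover have "l + 2 + 2 * real k = l + 2 * real (Suc k)" by simp
    ultimately show ?thesis using l by (simp add: ennreal_mult[symmetric] del: of_nat_Suc)
  qed
  finally show ?case by (simp add: l_def)
qed

text \<open>Jump chain and holding times are read off the right-continuous version X'. For X itself
  agreement with X' off a null set is enough.\<close>

lemma Lam_is_ctmc:
  assumes M: "prob_space M" and c: "composition c"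
    and X' [measurable]: "X' \<in> M \<rightarrow>\<^sub>M path_space" and law: "distr M path_space X' = Lam c"
    and X: "AE \<omega> in M. \<forall>t\<ge>0. X \<omega> t = X' \<omega> t"
  shows "is_ctmc M qC c X"
  unfolding is_ctmc_iff
proof (intro exI conjI)
  interpret M: prob_space M by fact
  interpret L: prob_space "Lam c" using path_law_Lam path_lawD by auto
  have L [measurable_cong]: "sets (Lam c) = sets path_space" using path_law_Lam path_lawD by auto
  have tr: "(\<integral>\<^sup>+\<omega>. f (X' \<omega>) \<partial>M) = (\<integral>\<^sup>+p. f p \<partial>Lam c)" if "f \<in> borel_measurable path_space" for f
    unfolding law[symmetric] using that by (subst nn_integral_distr) auto
  show "jump_hold M qC c (\<lambda>\<omega>. YE (X' \<omega>)) (\<lambda>\<omega>. HE (X' \<omega>))"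
    unfolding jump_hold_def
  proof (intro conjI allI impI)
    fix n :: nat and y :: "nat \<Rightarrow> nat list" and s :: "nat \<Rightarrow> real" assume s: "\<forall>i<n. 0 \<le> s i"
    note [measurable] = sets_cyl
    let ?A = "{\<omega> \<in> space M. (\<forall>i\<le>n. YE (X' \<omega>) i = y i) \<and> (\<forall>i<n. ennreal (s i) < HE (X' \<omega>) i)}"
    have A: "?A = (\<lambda>\<omega>. (YE (X' \<omega>), HE (X' \<omega>))) -` cyl n y s \<inter> space M"
      using s by (auto simp: cyl_def leD)
    have "?A \<in> sets M" unfolding A by measurable
    then have "emeasure M ?A = (\<integral>\<^sup>+\<omega>. indicator ?A \<omega> \<partial>M)" by simp
    also have "\<dots> = (\<integral>\<^sup>+\<omega>. indicator (cyl n y s) (YE (X' \<omega>), HE (X' \<omega>)) \<partial>M)"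
      by (intro nn_integral_cong) (unfold A, auto simp: indicator_def)
    also have "\<dots> = (\<integral>\<^sup>+p. indicator (cyl n y s) (YE p, HE p) \<partial>Lam c)"
      by (rule tr) measurable
    finally show "measure M ?A = (if y 0 = c then 1 else 0) * (\<Prod>i<n. jump_prob qC (y i) (y (Suc i)) * exp (- qtot qC (y i) * s i))"
      using Lam_cyl[OF c s, of y] by (simp add: M.emeasure_eq_measure)
  qed measurable
  have "AE \<omega> in M. (\<Sum>i. HE (X' \<omega>) i) = top"
  proof (rule AE_suminf_top[OF _ tot_mv_pos])
    show "(\<integral>\<^sup>+\<omega>. (\<Prod>i<k. eexp (HE (X' \<omega>) i)) \<partial>M) \<le> ennreal (tot (mv c) / (tot (mv c) + 2 * real k))" for k
      using Lam_laplace[OF c, of k] by (subst tr) measurable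
  qed measurable
  then show "AE \<omega> in M. (\<Sum>i. HE (X' \<omega>) i) = top \<and> (\<forall>t\<ge>0. X \<omega> t = path_of (YE (X' \<omega>)) (HE (X' \<omega>)) t)"
    using X AE_space
  proof eventually_elim
    case (elim \<omega>)
    have rc: "rc (X' \<omega>)" using measurable_space[OF X' elim(3)] by simp
    have "X' \<omega> t = path_of (YE (X' \<omega>)) (HE (X' \<omega>)) t" if "0 \<le> t" for t
      using suminf_top_ex[OF elim(1), of t] path_eq_path_of[OF rc that] by blast
    then show ?case using elim by simp
  qed
qed

end

section \<open>Deterministic identification of the skewer\<close>

text \<open>Strictly increasing times make a list determined by its set of elements, which gives the
  uniqueness behind THE. The index set I may be infinite; L only has to contain the indices alive at
  level y.\<close>

lemma skewer_list_eq:
  assumes "sorted_wrt (\<lambda>a b. time a < time b) L"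
    and "\<And>a. I a \<and> B a \<le> y \<and> y < D a \<longleftrightarrow> a \<in> set L \<and> B a \<le> y \<and> y < D a"
  shows "skewer_list I time B D mark y = map (\<lambda>a. mark a (y - B a)) (filter (\<lambda>a. B a \<le> y \<and> y < D a) L)"
proof -
  let ?F = "filter (\<lambda>a. B a \<le> y \<and> y < D a) L"
  have s: "sorted_wrt (\<lambda>a b. time a < time b) ?F" using assms(1) by (rule sorted_wrt_filter)
  have "(THE xs. set xs = {a. I a \<and> B a \<le> y \<and> y < D a} \<and> sorted_wrt (\<lambda>a b. time a < time b) xs) = ?F"
  proof (rule the_equality)
    show "set ?F = {a. I a \<and> B a \<le> y \<and> y < D a} \<and> sorted_wrt (\<lambda>a b. time a < time b) ?F"
      using s assms(2) by auto
    fix xs assume xs: "set xs = {a. I a \<and> B a \<le> y \<and> y < D a} \<and> sorted_wrt (\<lambda>a b. time a < time b) xs"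
    have st: "sorted_wrt (<) (map time xs)" "sorted_wrt (<) (map time ?F)"
      using xs s by (auto simp: sorted_wrt_map)
    have set: "set xs = set ?F" using xs assms(2) by auto
    then have "map time xs = map time ?F"
      by (intro strict_sorted_equal st) simp
    moreover have "inj_on time (set ?F)"
      using st(2) by (metis distinct_map strict_sorted_iff)
    ultimately show "xs = ?F" using set by (intro map_inj_on[of time xs ?F]) simp_all
  qed
  then show ?thesis by (simp add: skewer_list_def)
qed

text \<open>The i-th arrival time. \<open>enn2real\<close> maps top to 0, so this is meaningful only
  as long as the gaps before i are finite.\<close>

definition gsum :: "(nat \<Rightarrow> ennreal) \<Rightarrow> nat \<Rightarrow> real" where
  "gsum e i = (\<Sum>l<i. enn2real (e l))"

lemma gsum_Suc [simp]: "gsum e (Suc i) = gsum e i + enn2real (e i)" and gsum_0 [simp]: "gsum e 0 = 0"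
  by (simp_all add: gsum_def)

lemma gsum_nonneg: "0 \<le> gsum e i" by (simp add: gsum_def sum_nonneg)

lemma gsum_mono: "i \<le> j \<Longrightarrow> gsum e i \<le> gsum e j"
  unfolding gsum_def by (intro sum_mono2) auto

lemma ennreal_gsum:
  assumes "\<And>l. l < i \<Longrightarrow> e l < top" shows "ennreal (gsum e i) = (\<Sum>l<i. e l)"
  using assms
proof (induction i)
  case (Suc i)
  have "ennreal (gsum e i) + ennreal (enn2real (e i)) = ennreal (gsum e (Suc i))"
    by (simp add: gsum_nonneg flip: ennreal_plus)
  then show ?case using Suc by simp
qed simp

lemma gsum_strict_mono:
  assumes "\<And>l. l < j \<Longrightarrow> 0 < e l \<and> e l < top" "i < j" shows "gsum e i < gsum e j"
proof -
  have "gsum e i < gsum e (Suc i)" using assms by (simp add: enn2real_positive_iff)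
  also have "\<dots> \<le> gsum e j" using assms(2) by (intro gsum_mono) simp
  finally show ?thesis .
qed

text \<open>J counts arrivals with gaps e. The form with LEAST is that of \<open>path_of\<close>,
  and it covers an infinite gap, after which J is constant.\<close>

definition counts :: "(real \<Rightarrow> nat) \<Rightarrow> (nat \<Rightarrow> ennreal) \<Rightarrow> bool" where
  "counts J e \<longleftrightarrow> (\<forall>i. 0 < e i) \<and> (\<forall>t\<ge>0. J t = (LEAST n. ennreal t < (\<Sum>i\<le>n. e i)))"

lemma counts_eq:
  assumes "counts J e" "\<And>l. l < i \<Longrightarrow> e l < top" "gsum e i \<le> t" "ennreal (t - gsum e i) < e i"
  shows "J t = i"
proof -
  have t: "0 \<le> t" using gsum_nonneg[of e i] assms(3) by simp
  have "(LEAST n. ennreal t < (\<Sum>i\<le>n. e i)) = i"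
  proof (rule Least_equality)
    have "ennreal t = ennreal (gsum e i) + ennreal (t - gsum e i)"
      using gsum_nonneg[of e i] assms(3) by (simp flip: ennreal_plus)
    also have "\<dots> < ennreal (gsum e i) + e i" using assms(4) by (simp add: ennreal_add_left_cancel_less)
    also have "\<dots> = (\<Sum>l\<le>i. e l)" using assms(2) by (simp add: ennreal_gsum lessThan_Suc_atMost[symmetric])
    finally show "ennreal t < (\<Sum>l\<le>i. e l)" .
    fix n assume n: "ennreal t < (\<Sum>l\<le>n. e l)"
    show "i \<le> n"
    proof (rule ccontr)
      assume "\<not> i \<le> n"
      then have "(\<Sum>l\<le>n. e l) \<le> (\<Sum>l<i. e l)" by (intro sum_mono2) auto
      also have "\<dots> = ennreal (gsum e i)" using assms(2) by (simp add: ennreal_gsum)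
      also have "\<dots> \<le> ennreal t" using assms(3) by (intro ennreal_leI)
      finally show False using n by simp
    qed
  qed
  then show ?thesis using assms(1) t by (simp add: counts_def)
qed

lemma jtime_counts:
  assumes J: "counts J e" and fin: "\<And>l. l < i \<Longrightarrow> e l < top"
  shows "jtime J i = gsum e i"
  unfolding jtime_def
proof (rule cInf_eq_minimum)
  have "J (gsum e i) = i" using J by (intro counts_eq[OF J fin]) (auto simp: counts_def)
  then show "gsum e i \<in> {t. 0 \<le> t \<and> i \<le> J t}" by (simp add: gsum_nonneg)
  fix t assume t: "t \<in> {t. 0 \<le> t \<and> i \<le> J t}"
  show "gsum e i \<le> t"
  proof (rule ccontr)
    assume "\<not> gsum e i \<le> t"
    then have lt: "t < gsum e i" by simp
    then obtain k where k: "i = Suc k" using t by (cases i) auto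
    have "ennreal t < ennreal (gsum e i)" using lt t by (intro ennreal_lessI) auto
    also have "\<dots> = (\<Sum>l\<le>k. e l)" using fin by (simp add: ennreal_gsum k lessThan_Suc_atMost del: gsum_Suc)
    finally have "(LEAST n. ennreal t < (\<Sum>i\<le>n. e i)) \<le> k" by (rule Least_le)
    then show False using J t k by (auto simp: counts_def)
  qed
qed

text \<open>The height right after the i-th birth, that is, the top of the latest spindle, from
  which the next descent starts.\<close>

primrec hgt :: "real \<Rightarrow> (nat \<Rightarrow> ennreal) \<Rightarrow> (nat \<Rightarrow> real \<Rightarrow> nat) \<Rightarrow> nat \<Rightarrow> real" where
  "hgt h e z 0 = h"
| "hgt h e z (Suc i) = hgt h e z i - enn2real (e i) + zeta (z i)"

lemma hgt_shift: "hgt (h - enn2real (e 0) + zeta (z 0)) (\<lambda>i. e (Suc i)) (\<lambda>i. z (Suc i)) k = hgt h e z (Suc k)"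
  by (induction k) auto

text \<open>Unrolls the recursion of the exploration into explicit birth levels, the form that can
  be compared with the jumps of X.\<close>

lemma st_obtain:
  assumes "st h e z"
  obtains K where "\<And>k. k < K \<Longrightarrow> e k < ennreal (hgt h e z k)" "ennreal (hgt h e z K) < e K"
    "\<And>y. sk h e z y = concat (map (\<lambda>k. jn [] (hgt h e z k - enn2real (e k)) (rp (z k)) y) [0..<K])"
proof -
  obtain n where "stn n h e z" using assms by (auto simp: st_def)
  then have "\<exists>K. (\<forall>k<K. e k < ennreal (hgt h e z k)) \<and> ennreal (hgt h e z K) < e K \<and>
    (\<forall>y. skn n h e z y = concat (map (\<lambda>k. jn [] (hgt h e z k - enn2real (e k)) (rp (z k)) y) [0..<K]))"
  proof (induction n arbitrary: h e z)
    case (Suc n)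
    show ?case
    proof (cases "ennreal h < e 0")
      case True
      then show ?thesis by (intro exI[of _ 0]) (auto simp: leD less_imp_le)
    next
      case False
      then have lt: "e 0 < ennreal h" and "stn n (h - enn2real (e 0) + zeta (z 0)) (\<lambda>i. e (Suc i)) (\<lambda>i. z (Suc i))"
        using Suc.prems by auto
      from Suc.IH[OF this(2)] obtain K where K: "\<And>k. k < K \<Longrightarrow> e (Suc k) < ennreal (hgt h e z (Suc k))"
        "ennreal (hgt h e z (Suc K)) < e (Suc K)"
        "\<And>y. skn n (h - enn2real (e 0) + zeta (z 0)) (\<lambda>i. e (Suc i)) (\<lambda>i. z (Suc i)) y =
          concat (map (\<lambda>k. jn [] (hgt h e z (Suc k) - enn2real (e (Suc k))) (rp (z (Suc k))) y) [0..<K])"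
        unfolding hgt_shift by blast
      have "map (\<lambda>k. jn [] (hgt h e z k - enn2real (e k)) (rp (z k)) y) [0..<Suc K] =
        jn [] (h - enn2real (e 0)) (rp (z 0)) y # map (\<lambda>k. jn [] (hgt h e z (Suc k) - enn2real (e (Suc k))) (rp (z (Suc k))) y) [0..<K]" for y
        by (simp add: upt_conv_Cons map_Suc_upt[symmetric] del: upt_Suc hgt.simps(2))
      then show ?thesis
        using lt K by (intro exI[of _ "Suc K"]) (auto simp: cat_def less_Suc_eq_0_disj simp del: upt_Suc hgt.simps(2))
    qed
  qed simp
  then obtain K where K: "\<And>k. k < K \<Longrightarrow> e k < ennreal (hgt h e z k)" "ennreal (hgt h e z K) < e K"
    "\<And>y. skn n h e z y = concat (map (\<lambda>k. jn [] (hgt h e z k - enn2real (e k)) (rp (z k)) y) [0..<K])"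
    by blast
  show thesis
    by (rule that[OF K(1,2)]) (simp_all only: sk_eq[OF \<open>stn n h e z\<close>] K(3))
qed

lemma hit0_cong: "(\<And>t. 0 \<le> t \<Longrightarrow> f t = g t) \<Longrightarrow> hit0 f = hit0 g"
  unfolding hit0_def by (metis (mono_tags, lifting))

text \<open>The clock J has interarrival times e, the i-th birth is at level Bh i and dies at level H i, and
  K is the number of births after the root.\<close>

locale good_clade =
  fixes Z :: "nat \<Rightarrow> real \<Rightarrow> nat" and J :: "real \<Rightarrow> nat" and e :: "nat \<Rightarrow> ennreal" and z :: "nat \<Rightarrow> real \<Rightarrow> nat" and K :: nat
  assumes Zz: "0 \<le> t \<Longrightarrow> Z i t = z i t" and rcz: "rc (z i)" and hitsz: "hits (z i)"
    and J: "counts J e"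
    and below: "k < K \<Longrightarrow> e k < ennreal (hgt (zeta (z 0)) e (\<lambda>i. z (Suc i)) k)"
    and stop: "ennreal (hgt (zeta (z 0)) e (\<lambda>i. z (Suc i)) K) < e K"
begin

abbreviation "H \<equiv> hgt (zeta (z 0)) e (\<lambda>i. z (Suc i))"
abbreviation "U \<equiv> gsum e"

definition Bh :: "nat \<Rightarrow> real" where "Bh i = (if i = 0 then 0 else H (i - 1) - enn2real (e (i - 1)))"

lemma hit0_Z: "hit0 (Z i) = zeta (z i)"
  using hit0_cong[of "Z i" "z i"] hit0_eq_zeta[OF rcz hitsz] Zz by simp

lemma efin: "k < K \<Longrightarrow> e k < top" using below[of k] by (meson ennreal_less_top less_trans)

lemma epos: "0 < e k" using J by (simp add: counts_def)

lemma e_lt_H: "k < K \<Longrightarrow> enn2real (e k) < H k"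
proof -
  assume k: "k < K"
  obtain x where x: "e k = ennreal x" "0 \<le> x" using efin[OF k] by (cases "e k") auto
  then show ?thesis using below[OF k] by (cases "0 \<le> H k") (auto simp: ennreal_less_iff ennreal_neg)
qed

lemma H_nonneg: "k \<le> K \<Longrightarrow> 0 \<le> H k"
proof (cases k)
  case (Suc j)
  assume "k \<le> K"
  then have "enn2real (e j) < H j" using e_lt_H[of j] Suc by simp
  then show ?thesis using Suc zeta_nonneg[of "z (Suc j)"] by simp
qed simp

lemma H_eq: "H i = (\<Sum>l\<le>i. zeta (z l)) - U i"
  by (induction i) auto

lemma U_less: "i < j \<Longrightarrow> j \<le> K \<Longrightarrow> U i < U j"
  using efin epos by (intro gsum_strict_mono) auto

lemma J_eq: "i \<le> K \<Longrightarrow> U i \<le> t \<Longrightarrow> ennreal (t - U i) < e i \<Longrightarrow> J t = i"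
  using efin by (intro counts_eq[OF J]) auto

lemma X_eq: "i \<le> K \<Longrightarrow> U i \<le> t \<Longrightarrow> ennreal (t - U i) < e i \<Longrightarrow> mp_X Z J t = H i - (t - U i)"
  using J_eq[of i t] by (simp add: mp_X_def hit0_Z H_eq)

lemma locate:
  assumes "0 \<le> t" "t \<le> U K + H K"
  obtains i where "i \<le> K" "U i \<le> t" "ennreal (t - U i) < e i" "i < K \<Longrightarrow> t - U i < enn2real (e i)"
proof -
  define i where "i = Max {i. i \<le> K \<and> U i \<le> t}"
  have fin: "finite {i. i \<le> K \<and> U i \<le> t}" by (rule finite_subset[of _ "{..K}"]) auto
  have ne: "0 \<in> {i. i \<le> K \<and> U i \<le> t}" using assms by simp
  have i: "i \<le> K" "U i \<le> t" using Max_in[OF fin] ne unfolding i_def by blast+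
  have lt: "t - U i < enn2real (e i)" if "i < K"
  proof (rule ccontr)
    assume "\<not> t - U i < enn2real (e i)"
    then have "Suc i \<in> {i. i \<le> K \<and> U i \<le> t}" using that by simp
    then have "Suc i \<le> i" unfolding i_def by (intro Max_ge fin)
    then show False by simp
  qed
  have "ennreal (t - U i) < e i"
  proof (cases "i < K")
    case True
    obtain x where "e i = ennreal x" "0 \<le> x" using efin[OF True] by (cases "e i") auto
    then show ?thesis using lt[OF True] i by (simp add: ennreal_less_iff)
  next
    case False
    then have "i = K" using i by simp
    then have "ennreal (t - U i) \<le> ennreal (H K)" using assms by (intro ennreal_leI) simp
    then show ?thesis using stop \<open>i = K\<close> by (simp add: le_less_trans)
  qed
  then show thesis using that i lt by blast
qed

text \<open>Each of the first K gaps is shorter than the height at which it starts, so X does not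
  reach 0 between jumps; only the final descent does.\<close>

lemma X_pos: assumes "0 \<le> t" "t < U K + H K" shows "0 < mp_X Z J t"
proof -
  obtain i where i: "i \<le> K" "U i \<le> t" "ennreal (t - U i) < e i" "i < K \<Longrightarrow> t - U i < enn2real (e i)"
    using locate[of t] assms by auto
  have "t - U i < H i"
  proof (cases "i < K")
    case True
    then show ?thesis using i(4) e_lt_H[of i] by simp
  next
    case False
    then show ?thesis using i(1) assms by simp
  qed
  then show ?thesis using X_eq[OF i(1-3)] by simp
qed

lemma JT: "J (U K + H K) = K"
  by (rule J_eq) (use H_nonneg[of K] stop in auto)

lemma T_eq: "mp_T Z J = U K + H K"
  unfolding mp_T_def
proof (rule cInf_eq_minimum)
  show "U K + H K \<in> {t. 0 \<le> t \<and> mp_X Z J t = 0}"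
    using X_eq[of K "U K + H K"] H_nonneg[of K] gsum_nonneg[of e K] stop by simp
  fix t assume t: "t \<in> {t. 0 \<le> t \<and> mp_X Z J t = 0}"
  show "U K + H K \<le> t"
    using X_pos[of t] t by (cases "t < U K + H K") auto
qed

lemma jtime_eq: "i \<le> K \<Longrightarrow> jtime J i = U i"
  using efin by (intro jtime_counts[OF J]) auto

lemma D_eq: "i \<le> K \<Longrightarrow> mp_D Z J i = H i"
  unfolding mp_D_def using X_eq[of i "U i"] epos by (simp add: jtime_eq)

lemma B_eq: assumes "i \<le> K" shows "mp_B Z J i = Bh i"
proof (cases i)
  case (Suc k)
  have k: "k < K" using assms Suc by simp
  have e: "ennreal (enn2real (e k)) = e k" using efin[OF k] by simp
  \<comment> \<open>Between two successive jump times X is affine with slope -1, so its left limit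
    can be computed explicitly.\<close>
  have "eventually (\<lambda>t. H k - (t - U k) = mp_X Z J t) (at_left (U (Suc k)))"
    unfolding eventually_at_left_field
  proof (intro exI[of _ "U k"] conjI allI impI)
    show "U k < U (Suc k)" using U_less[of k "Suc k"] k by simp
    fix t assume t: "U k < t" "t < U (Suc k)"
    then have "ennreal (t - U k) < ennreal (enn2real (e k))" by (intro ennreal_lessI) auto
    then show "H k - (t - U k) = mp_X Z J t" using X_eq[of k t] t k e by simp
  qed
  moreover have "((\<lambda>t. H k - (t - U k)) \<longlongrightarrow> H k - (U (Suc k) - U k)) (at_left (U (Suc k)))"
    by (intro tendsto_intros)
  ultimately have "(mp_X Z J \<longlongrightarrow> H k - (U (Suc k) - U k)) (at_left (U (Suc k)))"
    by (rule Lim_transform_eventually[rotated])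
  then have "Lim (at_left (U (Suc k))) (mp_X Z J) = H k - (U (Suc k) - U k)"
    by (intro tendsto_Lim) auto
  then show ?thesis using Suc assms by (simp add: mp_B_def jtime_eq Bh_def del: gsum_Suc) simp
qed (simp add: mp_B_def Bh_def)

lemma Bh_D: "Bh i + zeta (z i) = H i"
  by (cases i) (auto simp: Bh_def)

lemma Bh_nonneg: "i \<le> K \<Longrightarrow> 0 \<le> Bh i"
  using e_lt_H[of "i - 1"] by (cases i) (auto simp: Bh_def)

definition lst :: "real \<Rightarrow> nat list" where
  "lst y = map (\<lambda>i. Z i (y - Bh i)) (filter (\<lambda>i. Bh i \<le> y \<and> y < H i) [0..<Suc K])"

lemma lst_eq: "lst y = concat (map (\<lambda>i. if Bh i \<le> y then rp (z i) (y - Bh i) else []) [0..<Suc K])"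
proof -
  have "map (\<lambda>i. Z i (y - Bh i)) (filter (\<lambda>i. Bh i \<le> y \<and> y < H i) L) =
    concat (map (\<lambda>i. if Bh i \<le> y then rp (z i) (y - Bh i) else []) L)" for L
  proof (induction L)
    case (Cons i L)
    have "y - Bh i < zeta (z i) \<longleftrightarrow> y < H i" using Bh_D[of i] by auto
    then show ?case using Cons Zz by (auto simp: rp_def)
  qed simp
  then show ?thesis by (simp only: lst_def)
qed

lemma lst_neg: "y < 0 \<Longrightarrow> lst y = []"
proof -
  assume y: "y < 0"
  have "\<not> Bh i \<le> y" if "i \<le> K" for i using Bh_nonneg[OF that] y by simp
  then show ?thesis by (auto simp: lst_def filter_empty_conv simp del: upt_Suc)
qed

lemma skewer_eq: "mp_skewer Z J y = lst y"
proof -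
  have "mp_skewer Z J y = map (\<lambda>a. Z a (y - mp_B Z J a)) (filter (\<lambda>a. mp_B Z J a \<le> y \<and> y < mp_D Z J a) [0..<Suc K])"
    unfolding mp_skewer_def T_eq JT
  proof (rule skewer_list_eq)
    show "sorted_wrt (\<lambda>a b. jtime J a < jtime J b) [0..<Suc K]"
      by (rule sorted_wrt_mono_rel[OF _ sorted_wrt_upt]) (auto simp: jtime_eq intro!: U_less)
  qed auto
  also have "\<dots> = map (\<lambda>a. Z a (y - Bh a)) (filter (\<lambda>a. mp_B Z J a \<le> y \<and> y < mp_D Z J a) [0..<Suc K])"
    by (intro map_cong) (auto simp: B_eq simp del: upt_Suc)
  also have "filter (\<lambda>a. mp_B Z J a \<le> y \<and> y < mp_D Z J a) [0..<Suc K] = filter (\<lambda>i. Bh i \<le> y \<and> y < H i) [0..<Suc K]"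
    by (intro filter_cong) (auto simp: B_eq D_eq simp del: upt_Suc)
  finally show ?thesis by (simp only: lst_def)
qed

lemma lst_cat:
  assumes "0 \<le> y" "\<And>y. sk (zeta (z 0)) e (\<lambda>i. z (Suc i)) y = concat (map (\<lambda>k. jn [] (H k - enn2real (e k)) (rp (z (Suc k))) y) [0..<K])"
  shows "lst y = cat (rp (z 0)) (sk (zeta (z 0)) e (\<lambda>i. z (Suc i))) y"
proof -
  have "[0..<Suc K] = 0 # map Suc [0..<K]" by (simp add: upt_conv_Cons map_Suc_upt del: upt_Suc)
  moreover have "(if Bh (Suc k) \<le> y then rp (z (Suc k)) (y - Bh (Suc k)) else []) = jn [] (H k - enn2real (e k)) (rp (z (Suc k))) y" for k
    by (simp add: Bh_def jn_def)
  moreover have "(if Bh 0 \<le> y then rp (z 0) (y - Bh 0) else []) = rp (z 0) y" using assms(1) by (simp add: Bh_def)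
  ultimately show ?thesis unfolding lst_eq cat_def assms(2) by (simp only: list.map concat.simps map_map comp_def)
qed

end

lemma gsum_shift: "gsum a (Suc j) = enn2real (a 0) + gsum (\<lambda>i. a (Suc i)) j"
  unfolding gsum_def by (rule sum.lessThan_Suc_shift)

text \<open>The reversal puts the highest immigration level first: it belongs to the earliest
  excursion in negative time and hence stands leftmost.\<close>

lemma imn_concat:
  "imn m a p y = concat (map (\<lambda>j. if gsum a (Suc j) \<le> y then p j (y - gsum a (Suc j)) else []) (rev [0..<m]))"
proof (induction m arbitrary: a p y)
  case (Suc m)
  have r: "rev [0..<Suc m] = map Suc (rev [0..<m]) @ [0]"
    by (simp add: upt_conv_Cons map_Suc_upt[symmetric] rev_map del: upt_Suc)
  show ?case
  proof (cases "y < enn2real (a 0)")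
    case True
    have "\<not> gsum a (Suc j) \<le> y" for j
      using True gsum_nonneg[of "\<lambda>i. a (Suc i)" j] unfolding gsum_shift by simp
    then show ?thesis using True by (simp add: jn_def del: gsum_Suc)
  next
    case False
    have "(if gsum a (Suc (Suc j)) \<le> y then p (Suc j) (y - gsum a (Suc (Suc j))) else []) =
      (if gsum (\<lambda>i. a (Suc i)) (Suc j) \<le> y - enn2real (a 0) then p (Suc j) (y - enn2real (a 0) - gsum (\<lambda>i. a (Suc i)) (Suc j)) else [])" for j
      unfolding gsum_shift[of a "Suc j"] by (simp add: algebra_simps del: gsum_Suc)
    then show ?thesis unfolding r using False
      by (simp add: jn_def cat_def Suc.IH comp_def gsum_shift[of a 0] del: gsum_Suc)
  qed
qed simp

lemma filter_concat_map: "map f (filter P (concat (map g js))) = concat (map (\<lambda>j. map f (filter P (g j))) js)"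
  by (induction js) auto

text \<open>The excursions of different immigrants occupy disjoint time intervals, ordered by
  decreasing j. Immigrants arriving above y have no jump across y, so a finite list of jumps
  suffices for each y.\<close>

lemma neg_skewer_eq:
  assumes N: "counts N a" and a: "imgood a" and y: "0 \<le> y"
    and C: "\<And>j. 1 \<le> j \<Longrightarrow> good_clade (ZN j) (JN j) (e j) (z j) (K j)"
    and S: "\<And>j y. 1 \<le> j \<Longrightarrow> sk (zeta (z j 0)) (e j) (\<lambda>i. z j (Suc i)) y =
      concat (map (\<lambda>k. jn [] (hgt (zeta (z j 0)) (e j) (\<lambda>i. z j (Suc i)) k - enn2real (e j k)) (rp (z j (Suc k))) y) [0..<K j])"
  shows "neg_skewer N ZN JN y = imp a (\<lambda>j. cat (rp (z (Suc j) 0)) (sk (zeta (z (Suc j) 0)) (e (Suc j)) (\<lambda>i. z (Suc j) (Suc i)))) y"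
proof -
  define A where "A j = gsum a j" for j
  define Bh where "Bh j i = good_clade.Bh (e j) (z j) i" for j i
  define H where "H j i = hgt (zeta (z j 0)) (e j) (\<lambda>i. z j (Suc i)) i" for j i
  define U where "U j i = gsum (e j) i" for j i
  define xi where "xi j = neg_xi ZN JN j" for j
  have a_fin: "a l < top" "0 < a l" for l using a by (auto simp: imgood_def)
  have jN: "jtime N j = A j" for j unfolding A_def by (rule jtime_counts[OF N]) (rule a_fin)
  have A_less: "i < j \<Longrightarrow> A i < A j" for i j unfolding A_def using a_fin by (intro gsum_strict_mono) auto
  have A_le: "i \<le> j \<Longrightarrow> A i \<le> A j" for i j unfolding A_def by (rule gsum_mono)
  have xi: "xi j = U j (K j) + H j (K j)" "JN j (xi j) = K j" "0 \<le> xi j" if "1 \<le> j" for j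
    using good_clade.T_eq[OF C[OF that]] good_clade.JT[OF C[OF that]] good_clade.H_nonneg[OF C[OF that], of "K j"] gsum_nonneg[of "e j" "K j"]
    by (auto simp: xi_def neg_xi_def U_def H_def)
  have tm: "jtime (JN j) i = U j i" "mp_B (ZN j) (JN j) i = Bh j i" "mp_D (ZN j) (JN j) i = H j i" "0 \<le> Bh j i"
    "0 \<le> U j i" "U j i \<le> xi j" if "1 \<le> j" "i \<le> K j" for j i
    using good_clade.jtime_eq[OF C that(2)] good_clade.B_eq[OF C that(2)] good_clade.D_eq[OF C that(2)] good_clade.Bh_nonneg[OF C that(2)]
      xi[OF that(1)] good_clade.H_nonneg[OF C, of j "K j"] gsum_mono[OF that(2), of "e j"] that gsum_nonneg[of "e j" i]
    by (auto simp: U_def Bh_def H_def)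
  define time where "time = (\<lambda>(j, i). neg_L N ZN JN j + jtime (JN j) i)"
  have negL: "neg_L N ZN JN j = - A j - (\<Sum>i=1..j. xi i)" for j by (simp add: neg_L_def jN xi_def)
  \<comment> \<open>Between two excursions X descends linearly from the higher immigration level to
    the lower one, which takes a positive time.\<close>
  have sep: "neg_L N ZN JN j' + xi j' < neg_L N ZN JN j" if jj: "1 \<le> j" "j < j'" for j j'
  proof -
    obtain k where k: "j' = Suc k" "j \<le> k" using jj by (cases j') auto
    have "(\<Sum>i=1..j. xi i) \<le> (\<Sum>i=1..k. xi i)" using k xi(3) by (intro sum_mono2) auto
    then show ?thesis using A_less[OF jj(2)] unfolding negL k(1) by simp
  qed
  have tlt: "time (j', i') < time (j, i)" if "1 \<le> j" "j < j'" "i \<le> K j" "i' \<le> K j'" for j j' i i'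
    using sep[OF that(1,2)] tm[of j' i'] tm[of j i] that by (simp add: time_def)
  obtain m where m: "ennreal y < (\<Sum>i\<le>m. a i)" using a suminf_top_ex[of a y] unfolding imgood_def by blast
  have "(\<Sum>i\<le>m. a i) = ennreal (A (Suc m))"
    unfolding A_def using a_fin by (subst ennreal_gsum) (auto simp: lessThan_Suc_atMost)
  then have ym: "y < A (Suc m)" using m y by (simp add: ennreal_less_iff)
  \<comment> \<open>The jumps of the first n immigrants in time order: the last immigrant comes
    first, and within an excursion jumps are listed by index.\<close>
  define L where "L n = concat (map (\<lambda>j. map (\<lambda>i. (j, i)) [0..<Suc (K j)]) (rev [1..<Suc n]))" for n
  have setL: "(j, i) \<in> set (L n) \<longleftrightarrow> 1 \<le> j \<and> j \<le> n \<and> i \<le> K j" for j i n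
    by (auto simp: L_def simp del: upt_Suc intro!: bexI[of _ j])
  have L_Suc: "L (Suc n) = map (\<lambda>i. (Suc n, i)) [0..<Suc (K (Suc n))] @ L n" for n
  proof -
    have "rev [1..<Suc (Suc n)] = Suc n # rev [1..<Suc n]" by simp
    then show ?thesis unfolding L_def by (simp del: upt_Suc)
  qed
  have sorted: "sorted_wrt (\<lambda>a b. time a < time b) (L n)" for n
  proof (induction n)
    case (Suc n)
    have "sorted_wrt (\<lambda>a b. time a < time b) (map (\<lambda>i. (Suc n, i)) [0..<Suc (K (Suc n))])"
      unfolding sorted_wrt_map
    proof (rule sorted_wrt_mono_rel[OF _ sorted_wrt_upt])
      fix i i' assume *: "i \<in> set [0..<Suc (K (Suc n))]" "i' \<in> set [0..<Suc (K (Suc n))]" "i < i'"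
      then have "i' \<le> K (Suc n)" by (simp del: upt_Suc)
      then show "time (Suc n, i) < time (Suc n, i')"
        using good_clade.U_less[OF C \<open>i < i'\<close>, of "Suc n"] tm(1)[of "Suc n" i] tm(1)[of "Suc n" i'] \<open>i < i'\<close>
        by (simp add: time_def U_def)
    qed
    then show ?case unfolding L_Suc sorted_wrt_append using Suc
    proof (intro conjI ballI)
      fix p q assume "p \<in> set (map (\<lambda>i. (Suc n, i)) [0..<Suc (K (Suc n))])" "q \<in> set (L n)"
      then show "time p < time q" using setL[of "fst q" "snd q" n] tlt[of "fst q" "Suc n" "snd q" "snd p"]
        by (auto simp del: upt_Suc)
    qed auto
  qed (simp add: L_def)
  let ?B = "\<lambda>(j, i). jtime N j + mp_B (ZN j) (JN j) i"
  let ?D = "\<lambda>(j, i). jtime N j + mp_D (ZN j) (JN j) i"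
  have "neg_skewer N ZN JN y = map (\<lambda>b. (\<lambda>(j, i). ZN j i) b (y - ?B b)) (filter (\<lambda>b. ?B b \<le> y \<and> y < ?D b) (L m))"
    unfolding neg_skewer_def time_def[symmetric]
  proof (rule skewer_list_eq[OF sorted])
    fix b :: "nat \<times> nat"
    obtain j i where b: "b = (j, i)" by (cases b)
    have "j \<le> m" if "1 \<le> j" "i \<le> K j" "jtime N j + mp_B (ZN j) (JN j) i \<le> y"
    proof (rule ccontr)
      assume "\<not> j \<le> m"
      then have "A (Suc m) \<le> A j" by (intro A_le) simp
      then show False using that tm[OF that(1,2)] ym by (simp add: jN)
    qed
    then show "((case b of (j, i) \<Rightarrow> 1 \<le> j \<and> i \<le> JN j (neg_xi ZN JN j)) \<and> ?B b \<le> y \<and> y < ?D b) =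
      (b \<in> set (L m) \<and> ?B b \<le> y \<and> y < ?D b)"
      using xi(2)[of j] by (auto simp: b setL xi_def)
  qed
  also have "\<dots> = concat (map (\<lambda>j. map (\<lambda>b. (\<lambda>(j, i). ZN j i) b (y - ?B b)) (filter (\<lambda>b. ?B b \<le> y \<and> y < ?D b) (map (\<lambda>i. (j, i)) [0..<Suc (K j)]))) (rev [1..<Suc m]))"
    unfolding L_def by (rule filter_concat_map)
  also have "\<dots> = concat (map (\<lambda>j. good_clade.lst (ZN j) (e j) (z j) (K j) (y - A j)) (rev [1..<Suc m]))"
  proof (intro arg_cong[where f=concat] map_cong refl)
    fix j assume "j \<in> set (rev [1..<Suc m])"
    then have j: "1 \<le> j" by (auto simp del: upt_Suc)
    have "map (\<lambda>b. (\<lambda>(j, i). ZN j i) b (y - ?B b)) (filter (\<lambda>b. ?B b \<le> y \<and> y < ?D b) (map (\<lambda>i. (j, i)) is)) =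
      map (\<lambda>i. ZN j i (y - A j - Bh j i)) (filter (\<lambda>i. Bh j i \<le> y - A j \<and> y - A j < H j i) is)" if "set is \<subseteq> {..K j}" for "is"
      using that
    proof (induction "is")
      case (Cons i "is")
      then show ?case using tm[OF j, of i] by (auto simp: jN algebra_simps)
    qed simp
    moreover have "set [0..<Suc (K j)] \<subseteq> {..K j}" by (auto simp del: upt_Suc)
    ultimately
    show "map (\<lambda>b. (\<lambda>(j, i). ZN j i) b (y - ?B b)) (filter (\<lambda>b. ?B b \<le> y \<and> y < ?D b) (map (\<lambda>i. (j, i)) [0..<Suc (K j)])) =
      good_clade.lst (ZN j) (e j) (z j) (K j) (y - A j)"
      unfolding good_clade.lst_def[OF C[OF j]] Bh_def H_def by blast
  qed
  also have "\<dots> = concat (map (\<lambda>j. good_clade.lst (ZN (Suc j)) (e (Suc j)) (z (Suc j)) (K (Suc j)) (y - A (Suc j))) (rev [0..<m]))"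
  proof -
    have "rev [1..<Suc m] = map Suc (rev [0..<m])" by (metis One_nat_def map_Suc_upt rev_map)
    then show ?thesis by (simp only: map_map comp_def)
  qed
  also have "\<dots> = concat (map (\<lambda>j. if gsum a (Suc j) \<le> y then cat (rp (z (Suc j) 0)) (sk (zeta (z (Suc j) 0)) (e (Suc j)) (\<lambda>i. z (Suc j) (Suc i))) (y - gsum a (Suc j)) else []) (rev [0..<m]))"
  proof (intro arg_cong[where f=concat] map_cong refl)
    fix j
    have j: "1 \<le> Suc j" by simp
    show "good_clade.lst (ZN (Suc j)) (e (Suc j)) (z (Suc j)) (K (Suc j)) (y - A (Suc j)) =
      (if gsum a (Suc j) \<le> y then cat (rp (z (Suc j) 0)) (sk (zeta (z (Suc j) 0)) (e (Suc j)) (\<lambda>i. z (Suc j) (Suc i))) (y - gsum a (Suc j)) else [])"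
    proof (cases "gsum a (Suc j) \<le> y")
      case True
      then show ?thesis using good_clade.lst_cat[OF C[OF j] _ S[OF j], of "y - A (Suc j)"] by (simp add: A_def del: gsum_Suc)
    next
      case False
      then show ?thesis using good_clade.lst_neg[OF C[OF j], of "y - A (Suc j)"] by (simp add: A_def del: gsum_Suc)
    qed
  qed
  also have "\<dots> = imn m a (\<lambda>j. cat (rp (z (Suc j) 0)) (sk (zeta (z (Suc j) 0)) (e (Suc j)) (\<lambda>i. z (Suc j) (Suc i)))) y"
    by (rule imn_concat[symmetric])
  also have "\<dots> = imp a (\<lambda>j. cat (rp (z (Suc j) 0)) (sk (zeta (z (Suc j) 0)) (e (Suc j)) (\<lambda>i. z (Suc j) (Suc i)))) y"
    by (rule imp_eq[symmetric, OF a m])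
  finally show ?thesis .
qed

section \<open>Poisson clocks\<close>

lemma AE_expo_0: "AE e in expo 0. e = top"
proof -
  have "(\<integral>\<^sup>+e. (if e = top then 0 else 1) \<partial>expo 0) = 0"
    by (subst nn_integral_expo0) auto
  then have "AE e in expo 0. (if e = top then 0 else 1) = (0::ennreal)"
    by (subst (asm) nn_integral_0_iff_AE) auto
  then show ?thesis by eventually_elim (auto split: if_splits)
qed

lemma qtot_qPois: "qtot (qPois r) m = r"
proof -
  have "qtot (qPois r) m = (\<Sum>y\<in>{m + 1}. qPois r m y)"
    unfolding qtot_def by (intro sum.mono_neutral_left) (auto simp: qPois_def split: if_splits)
  then show ?thesis by (simp add: qPois_def)
qed

text \<open>A clock of rate 0 never leaves state 0, in accordance with \<open>jump_prob\<close>,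
  which keeps an absorbing state in place.\<close>

definition pois_state :: "real \<Rightarrow> nat \<Rightarrow> nat" where "pois_state r i = (if r = 0 then 0 else i)"

lemma jump_prob_qPois: "jump_prob (qPois r) x y = (if y = (if r = 0 then x else Suc x) then 1 else 0)"
  by (auto simp: jump_prob_def qtot_qPois qPois_def)

lemma nn_integral_prod_expo:
  assumes r: "0 \<le> r" and s: "\<forall>i<n. 0 \<le> s i"
  shows "(\<integral>\<^sup>+\<omega>. (\<Prod>i<n. indicator {e. ennreal (s i) < e} (\<omega> i)) \<partial>PiM UNIV (\<lambda>_::nat. expo r)) = ennreal (\<Prod>i<n. exp (- r * s i))"
  using s
proof (induction n arbitrary: s)
  case 0
  interpret prob_space "PiM UNIV (\<lambda>_::nat. expo r)" by (intro prob_space_PiM prob_space_expo)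
  show ?case by (simp add: emeasure_space_1)
next
  case (Suc n)
  have s0: "0 \<le> s 0" using Suc.prems by auto
  have [measurable]: "(\<lambda>\<omega>. \<Prod>i<n. indicator {e. ennreal (s i) < e} (\<omega> i) :: ennreal) \<in> borel_measurable (PiM UNIV (\<lambda>_::nat. expo r))" for n and s :: "nat \<Rightarrow> real"
    by measurable
  have "(\<integral>\<^sup>+\<omega>. (\<Prod>i<Suc n. indicator {e. ennreal (s i) < e} (\<omega> i)) \<partial>PiM UNIV (\<lambda>_::nat. expo r)) =
    (\<integral>\<^sup>+e. \<integral>\<^sup>+\<omega>. indicator {e. ennreal (s 0) < e} e * (\<Prod>i<n. indicator {e. ennreal (s (Suc i)) < e} (\<omega> i)) \<partial>PiM UNIV (\<lambda>_::nat. expo r) \<partial>expo r)"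
    by (subst nn_integral_seq_split[OF prob_space_expo]) (auto simp del: prod.lessThan_Suc simp add: prod.lessThan_Suc_shift)
  also have "\<dots> = (\<integral>\<^sup>+e. indicator {e. ennreal (s 0) < e} e * ennreal (\<Prod>i<n. exp (- r * s (Suc i))) \<partial>expo r)"
    using Suc.IH[of "\<lambda>i. s (Suc i)"] Suc.prems by (subst nn_integral_cmult) auto
  also have "\<dots> = ennreal (exp (- r * s 0)) * ennreal (\<Prod>i<n. exp (- r * s (Suc i)))"
    using emeasure_expo_gt[OF r s0] by (subst nn_integral_multc) auto
  finally show ?case unfolding prod.lessThan_Suc_shift by (simp add: ennreal_mult prod_nonneg)
qed

lemma jump_hold_pois_model:
  assumes r: "0 \<le> r"
  shows "jump_hold (PiM UNIV (\<lambda>_::nat. expo r)) (qPois r) 0 (\<lambda>_ i. pois_state r i) (\<lambda>\<omega>. \<omega>)"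
  unfolding jump_hold_def
proof (intro conjI allI impI)
  let ?M = "PiM UNIV (\<lambda>_::nat. expo r)"
  interpret prob_space ?M by (intro prob_space_PiM prob_space_expo)
  show "(\<lambda>\<omega>. pois_state r i) \<in> ?M \<rightarrow>\<^sub>M count_space UNIV" "(\<lambda>\<omega>. \<omega> i) \<in> borel_measurable ?M" for i by measurable
  fix n y and s :: "nat \<Rightarrow> real" assume s: "\<forall>i<n. 0 \<le> s i"
  show "measure ?M {\<omega> \<in> space ?M. (\<forall>i\<le>n. pois_state r i = y i) \<and> (\<forall>i<n. ennreal (s i) < \<omega> i)} =
    (if y 0 = 0 then 1 else 0) * (\<Prod>i<n. jump_prob (qPois r) (y i) (y (Suc i)) * exp (- qtot (qPois r) (y i) * s i))"
  proof (cases "\<forall>i\<le>n. pois_state r i = y i")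
    case True
    have "emeasure ?M {\<omega> \<in> space ?M. \<forall>i<n. ennreal (s i) < \<omega> i} = (\<integral>\<^sup>+\<omega>. indicator {\<omega> \<in> space ?M. \<forall>i<n. ennreal (s i) < \<omega> i} \<omega> \<partial>?M)"
      by (subst nn_integral_indicator) auto
    also have "\<dots> = (\<integral>\<^sup>+\<omega>. (\<Prod>i<n. indicator {e. ennreal (s i) < e} (\<omega> i)) \<partial>?M)"
    proof (intro nn_integral_cong)
      fix \<omega> assume "\<omega> \<in> space ?M"
      then show "indicator {\<omega> \<in> space ?M. \<forall>i<n. ennreal (s i) < \<omega> i} \<omega> = (\<Prod>i<n. indicator {e. ennreal (s i) < e} (\<omega> i) :: ennreal)"
        by (induction n) (auto simp: indicator_def less_Suc_eq)
    qed
    also have "\<dots> = ennreal (\<Prod>i<n. exp (- r * s i))" by (rule nn_integral_prod_expo[OF r s])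
    finally have "measure ?M {\<omega> \<in> space ?M. \<forall>i<n. ennreal (s i) < \<omega> i} = (\<Prod>i<n. exp (- r * s i))"
      by (simp add: emeasure_eq_measure prod_nonneg)
    moreover have "y 0 = 0" using True by (auto simp: pois_state_def split: if_splits)
    moreover have "jump_prob (qPois r) (y i) (y (Suc i)) = 1" if "i < n" for i
      using True[rule_format, of i] True[rule_format, of "Suc i"] that by (simp add: jump_prob_qPois pois_state_def split: if_splits)
    ultimately show ?thesis using True by (simp add: qtot_qPois)
  next
    case False
    have "(if y 0 = 0 then 1 else 0) * (\<Prod>i<n. jump_prob (qPois r) (y i) (y (Suc i)) * exp (- qtot (qPois r) (y i) * s i)) = 0"
    proof (rule ccontr)
      assume nz: "(if y 0 = 0 then 1 else 0) * (\<Prod>i<n. jump_prob (qPois r) (y i) (y (Suc i)) * exp (- qtot (qPois r) (y i) * s i)) \<noteq> 0"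
      then have y0: "y 0 = 0" and st: "\<And>i. i < n \<Longrightarrow> jump_prob (qPois r) (y i) (y (Suc i)) \<noteq> 0"
        by (auto split: if_splits)
      have "pois_state r i = y i" if "i \<le> n" for i
        using that
      proof (induction i)
        case (Suc i)
        then show ?case using st[of i] by (auto simp: jump_prob_qPois pois_state_def split: if_splits)
      qed (simp add: y0 pois_state_def)
      with False show False by blast
    qed
    moreover have "{\<omega> \<in> space ?M. (\<forall>i\<le>n. pois_state r i = y i) \<and> (\<forall>i<n. ennreal (s i) < \<omega> i)} = {}" using False by auto
    ultimately show ?thesis by (simp only: measure_empty)
  qed
qed

lemma pois_path_aux:
  assumes "0 \<le> r" "\<And>i. y i = pois_state r i" "\<And>i. 0 < h i" "0 < r \<Longrightarrow> \<forall>i. h i < top" "r = 0 \<Longrightarrow> \<forall>i. h i = top" "(\<Sum>i. h i) = top"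
  shows "HE (pth (y, h)) = h" "counts (pth (y, h)) h"
proof -
  show "HE (pth (y, h)) = h"
  proof
    fix n
    show "HE (pth (y, h)) n = h n"
    proof (cases "r = 0")
      case True
      then show ?thesis using HE_path_of_absorbed[of h y n] assms(5) by simp
    next
      case False
      then show ?thesis using assms by (intro HE_path_of) (auto simp: pois_state_def)
    qed
  qed
  show "counts (pth (y, h)) h"
    unfolding counts_def pth_eq[OF assms(6)]
  proof (intro conjI allI impI assms(3))
    fix t :: real assume "0 \<le> t"
    have "(LEAST n. ennreal t < (\<Sum>i\<le>n. h i)) = 0" if "r = 0"
      using assms(5)[OF that] by (intro Least_eq_0) simp
    then show "path_of y h t = (LEAST n. ennreal t < (\<Sum>i\<le>n. h i))"
      unfolding path_of_def assms(2) pois_state_def by auto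
  qed
qed

text \<open>Comparison with the model of IID exponential gaps. The rate 0 is included for the sake
  of \<alpha> = 0: there the first gap is infinite and the clock stays at 0.\<close>

lemma pois_clock:
  assumes M: "prob_space M" and r: "0 \<le> r" and JH: "jump_hold M (qPois r) 0 Y H"
    and nonexpl: "AE \<omega> in M. (\<Sum>i. H \<omega> i) = top" and X: "X \<in> M \<rightarrow>\<^sub>M path_space" "AE \<omega> in M. X \<omega> = pth (Y \<omega>, H \<omega>)"
  shows "distr M SE (\<lambda>\<omega>. HE (X \<omega>)) = PiM UNIV (\<lambda>_. expo r)" "AE \<omega> in M. counts (X \<omega>) (HE (X \<omega>))"
proof -
  let ?P = "PiM UNIV (\<lambda>_::nat. expo r)"
  have P: "prob_space ?P" by (intro prob_space_PiM prob_space_expo)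
  have comp: "AE a in ?P. Q (a i)" if "AE e in expo r. Q e" for Q i
    using AE_PiM_component[of UNIV "\<lambda>_. expo r" i Q] that prob_space_expo by simp
  have pos: "AE a in ?P. \<forall>i. 0 < a i"
    unfolding AE_all_countable by (intro allI comp AE_expo_pos r)
  have law: "distr M JH (\<lambda>\<omega>. (Y \<omega>, H \<omega>)) = distr ?P JH (\<lambda>\<omega>. (\<lambda>i. pois_state r i, \<omega>))"
    by (rule jump_hold_law_unique[OF M P JH jump_hold_pois_model[OF r] pos])
  note [measurable] = measurable_jump_hold[OF JH] measurable_jump_hold[OF jump_hold_pois_model[OF r]] X(1)
  \<comment> \<open>These properties hold almost surely in the model and are expressed through
    states and holding times alone, so equality of laws transfers them to the given clock.\<close>
  let ?G = "\<lambda>w :: (nat \<Rightarrow> nat) \<times> (nat \<Rightarrow> ennreal). (\<forall>i. fst w i = pois_state r i) \<and> (\<forall>i. 0 < snd w i) \<and>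
     (if r = 0 then \<forall>i. snd w i = top else \<forall>i. snd w i < top)"
  have G: "Measurable.pred JH ?G"
  proof -
    have [measurable]: "Measurable.pred JH (\<lambda>w. fst w i = pois_state r i)" for i
      by (rule measurable_compose[of "\<lambda>w. fst w i" _ "count_space UNIV"]) measurable
    show ?thesis by measurable
  qed
  have "AE a in ?P. ?G (\<lambda>i. pois_state r i, a)"
  proof (cases "r = 0")
    case True
    have "AE a in ?P. \<forall>i. a i = top" unfolding AE_all_countable using comp[OF AE_expo_0[folded True]] by blast
    with pos show ?thesis by eventually_elim (simp add: True)
  next
    case False
    have "AE a in ?P. \<forall>i. a i < top" unfolding AE_all_countable using False r AE_expo_finite by (intro allI comp) simp
    with pos show ?thesis by eventually_elim (simp add: False)
  qed
  then have "AE w in distr ?P JH (\<lambda>\<omega>. (\<lambda>i. pois_state r i, \<omega>)). ?G w"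
    using G by (subst AE_distr_iff) (auto simp: pred_def)
  then have "AE w in distr M JH (\<lambda>\<omega>. (Y \<omega>, H \<omega>)). ?G w" unfolding law .
  then have ae: "AE \<omega> in M. ?G (Y \<omega>, H \<omega>)" by (rule AE_distrD[rotated]) measurable
  have eq: "AE \<omega> in M. HE (X \<omega>) = H \<omega> \<and> counts (X \<omega>) (H \<omega>)"
    using ae nonexpl X(2)
  proof eventually_elim
    case (elim \<omega>)
    then show ?case using pois_path_aux[of r "Y \<omega>" "H \<omega>"] r by (auto split: if_splits)
  qed
  then show "AE \<omega> in M. counts (X \<omega>) (HE (X \<omega>))" by eventually_elim simp
  have mX: "(\<lambda>\<omega>. HE (X \<omega>)) \<in> M \<rightarrow>\<^sub>M SE"
    by (intro measurable_compose[OF X(1)] measurable_PiM_single') (auto simp: space_PiM)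
  have mH: "H \<in> M \<rightarrow>\<^sub>M SE"
    using measurable_compose[OF measurable_jump_hold[OF JH] measurable_snd] by simp
  have "distr M SE (\<lambda>\<omega>. HE (X \<omega>)) = distr M SE H"
    by (rule distr_cong_AE[OF refl refl _ mX mH]) (use eq in eventually_elim, simp)
  also have "\<dots> = distr (distr M JH (\<lambda>\<omega>. (Y \<omega>, H \<omega>))) SE snd"
    by (subst distr_distr[OF measurable_snd measurable_jump_hold[OF JH]]) (simp only: comp_def snd_conv)
  also have "\<dots> = distr ?P SE (\<lambda>\<omega>. \<omega>)" unfolding law
    by (subst distr_distr[OF measurable_snd measurable_jump_hold[OF jump_hold_pois_model[OF r]]]) (simp only: comp_def snd_conv)
  also have "\<dots> = ?P"
    by (rule distr_id2) (intro sets_PiM_cong, auto)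
  finally show "distr M SE (\<lambda>\<omega>. HE (X \<omega>)) = ?P" .
qed

section \<open>Independent ingredients\<close>

text \<open>Functionals such as zeta are not measurable on the full product space in which the chains F
  live, so independence is transferred to right-continuous versions.\<close>

lemma (in prob_space) indep_vars_path_space:
  fixes F X :: "'i \<Rightarrow> 'a \<Rightarrow> real \<Rightarrow> 's"
  assumes ind: "indep_vars (\<lambda>_. PiM UNIV (\<lambda>_. count_space UNIV)) F I"
    and X: "\<And>i. i \<in> I \<Longrightarrow> X i \<in> M \<rightarrow>\<^sub>M path_space"
    and ae: "\<And>i. i \<in> I \<Longrightarrow> AE \<omega> in M. \<forall>t. X i \<omega> t = F i \<omega> (max 0 t)"
  shows "indep_vars (\<lambda>_. path_space) X I"
proof -
  let ?P = "PiM UNIV (\<lambda>_::real. count_space UNIV) :: (real \<Rightarrow> 's) measure"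
  define G where "G i \<omega> t = F i \<omega> (max 0 t)" for i \<omega> t
  have "(\<lambda>f t. f (max 0 t)) \<in> ?P \<rightarrow>\<^sub>M ?P"
    by (rule measurable_PiM_single') (auto simp: space_PiM)
  from indep_vars_compose2[OF ind this] have G: "indep_vars (\<lambda>_. ?P) G I"
    by (simp add: G_def[abs_def])
  have XG: "AE \<omega> in M. X i \<omega> = G i \<omega>" if "i \<in> I" for i
    using ae[OF that] by eventually_elim (auto simp: G_def)
  show ?thesis
    unfolding indep_vars_def2 indep_sets_def
  proof (intro conjI ballI allI impI)
    show "X i \<in> M \<rightarrow>\<^sub>M path_space" if "i \<in> I" for i using X that .
    show "{X i -` A \<inter> space M |A. A \<in> sets path_space} \<subseteq> events" if "i \<in> I" for i
      using measurable_sets[OF X[OF that]] by auto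
    fix J A assume J: "J \<subseteq> I" "J \<noteq> {}" "finite J" and A: "A \<in> (\<Pi> j\<in>J. {X j -` A \<inter> space M |A. A \<in> sets path_space})"
    \<comment> \<open>An event of \<open>path_space\<close> is the trace of a set C of the product
      space, and X is always right-continuous, so C can be used in place of the event; then X and G
      may be exchanged almost surely.\<close>
    have "\<exists>C. C \<in> sets ?P \<and> A j = X j -` C \<inter> space M" if "j \<in> J" for j
    proof -
      have "A j \<in> {X j -` A \<inter> space M |A. A \<in> sets path_space}" using A that by (rule Pi_mem)
      then obtain B where B: "A j = X j -` B \<inter> space M" "B \<in> sets path_space" by blast
      then obtain C where C: "C \<in> sets ?P" "B = {p. rc p} \<inter> C" unfolding path_space_def sets_restrict_space by auto
      have "rc (X j \<omega>)" if "\<omega> \<in> space M" for \<omega>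
        using measurable_space[OF X that, of j] J \<open>j \<in> J\<close> by auto
      then show ?thesis using B C by (intro exI[of _ C]) auto
    qed
    then obtain C where C: "\<And>j. j \<in> J \<Longrightarrow> C j \<in> sets ?P" "\<And>j. j \<in> J \<Longrightarrow> A j = X j -` C j \<inter> space M" by metis
    have Gm: "G j \<in> M \<rightarrow>\<^sub>M ?P" if "j \<in> J" for j using G that J unfolding indep_vars_def by auto
    have As: "A j \<in> events" if "j \<in> J" for j
      using measurable_sets[OF X[of j] ] C(2)[OF that] Pi_mem[OF A that] J that by auto
    have Gs: "G j -` C j \<inter> space M \<in> events" if "j \<in> J" for j using measurable_sets[OF Gm[OF that] C(1)[OF that]] .
    have ae': "AE \<omega> in M. \<omega> \<in> A j \<longleftrightarrow> \<omega> \<in> G j -` C j \<inter> space M" if "j \<in> J" for j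
    proof -
      have "j \<in> I" using J that by blast
      from XG[OF this] AE_space show ?thesis by eventually_elim (simp add: C(2)[OF that])
    qed
    have "prob (\<Inter>j\<in>J. A j) = prob (\<Inter>j\<in>J. G j -` C j \<inter> space M)"
    proof (rule finite_measure_eq_AE)
      have "AE \<omega> in M. \<forall>j\<in>J. \<omega> \<in> A j \<longleftrightarrow> \<omega> \<in> G j -` C j \<inter> space M"
        using J(3) ae' by (simp add: AE_finite_all)
      then show "AE \<omega> in M. \<omega> \<in> (\<Inter>j\<in>J. A j) \<longleftrightarrow> \<omega> \<in> (\<Inter>j\<in>J. G j -` C j \<inter> space M)"
        by eventually_elim auto
    qed (rule sets.finite_INT[OF J(3,2)], use As Gs in blast)+
    also have "\<dots> = (\<Prod>j\<in>J. prob (G j -` C j \<inter> space M))"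
      using indep_varsD[OF G J(2,3,1)] C(1) by simp
    also have "\<dots> = (\<Prod>j\<in>J. prob (A j))"
      by (intro prod.cong refl finite_measure_eq_AE[symmetric] ae' As Gs)
    finally show "prob (\<Inter>j\<in>J. A j) = (\<Prod>j\<in>J. prob (A j))" .
  qed
qed

text \<open>That f and g depend only on the coordinates in A and in B is expressed by invariance
  under restriction; functionals of the whole family can then be used without changing their
  type.\<close>

lemma (in prob_space) distr_pair_indep:
  assumes ind: "indep_vars M' X I" and AB: "A \<inter> B = {}" "A \<subseteq> I" "B \<subseteq> I"
    and f: "f \<in> PiM A M' \<rightarrow>\<^sub>M S" "\<And>w. f (restrict w A) = f w"
    and g: "g \<in> PiM B M' \<rightarrow>\<^sub>M T" "\<And>w. g (restrict w B) = g w"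
  shows "distr M (S \<Otimes>\<^sub>M T) (\<lambda>\<omega>. (f (\<lambda>i. X i \<omega>), g (\<lambda>i. X i \<omega>))) =
    distr M S (\<lambda>\<omega>. f (\<lambda>i. X i \<omega>)) \<Otimes>\<^sub>M distr M T (\<lambda>\<omega>. g (\<lambda>i. X i \<omega>))"
proof -
  let ?A = "\<lambda>\<omega>. restrict (\<lambda>i. X i \<omega>) A" and ?B = "\<lambda>\<omega>. restrict (\<lambda>i. X i \<omega>) B"
  have m: "?A \<in> M \<rightarrow>\<^sub>M PiM A M'" "?B \<in> M \<rightarrow>\<^sub>M PiM B M'"
    and eq: "distr M (PiM A M') ?A \<Otimes>\<^sub>M distr M (PiM B M') ?B = distr M (PiM A M' \<Otimes>\<^sub>M PiM B M') (\<lambda>\<omega>. (?A \<omega>, ?B \<omega>))"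
    using indep_var_restrict[OF ind AB] unfolding indep_var_distribution_eq by auto
  interpret S: prob_space "distr M S (\<lambda>\<omega>. f (?A \<omega>))" by (intro prob_space_distr measurable_compose[OF m(1) f(1)])
  interpret T: prob_space "distr M T (\<lambda>\<omega>. g (?B \<omega>))" by (intro prob_space_distr measurable_compose[OF m(2) g(1)])
  have ff: "distr M S (\<lambda>\<omega>. f (?A \<omega>)) = distr (distr M (PiM A M') ?A) S f"
    unfolding distr_distr[OF f(1) m(1)] comp_def ..
  have gg: "distr M T (\<lambda>\<omega>. g (?B \<omega>)) = distr (distr M (PiM B M') ?B) T g"
    unfolding distr_distr[OF g(1) m(2)] comp_def ..
  have fg: "(\<lambda>(x, y). (f x, g y)) \<in> PiM A M' \<Otimes>\<^sub>M PiM B M' \<rightarrow>\<^sub>M S \<Otimes>\<^sub>M T"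
    using f(1) g(1) by measurable
  have "distr M S (\<lambda>\<omega>. f (?A \<omega>)) \<Otimes>\<^sub>M distr M T (\<lambda>\<omega>. g (?B \<omega>)) =
    distr (distr M (PiM A M') ?A \<Otimes>\<^sub>M distr M (PiM B M') ?B) (S \<Otimes>\<^sub>M T) (\<lambda>(x, y). (f x, g y))"
    unfolding ff gg
  proof (rule pair_measure_distr)
    show "sigma_finite_measure (distr (distr M (PiM B M') ?B) T g)"
      unfolding gg[symmetric] by unfold_locales
  qed (use f g in auto)
  also have "\<dots> = distr M (S \<Otimes>\<^sub>M T) (\<lambda>\<omega>. (f (?A \<omega>), g (?B \<omega>)))"
    unfolding eq distr_distr[OF fg measurable_Pair[OF m]] by (simp add: comp_def)
  finally show ?thesis unfolding f(2) g(2) ..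
qed

text \<open>The version for countably many disjoint blocks, used for the spindles of one clade and
  for the clades of all immigrants.\<close>

lemma (in prob_space) distr_seq_indep:
  assumes ind: "indep_vars M' X I" and K: "\<And>j::nat. K j \<subseteq> I" "disjoint_family K"
    and f: "\<And>j. f j \<in> PiM (K j) M' \<rightarrow>\<^sub>M N" "\<And>j w. f j (restrict w (K j)) = f j w"
    and D: "\<And>j. distr M N (\<lambda>\<omega>. f j (\<lambda>i. X i \<omega>)) = D"
  shows "distr M (PiM UNIV (\<lambda>_. N)) (\<lambda>\<omega> j. f j (\<lambda>i. X i \<omega>)) = PiM UNIV (\<lambda>_. D)"
proof -
  have "indep_vars (\<lambda>j. PiM (K j) M') (\<lambda>j \<omega>. restrict (\<lambda>i. X i \<omega>) (K j)) UNIV"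
    using K by (intro indep_vars_restrict[OF ind]) auto
  from indep_vars_compose2[OF this f(1)]
  have i: "indep_vars (\<lambda>_. N) (\<lambda>j \<omega>. f j (\<lambda>i. X i \<omega>)) UNIV"
    unfolding f(2) .
  have rv: "random_variable N (\<lambda>\<omega>. f j (\<lambda>i. X i \<omega>))" for j using i unfolding indep_vars_def by auto
  have "distr M (PiM UNIV (\<lambda>_. N)) (\<lambda>\<omega>. \<lambda>j\<in>UNIV. f j (\<lambda>i. X i \<omega>)) = PiM UNIV (\<lambda>j. distr M N (\<lambda>\<omega>. f j (\<lambda>i. X i \<omega>)))"
    by (rule indep_vars_iff_distr_eq_PiM[THEN iffD1, OF _ rv i]) simp
  then show ?thesis unfolding D restrict_UNIV .
qed

definition clade :: "(nat \<Rightarrow> real \<Rightarrow> nat) \<Rightarrow> (real \<Rightarrow> nat) \<Rightarrow> real \<Rightarrow> nat list" where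
  "clade z J = cat (rp (z 0)) (sk (zeta (z 0)) (HE J) (\<lambda>i. z (Suc i)))"

lemma good_clade_obtain:
  assumes "\<And>i t. 0 \<le> t \<Longrightarrow> Z i t = z i t" "\<And>i. rc (z i)" "\<And>i. hits (z i)" "counts J e"
    and st: "st (zeta (z 0)) e (\<lambda>i. z (Suc i))"
  obtains K where "good_clade Z J e z K"
    "\<And>y. sk (zeta (z 0)) e (\<lambda>i. z (Suc i)) y =
      concat (map (\<lambda>k. jn [] (hgt (zeta (z 0)) e (\<lambda>i. z (Suc i)) k - enn2real (e k)) (rp (z (Suc k))) y) [0..<K])"
proof -
  from st_obtain[OF st] obtain K where K: "\<And>k. k < K \<Longrightarrow> e k < ennreal (hgt (zeta (z 0)) e (\<lambda>i. z (Suc i)) k)"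
    "ennreal (hgt (zeta (z 0)) e (\<lambda>i. z (Suc i)) K) < e K"
    "\<And>y. sk (zeta (z 0)) e (\<lambda>i. z (Suc i)) y =
      concat (map (\<lambda>k. jn [] (hgt (zeta (z 0)) e (\<lambda>i. z (Suc i)) k - enn2real (e k)) (rp (z (Suc k))) y) [0..<K])"
    by blast
  have "good_clade Z J e z K" using assms K(1,2) by unfold_locales auto
  then show thesis using K(3) by (rule that)
qed

lemma measurable_HE_seq: "J \<in> N \<rightarrow>\<^sub>M path_space \<Longrightarrow> (\<lambda>w. HE (J w :: real \<Rightarrow> nat)) \<in> N \<rightarrow>\<^sub>M SE"
  by (rule measurable_PiM_single') (auto simp: space_PiM)

lemma counts_cong: "counts J e \<Longrightarrow> (\<And>t. 0 \<le> t \<Longrightarrow> J' t = J t) \<Longrightarrow> counts J' e"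
  by (simp add: counts_def)

context spindle
begin

text \<open>The index maps zi and ji are left abstract so that the clades on both sides of time 0
  are covered. The three ingredients, root spindle, gaps and further spindles, come from disjoint
  blocks of indices.\<close>

lemma clade_law:
  fixes X :: "'i \<Rightarrow> 'w \<Rightarrow> real \<Rightarrow> nat"
  assumes M: "prob_space M" and ind: "prob_space.indep_vars M (\<lambda>_. path_space) X I"
    and zi: "inj zi" "ji \<notin> range zi" "range zi \<subseteq> I" "ji \<in> I"
    and law: "distr M path_space (X (zi 0)) = Q n" "\<And>i. distr M path_space (X (zi (Suc i))) = Q 1"
      "distr M SE (\<lambda>\<omega>. HE (X ji \<omega>)) = PE"
  shows "distr M path_space (\<lambda>\<omega>. clade (\<lambda>i. X (zi i) \<omega>) (X ji \<omega>)) = cl n"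
    and "AE \<omega> in M. st (zeta (X (zi 0) \<omega>)) (HE (X ji \<omega>)) (\<lambda>i. X (zi (Suc i)) \<omega>)"
proof -
  interpret prob_space M by fact
  have X: "X i \<in> M \<rightarrow>\<^sub>M path_space" if "i \<in> I" for i using ind that unfolding indep_vars_def by auto
  have [measurable]: "X (zi i) \<in> M \<rightarrow>\<^sub>M path_space" "X ji \<in> M \<rightarrow>\<^sub>M path_space" for i
    using X zi(3,4) by blast+
  have mH: "(\<lambda>w. HE (w ji)) \<in> PiM A (\<lambda>_. path_space :: (real \<Rightarrow> nat) measure) \<rightarrow>\<^sub>M SE" if "ji \<in> A" for A
    by (intro measurable_HE_seq measurable_component_singleton that)
  have mz: "(\<lambda>w i. w (zi (Suc i))) \<in> PiM A (\<lambda>_. path_space) \<rightarrow>\<^sub>M SP" if "range (\<lambda>i. zi (Suc i)) \<subseteq> A" for A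
  proof (rule measurable_PiM_single')
    show "(\<lambda>w. w (zi (Suc i))) \<in> PiM A (\<lambda>_. path_space) \<rightarrow>\<^sub>M path_space" for i
      using that by (intro measurable_component_singleton) auto
    show "(\<lambda>w i. w (zi (Suc i))) \<in> space (PiM A (\<lambda>_. path_space)) \<rightarrow> (\<Pi>\<^sub>E i\<in>UNIV. space path_space)"
      using that by (fastforce simp: space_PiM PiE_iff)
  qed
  let ?A = "{zi 0}" and ?B = "insert ji (range (\<lambda>i. zi (Suc i)))"
  have Z: "distr M SP (\<lambda>\<omega> i. X (zi (Suc i)) \<omega>) = PZ"
    unfolding PZ_def
    by (rule distr_seq_indep[OF ind, of "\<lambda>j. {zi (Suc j)}" "\<lambda>j w. w (zi (Suc j))"])
       (use zi law in \<open>auto simp: disjoint_family_on_def inj_def intro: measurable_component_singleton\<close>)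
  have EZ: "distr M (SE \<Otimes>\<^sub>M SP) (\<lambda>\<omega>. (HE (X ji \<omega>), \<lambda>i. X (zi (Suc i)) \<omega>)) = PE \<Otimes>\<^sub>M PZ"
    unfolding law(3)[symmetric] Z[symmetric]
    by (rule distr_pair_indep[OF ind, of "{ji}" "range (\<lambda>i. zi (Suc i))"])
       (use zi in \<open>auto intro!: mH mz\<close>)
  have QEZ: "distr M (path_space \<Otimes>\<^sub>M (SE \<Otimes>\<^sub>M SP)) (\<lambda>\<omega>. (X (zi 0) \<omega>, HE (X ji \<omega>), \<lambda>i. X (zi (Suc i)) \<omega>)) = Q n \<Otimes>\<^sub>M (PE \<Otimes>\<^sub>M PZ)"
    unfolding law(1)[symmetric] EZ[symmetric]
  proof (rule distr_pair_indep[OF ind, of ?A ?B])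
    show "(\<lambda>w. (HE (w ji), \<lambda>i. w (zi (Suc i)))) \<in> PiM ?B (\<lambda>_. path_space) \<rightarrow>\<^sub>M SE \<Otimes>\<^sub>M SP"
      by (rule measurable_Pair[OF mH mz]) auto
  qed (use zi in \<open>auto simp: inj_def intro: measurable_component_singleton\<close>)
  have m: "(\<lambda>\<omega>. (X (zi 0) \<omega>, HE (X ji \<omega>), \<lambda>i. X (zi (Suc i)) \<omega>)) \<in> M \<rightarrow>\<^sub>M path_space \<Otimes>\<^sub>M (SE \<Otimes>\<^sub>M SP)"
  proof (intro measurable_Pair)
    show "(\<lambda>\<omega>. HE (X ji \<omega>)) \<in> M \<rightarrow>\<^sub>M SE"
      by (rule measurable_HE_seq) measurable
    show "(\<lambda>\<omega> i. X (zi (Suc i)) \<omega>) \<in> M \<rightarrow>\<^sub>M SP"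
    proof (rule measurable_PiM_single')
      have "zi i \<in> I" for i using zi(3) by blast
      then show "(\<lambda>\<omega> i. X (zi (Suc i)) \<omega>) \<in> space M \<rightarrow> (\<Pi>\<^sub>E i\<in>UNIV. space path_space)"
        using measurable_space[OF X] by auto
    qed simp
  qed simp
  have c: "(\<lambda>(z0, e, z). cat (rp z0) (sk (zeta z0) e z)) \<in> path_space \<Otimes>\<^sub>M (SE \<Otimes>\<^sub>M SP) \<rightarrow>\<^sub>M path_space"
    by measurable
  show "distr M path_space (\<lambda>\<omega>. clade (\<lambda>i. X (zi i) \<omega>) (X ji \<omega>)) = cl n"
    unfolding cl_def QEZ[symmetric] distr_distr[OF c m] by (simp add: comp_def clade_def)
  interpret E: prob_space PE by (rule prob_space_PE)
  interpret Zp: prob_space PZ by (rule prob_space_PZ)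
  interpret EZ: pair_prob_space PE PZ ..
  interpret Q: prob_space "Q n" by (rule sp.prob_space_PL)
  interpret P: pair_prob_space "Q n" "PE \<Otimes>\<^sub>M PZ" ..
  let ?P = "\<lambda>w. st (zeta (fst w)) (fst (snd w)) (snd (snd w))"
  have "AE w in Q n \<Otimes>\<^sub>M (PE \<Otimes>\<^sub>M PZ). ?P w"
  proof (rule P.AE_pair_measure)
    show "{w \<in> space (Q n \<Otimes>\<^sub>M (PE \<Otimes>\<^sub>M PZ)). ?P w} \<in> sets (Q n \<Otimes>\<^sub>M (PE \<Otimes>\<^sub>M PZ))" by measurable
    have "AE w in PE \<Otimes>\<^sub>M PZ. st h (fst w) (snd w)" if "0 \<le> h" for h
    proof (rule EZ.AE_pair_measure)
      show "{w \<in> space (PE \<Otimes>\<^sub>M PZ). st h (fst w) (snd w)} \<in> sets (PE \<Otimes>\<^sub>M PZ)" by measurable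
      show "AE e in PE. AE z in PZ. st h (fst (e, z)) (snd (e, z))" using AE_st[OF that] by simp
    qed
    then show "AE z0 in Q n. AE w in PE \<Otimes>\<^sub>M PZ. ?P (z0, w)" by (simp add: zeta_nonneg)
  qed
  then have "AE w in distr M (path_space \<Otimes>\<^sub>M (SE \<Otimes>\<^sub>M SP)) (\<lambda>\<omega>. (X (zi 0) \<omega>, HE (X ji \<omega>), \<lambda>i. X (zi (Suc i)) \<omega>)). ?P w"
    unfolding QEZ .
  from AE_distrD[OF m this] show "AE \<omega> in M. st (zeta (X (zi 0) \<omega>)) (HE (X ji \<omega>)) (\<lambda>i. X (zi (Suc i)) \<omega>)"
    by simp
qed

end

section \<open>Assembling the independent ingredients\<close>

definition blkP :: "nat \<Rightarrow> ingr set" where "blkP j = insert (PosJ j) (range (PosZ j))"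
definition blkN :: "nat \<Rightarrow> ingr set" where "blkN j = insert (NegJ j) (range (NegZ j))"
text \<open>The indices for which a law is prescribed. \<open>NegZ 0\<close>, \<open>NegJ 0\<close>
  and the positive indices from k on belong to no chain, so right-continuous versions are available
  on this set only.\<close>

definition ix :: "nat \<Rightarrow> ingr set" where
  "ix k = insert NegN (\<Union>j. blkN (Suc j)) \<union> (\<Union>j<k. blkP j)"

definition cladeP :: "nat \<Rightarrow> (ingr \<Rightarrow> real \<Rightarrow> nat) \<Rightarrow> real \<Rightarrow> nat list" where
  "cladeP j w = clade (\<lambda>i. w (PosZ j i)) (w (PosJ j))"
definition cladeN :: "nat \<Rightarrow> (ingr \<Rightarrow> real \<Rightarrow> nat) \<Rightarrow> real \<Rightarrow> nat list" where
  "cladeN j w = clade (\<lambda>i. w (NegZ j i)) (w (NegJ j))"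

text \<open>The skewer as a function of right-continuous versions of the ingredients; unlike
  \<open>neg_skewer\<close> and \<open>mp_skewer\<close> it is measurable by construction.\<close>

fun forest :: "nat \<Rightarrow> (ingr \<Rightarrow> real \<Rightarrow> nat) \<Rightarrow> real \<Rightarrow> nat list" where
  "forest 0 w = imp (HE (w NegN)) (\<lambda>j. cladeN (Suc j) w)"
| "forest (Suc k) w = cat (forest k w) (cladeP k w)"

lemma measurable_clade [measurable (raw)]:
  assumes z: "\<And>i. z i \<in> N \<rightarrow>\<^sub>M path_space" and J [measurable]: "J \<in> N \<rightarrow>\<^sub>M path_space"
  shows "(\<lambda>w. clade (\<lambda>i. z i w) (J w)) \<in> N \<rightarrow>\<^sub>M path_space"
proof -
  note [measurable] = measurable_HE_seq[OF J]
  have [measurable]: "(\<lambda>w i. z (Suc i) w) \<in> N \<rightarrow>\<^sub>M SP"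
    using measurable_space[OF z] z by (intro measurable_PiM_single') auto
  note [measurable] = z
  show ?thesis unfolding clade_def by measurable
qed

lemma measurable_cladeP: "blkP j \<subseteq> A \<Longrightarrow> cladeP j \<in> PiM A (\<lambda>_. path_space) \<rightarrow>\<^sub>M path_space"
  unfolding cladeP_def[abs_def] blkP_def by (intro measurable_clade measurable_component_singleton) auto

lemma measurable_cladeN: "blkN j \<subseteq> A \<Longrightarrow> cladeN j \<in> PiM A (\<lambda>_. path_space) \<rightarrow>\<^sub>M path_space"
  unfolding cladeN_def[abs_def] blkN_def by (intro measurable_clade measurable_component_singleton) auto

lemma cladeP_restrict: "blkP j \<subseteq> A \<Longrightarrow> cladeP j (restrict w A) = cladeP j w"
  by (auto simp: cladeP_def blkP_def image_subset_iff)

lemma cladeN_restrict: "blkN j \<subseteq> A \<Longrightarrow> cladeN j (restrict w A) = cladeN j w"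
  by (auto simp: cladeN_def blkN_def image_subset_iff)

lemma measurable_cladesN:
  assumes "(\<Union>j. blkN (Suc j)) \<subseteq> A"
  shows "(\<lambda>w j. cladeN (Suc j) w) \<in> PiM A (\<lambda>_. path_space) \<rightarrow>\<^sub>M SL"
proof -
  have m: "cladeN (Suc j) \<in> PiM A (\<lambda>_. path_space) \<rightarrow>\<^sub>M path_space" for j
    using assms by (intro measurable_cladeN) auto
  show ?thesis using measurable_space[OF m] m by (intro measurable_PiM_single') auto
qed

lemma ix_Suc: "ix (Suc k) = ix k \<union> blkP k"
  by (auto simp: ix_def less_Suc_eq)

lemma measurable_forest: "ix k \<subseteq> A \<Longrightarrow> forest k \<in> PiM A (\<lambda>_. path_space) \<rightarrow>\<^sub>M path_space"
proof (induction k)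
  case 0
  then have "(\<lambda>w. imp (HE (w NegN)) (\<lambda>j. cladeN (Suc j) w)) \<in> PiM A (\<lambda>_. path_space) \<rightarrow>\<^sub>M path_space"
    unfolding ix_def
    by (intro measurable_imp measurable_HE_seq measurable_component_singleton measurable_cladesN) auto
  then show ?case by (simp add: fun_eq_iff[symmetric])
next
  case (Suc k)
  then have "(\<lambda>w. cat (forest k w) (cladeP k w)) \<in> PiM A (\<lambda>_. path_space) \<rightarrow>\<^sub>M path_space"
    unfolding ix_Suc by (intro measurable_cat measurable_cladeP Suc.IH) auto
  then show ?case by simp
qed

lemma forest_restrict: "ix k \<subseteq> A \<Longrightarrow> forest k (restrict w A) = forest k w"
proof (induction k)
  case 0
  then have "cladeN (Suc j) (restrict w A) = cladeN (Suc j) w" for j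
    by (intro cladeN_restrict) (auto simp: ix_def)
  moreover have "NegN \<in> A" using 0 by (auto simp: ix_def)
  ultimately show ?case by (simp del: restrict_apply add: restrict_apply')
next
  case (Suc k)
  then have "forest k (restrict w A) = forest k w" "cladeP k (restrict w A) = cladeP k w"
    unfolding ix_Suc by (auto intro!: Suc.IH cladeP_restrict)
  then show ?case by (simp only: forest.simps)
qed

context immigration
begin

text \<open>Induction over the number of initial blocks: the forest built so far and the next clade
  use disjoint sets of ingredients, so each step is one convolution in \<open>Lam\<close>.\<close>

lemma forest_law:
  assumes M: "prob_space M" and ind: "prob_space.indep_vars M (\<lambda>_. path_space) X (ix (length c))"
    and P: "\<And>j. j < length c \<Longrightarrow> distr M path_space (X (PosZ j 0)) = Q (c ! j)"
      "\<And>j i. j < length c \<Longrightarrow> distr M path_space (X (PosZ j (Suc i))) = Q 1"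
      "\<And>j. j < length c \<Longrightarrow> distr M SE (\<lambda>\<omega>. HE (X (PosJ j) \<omega>)) = PE"
    and N: "\<And>j i. distr M path_space (X (NegZ (Suc j) i)) = Q 1"
      "\<And>j. distr M SE (\<lambda>\<omega>. HE (X (NegJ (Suc j)) \<omega>)) = PE"
      "distr M SE (\<lambda>\<omega>. HE (X NegN \<omega>)) = PA"
  shows "distr M path_space (\<lambda>\<omega>. forest (length c) (\<lambda>i. X i \<omega>)) = Lam c"
proof -
  interpret prob_space M by fact
  have X: "X i \<in> M \<rightarrow>\<^sub>M path_space" if "i \<in> ix (length c)" for i using ind that unfolding indep_vars_def by auto
  have "distr M path_space (\<lambda>\<omega>. forest k (\<lambda>i. X i \<omega>)) = Lam (take k c)" if "k \<le> length c" for k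
    using that
  proof (induction k)
    case 0
    let ?U = "\<Union>j. blkN (Suc j)"
    have cN: "distr M path_space (\<lambda>\<omega>. cladeN (Suc j) (\<lambda>i. X i \<omega>)) = cl 1" for j
      unfolding cladeN_def
      by (rule clade_law(1)[OF M ind]) (use N in \<open>auto simp: inj_def ix_def blkN_def\<close>)
    have C: "distr M SL (\<lambda>\<omega> j. cladeN (Suc j) (\<lambda>i. X i \<omega>)) = PC"
      unfolding PC_def
      by (rule distr_seq_indep[OF ind, of "\<lambda>j. blkN (Suc j)" "\<lambda>j. cladeN (Suc j)"])
         (auto simp: disjoint_family_on_def blkN_def ix_def cN intro!: measurable_cladeN cladeN_restrict)
    have AC: "distr M (SE \<Otimes>\<^sub>M SL) (\<lambda>\<omega>. (HE (X NegN \<omega>), \<lambda>j. cladeN (Suc j) (\<lambda>i. X i \<omega>))) = PA \<Otimes>\<^sub>M PC"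
      unfolding N(3)[symmetric] C[symmetric]
    proof (rule distr_pair_indep[OF ind, of "{NegN}" ?U])
      show "(\<lambda>j. cladeN (Suc j) (restrict w ?U)) = (\<lambda>j. cladeN (Suc j) w)" for w
        by (intro ext cladeN_restrict[THEN fun_cong]) auto
    qed (auto simp: ix_def blkN_def intro!: measurable_cladesN measurable_HE_seq measurable_component_singleton)
    have Xm: "(\<lambda>\<omega>. restrict (\<lambda>i. X i \<omega>) (ix 0)) \<in> M \<rightarrow>\<^sub>M PiM (ix 0) (\<lambda>_. path_space)"
      by (intro measurable_restrict X) (auto simp: ix_def)
    have m1: "(\<lambda>\<omega>. HE (X NegN \<omega>)) \<in> M \<rightarrow>\<^sub>M SE" by (intro measurable_HE_seq X) (auto simp: ix_def)
    have "(\<lambda>\<omega> j. cladeN (Suc j) (restrict (\<lambda>i. X i \<omega>) (ix 0))) \<in> M \<rightarrow>\<^sub>M SL"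
      by (rule measurable_compose[OF Xm measurable_cladesN]) (auto simp: ix_def)
    moreover have "cladeN (Suc j) (restrict (\<lambda>i. X i \<omega>) (ix 0)) = cladeN (Suc j) (\<lambda>i. X i \<omega>)" for j \<omega>
      by (rule cladeN_restrict) (auto simp: ix_def)
    ultimately have m2: "(\<lambda>\<omega> j. cladeN (Suc j) (\<lambda>i. X i \<omega>)) \<in> M \<rightarrow>\<^sub>M SL" by simp
    have c: "(\<lambda>(a, p). imp a p) \<in> SE \<Otimes>\<^sub>M SL \<rightarrow>\<^sub>M path_space" by measurable
    show ?case
      unfolding take_0 Lam_Nil im_def AC[symmetric] distr_distr[OF c measurable_Pair[OF m1 m2]]
      by (simp add: comp_def)
  next
    case (Suc k)
    then have k: "k < length c" "distr M path_space (\<lambda>\<omega>. forest k (\<lambda>i. X i \<omega>)) = Lam (take k c)" by auto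
    have cP: "distr M path_space (\<lambda>\<omega>. cladeP k (\<lambda>i. X i \<omega>)) = cl (c ! k)"
      unfolding cladeP_def
      by (rule clade_law(1)[OF M ind]) (use P k in \<open>auto simp: inj_def ix_def blkP_def\<close>)
    have FC: "distr M (path_space \<Otimes>\<^sub>M path_space) (\<lambda>\<omega>. (forest k (\<lambda>i. X i \<omega>), cladeP k (\<lambda>i. X i \<omega>))) = Lam (take k c) \<Otimes>\<^sub>M cl (c ! k)"
      unfolding k(2)[symmetric] cP[symmetric]
    proof (rule distr_pair_indep[OF ind, of "ix k" "blkP k"])
      show "ix k \<inter> blkP k = {}" by (auto simp: ix_def blkP_def blkN_def)
      show "ix k \<subseteq> ix (length c)" "blkP k \<subseteq> ix (length c)" using k(1) by (auto simp: ix_def)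
    qed (intro measurable_forest measurable_cladeP forest_restrict cladeP_restrict order_refl)+
    have sub: "ix k \<subseteq> ix (length c)" "blkP k \<subseteq> ix (length c)" using k(1) by (auto simp: ix_def)
    have Xm: "(\<lambda>\<omega>. restrict (\<lambda>i. X i \<omega>) (ix (length c))) \<in> M \<rightarrow>\<^sub>M PiM (ix (length c)) (\<lambda>_. path_space)"
      by (intro measurable_restrict X)
    have m1: "(\<lambda>\<omega>. forest k (\<lambda>i. X i \<omega>)) \<in> M \<rightarrow>\<^sub>M path_space"
      using measurable_compose[OF Xm measurable_forest[OF sub(1)]] unfolding forest_restrict[OF sub(1)] .
    have m2: "(\<lambda>\<omega>. cladeP k (\<lambda>i. X i \<omega>)) \<in> M \<rightarrow>\<^sub>M path_space"
      using measurable_compose[OF Xm measurable_cladeP[OF sub(2)]] unfolding cladeP_restrict[OF sub(2)] .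
    have c: "(\<lambda>(p, q). cat p q :: real \<Rightarrow> nat list) \<in> path_space \<Otimes>\<^sub>M path_space \<rightarrow>\<^sub>M path_space" by measurable
    show ?case
      unfolding take_Suc_conv_app_nth[OF k(1)] Lam_snoc cv_def FC[symmetric] distr_distr[OF c measurable_Pair[OF m1 m2]]
      by (simp add: comp_def)
  qed
  from this[of "length c"] show ?thesis by simp
qed

end

lemma pth_max_0: "pth w (max 0 t) = pth w t"
  by (simp add: pth_def path_of_def ennreal_max_0)

instance ingr :: countable by countable_datatype

text \<open>Purely deterministic: all almost sure properties appear as assumptions on one outcome,
  so the identity holds simultaneously for all levels y.\<close>

lemma skewers_forest:
  assumes F: "\<And>i t. i \<in> ix k \<Longrightarrow> 0 \<le> t \<Longrightarrow> F i t = X i t"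
    and Z: "\<And>j i. j < k \<Longrightarrow> rc (X (PosZ j i)) \<and> hits (X (PosZ j i))" "\<And>j i. 1 \<le> j \<Longrightarrow> rc (X (NegZ j i)) \<and> hits (X (NegZ j i))"
    and J: "\<And>j. j < k \<Longrightarrow> counts (X (PosJ j)) (HE (X (PosJ j)))" "\<And>j. 1 \<le> j \<Longrightarrow> counts (X (NegJ j)) (HE (X (NegJ j)))"
      "counts (X NegN) (HE (X NegN))" "imgood (HE (X NegN))"
    and st: "\<And>j. j < k \<Longrightarrow> st (zeta (X (PosZ j 0))) (HE (X (PosJ j))) (\<lambda>i. X (PosZ j (Suc i)))"
      "\<And>j. 1 \<le> j \<Longrightarrow> st (zeta (X (NegZ j 0))) (HE (X (NegJ j))) (\<lambda>i. X (NegZ j (Suc i)))"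
    and y: "0 \<le> y"
  shows "neg_skewer (F NegN) (\<lambda>j i. F (NegZ j i)) (\<lambda>j. F (NegJ j)) y
      @ concat (map (\<lambda>j. mp_skewer (\<lambda>i. F (PosZ j i)) (F (PosJ j)) y) [0..<k]) = forest k X y"
proof -
  have ixN: "NegZ j i \<in> ix k" "NegJ j \<in> ix k" if "1 \<le> j" for j i
    using that by (auto simp: ix_def blkN_def intro!: exI[of _ "j - 1"])
  have ixP: "PosZ j i \<in> ix k" "PosJ j \<in> ix k" if "j < k" for j i
    using that by (auto simp: ix_def blkP_def)
  have pos: "mp_skewer (\<lambda>i. F (PosZ j i)) (F (PosJ j)) y = cladeP j X y" if j: "j < k" for j
  proof -
    have "F (PosZ j i) t = X (PosZ j i) t" if "0 \<le> t" for i t by (rule F[OF ixP(1)[OF j] that])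
    moreover have "counts (F (PosJ j)) (HE (X (PosJ j)))" by (rule counts_cong[OF J(1)[OF j] F[OF ixP(2)[OF j]]])
    ultimately obtain K where K: "good_clade (\<lambda>i. F (PosZ j i)) (F (PosJ j)) (HE (X (PosJ j))) (\<lambda>i. X (PosZ j i)) K"
      "\<And>y. sk (zeta (X (PosZ j 0))) (HE (X (PosJ j))) (\<lambda>i. X (PosZ j (Suc i))) y =
        concat (map (\<lambda>k. jn [] (hgt (zeta (X (PosZ j 0))) (HE (X (PosJ j))) (\<lambda>i. X (PosZ j (Suc i))) k - enn2real (HE (X (PosJ j)) k)) (rp (X (PosZ j (Suc k)))) y) [0..<K])"
      using good_clade_obtain[OF _ conjunct1[OF Z(1)[OF j]] conjunct2[OF Z(1)[OF j]] _ st(1)[OF j],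
        of "\<lambda>i. F (PosZ j i)" "F (PosJ j)"] by blast
    show ?thesis unfolding good_clade.skewer_eq[OF K(1)] good_clade.lst_cat[OF K(1) y K(2)] cladeP_def clade_def ..
  qed
  define V where "V j K \<longleftrightarrow> good_clade (\<lambda>i. F (NegZ j i)) (F (NegJ j)) (HE (X (NegJ j))) (\<lambda>i. X (NegZ j i)) K \<and>
      (\<forall>y. sk (zeta (X (NegZ j 0))) (HE (X (NegJ j))) (\<lambda>i. X (NegZ j (Suc i))) y =
        concat (map (\<lambda>k. jn [] (hgt (zeta (X (NegZ j 0))) (HE (X (NegJ j))) (\<lambda>i. X (NegZ j (Suc i))) k - enn2real (HE (X (NegJ j)) k)) (rp (X (NegZ j (Suc k)))) y) [0..<K]))"
    for j K
  have "\<exists>K. V j K"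
    if j: "1 \<le> j" for j
  proof -
    have "F (NegZ j i) t = X (NegZ j i) t" if "0 \<le> t" for i t by (rule F[OF ixN(1)[OF j] that])
    moreover have "counts (F (NegJ j)) (HE (X (NegJ j)))" by (rule counts_cong[OF J(2)[OF j] F[OF ixN(2)[OF j]]])
    ultimately show ?thesis unfolding V_def
      using good_clade_obtain[OF _ conjunct1[OF Z(2)[OF j]] conjunct2[OF Z(2)[OF j]] _ st(2)[OF j],
        of "\<lambda>i. F (NegZ j i)" "F (NegJ j)"] by blast
  qed
  then obtain K where "\<And>j. 1 \<le> j \<Longrightarrow> V j (K j)" by metis
  then have K: "\<And>j. 1 \<le> j \<Longrightarrow> good_clade (\<lambda>i. F (NegZ j i)) (F (NegJ j)) (HE (X (NegJ j))) (\<lambda>i. X (NegZ j i)) (K j)"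
      "\<And>j y. 1 \<le> j \<Longrightarrow> sk (zeta (X (NegZ j 0))) (HE (X (NegJ j))) (\<lambda>i. X (NegZ j (Suc i))) y =
        concat (map (\<lambda>k. jn [] (hgt (zeta (X (NegZ j 0))) (HE (X (NegJ j))) (\<lambda>i. X (NegZ j (Suc i))) k - enn2real (HE (X (NegJ j)) k)) (rp (X (NegZ j (Suc k)))) y) [0..<K j])"
    unfolding V_def by blast+
  have N: "counts (F NegN) (HE (X NegN))" by (rule counts_cong[OF J(3)]) (auto simp: F ix_def)
  have neg: "neg_skewer (F NegN) (\<lambda>j i. F (NegZ j i)) (\<lambda>j. F (NegJ j)) y = forest 0 X y"
    using neg_skewer_eq[where ZN="\<lambda>j i. F (NegZ j i)" and JN="\<lambda>j. F (NegJ j)" and e="\<lambda>j. HE (X (NegJ j))"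
      and z="\<lambda>j i. X (NegZ j i)" and K=K, OF N J(4) y K] by (simp add: cladeN_def[abs_def] clade_def)
  have "forest n X y = forest 0 X y @ concat (map (\<lambda>j. cladeP j X y) [0..<n])" for n
    by (induction n) (auto simp: cat_def)
  from this[of k] have f: "forest k X y = forest 0 X y @ concat (map (\<lambda>j. cladeP j X y) [0..<k])" .
  have m: "map (\<lambda>j. mp_skewer (\<lambda>i. F (PosZ j i)) (F (PosJ j)) y) [0..<k] = map (\<lambda>j. cladeP j X y) [0..<k]"
    by (rule map_cong) (simp_all add: pos)
  show ?thesis unfolding neg m f ..
qed

text \<open>Together with \<open>start_of\<close> this gives all chain assumptions one common form,
  so versions can be chosen for all indices at once.\<close>

fun rate_of :: "real \<Rightarrow> real \<Rightarrow> ingr \<Rightarrow> nat \<Rightarrow> nat \<Rightarrow> real" where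
  "rate_of \<alpha> \<theta> (PosZ _ _) = qQ \<alpha>"
| "rate_of \<alpha> \<theta> (PosJ _) = qPois \<alpha>"
| "rate_of \<alpha> \<theta> (NegZ _ _) = qQ \<alpha>"
| "rate_of \<alpha> \<theta> (NegJ _) = qPois \<alpha>"
| "rate_of \<alpha> \<theta> NegN = qPois \<theta>"

fun start_of :: "nat list \<Rightarrow> ingr \<Rightarrow> nat" where
  "start_of c (PosZ j i) = (if i = 0 then c ! j else 1)"
| "start_of c (NegZ _ _) = 1"
| "start_of c _ = 0"

theorem theorem2p5:
  fixes M :: "'w measure" and \<alpha> \<theta> :: real and c :: "nat list"
    and F :: "ingr \<Rightarrow> 'w \<Rightarrow> real \<Rightarrow> nat"
  assumes "prob_space M"
    and "0 \<le> \<alpha>" and "\<alpha> \<le> 1" and "0 < \<theta>" and "composition c"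
    and "prob_space.indep_vars M (\<lambda>_. PiM UNIV (\<lambda>_. count_space UNIV)) F UNIV"
    and "\<forall>j<length c. is_ctmc M (qQ \<alpha>) (c ! j) (F (PosZ j 0))"
    and "\<forall>j<length c. \<forall>i\<ge>1. is_ctmc M (qQ \<alpha>) 1 (F (PosZ j i))"
    and "\<forall>j<length c. is_ctmc M (qPois \<alpha>) 0 (F (PosJ j))"
    and "\<forall>j\<ge>1. \<forall>i. is_ctmc M (qQ \<alpha>) 1 (F (NegZ j i))"
    and "\<forall>j\<ge>1. is_ctmc M (qPois \<alpha>) 0 (F (NegJ j))"
    and "is_ctmc M (qPois \<theta>) 0 (F NegN)"
  shows "is_ctmc M (qOCRP \<alpha> \<theta>) c
           (\<lambda>\<omega> y. neg_skewer (F NegN \<omega>) (\<lambda>j i. F (NegZ j i) \<omega>) (\<lambda>j. F (NegJ j) \<omega>) y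
                  @ concat (map (\<lambda>j. mp_skewer (\<lambda>i. F (PosZ j i) \<omega>) (F (PosJ j) \<omega>) y)
                                [0..<length c]))"
proof -
  interpret prob_space M by fact
  interpret immigration \<alpha> \<theta> by unfold_locales (use assms in auto)
  let ?I = "ix (length c)"
  have ctmc: "is_ctmc M (rate_of \<alpha> \<theta> i) (start_of c i) (F i)" if "i \<in> ?I" for i
    using that assms(7-12) by (auto simp: ix_def blkP_def blkN_def)
  have Fm: "(\<lambda>\<omega>. F i \<omega> t) \<in> M \<rightarrow>\<^sub>M count_space UNIV" for i t
  proof -
    have "F i \<in> M \<rightarrow>\<^sub>M PiM UNIV (\<lambda>_. count_space UNIV)" using assms(6) unfolding indep_vars_def by auto
    from measurable_compose[OF this measurable_component_singleton[of t]] show ?thesis by simp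
  qed
  \<comment> \<open>Bundling the properties of a version into one predicate lets version, jump chain
    and holding times be chosen simultaneously for all indices.\<close>
  define V where "V i X' Y H \<longleftrightarrow> X' \<in> M \<rightarrow>\<^sub>M path_space \<and> jump_hold M (rate_of \<alpha> \<theta> i) (start_of c i) Y H \<and>
    (AE \<omega> in M. (\<Sum>n. H \<omega> n) = top) \<and> (AE \<omega> in M. X' \<omega> = pth (Y \<omega>, H \<omega>)) \<and> (AE \<omega> in M. \<forall>t\<ge>0. F i \<omega> t = X' \<omega> t)"
    for i X' Y H
  have "\<exists>X' Y H. V i X' Y H" if "i \<in> ?I" for i
    unfolding V_def by (rule is_ctmc_version[OF ctmc[OF that] Fm]) blast
  then obtain X Y H where "\<And>i. i \<in> ?I \<Longrightarrow> V i (X i) (Y i) (H i)" by metis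
  then have X: "\<And>i. i \<in> ?I \<Longrightarrow> X i \<in> M \<rightarrow>\<^sub>M path_space"
    and JH: "\<And>i. i \<in> ?I \<Longrightarrow> jump_hold M (rate_of \<alpha> \<theta> i) (start_of c i) (Y i) (H i)"
    and top: "\<And>i. i \<in> ?I \<Longrightarrow> AE \<omega> in M. (\<Sum>n. H i \<omega> n) = top"
    and Xp: "\<And>i. i \<in> ?I \<Longrightarrow> AE \<omega> in M. X i \<omega> = pth (Y i \<omega>, H i \<omega>)"
    and FX: "\<And>i. i \<in> ?I \<Longrightarrow> AE \<omega> in M. \<forall>t\<ge>0. F i \<omega> t = X i \<omega> t"
    unfolding V_def by blast+
  have ind: "indep_vars (\<lambda>_. path_space) X ?I"
  proof (rule indep_vars_path_space[OF indep_vars_subset[OF assms(6)] X])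
    show "AE \<omega> in M. \<forall>t. X i \<omega> t = F i \<omega> (max 0 t)" if "i \<in> ?I" for i
      using Xp[OF that] FX[OF that] by eventually_elim (auto simp: pth_max_0)
  qed auto
  have lawZ: "distr M path_space (X i) = Q (start_of c i)" if "i \<in> ?I" "rate_of \<alpha> \<theta> i = qQ \<alpha>" for i
    by (rule sp.law_eq_PL[OF assms(1) jump_prob_qQ qtot_qQ JH[OF that(1), unfolded that(2)] X Xp]) (rule that)+
  have clock: "distr M SE (\<lambda>\<omega>. HE (X i \<omega>)) = PiM UNIV (\<lambda>_. expo r)" "AE \<omega> in M. counts (X i \<omega>) (HE (X i \<omega>))"
    if "i \<in> ?I" "rate_of \<alpha> \<theta> i = qPois r" "start_of c i = 0" "0 \<le> r" for i r
    using pois_clock[OF assms(1) that(4) JH[OF that(1), unfolded that(2,3)] top X Xp] that by auto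
  have ixN: "NegZ j i \<in> ?I" "NegJ j \<in> ?I" if "1 \<le> j" for j i
    using that by (auto simp: ix_def blkN_def intro!: exI[of _ "j - 1"])
  have ixP: "PosZ j i \<in> ?I" "PosJ j \<in> ?I" if "j < length c" for j i
    using that by (auto simp: ix_def blkP_def)
  have ixNN: "NegN \<in> ?I" by (simp add: ix_def)
  note P = lawZ[OF ixP(1)] clock[OF ixP(2), of _ \<alpha>, folded PE_def] and N = lawZ[OF ixN(1)] clock[OF ixN(2), of _ \<alpha>, folded PE_def]
    and NN = clock[OF ixNN, of \<theta>, folded PA_def]
  have PosZ: "distr M path_space (X (PosZ j 0)) = Q (c ! j)" "distr M path_space (X (PosZ j (Suc i))) = Q 1"
    and PosJ: "distr M SE (\<lambda>\<omega>. HE (X (PosJ j) \<omega>)) = PE"  "AE \<omega> in M. counts (X (PosJ j) \<omega>) (HE (X (PosJ j) \<omega>))"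
    if "j < length c" for i j
    using P[OF that] \<alpha>0 by auto
  have NegZ: "distr M path_space (X (NegZ j i)) = Q 1"
    and NegJ: "distr M SE (\<lambda>\<omega>. HE (X (NegJ j) \<omega>)) = PE" "AE \<omega> in M. counts (X (NegJ j) \<omega>) (HE (X (NegJ j) \<omega>))"
    if "1 \<le> j" for i j
    using N[OF that] \<alpha>0 by auto
  have NegN: "distr M SE (\<lambda>\<omega>. HE (X NegN \<omega>)) = PA" "AE \<omega> in M. counts (X NegN \<omega>) (HE (X NegN \<omega>))"
    using NN assms(4) by auto
  have hit: "AE \<omega> in M. rc (X i \<omega>) \<and> hits (X i \<omega>)" if "i \<in> ?I" "rate_of \<alpha> \<theta> i = qQ \<alpha>" for i
  proof -
    have "AE p in distr M path_space (X i). hits p" unfolding lawZ[OF that] by (rule AE_Q_hits)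
    from AE_distrD[OF X[OF that(1)] this] AE_space show ?thesis
      by eventually_elim (use measurable_space[OF X[OF that(1)]] in auto)
  qed
  have good: "AE \<omega> in M. imgood (HE (X NegN \<omega>))"
    by (rule AE_distrD[OF measurable_HE_seq[OF X[OF ixNN]]], unfold NegN(1)) (rule AE_imgood)
  have st: "AE \<omega> in M. st (zeta (X (PosZ j 0) \<omega>)) (HE (X (PosJ j) \<omega>)) (\<lambda>i. X (PosZ j (Suc i)) \<omega>)" if "j < length c" for j
    by (rule clade_law(2)[OF assms(1) ind, of "PosZ j"]) (use PosZ PosJ ixP that in \<open>auto simp: inj_def\<close>)
  have st': "AE \<omega> in M. st (zeta (X (NegZ j 0) \<omega>)) (HE (X (NegJ j) \<omega>)) (\<lambda>i. X (NegZ j (Suc i)) \<omega>)" if "1 \<le> j" for j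
    by (rule clade_law(2)[OF assms(1) ind, of "NegZ j"]) (use NegZ NegJ ixN that in \<open>auto simp: inj_def\<close>)
  have law: "distr M path_space (\<lambda>\<omega>. forest (length c) (\<lambda>i. X i \<omega>)) = Lam c"
    by (rule forest_law[OF assms(1) ind PosZ PosJ(1) NegZ NegJ(1) NegN(1)]) auto
  have Xm: "(\<lambda>\<omega>. restrict (\<lambda>i. X i \<omega>) ?I) \<in> M \<rightarrow>\<^sub>M PiM ?I (\<lambda>_. path_space)"
    by (intro measurable_restrict X)
  have fm: "(\<lambda>\<omega>. forest (length c) (\<lambda>i. X i \<omega>)) \<in> M \<rightarrow>\<^sub>M path_space"
    using measurable_compose[OF Xm measurable_forest[OF order_refl]] unfolding forest_restrict[OF order_refl] .
  \<comment> \<open>The ingredients are countably many, so the exceptional null sets can be united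
    before any level y is considered.\<close>
  have "AE \<omega> in M. \<forall>i\<in>?I. \<forall>t\<ge>0. F i \<omega> t = X i \<omega> t"
    using FX by (intro AE_ball_countable[THEN iffD2] ballI) auto
  moreover have "AE \<omega> in M. \<forall>j\<in>{..<length c}. \<forall>i. rc (X (PosZ j i) \<omega>) \<and> hits (X (PosZ j i) \<omega>)"
    using hit[OF ixP(1)] by (intro AE_ball_countable[THEN iffD2] ballI) (auto simp: AE_all_countable)
  moreover have "AE \<omega> in M. \<forall>j\<in>{1..}. \<forall>i. rc (X (NegZ j i) \<omega>) \<and> hits (X (NegZ j i) \<omega>)"
    using hit[OF ixN(1)] by (intro AE_ball_countable[THEN iffD2] ballI) (auto simp: AE_all_countable)
  moreover have "AE \<omega> in M. \<forall>j\<in>{..<length c}. counts (X (PosJ j) \<omega>) (HE (X (PosJ j) \<omega>)) \<and>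
      st (zeta (X (PosZ j 0) \<omega>)) (HE (X (PosJ j) \<omega>)) (\<lambda>i. X (PosZ j (Suc i)) \<omega>)"
    using PosJ(2) st by (intro AE_ball_countable[THEN iffD2] ballI) auto
  moreover have "AE \<omega> in M. \<forall>j\<in>{1..}. counts (X (NegJ j) \<omega>) (HE (X (NegJ j) \<omega>)) \<and>
      st (zeta (X (NegZ j 0) \<omega>)) (HE (X (NegJ j) \<omega>)) (\<lambda>i. X (NegZ j (Suc i)) \<omega>)"
    using NegJ(2) st' by (intro AE_ball_countable[THEN iffD2] ballI) auto
  \<comment> \<open>The quantifier over y stands inside: the skewer agrees with its version at all
    levels off a single null set, as \<open>is_ctmc\<close> requires.\<close>
  ultimately have "AE \<omega> in M. \<forall>y\<ge>0. neg_skewer (F NegN \<omega>) (\<lambda>j i. F (NegZ j i) \<omega>) (\<lambda>j. F (NegJ j) \<omega>) y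
      @ concat (map (\<lambda>j. mp_skewer (\<lambda>i. F (PosZ j i) \<omega>) (F (PosJ j) \<omega>) y) [0..<length c]) = forest (length c) (\<lambda>i. X i \<omega>) y"
    using good NegN(2)
  proof eventually_elim
    case (elim \<omega>)
    show ?case
    proof (intro allI impI)
      fix y :: real assume "0 \<le> y"
      then show "neg_skewer (F NegN \<omega>) (\<lambda>j i. F (NegZ j i) \<omega>) (\<lambda>j. F (NegJ j) \<omega>) y
      @ concat (map (\<lambda>j. mp_skewer (\<lambda>i. F (PosZ j i) \<omega>) (F (PosJ j) \<omega>) y) [0..<length c]) = forest (length c) (\<lambda>i. X i \<omega>) y"
        by (rule skewers_forest[of "length c" "\<lambda>i. F i \<omega>" "\<lambda>i. X i \<omega>", rotated -1])
          (use elim in \<open>blast intro: lessThan_iff[THEN iffD2] atLeast_iff[THEN iffD2]\<close>)+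
    qed
  qed
  then show ?thesis by (rule Lam_is_ctmc[OF assms(1,5) fm law])
qed

end
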